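(* Let $n\geq2$ and $1\leq N\leq n$, let $A:=\operatorname{UHF}(n^\infty)$, let $p=1_N\oplus0_{n-N}\in M_n(\mathbb{C})$, and let $(A,\alpha,L)$ be the Exel system in which $$\alpha(a_1\otimes\cdots\otimes a_k\otimes1_\infty)=p\otimes a_1\otimes\cdots\otimes a_k\otimes1_\infty,$$ $$L(a_1\otimes\cdots\otimes a_k\otimes1_\infty)=\operatorname{tr}(pa_1p)(a_2\otimes\cdots\otimes a_k\otimes1_\infty).$$ Then the Exel crossed product $A\rtimes_{\alpha,L}\mathbb{N}$ equals the Cuntz-Pimsner algebra $\mathcal{O}(M_L)$, and there is a Cuntz-Pimsner covariant representation $(\psi,\pi)$ of $M_L$ in the Cuntz algebra $\mathcal{O}_{nN}$ whose induced homomorphism $\psi\times\pi$ is an isomorphism of $A\rtimes_{\alpha,L}\mathbb{N}=\mathcal{O}(M_L)$ onto $\mathcal{O}_{nN}$.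
   Context: $\operatorname{UHF}(n^\infty)$ is the direct limit of the tensor powers $M_n^{\otimes k}$ of $M_n=M_n(\mathbb{C})$ with bonding maps $a_1\otimes\cdots\otimes a_k\mapsto a_1\otimes\cdots\otimes a_k\otimes1$; $a_1\otimes\cdots\otimes a_k\otimes1_\infty$ denotes the image of $a_1\otimes\cdots\otimes a_k\in M_n^{\otimes k}$ in the limit. $\operatorname{tr}$ is the normalised trace on the corner $pM_np\cong M_N(\mathbb{C})$. The displayed formulas determine an endomorphism $\alpha$ of $A$ and a positive linear map $L:A\to A$ with $L(\alpha(a)b)=aL(b)$ and $L(1)=1$ (a transfer operator). The bimodule $M_L$: give $A$ the bimodule structure $a\cdot m=am$, $m\cdot b=m\alpha(b)$ and the pre-inner product $\langle m,n\rangle=L(m^*n)$; modding out by elements of norm $0$ and completing gives a right-Hilbert $A$--$A$ bimodule $M_L$, with canonical map $q:A\to M_L$ and left action $\phi:A\to\mathcal{L}(M_L)$. A representation $(\psi,\pi)$ of $M_L$ in a $C^*$-algebra $B$ consists of a linear map $\psi:M_L\to B$ and a homomorphism $\pi:A\to B$ with $\psi(m\cdot a)=\psi(m)\pi(a)$, $\psi(m)^*\psi(n)=\pi(\langle m,n\rangle)$, $\psi(a\cdot m)=\pi(a)\psi(m)$; it induces $(\psi,\pi)^{(1)}:\mathcal{K}(M_L)\to B$ with $(\psi,\pi)^{(1)}(\Theta_{m,n})=\psi(m)\psi(n)^*$, where $\Theta_{m,n}(x)=m\cdot\langle n,x\rangle$. It is Cuntz-Pimsner covariant if $\pi(a)=(\psi,\pi)^{(1)}(\phi(a))$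 for all $a\in\phi^{-1}(\mathcal{K}(M_L))$. For an ideal $J\subset\phi^{-1}(\mathcal{K}(M_L))$, $\mathcal{O}(J,M_L)$ is the $C^*$-algebra generated by a representation $(k_M,k_A)$ universal for representations with $\pi(a)=(\psi,\pi)^{(1)}(\phi(a))$ for $a\in J$; $\psi\times\pi$ denotes the homomorphism with $(\psi\times\pi)\circ k_M=\psi$, $(\psi\times\pi)\circ k_A=\pi$. The Cuntz-Pimsner algebra is $\mathcal{O}(M_L):=\mathcal{O}(\phi^{-1}(\mathcal{K}(M_L)),M_L)$, and the Exel crossed product $A\rtimes_{\alpha,L}\mathbb{N}$ is (identified with) $\mathcal{O}(K_\alpha,M_L)$, where $K_\alpha:=\overline{A\alpha(A)A}\cap\phi^{-1}(\mathcal{K}(M_L))$ ($\overline{A\alpha(A)A}$ being the closed linear span). The Cuntz algebra $\mathcal{O}_d$ ($d\geq2$) is the universal $C^*$-algebra generated by isometries $s_1,\dots,s_d$ with $\sum_is_is_i^*=1$. *)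

theory Defs
  imports
    "HOL-Algebra.Module"
    "HOL-Algebra.Algebraic_Closure_Type"
    "HOL-Analysis.Abstract_Metric_Spaces"
    "Jordan_Normal_Form.Schur_Decomposition"
begin

section \<open>$C^*$-algebras\<close>

text \<open>
  Algebraic structures are carrier based and extend the records of HOL-Algebra. The field
  \<open>one\<close> that is inherited from there is only meaningful where an algebra is
  explicitly assumed to be unital. Algebras, homomorphisms and representations are not assumed
  to be unital.
\<close>

abbreviation \<CC> :: "complex ring" (\<open>\<CC>\<close>)
  where "\<CC> \<equiv> ring_of_type_algebra"

record 'a cstar = "(complex, 'a) module" +
  star :: "'a \<Rightarrow> 'a" (\<open>_\<^sup>\<star>\<index>\<close> [1000] 999)
  cnorm :: "'a \<Rightarrow> real"

text \<open>The guard is needed because \<^locale>\<open>Metric_space\<close> demands nonnegativity and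
  symmetry also outside the carrier.\<close>

definition cdist :: "'a cstar \<Rightarrow> 'a \<Rightarrow> 'a \<Rightarrow> real" where
  "cdist A x y = (if x \<in> carrier A \<and> y \<in> carrier A then cnorm A (x \<ominus>\<^bsub>A\<^esub> y) else 0)"

definition norm_topology :: "'a cstar \<Rightarrow> 'a topology" where
  "norm_topology A = Metric_space.mtopology (carrier A) (cdist A)"

locale cstar_algebra = module \<CC> A for A :: "'a cstar" (structure) +
  assumes mult_closed: "\<lbrakk>x \<in> carrier A; y \<in> carrier A\<rbrakk> \<Longrightarrow> x \<otimes> y \<in> carrier A"
    and mult_assoc: "\<lbrakk>x \<in> carrier A; y \<in> carrier A; z \<in> carrier A\<rbrakk>
      \<Longrightarrow> (x \<otimes> y) \<otimes> z = x \<otimes> (y \<otimes> z)"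
    and mult_add_left: "\<lbrakk>x \<in> carrier A; y \<in> carrier A; z \<in> carrier A\<rbrakk>
      \<Longrightarrow> (x \<oplus> y) \<otimes> z = x \<otimes> z \<oplus> y \<otimes> z"
    and mult_add_right: "\<lbrakk>x \<in> carrier A; y \<in> carrier A; z \<in> carrier A\<rbrakk>
      \<Longrightarrow> x \<otimes> (y \<oplus> z) = x \<otimes> y \<oplus> x \<otimes> z"
    and mult_smult_left: "\<lbrakk>x \<in> carrier A; y \<in> carrier A\<rbrakk> \<Longrightarrow> (c \<odot> x) \<otimes> y = c \<odot> (x \<otimes> y)"
    and mult_smult_right: "\<lbrakk>x \<in> carrier A; y \<in> carrier A\<rbrakk> \<Longrightarrow> x \<otimes> (c \<odot> y) = c \<odot> (x \<otimes> y)"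
    and star_closed: "x \<in> carrier A \<Longrightarrow> x\<^sup>\<star> \<in> carrier A"
    and star_star: "x \<in> carrier A \<Longrightarrow> (x\<^sup>\<star>)\<^sup>\<star> = x"
    and star_add: "\<lbrakk>x \<in> carrier A; y \<in> carrier A\<rbrakk> \<Longrightarrow> (x \<oplus> y)\<^sup>\<star> = x\<^sup>\<star> \<oplus> y\<^sup>\<star>"
    and star_smult: "x \<in> carrier A \<Longrightarrow> (c \<odot> x)\<^sup>\<star> = cnj c \<odot> x\<^sup>\<star>"
    and star_mult: "\<lbrakk>x \<in> carrier A; y \<in> carrier A\<rbrakk> \<Longrightarrow> (x \<otimes> y)\<^sup>\<star> = y\<^sup>\<star> \<otimes> x\<^sup>\<star>"
    and cnorm_nonneg: "x \<in> carrier A \<Longrightarrow> 0 \<le> cnorm A x"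
    and cnorm_eq_0: "x \<in> carrier A \<Longrightarrow> cnorm A x = 0 \<longleftrightarrow> x = \<zero>"
    and cnorm_smult: "x \<in> carrier A \<Longrightarrow> cnorm A (c \<odot> x) = cmod c * cnorm A x"
    and cnorm_add: "\<lbrakk>x \<in> carrier A; y \<in> carrier A\<rbrakk> \<Longrightarrow> cnorm A (x \<oplus> y) \<le> cnorm A x + cnorm A y"
    and cnorm_mult: "\<lbrakk>x \<in> carrier A; y \<in> carrier A\<rbrakk> \<Longrightarrow> cnorm A (x \<otimes> y) \<le> cnorm A x * cnorm A y"
    and cstar_identity: "x \<in> carrier A \<Longrightarrow> cnorm A (x\<^sup>\<star> \<otimes> x) = (cnorm A x)\<^sup>2"
    and complete: "Metric_space.mcomplete (carrier A) (cdist A)"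

locale unital_cstar_algebra = cstar_algebra +
  assumes one_closed: "\<one> \<in> carrier A"
    and one_mult: "x \<in> carrier A \<Longrightarrow> \<one> \<otimes> x = x"
    and mult_one: "x \<in> carrier A \<Longrightarrow> x \<otimes> \<one> = x"

definition linear_maps :: "(complex, 'a, 'x) module_scheme \<Rightarrow> (complex, 'b, 'y) module_scheme
    \<Rightarrow> ('a \<Rightarrow> 'b) set" where
  "linear_maps V W = {f \<in> carrier V \<rightarrow> carrier W.
     (\<forall>x \<in> carrier V. \<forall>y \<in> carrier V. f (x \<oplus>\<^bsub>V\<^esub> y) = f x \<oplus>\<^bsub>W\<^esub> f y) \<and>
     (\<forall>c. \<forall>x \<in> carrier V. f (c \<odot>\<^bsub>V\<^esub> x) = c \<odot>\<^bsub>W\<^esub> f x)}"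

definition star_hom :: "'a cstar \<Rightarrow> 'b cstar \<Rightarrow> ('a \<Rightarrow> 'b) set" where
  "star_hom A B = {f \<in> linear_maps A B.
     (\<forall>x \<in> carrier A. \<forall>y \<in> carrier A. f (x \<otimes>\<^bsub>A\<^esub> y) = f x \<otimes>\<^bsub>B\<^esub> f y) \<and>
     (\<forall>x \<in> carrier A. f (x\<^sup>\<star>\<^bsub>A\<^esub>) = (f x)\<^sup>\<star>\<^bsub>B\<^esub>)}"

definition star_iso :: "'a cstar \<Rightarrow> 'b cstar \<Rightarrow> ('a \<Rightarrow> 'b) set" where
  "star_iso A B = {f \<in> star_hom A B. bij_betw f (carrier A) (carrier B)}"

definition positive_elements :: "'a cstar \<Rightarrow> 'a set" where
  "positive_elements A = {x\<^sup>\<star>\<^bsub>A\<^esub> \<otimes>\<^bsub>A\<^esub> x | x. x \<in> carrier A}"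

definition closed_span :: "'a cstar \<Rightarrow> 'a set \<Rightarrow> 'a set" where
  "closed_span A S = \<Inter>{V. Module.submodule V \<CC> A \<and> closedin (norm_topology A) V \<and> S \<subseteq> V}"

definition closed_star_subalgebra :: "'a set \<Rightarrow> 'a cstar \<Rightarrow> bool" where
  "closed_star_subalgebra V A \<longleftrightarrow> Module.submodule V \<CC> A \<and> closedin (norm_topology A) V \<and>
     (\<forall>x \<in> V. \<forall>y \<in> V. x \<otimes>\<^bsub>A\<^esub> y \<in> V) \<and> (\<forall>x \<in> V. x\<^sup>\<star>\<^bsub>A\<^esub> \<in> V)"

definition generates :: "'a set \<Rightarrow> 'a cstar \<Rightarrow> bool" where
  "generates S A \<longleftrightarrow> S \<subseteq> carrier A \<and>
     (\<forall>V. closed_star_subalgebra V A \<and> S \<subseteq> V \<longrightarrow> V = carrier A)"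

section \<open>UHF algebras\<close>

definition op_norm :: "complex mat \<Rightarrow> real" where
  "op_norm a = Sup {sqrt (Re ((a *\<^sub>v v) \<bullet>c (a *\<^sub>v v))) | v.
     v \<in> carrier_vec (dim_col a) \<and> Re (v \<bullet>c v) \<le> 1}"

definition matrix_algebra :: "nat \<Rightarrow> complex mat cstar" where
  "matrix_algebra d = \<lparr>carrier = carrier_mat d d, monoid.mult = (*), one = 1\<^sub>m d, zero = 0\<^sub>m d d,
     add = (+), module.smult = (\<cdot>\<^sub>m), star = mat_adjoint, cnorm = op_norm\<rparr>"

definition kronecker :: "complex mat \<Rightarrow> complex mat \<Rightarrow> complex mat" where
  "kronecker a b = mat (dim_row a * dim_row b) (dim_col a * dim_col b)
     (\<lambda>(i, j). a $$ (i div dim_row b, j div dim_col b) * b $$ (i mod dim_row b, j mod dim_col b))"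

text \<open>The tensor power $M_n^{\otimes k}$ is realised as $M_{n^k}$, with the Kronecker product
  as tensor product; the empty tensor is the unit of $M_n^{\otimes 0} = \mathbf{C}$.\<close>

definition tensor_power :: "nat \<Rightarrow> nat \<Rightarrow> complex mat cstar" where
  "tensor_power n k = matrix_algebra (n ^ k)"

definition elementary_tensor :: "complex mat list \<Rightarrow> complex mat" where
  "elementary_tensor as = foldr kronecker as (1\<^sub>m 1)"

text \<open>The direct limit in the category of $C^*$-algebras, i.e. the completion of the algebraic
  direct limit in the $C^*$-seminorm $\lim_m \| \beta_{k+m-1} \cdots \beta_k(x) \|$, with
  \<open>\<iota> k\<close> the canonical map of the \<open>k\<close>-th algebra.\<close>

primrec iterated_bonding :: "(nat \<Rightarrow> 'b \<Rightarrow> 'b) \<Rightarrow> nat \<Rightarrow> nat \<Rightarrow> 'b \<Rightarrow> 'b" where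
  "iterated_bonding \<beta> k 0 x = x"
| "iterated_bonding \<beta> k (Suc m) x = \<beta> (k + m) (iterated_bonding \<beta> k m x)"

definition direct_limit :: "(nat \<Rightarrow> 'b cstar) \<Rightarrow> (nat \<Rightarrow> 'b \<Rightarrow> 'b) \<Rightarrow> 'a cstar
    \<Rightarrow> (nat \<Rightarrow> 'b \<Rightarrow> 'a) \<Rightarrow> bool" where
  "direct_limit B \<beta> A \<iota> \<longleftrightarrow> cstar_algebra A \<and>
     (\<forall>k. \<iota> k \<in> star_hom (B k) A) \<and>
     (\<forall>k. \<forall>x \<in> carrier (B k). \<iota> (Suc k) (\<beta> k x) = \<iota> k x) \<and>
     (\<forall>k. \<forall>x \<in> carrier (B k).
        (\<lambda>m. cnorm (B (k + m)) (iterated_bonding \<beta> k m x)) \<longlonglongrightarrow> cnorm A (\<iota> k x)) \<and>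
     norm_topology A closure_of (\<Union>k. \<iota> k ` carrier (B k)) = carrier A"

text \<open>\<open>\<iota> k (elementary_tensor [a\<^sub>1, \<dots>, a\<^sub>k])\<close> is the element
  $a_1 \otimes \cdots \otimes a_k \otimes 1_\infty$.\<close>

definition uhf_algebra :: "nat \<Rightarrow> 'a cstar \<Rightarrow> (nat \<Rightarrow> complex mat \<Rightarrow> 'a) \<Rightarrow> bool" where
  "uhf_algebra n A \<iota> \<longleftrightarrow> unital_cstar_algebra A \<and>
     direct_limit (tensor_power n) (\<lambda>k a. kronecker a (1\<^sub>m n)) A \<iota>"

definition corner_projection :: "nat \<Rightarrow> nat \<Rightarrow> complex mat" where
  "corner_projection n N = mat n n (\<lambda>(i, j). if i = j \<and> i < N then 1 else 0)"

text \<open>The normalised trace on the corner $p M_n p \cong M_N(\mathbf{C})$,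
  $p = 1_N \oplus 0_{n-N}$.\<close>

definition corner_trace :: "nat \<Rightarrow> complex mat \<Rightarrow> complex" where
  "corner_trace N a = (\<Sum>i<N. a $$ (i, i)) / of_nat N"

section \<open>Hilbert bimodules\<close>

record ('a, 'm) hilbert_bimodule = "(complex, 'm) module" +
  ract :: "'m \<Rightarrow> 'a \<Rightarrow> 'm" (infixl \<open>\<triangleleft>\<index>\<close> 70)
  lact :: "'a \<Rightarrow> 'm \<Rightarrow> 'm" (infixr \<open>\<triangleright>\<index>\<close> 70)
  inprod :: "'m \<Rightarrow> 'm \<Rightarrow> 'a" (\<open>\<langle>_, _\<rangle>\<index>\<close>)

definition hnorm :: "'a cstar \<Rightarrow> ('a, 'm) hilbert_bimodule \<Rightarrow> 'm \<Rightarrow> real" where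
  "hnorm A M x = sqrt (cnorm A \<langle>x, x\<rangle>\<^bsub>M\<^esub>)"

definition hdist :: "'a cstar \<Rightarrow> ('a, 'm) hilbert_bimodule \<Rightarrow> 'm \<Rightarrow> 'm \<Rightarrow> real" where
  "hdist A M x y = (if x \<in> carrier M \<and> y \<in> carrier M then hnorm A M (x \<ominus>\<^bsub>M\<^esub> y) else 0)"

locale right_hilbert_module = A: cstar_algebra A + module \<CC> M
  for A :: "'a cstar" and M :: "('a, 'm) hilbert_bimodule" (structure) +
  assumes ract_closed: "\<lbrakk>x \<in> carrier M; a \<in> carrier A\<rbrakk> \<Longrightarrow> x \<triangleleft> a \<in> carrier M"
    and ract_add_left: "\<lbrakk>x \<in> carrier M; y \<in> carrier M; a \<in> carrier A\<rbrakk>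
      \<Longrightarrow> (x \<oplus> y) \<triangleleft> a = x \<triangleleft> a \<oplus> y \<triangleleft> a"
    and ract_add_right: "\<lbrakk>x \<in> carrier M; a \<in> carrier A; b \<in> carrier A\<rbrakk>
      \<Longrightarrow> x \<triangleleft> (a \<oplus>\<^bsub>A\<^esub> b) = x \<triangleleft> a \<oplus> x \<triangleleft> b"
    and ract_smult_left: "\<lbrakk>x \<in> carrier M; a \<in> carrier A\<rbrakk> \<Longrightarrow> (c \<odot> x) \<triangleleft> a = c \<odot> (x \<triangleleft> a)"
    and ract_smult_right: "\<lbrakk>x \<in> carrier M; a \<in> carrier A\<rbrakk>
      \<Longrightarrow> x \<triangleleft> (c \<odot>\<^bsub>A\<^esub> a) = c \<odot> (x \<triangleleft> a)"
    and ract_mult: "\<lbrakk>x \<in> carrier M; a \<in> carrier A; b \<in> carrier A\<rbrakk>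
      \<Longrightarrow> x \<triangleleft> (a \<otimes>\<^bsub>A\<^esub> b) = (x \<triangleleft> a) \<triangleleft> b"
    and inprod_closed: "\<lbrakk>x \<in> carrier M; y \<in> carrier M\<rbrakk> \<Longrightarrow> \<langle>x, y\<rangle> \<in> carrier A"
    and inprod_add: "\<lbrakk>x \<in> carrier M; y \<in> carrier M; z \<in> carrier M\<rbrakk>
      \<Longrightarrow> \<langle>x, y \<oplus> z\<rangle> = \<langle>x, y\<rangle> \<oplus>\<^bsub>A\<^esub> \<langle>x, z\<rangle>"
    and inprod_smult: "\<lbrakk>x \<in> carrier M; y \<in> carrier M\<rbrakk> \<Longrightarrow> \<langle>x, c \<odot> y\<rangle> = c \<odot>\<^bsub>A\<^esub> \<langle>x, y\<rangle>"
    and inprod_ract: "\<lbrakk>x \<in> carrier M; y \<in> carrier M; a \<in> carrier A\<rbrakk>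
      \<Longrightarrow> \<langle>x, y \<triangleleft> a\<rangle> = \<langle>x, y\<rangle> \<otimes>\<^bsub>A\<^esub> a"
    and inprod_star: "\<lbrakk>x \<in> carrier M; y \<in> carrier M\<rbrakk> \<Longrightarrow> \<langle>x, y\<rangle>\<^sup>\<star>\<^bsub>A\<^esub> = \<langle>y, x\<rangle>"
    and inprod_positive: "x \<in> carrier M \<Longrightarrow> \<langle>x, x\<rangle> \<in> positive_elements A"
    and inprod_definite: "x \<in> carrier M \<Longrightarrow> \<langle>x, x\<rangle> = \<zero>\<^bsub>A\<^esub> \<Longrightarrow> x = \<zero>"
    and complete: "Metric_space.mcomplete (carrier M) (hdist A M)"

text \<open>The $C^*$-algebra $\mathcal{L}(M)$ of adjointable operators; operators are extensional
  functions on the carrier of \<open>M\<close>.\<close>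

definition is_adjoint :: "('a, 'm) hilbert_bimodule \<Rightarrow> ('m \<Rightarrow> 'm) \<Rightarrow> ('m \<Rightarrow> 'm) \<Rightarrow> bool" where
  "is_adjoint M T S \<longleftrightarrow>
     (\<forall>x \<in> carrier M. \<forall>y \<in> carrier M. \<langle>T x, y\<rangle>\<^bsub>M\<^esub> = \<langle>x, S y\<rangle>\<^bsub>M\<^esub>)"

definition adjointable_operators :: "'a cstar \<Rightarrow> ('a, 'm) hilbert_bimodule \<Rightarrow> ('m \<Rightarrow> 'm) cstar"
  where "adjointable_operators A M = \<lparr>
     carrier = {T \<in> carrier M \<rightarrow>\<^sub>E carrier M. \<exists>S \<in> carrier M \<rightarrow>\<^sub>E carrier M. is_adjoint M T S},
     monoid.mult = (\<lambda>S T. compose (carrier M) S T),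
     one = (\<lambda>x \<in> carrier M. x),
     zero = (\<lambda>x \<in> carrier M. \<zero>\<^bsub>M\<^esub>),
     add = (\<lambda>S T. \<lambda>x \<in> carrier M. S x \<oplus>\<^bsub>M\<^esub> T x),
     module.smult = (\<lambda>c T. \<lambda>x \<in> carrier M. c \<odot>\<^bsub>M\<^esub> T x),
     star = (\<lambda>T. THE S. S \<in> carrier M \<rightarrow>\<^sub>E carrier M \<and> is_adjoint M T S),
     cnorm = (\<lambda>T. Sup {hnorm A M (T x) | x. x \<in> carrier M \<and> hnorm A M x \<le> 1})\<rparr>"

definition rank_one :: "('a, 'm) hilbert_bimodule \<Rightarrow> 'm \<Rightarrow> 'm \<Rightarrow> ('m \<Rightarrow> 'm)" (\<open>\<Theta>\<index>\<close>) where
  "\<Theta>\<^bsub>M\<^esub> m n = (\<lambda>x \<in> carrier M. m \<triangleleft>\<^bsub>M\<^esub> \<langle>n, x\<rangle>\<^bsub>M\<^esub>)"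

definition compact_operators :: "'a cstar \<Rightarrow> ('a, 'm) hilbert_bimodule \<Rightarrow> ('m \<Rightarrow> 'm) cstar" where
  "compact_operators A M = adjointable_operators A M
     \<lparr>carrier := closed_span (adjointable_operators A M)
        {\<Theta>\<^bsub>M\<^esub> m n | m n. m \<in> carrier M \<and> n \<in> carrier M}\<rparr>"

definition left_operator :: "('a, 'm) hilbert_bimodule \<Rightarrow> 'a \<Rightarrow> ('m \<Rightarrow> 'm)" (\<open>\<phi>\<index>\<close>) where
  "\<phi>\<^bsub>M\<^esub> a = (\<lambda>x \<in> carrier M. a \<triangleright>\<^bsub>M\<^esub> x)"

definition right_hilbert_bimodule :: "'a cstar \<Rightarrow> ('a, 'm) hilbert_bimodule \<Rightarrow> bool" where
  "right_hilbert_bimodule A M \<longleftrightarrow> right_hilbert_module A M \<and>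
     \<phi>\<^bsub>M\<^esub> \<in> star_hom A (adjointable_operators A M)"

section \<open>Exel systems and the bimodule $M_L$\<close>

definition exel_system :: "'a cstar \<Rightarrow> ('a \<Rightarrow> 'a) \<Rightarrow> ('a \<Rightarrow> 'a) \<Rightarrow> bool" where
  "exel_system A \<alpha> L \<longleftrightarrow> unital_cstar_algebra A \<and> \<alpha> \<in> star_hom A A \<and> L \<in> linear_maps A A \<and>
     (\<forall>a \<in> positive_elements A. L a \<in> positive_elements A) \<and>
     (\<forall>a \<in> carrier A. \<forall>b \<in> carrier A. L (\<alpha> a \<otimes>\<^bsub>A\<^esub> b) = a \<otimes>\<^bsub>A\<^esub> L b) \<and>
     L \<one>\<^bsub>A\<^esub> = \<one>\<^bsub>A\<^esub>"

text \<open>\<open>M\<close> with \<open>q : A \<rightarrow> M\<close> is the Hausdorff completion of \<open>A\<close> in the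
  pre-inner product $\langle a, b\rangle = L(a^*b)$.\<close>

definition exel_bimodule :: "'a cstar \<Rightarrow> ('a \<Rightarrow> 'a) \<Rightarrow> ('a \<Rightarrow> 'a)
    \<Rightarrow> ('a, 'm) hilbert_bimodule \<Rightarrow> ('a \<Rightarrow> 'm) \<Rightarrow> bool" where
  "exel_bimodule A \<alpha> L M q \<longleftrightarrow> right_hilbert_bimodule A M \<and> q \<in> linear_maps A M \<and>
     (\<forall>a \<in> carrier A. \<forall>b \<in> carrier A. q a \<triangleleft>\<^bsub>M\<^esub> b = q (a \<otimes>\<^bsub>A\<^esub> \<alpha> b)) \<and>
     (\<forall>a \<in> carrier A. \<forall>b \<in> carrier A. a \<triangleright>\<^bsub>M\<^esub> q b = q (a \<otimes>\<^bsub>A\<^esub> b)) \<and>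
     (\<forall>a \<in> carrier A. \<forall>b \<in> carrier A. \<langle>q a, q b\<rangle>\<^bsub>M\<^esub> = L (a\<^sup>\<star>\<^bsub>A\<^esub> \<otimes>\<^bsub>A\<^esub> b)) \<and>
     Metric_space.mtopology (carrier M) (hdist A M) closure_of (q ` carrier A) = carrier M"

section \<open>Representations and Cuntz-Pimsner algebras\<close>

definition representation :: "'a cstar \<Rightarrow> ('a, 'm) hilbert_bimodule \<Rightarrow> 'b cstar
    \<Rightarrow> ('m \<Rightarrow> 'b) \<Rightarrow> ('a \<Rightarrow> 'b) \<Rightarrow> bool" where
  "representation A M B \<psi> \<pi> \<longleftrightarrow> \<psi> \<in> linear_maps M B \<and> \<pi> \<in> star_hom A B \<and>
     (\<forall>m \<in> carrier M. \<forall>a \<in> carrier A. \<psi> (m \<triangleleft>\<^bsub>M\<^esub> a) = \<psi> m \<otimes>\<^bsub>B\<^esub> \<pi> a) \<and>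
     (\<forall>m \<in> carrier M. \<forall>n \<in> carrier M. (\<psi> m)\<^sup>\<star>\<^bsub>B\<^esub> \<otimes>\<^bsub>B\<^esub> \<psi> n = \<pi> \<langle>m, n\<rangle>\<^bsub>M\<^esub>) \<and>
     (\<forall>m \<in> carrier M. \<forall>a \<in> carrier A. \<psi> (a \<triangleright>\<^bsub>M\<^esub> m) = \<pi> a \<otimes>\<^bsub>B\<^esub> \<psi> m)"

text \<open>The homomorphism $(\psi,\pi)^{(1)} : \mathcal{K}(M) \to B$. It exists for every
  representation, and its values on rank one operators determine it.\<close>

definition compact_rep :: "'a cstar \<Rightarrow> ('a, 'm) hilbert_bimodule \<Rightarrow> 'b cstar
    \<Rightarrow> ('m \<Rightarrow> 'b) \<Rightarrow> ('m \<Rightarrow> 'm) \<Rightarrow> 'b" where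
  "compact_rep A M B \<psi> = (THE \<rho>.
     \<rho> \<in> star_hom (compact_operators A M) B \<and> \<rho> \<in> extensional (carrier (compact_operators A M)) \<and>
     (\<forall>m \<in> carrier M. \<forall>n \<in> carrier M. \<rho> (\<Theta>\<^bsub>M\<^esub> m n) = \<psi> m \<otimes>\<^bsub>B\<^esub> (\<psi> n)\<^sup>\<star>\<^bsub>B\<^esub>))"

definition covariant_on :: "'a set \<Rightarrow> 'a cstar \<Rightarrow> ('a, 'm) hilbert_bimodule \<Rightarrow> 'b cstar
    \<Rightarrow> ('m \<Rightarrow> 'b) \<Rightarrow> ('a \<Rightarrow> 'b) \<Rightarrow> bool" where
  "covariant_on J A M B \<psi> \<pi> \<longleftrightarrow> representation A M B \<psi> \<pi> \<and>
     (\<forall>a \<in> J. \<pi> a = compact_rep A M B \<psi> (\<phi>\<^bsub>M\<^esub> a))"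

definition compact_ideal :: "'a cstar \<Rightarrow> ('a, 'm) hilbert_bimodule \<Rightarrow> 'a set" where
  "compact_ideal A M = {a \<in> carrier A. \<phi>\<^bsub>M\<^esub> a \<in> carrier (compact_operators A M)}"

definition cuntz_pimsner_covariant :: "'a cstar \<Rightarrow> ('a, 'm) hilbert_bimodule \<Rightarrow> 'b cstar
    \<Rightarrow> ('m \<Rightarrow> 'b) \<Rightarrow> ('a \<Rightarrow> 'b) \<Rightarrow> bool" where
  "cuntz_pimsner_covariant A M B \<psi> \<pi> \<longleftrightarrow> covariant_on (compact_ideal A M) A M B \<psi> \<pi>"

definition integrated_form :: "'a cstar \<Rightarrow> ('a, 'm) hilbert_bimodule
    \<Rightarrow> 'u cstar \<Rightarrow> ('m \<Rightarrow> 'u) \<Rightarrow> ('a \<Rightarrow> 'u)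
    \<Rightarrow> 'b cstar \<Rightarrow> ('m \<Rightarrow> 'b) \<Rightarrow> ('a \<Rightarrow> 'b) \<Rightarrow> ('u \<Rightarrow> 'b) \<Rightarrow> bool" where
  "integrated_form A M E k\<^sub>M k\<^sub>A B \<psi> \<pi> h \<longleftrightarrow> h \<in> star_hom E B \<and>
     (\<forall>m \<in> carrier M. h (k\<^sub>M m) = \<psi> m) \<and> (\<forall>a \<in> carrier A. h (k\<^sub>A a) = \<pi> a)"

text \<open>
  \<open>(E, k\<^sub>M, k\<^sub>A)\<close> is $\mathcal{O}(J, M)$. HOL cannot quantify over types inside a
  formula, so universality ranges over all $C^*$-algebras whose carrier is a subset of the type
  \<open>'u\<close> that also hosts \<open>E\<close>; this type plays the role of a universe. If it is
  large enough (for separable \<open>A\<close> and \<open>M\<close>, of cardinality at least that of the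
  continuum), this is universality among all $C^*$-algebras, since only the subalgebras generated
  by representations matter. The map \<open>h\<close> is unique because \<open>E\<close> is generated by
  the images of \<open>k\<^sub>M\<close> and \<open>k\<^sub>A\<close>.
\<close>

definition relative_cuntz_pimsner_algebra :: "'a set \<Rightarrow> 'a cstar \<Rightarrow> ('a, 'm) hilbert_bimodule
    \<Rightarrow> 'u cstar \<Rightarrow> ('m \<Rightarrow> 'u) \<Rightarrow> ('a \<Rightarrow> 'u) \<Rightarrow> bool" where
  "relative_cuntz_pimsner_algebra J A M E k\<^sub>M k\<^sub>A \<longleftrightarrow>
     cstar_algebra E \<and> covariant_on J A M E k\<^sub>M k\<^sub>A \<and>
     generates (k\<^sub>M ` carrier M \<union> k\<^sub>A ` carrier A) E \<and>
     (\<forall>(B :: 'u cstar) \<psi> \<pi>. cstar_algebra B \<and> covariant_on J A M B \<psi> \<pi> \<longrightarrow>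
        (\<exists>h. integrated_form A M E k\<^sub>M k\<^sub>A B \<psi> \<pi> h))"

definition cuntz_pimsner_algebra :: "'a cstar \<Rightarrow> ('a, 'm) hilbert_bimodule
    \<Rightarrow> 'u cstar \<Rightarrow> ('m \<Rightarrow> 'u) \<Rightarrow> ('a \<Rightarrow> 'u) \<Rightarrow> bool" where
  "cuntz_pimsner_algebra A M = relative_cuntz_pimsner_algebra (compact_ideal A M) A M"

definition exel_ideal :: "'a cstar \<Rightarrow> ('a \<Rightarrow> 'a) \<Rightarrow> ('a, 'm) hilbert_bimodule \<Rightarrow> 'a set" where
  "exel_ideal A \<alpha> M =
     closed_span A {a \<otimes>\<^bsub>A\<^esub> \<alpha> b \<otimes>\<^bsub>A\<^esub> c | a b c. a \<in> carrier A \<and> b \<in> carrier A \<and> c \<in> carrier A}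
     \<inter> compact_ideal A M"

definition exel_crossed_product :: "'a cstar \<Rightarrow> ('a \<Rightarrow> 'a) \<Rightarrow> ('a, 'm) hilbert_bimodule
    \<Rightarrow> 'u cstar \<Rightarrow> ('m \<Rightarrow> 'u) \<Rightarrow> ('a \<Rightarrow> 'u) \<Rightarrow> bool" where
  "exel_crossed_product A \<alpha> M = relative_cuntz_pimsner_algebra (exel_ideal A \<alpha> M) A M"

section \<open>Cuntz algebras\<close>

definition cuntz_family :: "nat \<Rightarrow> 'b cstar \<Rightarrow> (nat \<Rightarrow> 'b) \<Rightarrow> bool" where
  "cuntz_family d B s \<longleftrightarrow> (\<forall>i<d. s i \<in> carrier B \<and> (s i)\<^sup>\<star>\<^bsub>B\<^esub> \<otimes>\<^bsub>B\<^esub> s i = \<one>\<^bsub>B\<^esub>) \<and>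
     (\<Oplus>\<^bsub>B\<^esub>i \<in> {..<d}. s i \<otimes>\<^bsub>B\<^esub> (s i)\<^sup>\<star>\<^bsub>B\<^esub>) = \<one>\<^bsub>B\<^esub>"

text \<open>Universality again ranges over the $C^*$-algebras with carrier in \<open>'u\<close>.\<close>

definition cuntz_algebra :: "nat \<Rightarrow> 'u cstar \<Rightarrow> (nat \<Rightarrow> 'u) \<Rightarrow> bool" where
  "cuntz_algebra d C s \<longleftrightarrow> unital_cstar_algebra C \<and> cuntz_family d C s \<and>
     generates (s ` {..<d}) C \<and>
     (\<forall>(B :: 'u cstar) t. unital_cstar_algebra B \<and> cuntz_family d B t \<longrightarrow>
        (\<exists>h \<in> star_hom C B. \<forall>i<d. h (s i) = t i))"

end

theory Submission imports Defs begin

text \<open>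
  \<open>M\<^sub>L\<close> is a free right \<open>A\<close>-module of rank \<open>n N\<close>: the vectors
  \<open>m\<^sub>i\<^sub>j = \<surd>N q (e\<^sub>i\<^sub>j \<otimes> 1)\<close>, \<open>i < n\<close>, \<open>j < N\<close>, form an orthonormal basis. Hence
  \<open>A\<close> acts by compact operators, and a representation \<open>(\<psi>, \<pi>)\<close> is covariant on all
  of \<open>A\<close> iff \<open>\<Sum> \<psi>(m\<^sub>i\<^sub>j) \<psi>(m\<^sub>i\<^sub>j)\<^sup>\<star> = \<pi>(1)\<close>, that is, iff the isometries \<open>\<psi>(m\<^sub>i\<^sub>j)\<close> form a
  Cuntz family. Conversely, a Cuntz family \<open>s\<^sub>i\<^sub>j\<close> determines \<open>\<pi>\<close> on matrix units by
  \<open>\<pi>(e\<^sub>i\<^sub>l \<otimes> x) = \<Sum>\<^sub>j s\<^sub>i\<^sub>j \<pi>(x) s\<^sub>l\<^sub>j\<^sup>\<star>\<close> and then \<open>\<psi>\<close> by \<open>\<psi>(m\<^sub>i\<^sub>j) = s\<^sub>i\<^sub>j\<close>. The two universal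
  properties therefore give mutually inverse homomorphisms.

  No spectral theory is used: \<open>*\<close>-homomorphisms are contractive because a self-adjoint element of
  norm one has a square without quasi-inverse, and in a UHF algebra \<open>\<parallel>b\<^sup>\<star> b\<parallel> \<le> \<parallel>b\<^sup>\<star> b + z\<^sup>\<star> z\<parallel>\<close> because
  \<open>b\<close> and \<open>z\<close> can be combined into a column with the help of one more tensor factor.
\<close>

section \<open>Complex vector spaces and finite sums\<close>

text \<open>Injectivity is not taken from a gauge-invariant uniqueness theorem. An explicit inverse
  is produced, which is possible because \<open>E\<close> and \<open>C\<close> are hosted by the
  same type, so that each is an admissible target for the universal property of the other. As
  \<open>E\<close> comes without a unit, \<open>kA 1\<close> must first be shown to be one.

  The factor \<open>sqrt N\<close> compensates the normalised trace, for which
  \<open>L (e_jj \<otimes> 1) = 1 / N\<close> when \<open>j < N\<close>; columns from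
  \<open>N\<close> on vanish in the module because \<open>e_ij p = 0\<close> there.

  Two obstacles shape the analytic part. Orthonormal vectors only give a projection onto their span;
  that the span is everything follows from density of \<open>q\<close> once coefficients are
  bounded, and this bound rests on monotonicity of the norm on positive elements. In a Cuntz family
  the orthogonality of different ranges is not postulated but hidden in the relation that the range
  projections add up to one, and it has to be extracted from norm estimates.

  Finite matrix algebras are used only as algebras with involution: the norm of a matrix is always
  that of its image in \<open>A\<close>.\<close>

lemma additive_finsum:
  assumes "abelian_group G" "abelian_group H"
    and f: "\<And>x. x \<in> carrier G \<Longrightarrow> f x \<in> carrier H"
    and add: "\<And>x y. x \<in> carrier G \<Longrightarrow> y \<in> carrier G \<Longrightarrow> f (x \<oplus>\<^bsub>G\<^esub> y) = f x \<oplus>\<^bsub>H\<^esub> f y"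
    and g: "\<And>i. i \<in> I \<Longrightarrow> g i \<in> carrier G"
  shows "f (finsum G g I) = finsum H (\<lambda>i. f (g i)) I"
proof -
  interpret G: abelian_group G by fact
  interpret H: abelian_group H by fact
  have zero: "f \<zero>\<^bsub>G\<^esub> = \<zero>\<^bsub>H\<^esub>"
    by (metis G.add.l_cancel_one G.add.one_closed H.add.l_cancel_one' add f)
  \<comment> \<open>An infinite index set is harmless: both sums then take the default value
    zero.\<close>
  show ?thesis
  proof (cases "finite I")
    case True
    then show ?thesis using g
    proof (induction I)
      case (insert i I)
      then show ?case
        by (simp add: G.finsum_insert H.finsum_insert f add G.finsum_closed Pi_iff)
    qed (simp add: zero)
  qed (simp add: G.finsum_infinite H.finsum_infinite zero)
qed

text \<open>The record scheme is left open so that the same linear arithmetic serves algebras,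
  Hilbert modules and spaces of operators. Differences are normalised to
  \<open>x \<oplus> (- 1) \<odot> y\<close>, after which associativity and commutativity of addition
  do the rest.\<close>

locale complex_module = module \<CC> V for V :: "(complex, 'v, 'x) module_scheme" (structure)
begin

lemma scalar_simps [simp]:
  "carrier \<CC> = UNIV" "\<zero>\<^bsub>\<CC>\<^esub> = (0::complex)" "\<one>\<^bsub>\<CC>\<^esub> = (1::complex)"
  "c \<oplus>\<^bsub>\<CC>\<^esub> d = c + (d::complex)" "c \<otimes>\<^bsub>\<CC>\<^esub> d = c * (d::complex)"
  by (simp_all add: ring_of_type_algebra_def)

lemma scale_closed [simp, intro]: "x \<in> carrier V \<Longrightarrow> c \<odot> x \<in> carrier V"
  using smult_closed[of c x] by simp

lemma scale_left_add: "x \<in> carrier V \<Longrightarrow> (c + d) \<odot> x = c \<odot> x \<oplus> d \<odot> x"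
  using smult_l_distr[of c d x] by simp

lemma scale_right_add:
  "\<lbrakk>x \<in> carrier V; y \<in> carrier V\<rbrakk> \<Longrightarrow> c \<odot> (x \<oplus> y) = c \<odot> x \<oplus> c \<odot> y"
  using smult_r_distr[of c x y] by simp

lemma scale_scale [simp]: "x \<in> carrier V \<Longrightarrow> c \<odot> (d \<odot> x) = (c * d) \<odot> x"
  using smult_assoc1[of c d x] by simp

lemma scale_one [simp]: "x \<in> carrier V \<Longrightarrow> 1 \<odot> x = x"
  using smult_one[of x] by simp

lemma scale_zero_left [simp]: "x \<in> carrier V \<Longrightarrow> 0 \<odot> x = \<zero>"
  using smult_l_null[of x] by simp

lemma scale_zero_right [simp]: "c \<odot> \<zero> = \<zero>"
  using smult_r_null[of c] by simp

lemma uminus_scale: "x \<in> carrier V \<Longrightarrow> \<ominus> x = (- 1) \<odot> x"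
proof (rule M.minus_equality)
  assume "x \<in> carrier V"
  then show "(- 1) \<odot> x \<oplus> x = \<zero>"
    using scale_left_add[of x "-1" 1] by simp
qed auto

lemma minus_scale: "\<lbrakk>x \<in> carrier V; y \<in> carrier V\<rbrakk> \<Longrightarrow> x \<ominus> y = x \<oplus> (- 1) \<odot> y"
  by (simp add: a_minus_def uminus_scale)

lemma scale_minus_right:
  "\<lbrakk>x \<in> carrier V; y \<in> carrier V\<rbrakk> \<Longrightarrow> c \<odot> (x \<ominus> y) = c \<odot> x \<ominus> c \<odot> y"
  by (simp add: minus_scale scale_right_add)

lemma minus_self [simp]: "x \<in> carrier V \<Longrightarrow> x \<ominus> x = \<zero>"
  by (simp add: a_minus_def M.r_neg)

lemma minus_eq_zero_iff:
  "\<lbrakk>x \<in> carrier V; y \<in> carrier V\<rbrakk> \<Longrightarrow> x \<ominus> y = \<zero> \<longleftrightarrow> x = y"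
  by (metis M.add.inv_closed M.minus_equality M.minus_minus a_minus_def minus_self)

lemma minus_add_cancel: "\<lbrakk>x \<in> carrier V; y \<in> carrier V\<rbrakk> \<Longrightarrow> (x \<ominus> y) \<oplus> y = x"
  by (simp add: a_minus_def M.a_assoc M.l_neg)

lemma add_diff_add:
  "\<lbrakk>x \<in> carrier V; y \<in> carrier V; u \<in> carrier V; v \<in> carrier V\<rbrakk>
    \<Longrightarrow> (x \<oplus> y) \<ominus> (u \<oplus> v) = (x \<ominus> u) \<oplus> (y \<ominus> v)"
  by (simp add: minus_scale scale_right_add M.a_ac)

lemma diff_trans:
  "\<lbrakk>x \<in> carrier V; y \<in> carrier V; z \<in> carrier V\<rbrakk> \<Longrightarrow> (x \<ominus> y) \<oplus> (y \<ominus> z) = x \<ominus> z"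
  by (metis (no_types, lifting) M.add.inv_closed M.a_assoc M.minus_closed a_minus_def
      minus_add_cancel)

lemma minus_zero_right [simp]: "x \<in> carrier V \<Longrightarrow> x \<ominus> \<zero> = x"
  by (simp add: minus_scale)

lemma diff_diff_cancel:
  assumes "x \<in> carrier V" "y \<in> carrier V" "z \<in> carrier V"
  shows "(x \<ominus> y) \<ominus> (z \<ominus> y) = x \<ominus> z"
proof -
  have "(x \<ominus> y) \<ominus> (z \<ominus> y) = (x \<ominus> z) \<oplus> (y \<ominus> y)"
    using assms by (simp add: minus_scale scale_right_add M.a_ac del: minus_self)
  then show ?thesis using assms by simp
qed

lemma minus_swap: "\<lbrakk>x \<in> carrier V; y \<in> carrier V\<rbrakk> \<Longrightarrow> y \<ominus> x = (- 1) \<odot> (x \<ominus> y)"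
  by (simp add: minus_scale scale_right_add M.a_comm)

lemma sum_closed [simp, intro]: "(\<And>i. i \<in> I \<Longrightarrow> f i \<in> carrier V) \<Longrightarrow> finsum V f I \<in> carrier V"
  by (rule M.finsum_closed) auto

lemma sum_cong:
  "\<lbrakk>I = J; \<And>i. i \<in> J \<Longrightarrow> f i = g i; \<And>i. i \<in> J \<Longrightarrow> g i \<in> carrier V\<rbrakk>
    \<Longrightarrow> finsum V f I = finsum V g J"
  by (rule M.finsum_cong') auto

lemma sum_insert:
  "\<lbrakk>finite I; i \<notin> I; \<And>j. j \<in> insert i I \<Longrightarrow> f j \<in> carrier V\<rbrakk>
    \<Longrightarrow> finsum V f (insert i I) = f i \<oplus> finsum V f I"
  by (rule M.finsum_insert) auto

lemma sum_neutral: "(\<And>i. i \<in> I \<Longrightarrow> f i = \<zero>) \<Longrightarrow> finsum V f I = \<zero>"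
  using sum_cong[of I I f "\<lambda>_. \<zero>"] by (simp add: M.finsum_zero)

lemma sum_add:
  "\<lbrakk>\<And>i. i \<in> I \<Longrightarrow> f i \<in> carrier V; \<And>i. i \<in> I \<Longrightarrow> g i \<in> carrier V\<rbrakk>
    \<Longrightarrow> finsum V (\<lambda>i. f i \<oplus> g i) I = finsum V f I \<oplus> finsum V g I"
  by (rule M.finsum_addf) auto

lemma sum_scale:
  "(\<And>i. i \<in> I \<Longrightarrow> f i \<in> carrier V) \<Longrightarrow> c \<odot> finsum V f I = finsum V (\<lambda>i. c \<odot> f i) I"
  by (rule additive_finsum) (auto simp: scale_right_add M.abelian_group_axioms)

lemma scale_sum_left:
  assumes "x \<in> carrier V"
  shows "(\<Sum>i\<in>I. g i) \<odot> x = finsum V (\<lambda>i. g i \<odot> x) I"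
proof (cases "finite I")
  case True
  then show ?thesis
    using assms by (induction I) (auto simp: sum_insert scale_left_add)
qed (use assms in \<open>simp add: M.finsum_infinite\<close>)

lemma sum_restrict:
  assumes "finite I" "J \<subseteq> I" "\<And>i. i \<in> I - J \<Longrightarrow> f i = \<zero>" "\<And>i. i \<in> J \<Longrightarrow> f i \<in> carrier V"
  shows "finsum V f I = finsum V f J"
  by (rule M.add.finprod_mono_neutral_cong_right) (use assms in force)+

lemma sum_single:
  assumes "finite I" "i \<in> I" "\<And>j. j \<in> I \<Longrightarrow> j \<noteq> i \<Longrightarrow> f j = \<zero>" "f i \<in> carrier V"
  shows "finsum V f I = f i"
proof -
  have "finsum V f I = finsum V f {i}"
    by (rule sum_restrict) (use assms in auto)
  then show ?thesis
    using assms by (simp add: sum_insert)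
qed

lemma sum_swap:
  assumes "finite I" "finite J" "\<And>i j. i \<in> I \<Longrightarrow> j \<in> J \<Longrightarrow> f i j \<in> carrier V"
  shows "finsum V (\<lambda>i. finsum V (f i) J) I = finsum V (\<lambda>j. finsum V (\<lambda>i. f i j) I) J"
  using assms
proof (induction I)
  case (insert i I)
  have "finsum V (\<lambda>j. finsum V (\<lambda>i. f i j) (insert i I)) J
      = finsum V (\<lambda>j. f i j \<oplus> finsum V (\<lambda>i. f i j) I) J"
    by (rule sum_cong) (use insert in \<open>auto simp: sum_insert\<close>)
  also have "\<dots> = finsum V (f i) J \<oplus> finsum V (\<lambda>j. finsum V (\<lambda>i. f i j) I) J"
    by (rule sum_add) (use insert in auto)
  finally show ?case
    using insert by (simp add: sum_insert)
qed (simp add: M.finsum_zero)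

lemma sum_product:
  assumes "finite I" "finite J" "\<And>i j. i \<in> I \<Longrightarrow> j \<in> J \<Longrightarrow> f (i, j) \<in> carrier V"
  shows "finsum V f (I \<times> J) = finsum V (\<lambda>i. finsum V (\<lambda>j. f (i, j)) J) I"
  using assms
proof (induction I)
  case (insert i I)
  have "finsum V f (insert i I \<times> J) = finsum V f ({i} \<times> J \<union> I \<times> J)"
    by (rule arg_cong[where f = "finsum V f"]) auto
  also have "\<dots> = finsum V f ({i} \<times> J) \<oplus> finsum V f (I \<times> J)"
    by (rule M.finsum_Un_disjoint) (use insert in auto)
  also have "finsum V f ({i} \<times> J) = finsum V (\<lambda>j. f (i, j)) J"
  proof -
    have "finsum V f (Pair i ` J) = finsum V (\<lambda>j. f (i, j)) J"
      by (rule M.finsum_reindex) (use insert in \<open>auto simp: inj_on_def\<close>)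
    moreover have "Pair i ` J = {i} \<times> J" by auto
    ultimately show ?thesis by simp
  qed
  finally show ?case
    using insert by (simp add: sum_insert)
qed simp

lemma sum_reindex:
  "\<lbrakk>inj_on h I; \<And>i. i \<in> I \<Longrightarrow> f (h i) \<in> carrier V\<rbrakk>
    \<Longrightarrow> finsum V f (h ` I) = finsum V (\<lambda>i. f (h i)) I"
  by (rule M.finsum_reindex) auto

end

lemma linear_mapsI:
  assumes "\<And>x. x \<in> carrier V \<Longrightarrow> f x \<in> carrier W"
    and "\<And>x y. x \<in> carrier V \<Longrightarrow> y \<in> carrier V \<Longrightarrow> f (x \<oplus>\<^bsub>V\<^esub> y) = f x \<oplus>\<^bsub>W\<^esub> f y"
    and "\<And>c x. x \<in> carrier V \<Longrightarrow> f (c \<odot>\<^bsub>V\<^esub> x) = c \<odot>\<^bsub>W\<^esub> f x"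
  shows "f \<in> linear_maps V W"
  using assms by (auto simp: linear_maps_def)

lemma linear_mapsD:
  assumes "f \<in> linear_maps V W" "x \<in> carrier V"
  shows "f x \<in> carrier W" "y \<in> carrier V \<Longrightarrow> f (x \<oplus>\<^bsub>V\<^esub> y) = f x \<oplus>\<^bsub>W\<^esub> f y"
    "f (c \<odot>\<^bsub>V\<^esub> x) = c \<odot>\<^bsub>W\<^esub> f x"
  using assms by (auto simp: linear_maps_def)

lemma linear_maps_minus:
  assumes "complex_module V" "complex_module W" "f \<in> linear_maps V W"
    and "x \<in> carrier V" "y \<in> carrier V"
  shows "f (x \<ominus>\<^bsub>V\<^esub> y) = f x \<ominus>\<^bsub>W\<^esub> f y"
proof -
  interpret V: complex_module V by fact
  interpret W: complex_module W by fact
  show ?thesis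
    using assms(3-5) by (simp add: V.minus_scale W.minus_scale linear_mapsD)
qed

lemma linear_maps_zero:
  assumes "complex_module V" "complex_module W" "f \<in> linear_maps V W"
  shows "f \<zero>\<^bsub>V\<^esub> = \<zero>\<^bsub>W\<^esub>"
proof -
  interpret V: complex_module V by fact
  interpret W: complex_module W by fact
  have "f (0 \<odot>\<^bsub>V\<^esub> \<zero>\<^bsub>V\<^esub>) = 0 \<odot>\<^bsub>W\<^esub> f \<zero>\<^bsub>V\<^esub>"
    using linear_mapsD(3)[OF assms(3) V.M.zero_closed] .
  then show ?thesis using linear_mapsD(1)[OF assms(3), of "\<zero>\<^bsub>V\<^esub>"] by simp
qed

lemma linear_maps_sum:
  assumes "complex_module V" "complex_module W" "f \<in> linear_maps V W"
    and "\<And>i. i \<in> I \<Longrightarrow> g i \<in> carrier V"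
  shows "f (finsum V g I) = finsum W (\<lambda>i. f (g i)) I"
proof -
  interpret V: complex_module V by fact
  interpret W: complex_module W by fact
  show ?thesis
    by (rule additive_finsum[OF V.abelian_group_axioms W.abelian_group_axioms])
      (use assms in \<open>auto simp: linear_mapsD\<close>)
qed

lemma star_homI:
  assumes "\<And>x. x \<in> carrier V \<Longrightarrow> f x \<in> carrier W"
    and "\<And>x y. x \<in> carrier V \<Longrightarrow> y \<in> carrier V \<Longrightarrow> f (x \<oplus>\<^bsub>V\<^esub> y) = f x \<oplus>\<^bsub>W\<^esub> f y"
    and "\<And>c x. x \<in> carrier V \<Longrightarrow> f (c \<odot>\<^bsub>V\<^esub> x) = c \<odot>\<^bsub>W\<^esub> f x"
    and "\<And>x y. x \<in> carrier V \<Longrightarrow> y \<in> carrier V \<Longrightarrow> f (x \<otimes>\<^bsub>V\<^esub> y) = f x \<otimes>\<^bsub>W\<^esub> f y"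
    and "\<And>x. x \<in> carrier V \<Longrightarrow> f (x\<^sup>\<star>\<^bsub>V\<^esub>) = (f x)\<^sup>\<star>\<^bsub>W\<^esub>"
  shows "f \<in> star_hom V W"
  using assms by (auto simp: star_hom_def linear_maps_def)

lemma star_homD:
  assumes "f \<in> star_hom V W" "x \<in> carrier V"
  shows "f x \<in> carrier W" "y \<in> carrier V \<Longrightarrow> f (x \<oplus>\<^bsub>V\<^esub> y) = f x \<oplus>\<^bsub>W\<^esub> f y"
    "f (c \<odot>\<^bsub>V\<^esub> x) = c \<odot>\<^bsub>W\<^esub> f x"
    "y \<in> carrier V \<Longrightarrow> f (x \<otimes>\<^bsub>V\<^esub> y) = f x \<otimes>\<^bsub>W\<^esub> f y" "f (x\<^sup>\<star>\<^bsub>V\<^esub>) = (f x)\<^sup>\<star>\<^bsub>W\<^esub>"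
  using assms by (auto simp: star_hom_def linear_maps_def)

lemma star_hom_linear: "f \<in> star_hom V W \<Longrightarrow> f \<in> linear_maps V W"
  by (simp add: star_hom_def)

section \<open>Elementary properties of $C^*$-algebras\<close>

sublocale cstar_algebra \<subseteq> complex_module A ..

context cstar_algebra
begin

declare mult_closed [simp, intro] star_closed [simp, intro] star_star [simp]
  cnorm_nonneg [simp] mult_smult_left [simp] mult_smult_right [simp] star_smult [simp]

lemma mult_sum_left:
  assumes "\<And>i. i \<in> I \<Longrightarrow> f i \<in> carrier A" "y \<in> carrier A"
  shows "finsum A f I \<otimes> y = finsum A (\<lambda>i. f i \<otimes> y) I"
  using additive_finsum[OF abelian_group_axioms abelian_group_axioms, of "\<lambda>x. x \<otimes> y" I f] assms
  by (simp add: mult_add_left)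

lemma mult_sum_right:
  assumes "\<And>i. i \<in> I \<Longrightarrow> f i \<in> carrier A" "y \<in> carrier A"
  shows "y \<otimes> finsum A f I = finsum A (\<lambda>i. y \<otimes> f i) I"
  using additive_finsum[OF abelian_group_axioms abelian_group_axioms, of "\<lambda>x. y \<otimes> x" I f] assms
  by (simp add: mult_add_right)

lemma star_sum:
  assumes "\<And>i. i \<in> I \<Longrightarrow> f i \<in> carrier A"
  shows "(finsum A f I)\<^sup>\<star> = finsum A (\<lambda>i. (f i)\<^sup>\<star>) I"
  using additive_finsum[OF abelian_group_axioms abelian_group_axioms, of "star A" I f] assms
  by (simp add: star_add)

lemma mult_zero_left [simp]: "x \<in> carrier A \<Longrightarrow> \<zero> \<otimes> x = \<zero>"
  using mult_smult_left[of \<zero> x 0] by simp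

lemma mult_zero_right [simp]: "x \<in> carrier A \<Longrightarrow> x \<otimes> \<zero> = \<zero>"
  using mult_smult_right[of x \<zero> 0] by simp

lemma star_zero [simp]: "\<zero>\<^sup>\<star> = \<zero>"
  using star_smult[of \<zero> 0] by simp

lemma mult_minus_left:
  "\<lbrakk>x \<in> carrier A; y \<in> carrier A; z \<in> carrier A\<rbrakk> \<Longrightarrow> (x \<ominus> y) \<otimes> z = x \<otimes> z \<ominus> y \<otimes> z"
  by (simp add: minus_scale mult_add_left)

lemma mult_minus_right:
  "\<lbrakk>x \<in> carrier A; y \<in> carrier A; z \<in> carrier A\<rbrakk> \<Longrightarrow> x \<otimes> (y \<ominus> z) = x \<otimes> y \<ominus> x \<otimes> z"
  by (simp add: minus_scale mult_add_right)

lemma star_minus: "\<lbrakk>x \<in> carrier A; y \<in> carrier A\<rbrakk> \<Longrightarrow> (x \<ominus> y)\<^sup>\<star> = x\<^sup>\<star> \<ominus> y\<^sup>\<star>"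
  by (simp add: minus_scale star_add)

lemma cnorm_zero [simp]: "cnorm A \<zero> = 0"
  by (simp add: cnorm_eq_0)

lemma cnorm_minus_commute: "\<lbrakk>x \<in> carrier A; y \<in> carrier A\<rbrakk> \<Longrightarrow> cnorm A (x \<ominus> y) = cnorm A (y \<ominus> x)"
  using cnorm_smult[of "x \<ominus> y" "-1"] by (simp add: minus_swap[of x y])

lemma cnorm_minus_le: "\<lbrakk>x \<in> carrier A; y \<in> carrier A\<rbrakk> \<Longrightarrow> cnorm A (x \<ominus> y) \<le> cnorm A x + cnorm A y"
  using cnorm_add[of x "(-1) \<odot> y"] by (simp add: minus_scale cnorm_smult)

lemma cnorm_triangle_diff:
  "\<lbrakk>x \<in> carrier A; y \<in> carrier A; z \<in> carrier A\<rbrakk>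
    \<Longrightarrow> cnorm A (x \<ominus> z) \<le> cnorm A (x \<ominus> y) + cnorm A (y \<ominus> z)"
  using cnorm_add[of "x \<ominus> y" "y \<ominus> z"] by (simp add: diff_trans)

lemma cnorm_le_diff: "\<lbrakk>x \<in> carrier A; y \<in> carrier A\<rbrakk> \<Longrightarrow> cnorm A x \<le> cnorm A y + cnorm A (x \<ominus> y)"
  using cnorm_add[of "x \<ominus> y" y] by (simp add: minus_add_cancel)

text \<open>The C*-identity and submultiplicativity bound the square of the norm of \<open>x\<close>
  by the product of the norms of its adjoint and of \<open>x\<close>. Cancelling one factor proves
  one inequality for every element; the other is the same inequality for the adjoint.\<close>

lemma cnorm_star [simp]: "x \<in> carrier A \<Longrightarrow> cnorm A (x\<^sup>\<star>) = cnorm A x"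
proof -
  have *: "cnorm A x \<le> cnorm A (x\<^sup>\<star>)" if x: "x \<in> carrier A" for x
  proof (cases "cnorm A x = 0")
    case False
    have "(cnorm A x)\<^sup>2 \<le> cnorm A (x\<^sup>\<star>) * cnorm A x"
      using cnorm_mult[of "x\<^sup>\<star>" x] x by (simp add: cstar_identity)
    then show ?thesis
      using False cnorm_nonneg[OF x] by (auto simp: power2_eq_square)
  qed (use x in simp)
  show "x \<in> carrier A \<Longrightarrow> ?thesis"
    using *[of x] *[of "x\<^sup>\<star>"] by simp
qed

lemma cnorm_sum_le:
  assumes "finite I" "\<And>i. i \<in> I \<Longrightarrow> f i \<in> carrier A"
  shows "cnorm A (finsum A f I) \<le> (\<Sum>i\<in>I. cnorm A (f i))"
  using assms
proof (induction I)
  case (insert i I)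
  then show ?case
    using cnorm_add[of "f i" "finsum A f I"] by (simp add: sum_insert)
qed simp

lemma cnorm_mult_le:
  assumes "x \<in> carrier A" "y \<in> carrier A" "cnorm A x \<le> r" "cnorm A y \<le> t"
  shows "cnorm A (x \<otimes> y) \<le> r * t"
  using cnorm_mult[of x y] mult_mono[OF assms(3,4)] assms cnorm_nonneg[of x] cnorm_nonneg[of y]
  by linarith

text \<open>The hypothesis makes \<open>p\<close> a projection, whose norm \<open>r\<close>
  satisfies \<open>r^2 = r\<close>. Units and matrix units are later bounded through this.\<close>

lemma projection_cnorm_le: "p \<in> carrier A \<Longrightarrow> p\<^sup>\<star> \<otimes> p = p \<Longrightarrow> cnorm A p \<le> 1"
  using cstar_identity[of p] cnorm_nonneg[of p] by (auto simp: power2_eq_square)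

section \<open>The norm metric, closures and convergent sequences\<close>

sublocale metric: Metric_space "carrier A" "cdist A"
proof
  show "0 \<le> cdist A x y" for x y by (simp add: cdist_def)
  show "cdist A x y = cdist A y x" for x y
    by (simp add: cdist_def cnorm_minus_commute)
  show "cdist A x y = 0 \<longleftrightarrow> x = y" if "x \<in> carrier A" "y \<in> carrier A" for x y
    using that by (simp add: cdist_def cnorm_eq_0 minus_eq_zero_iff)
  show "cdist A x z \<le> cdist A x y + cdist A y z"
    if "x \<in> carrier A" "y \<in> carrier A" "z \<in> carrier A" for x y z
    using that by (simp add: cdist_def cnorm_triangle_diff)
qed

lemma norm_topology_eq: "norm_topology A = metric.mtopology"
  by (simp add: norm_topology_def)

lemma closedin_normI:
  assumes "V \<subseteq> carrier A"
    and "\<And>x. \<lbrakk>x \<in> carrier A; \<And>e. 0 < e \<Longrightarrow> \<exists>y\<in>V. cnorm A (x \<ominus> y) < e\<rbrakk> \<Longrightarrow> x \<in> V"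
  shows "closedin (norm_topology A) V"
proof -
  have "x \<in> V" if cl: "x \<in> metric.mtopology closure_of V" for x
  proof (rule assms(2))
    show "x \<in> carrier A" using cl by (simp add: metric.metric_closure_of)
    fix e :: real assume "0 < e"
    then obtain y where "y \<in> V" "y \<in> metric.mball x e"
      using cl by (auto simp: metric.metric_closure_of)
    then show "\<exists>y\<in>V. cnorm A (x \<ominus> y) < e"
      by (auto simp: cdist_def split: if_splits)
  qed
  then show ?thesis
    unfolding norm_topology_eq
    by (metis assms(1) closure_of_subset_eq metric.topspace_mtopology subsetI)
qed

lemma closure_normD:
  assumes "norm_topology A closure_of S = carrier A" "x \<in> carrier A" "0 < e"
  obtains y where "y \<in> S" "y \<in> carrier A" "cnorm A (x \<ominus> y) < e"
proof -
  have "x \<in> metric.mtopology closure_of S" using assms by (simp add: norm_topology_eq)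
  then obtain y where "y \<in> S" "y \<in> metric.mball x e"
    using assms(3) by (auto simp: metric.metric_closure_of)
  then show ?thesis using that by (auto simp: cdist_def split: if_splits)
qed

text \<open>Convergence is expressed by real sequences of norms of differences, so that the limit
  laws for real numbers apply directly.\<close>

lemma cauchy_convergent:
  assumes f: "\<And>k. f k \<in> carrier A"
    and cauchy: "\<And>e. 0 < e \<Longrightarrow> \<exists>K. \<forall>k\<ge>K. \<forall>l\<ge>K. cnorm A (f k \<ominus> f l) < e"
  obtains x where "x \<in> carrier A" "(\<lambda>k. cnorm A (f k \<ominus> x)) \<longlonglongrightarrow> 0"
proof -
  have "metric.MCauchy f"
    unfolding metric.MCauchy_def using f cauchy by (simp add: cdist_def image_subset_iff)
  then obtain x where "limitin metric.mtopology f x sequentially"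
    using complete unfolding metric.mcomplete_def by blast
  then have "x \<in> carrier A" "(\<lambda>k. cdist A (f k) x) \<longlonglongrightarrow> 0"
    by (auto simp: metric.limitin_metric_dist_null)
  then show ?thesis
    using that f by (simp add: cdist_def)
qed

text \<open>Summing the steps as a geometric series gives the tail bound
  \<open>C * r ^ k / (1 - r)\<close>. Both the Neumann series and the iteration for square roots
  converge by this criterion.\<close>

lemma geometric_convergent:
  assumes f: "\<And>k. f k \<in> carrier A"
    and step: "\<And>k. cnorm A (f (Suc k) \<ominus> f k) \<le> C * r ^ k" and r: "0 \<le> r" "r < 1"
  obtains x where "x \<in> carrier A" "(\<lambda>k. cnorm A (f k \<ominus> x)) \<longlonglongrightarrow> 0"
proof (rule cauchy_convergent[of f])
  show "f k \<in> carrier A" for k by fact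
  have C: "0 \<le> C"
    using order_trans[OF cnorm_nonneg step[of 0]] f by simp
  have bound: "cnorm A (f (k + l) \<ominus> f k) \<le> C * r ^ k / (1 - r)" for k l
  proof -
    have "cnorm A (f (k + l) \<ominus> f k) \<le> (\<Sum>i<l. C * r ^ (k + i))"
    proof (induction l)
      case (Suc l)
      then show ?case
        using cnorm_triangle_diff[of "f (Suc (k + l))" "f (k + l)" "f k"] step[of "k + l"] f
        by simp
    qed (use f in simp)
    also have "\<dots> = C * r ^ k * (\<Sum>i<l. r ^ i)"
      by (simp add: power_add sum_distrib_left mult.assoc)
    also have "(\<Sum>i<l. r ^ i) \<le> 1 / (1 - r)"
      using r by (simp add: sum_gp_strict divide_right_mono)
    then have "C * r ^ k * (\<Sum>i<l. r ^ i) \<le> C * r ^ k * (1 / (1 - r))"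
      using C r by (intro mult_left_mono) auto
    finally show ?thesis by simp
  qed
  fix e :: real assume e: "0 < e"
  have "(\<lambda>k. C * r ^ k / (1 - r)) \<longlonglongrightarrow> C * 0 / (1 - r)"
    using r by (intro tendsto_intros LIMSEQ_realpow_zero) auto
  then have "\<forall>\<^sub>F k in sequentially. C * r ^ k / (1 - r) < e / 2"
    using e by (intro order_tendstoD(2)[of _ 0]) auto
  then obtain K where K: "C * r ^ K / (1 - r) < e / 2"
    by (auto simp: eventually_sequentially)
  have near: "cnorm A (f k \<ominus> f K) < e / 2" if "K \<le> k" for k
    using order_le_less_trans[OF bound[of K "k - K"] K] that by simp
  have "cnorm A (f k \<ominus> f l) < e" if "K \<le> k" "K \<le> l" for k l
    using near[OF that(1)] near[OF that(2)] f cnorm_triangle_diff[of "f k" "f K" "f l"]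
      cnorm_minus_commute[of "f K" "f l"] by simp
  then show "\<exists>K. \<forall>k\<ge>K. \<forall>l\<ge>K. cnorm A (f k \<ominus> f l) < e" by blast
qed

lemma limit_unique:
  assumes "\<And>k. f k \<in> carrier A" "x \<in> carrier A" "y \<in> carrier A"
    and "(\<lambda>k. cnorm A (f k \<ominus> x)) \<longlonglongrightarrow> 0" "(\<lambda>k. cnorm A (f k \<ominus> y)) \<longlonglongrightarrow> 0"
  shows "x = y"
proof -
  have "(\<lambda>k. cnorm A (f k \<ominus> x) + cnorm A (f k \<ominus> y)) \<longlonglongrightarrow> 0 + 0"
    by (intro tendsto_add assms)
  moreover have "cnorm A (x \<ominus> y) \<le> cnorm A (f k \<ominus> x) + cnorm A (f k \<ominus> y)" for k
    using cnorm_triangle_diff[of x "f k" y] cnorm_minus_commute[of x "f k"] assms by simp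
  ultimately have "cnorm A (x \<ominus> y) \<le> 0"
    using LIMSEQ_le_const by force
  then show ?thesis
    using assms order_antisym[OF _ cnorm_nonneg[of "x \<ominus> y"]]
    by (simp add: cnorm_eq_0 minus_eq_zero_iff)
qed

end

section \<open>Automatic contractivity of $*$-homomorphisms\<close>

text \<open>Powers are indexed from the first one since algebras need not be unital.\<close>

primrec spow :: "'a cstar \<Rightarrow> 'a \<Rightarrow> nat \<Rightarrow> 'a" where
  "spow A x 0 = x"
| "spow A x (Suc k) = spow A x k \<otimes>\<^bsub>A\<^esub> x"

text \<open>Of the source only closure under multiplication is asked, so that matrix algebras can
  serve as \<open>R\<close> with just their algebraic operations.\<close>

lemma spow_hom:
  assumes "f \<in> star_hom R A" "x \<in> carrier R"
    and "\<And>x y. x \<in> carrier R \<Longrightarrow> y \<in> carrier R \<Longrightarrow> x \<otimes>\<^bsub>R\<^esub> y \<in> carrier R"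
  shows "spow R x k \<in> carrier R \<and> f (spow R x k) = spow A (f x) k"
  using assms by (induction k) (auto simp: star_homD)

context cstar_algebra
begin

lemma spow_closed [simp, intro]: "x \<in> carrier A \<Longrightarrow> spow A x k \<in> carrier A"
  by (induction k) auto

lemma spow_mult: "x \<in> carrier A \<Longrightarrow> spow A x k \<otimes> spow A x l = spow A x (Suc (k + l))"
  by (induction l) (auto simp: mult_assoc[symmetric])

lemma spow_star: "x \<in> carrier A \<Longrightarrow> x\<^sup>\<star> = x \<Longrightarrow> (spow A x k)\<^sup>\<star> = spow A x k"
proof (induction k)
  case (Suc k)
  then show ?case
    using spow_mult[of x 0 k] by (simp add: star_mult)
qed simp

lemma cnorm_spow_le: "x \<in> carrier A \<Longrightarrow> cnorm A (spow A x k) \<le> cnorm A x ^ Suc k"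
proof (induction k)
  case (Suc k)
  then have "cnorm A (spow A x (Suc k)) \<le> cnorm A x ^ Suc k * cnorm A x"
    using cnorm_mult_le[of "spow A x k" x] by simp
  then show ?case by (simp add: mult.commute mult.left_commute)
qed simp

lemma cnorm_selfadjoint_square:
  "x \<in> carrier A \<Longrightarrow> x\<^sup>\<star> = x \<Longrightarrow> cnorm A (x \<otimes> x) = (cnorm A x)\<^sup>2"
  using cstar_identity[of x] by simp

text \<open>Squaring a self-adjoint element squares its norm. Since \<open>spow A x k\<close> is the
  power with exponent \<open>k + 1\<close>, the index \<open>2 ^ j - 1\<close> stands for the
  exponent \<open>2 ^ j\<close>.\<close>

lemma cnorm_spow_two_power:
  assumes "x \<in> carrier A" "x\<^sup>\<star> = x"
  shows "cnorm A (spow A x (2 ^ j - 1)) = cnorm A x ^ 2 ^ j"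
proof (induction j)
  case (Suc j)
  have "Suc ((2 ^ j - 1) + (2 ^ j - 1)) = 2 ^ Suc j - (1::nat)"
    by (cases "2 ^ j :: nat") simp_all
  then have "spow A x (2 ^ Suc j - 1) = spow A x (2 ^ j - 1) \<otimes> spow A x (2 ^ j - 1)"
    using assms spow_mult[of x "2 ^ j - 1" "2 ^ j - 1"] by simp
  then show ?case
    using assms Suc by (simp add: cnorm_selfadjoint_square spow_star power2_eq_square mult_2 power_add)
qed (use assms in simp)

text \<open>In \<open>w^* w\<close> for \<open>w = a + i b\<close> the mixed terms cancel because
  \<open>a\<close> and \<open>b\<close> commute, which leaves the sum of squares; and
  \<open>a\<close> is the real part of \<open>w\<close>, so its norm is at most that of
  \<open>w\<close>.\<close>

lemma cnorm_square_sum_ge: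
  assumes a: "a \<in> carrier A" "a\<^sup>\<star> = a" and b: "b \<in> carrier A" "b\<^sup>\<star> = b"
    and comm: "a \<otimes> b = b \<otimes> a"
  shows "(cnorm A a)\<^sup>2 \<le> cnorm A (a \<otimes> a \<oplus> b \<otimes> b)"
proof -
  define w where "w = a \<oplus> \<i> \<odot> b"
  have w: "w \<in> carrier A" and ws: "w\<^sup>\<star> = a \<oplus> (- \<i>) \<odot> b"
    using a b by (auto simp: w_def star_add)
  have cancel: "(- \<i>) \<odot> (b \<otimes> a) \<oplus> \<i> \<odot> (b \<otimes> a) = \<zero>"
    using a b scale_left_add[of "b \<otimes> a" "- \<i>" \<i>] by simp
  have "w\<^sup>\<star> \<otimes> w = (a \<otimes> a \<oplus> (- \<i>) \<odot> (b \<otimes> a)) \<oplus> (\<i> \<odot> (b \<otimes> a) \<oplus> b \<otimes> b)"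
    unfolding ws using a b by (simp add: w_def mult_add_left mult_add_right scale_right_add comm)
  also have "\<dots> = a \<otimes> a \<oplus> (((- \<i>) \<odot> (b \<otimes> a) \<oplus> \<i> \<odot> (b \<otimes> a)) \<oplus> b \<otimes> b)"
    using a b by (simp add: M.a_assoc)
  also have "\<dots> = a \<otimes> a \<oplus> b \<otimes> b"
    unfolding cancel using a b by simp
  finally have ww: "w\<^sup>\<star> \<otimes> w = a \<otimes> a \<oplus> b \<otimes> b" .
  have "\<i> \<odot> b \<oplus> (- \<i>) \<odot> b = \<zero>"
    using b scale_left_add[of b \<i> "- \<i>"] by simp
  then have "w \<oplus> w\<^sup>\<star> = a \<oplus> a"
    unfolding ws using a b
    by (simp add: w_def M.a_assoc M.a_lcomm[of "\<i> \<odot> b" a "(- \<i>) \<odot> b"])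
  also have "\<dots> = 2 \<odot> a"
    using a scale_left_add[of a 1 1] by simp
  finally have "cnorm A (2 \<odot> a) \<le> cnorm A w + cnorm A (w\<^sup>\<star>)"
    using w by (metis cnorm_add star_closed)
  then have "cnorm A a \<le> cnorm A w"
    using a w by (simp add: cnorm_smult)
  then have "(cnorm A a)\<^sup>2 \<le> (cnorm A w)\<^sup>2"
    using a by (simp add: power_mono)
  then show ?thesis
    using cstar_identity[OF w] ww by simp
qed

text \<open>The arithmetic-geometric mean inequality, from \<open>(u + v)\<^sup>2 = (2 w)\<^sup>2 + (u - v)\<^sup>2\<close>.\<close>

lemma cnorm_add_ge_geometric_mean:
  assumes u: "u \<in> carrier A" "u\<^sup>\<star> = u" and v: "v \<in> carrier A" "v\<^sup>\<star> = v"
    and w: "w \<in> carrier A" "w\<^sup>\<star> = w"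
    and uv: "u \<otimes> v = w \<otimes> w" "v \<otimes> u = w \<otimes> w" and comm: "w \<otimes> u = u \<otimes> w" "w \<otimes> v = v \<otimes> w"
  shows "2 * cnorm A w \<le> cnorm A (u \<oplus> v)"
proof -
  define p where "p = w \<otimes> w"
  note cl = u(1) v(1) w(1)
  have p: "p \<in> carrier A" using cl by (simp add: p_def)
  have "(u \<ominus> v) \<otimes> (u \<ominus> v) = (u \<otimes> u \<oplus> (- 1) \<odot> p) \<oplus> ((- 1) \<odot> p \<oplus> v \<otimes> v)"
    using cl by (simp add: minus_scale mult_add_left mult_add_right scale_right_add uv p_def)
  also have "\<dots> = (u \<otimes> u \<oplus> v \<otimes> v) \<oplus> ((- 1) \<odot> p \<oplus> (- 1) \<odot> p)"
    using cl p by (simp add: M.a_ac)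
  also have "(- 1) \<odot> p \<oplus> (- 1) \<odot> p = (- 2) \<odot> p"
    using p scale_left_add[of p "-1" "-1"] by simp
  finally have d: "(u \<ominus> v) \<otimes> (u \<ominus> v) = (u \<otimes> u \<oplus> v \<otimes> v) \<oplus> (- 2) \<odot> p" .
  have "(2 \<odot> w) \<otimes> (2 \<odot> w) \<oplus> (u \<ominus> v) \<otimes> (u \<ominus> v)
      = (u \<otimes> u \<oplus> v \<otimes> v) \<oplus> (4 \<odot> p \<oplus> (- 2) \<odot> p)"
    unfolding d using cl p by (simp add: p_def[symmetric] M.a_ac)
  also have "4 \<odot> p \<oplus> (- 2) \<odot> p = p \<oplus> p"
    using p scale_left_add[of p 4 "-2"] scale_left_add[of p 1 1] by simp
  also have "(u \<otimes> u \<oplus> v \<otimes> v) \<oplus> (p \<oplus> p) = (u \<oplus> v) \<otimes> (u \<oplus> v)"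
    using cl p by (simp add: mult_add_left mult_add_right uv p_def[symmetric] M.a_ac)
  finally have eq: "(2 \<odot> w) \<otimes> (2 \<odot> w) \<oplus> (u \<ominus> v) \<otimes> (u \<ominus> v) = (u \<oplus> v) \<otimes> (u \<oplus> v)" .
  have "(cnorm A (2 \<odot> w))\<^sup>2 \<le> cnorm A ((2 \<odot> w) \<otimes> (2 \<odot> w) \<oplus> (u \<ominus> v) \<otimes> (u \<ominus> v))"
    by (rule cnorm_square_sum_ge)
      (use u v w comm in \<open>auto simp: star_minus mult_minus_left mult_minus_right scale_minus_right\<close>)
  also have "\<dots> = (cnorm A (u \<oplus> v))\<^sup>2"
    unfolding eq using u v by (simp add: cnorm_selfadjoint_square star_add)
  finally have "cnorm A (2 \<odot> w) \<le> cnorm A (u \<oplus> v)"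
    by (rule power2_le_imp_le) (use cl in auto)
  then show ?thesis using cl by (simp add: cnorm_smult)
qed

text \<open>By the index shift of \<open>spow\<close> the exponents are
  \<open>r + 1, r + 3, ..., r + 2 m - 1\<close>: odd powers for \<open>r = 0\<close>, even powers
  for \<open>r = 1\<close>. The offset is kept free for an induction that halves the sum.\<close>

definition odd_sum :: "'a \<Rightarrow> nat \<Rightarrow> nat \<Rightarrow> 'a" where
  "odd_sum x r m = (\<Oplus>k\<in>{..<m}. spow A x (r + 2 * k))"

lemma odd_sum_closed [simp, intro]: "x \<in> carrier A \<Longrightarrow> odd_sum x r m \<in> carrier A"
  by (auto simp: odd_sum_def)

lemma odd_sum_Suc: "x \<in> carrier A \<Longrightarrow> odd_sum x r (Suc m) = odd_sum x r m \<oplus> spow A x (r + 2 * m)"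
  by (simp add: odd_sum_def lessThan_Suc sum_insert M.a_comm)

text \<open>The right-hand side depends on the offsets only through \<open>a + b\<close>. This
  provides at once the commutation relations and the identity \<open>u v = w w\<close> that the mean
  inequality asks for.\<close>

lemma odd_sum_mult:
  assumes "x \<in> carrier A"
  shows "odd_sum x a m \<otimes> odd_sum x b m
    = (\<Oplus>k\<in>{..<m}. \<Oplus>l\<in>{..<m}. spow A x (Suc (a + b + 2 * k + 2 * l)))"
  using assms unfolding odd_sum_def
  by (subst mult_sum_left, simp, blast, intro sum_cong refl)
    (auto simp: mult_sum_right spow_mult algebra_simps)

lemma odd_sum_add:
  assumes x: "x \<in> carrier A"
  shows "odd_sum x r (m + l) = odd_sum x r m \<oplus> odd_sum x (r + 2 * m) l"
  using x
  by (induction l) (simp_all add: odd_sum_Suc M.a_assoc algebra_simps, simp add: odd_sum_def)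

text \<open>The exponents average to \<open>r + 2 ^ j\<close>, so the bound reads: number of terms
  times geometric mean. A sum of \<open>2 ^ Suc j\<close> terms consists of two blocks whose product
  is the square of the block of the same length started at \<open>r + 2 ^ j\<close>; the mean
  inequality leads to that middle block, where the induction hypothesis applies.\<close>

lemma cnorm_odd_sum_ge:
  assumes x: "x \<in> carrier A" "x\<^sup>\<star> = x"
  shows "2 ^ j * cnorm A (spow A x (r + 2 ^ j - 1)) \<le> cnorm A (odd_sum x r (2 ^ j))"
proof (induction j arbitrary: r)
  case 0
  then show ?case using x by (simp add: odd_sum_def lessThan_Suc sum_insert)
next
  case (Suc j)
  let ?G = "\<lambda>r. odd_sum x r (2 ^ j)"
  have star: "(?G r)\<^sup>\<star> = ?G r" for r
    using x by (simp add: odd_sum_def star_sum spow_star)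
  have comm: "?G a \<otimes> ?G b = ?G c \<otimes> ?G e" if "a + b = c + e" for a b c e
    using x that by (simp add: odd_sum_mult)
  have "2 * cnorm A (?G (r + 2 ^ j)) \<le> cnorm A (?G r \<oplus> ?G (r + 2 * 2 ^ j))"
    by (rule cnorm_add_ge_geometric_mean) (use x star in \<open>auto intro!: comm\<close>)
  then have "2 * cnorm A (?G (r + 2 ^ j)) \<le> cnorm A (odd_sum x r (2 ^ Suc j))"
    using odd_sum_add[OF x(1), of r "2 ^ j" "2 ^ j"] by (simp flip: mult_2)
  moreover have "2 ^ j * cnorm A (spow A x (r + 2 ^ Suc j - 1)) \<le> cnorm A (?G (r + 2 ^ j))"
    using Suc.IH[of "r + 2 ^ j"] by (simp add: mult_2 add.assoc)
  ultimately show ?case by simp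
qed

text \<open>The finite geometric series for \<open>1 - x^2\<close>, written without a unit;
  \<open>spow A x (2 * m)\<close> has exponent \<open>2 m + 1\<close>.\<close>

lemma odd_sum_telescope:
  assumes x: "x \<in> carrier A"
  shows "odd_sum x 0 m \<ominus> (x \<otimes> x) \<otimes> odd_sum x 0 m = x \<ominus> spow A x (2 * m)"
proof (induction m)
  case (Suc m)
  have "(x \<otimes> x) \<otimes> spow A x (2 * m) = spow A x (2 * Suc m)"
    using x spow_mult[of x 1 "2 * m"] by simp
  then have "odd_sum x 0 (Suc m) \<ominus> (x \<otimes> x) \<otimes> odd_sum x 0 (Suc m)
      = (odd_sum x 0 m \<ominus> (x \<otimes> x) \<otimes> odd_sum x 0 m)
        \<oplus> (spow A x (2 * m) \<ominus> spow A x (2 * Suc m))"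
    using x by (simp add: odd_sum_Suc mult_add_right add_diff_add del: spow.simps)
  then show ?case
    using x by (simp add: Suc diff_trans del: spow.simps)
qed (use x in \<open>simp add: odd_sum_def\<close>)

text \<open>A self-adjoint element of norm one has \<open>1\<close> in the spectrum of its square: a quasi-inverse
  of the square would bound the sums of odd powers.\<close>

lemma no_quasi_inverse_of_square:
  assumes x: "x \<in> carrier A" "x\<^sup>\<star> = x" "cnorm A x = 1"
    and w: "w \<in> carrier A"
  shows "w \<noteq> x \<otimes> x \<oplus> w \<otimes> (x \<otimes> x)"
proof
  assume weq: "w = x \<otimes> x \<oplus> w \<otimes> (x \<otimes> x)"
  have bound: "cnorm A (odd_sum x 0 m) \<le> 2 + cnorm A w * 2" for m
  proof -
    define T where "T = odd_sum x 0 m"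
    define D where "D = T \<ominus> (x \<otimes> x) \<otimes> T"
    have T: "T \<in> carrier A" and D: "D \<in> carrier A"
      using x by (auto simp: T_def D_def)
    have "w \<otimes> T = (x \<otimes> x) \<otimes> T \<oplus> w \<otimes> ((x \<otimes> x) \<otimes> T)"
      using x w T by (subst weq) (simp add: mult_add_left mult_assoc)
    moreover have "w \<otimes> D = w \<otimes> T \<ominus> w \<otimes> ((x \<otimes> x) \<otimes> T)"
      using x w T by (simp add: D_def mult_minus_right)
    ultimately have "w \<otimes> D = (x \<otimes> x) \<otimes> T"
      using x w T by (simp add: a_minus_def M.a_assoc M.r_neg)
    \<comment> \<open>Formally the equation for \<open>w\<close> says
      \<open>(1 + w) (1 - x^2) = 1\<close>, so \<open>T\<close> is recovered from
      \<open>D = (1 - x^2) T\<close>. The telescoped form of \<open>D\<close> has norm at most two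
      whatever \<open>m\<close> is.\<close>
    then have "T = D \<oplus> w \<otimes> D"
      using x T by (simp add: D_def minus_add_cancel)
    moreover have "cnorm A D \<le> 2"
      using odd_sum_telescope[OF x(1), of m] cnorm_minus_le[of x "spow A x (2 * m)"]
        cnorm_spow_le[OF x(1), of "2 * m"] x by (simp add: D_def T_def)
    moreover have "cnorm A (w \<otimes> D) \<le> cnorm A w * 2"
      using w D \<open>cnorm A D \<le> 2\<close> by (intro cnorm_mult_le) auto
    ultimately show ?thesis
      using cnorm_add[of D "w \<otimes> D"] w D by (simp add: T_def)
  qed
  \<comment> \<open>The sum of \<open>2 ^ j\<close> odd powers has norm at least
    \<open>2 ^ j\<close>, because the power of \<open>x\<close> with exponent \<open>2 ^ j\<close>
    still has norm one.\<close>
  obtain j where j: "2 + cnorm A w * 2 < 2 ^ j"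
    using real_arch_pow[of 2] by auto
  have "2 ^ j \<le> cnorm A (odd_sum x 0 (2 ^ j))"
    using cnorm_odd_sum_ge[OF x(1,2), of j 0] cnorm_spow_two_power[OF x(1,2), of j] x(3) by simp
  with bound[of "2 ^ j"] j show False by simp
qed

text \<open>The Neumann series of the square.\<close>

lemma quasi_inverse_of_square:
  assumes a: "a \<in> carrier A" "cnorm A a < 1"
  obtains b where "b \<in> carrier A" "b = a \<otimes> a \<oplus> b \<otimes> (a \<otimes> a)"
proof -
  \<comment> \<open>The offset one makes \<open>S m = a^2 + a^4 + ... + a^(2 m)\<close>, the partial
    sums of \<open>a^2 / (1 - a^2)\<close>.\<close>
  define S where "S = odd_sum a 1"
  have S: "S m \<in> carrier A" for m using a by (simp add: S_def)
  have "cnorm A (S (Suc k) \<ominus> S k) \<le> 1 * cnorm A a ^ k" for k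
  proof -
    have "S (Suc k) \<ominus> S k = spow A a (1 + 2 * k)"
      using a S[of k] unfolding S_def
      by (simp add: odd_sum_Suc a_minus_def M.a_ac M.r_neg2 del: spow.simps)
    also have "cnorm A (spow A a (1 + 2 * k)) \<le> cnorm A a ^ (Suc (1 + 2 * k))"
      using a by (rule_tac cnorm_spow_le)
    also have "\<dots> \<le> cnorm A a ^ k"
      using a by (intro power_decreasing) auto
    finally show ?thesis by simp
  qed
  then obtain b where b: "b \<in> carrier A" "(\<lambda>k. cnorm A (S k \<ominus> b)) \<longlonglongrightarrow> 0"
    using geometric_convergent[of S 1 "cnorm A a"] S a by auto
  let ?t = "a \<otimes> a"
  have rec: "S (Suc m) = ?t \<oplus> S m \<otimes> ?t" for m
  proof (induction m)
    case 0
    then show ?case using a by (simp add: S_def odd_sum_def lessThan_Suc sum_insert)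
  next
    case (Suc m)
    have "spow A a (1 + 2 * m) \<otimes> ?t = spow A a (1 + 2 * Suc m)"
      using a spow_mult[of a "1 + 2 * m" 1] by simp
    then have "?t \<oplus> S (Suc m) \<otimes> ?t = (?t \<oplus> S m \<otimes> ?t) \<oplus> spow A a (1 + 2 * Suc m)"
      using a S[of m] unfolding S_def
      by (simp add: odd_sum_Suc mult_add_left M.a_assoc del: spow.simps)
    then show ?case
      using Suc a by (simp add: S_def odd_sum_Suc del: spow.simps)
  qed
  have "b = ?t \<oplus> b \<otimes> ?t"
  proof (rule limit_unique)
    show "(\<lambda>k. cnorm A (S (Suc k) \<ominus> b)) \<longlonglongrightarrow> 0"
      using b(2) by (rule LIMSEQ_Suc)
    have "(\<lambda>k. cnorm A (S k \<ominus> b) * cnorm A ?t) \<longlonglongrightarrow> 0 * cnorm A ?t"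
      by (intro tendsto_mult b tendsto_const)
    moreover have "cnorm A (S (Suc k) \<ominus> (?t \<oplus> b \<otimes> ?t)) \<le> cnorm A (S k \<ominus> b) * cnorm A ?t" for k
      using a b S cnorm_mult[of "S k \<ominus> b" ?t] unfolding rec
      by (simp add: add_diff_add mult_minus_left)
    ultimately show "(\<lambda>k. cnorm A (S (Suc k) \<ominus> (?t \<oplus> b \<otimes> ?t))) \<longlonglongrightarrow> 0"
      using tendsto_sandwich[of "\<lambda>_. 0" "\<lambda>k. cnorm A (S (Suc k) \<ominus> (?t \<oplus> b \<otimes> ?t))"
          sequentially "\<lambda>k. cnorm A (S k \<ominus> b) * cnorm A ?t" 0] a b S by simp
  qed (use a b S in auto)
  with b(1) that show ?thesis by blast
qed

end

text \<open>If \<open>f\<close> increased the norm of a self-adjoint element, rescaling would give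
  \<open>a'\<close> of norm below one whose image has norm one. The square of \<open>a'\<close> has
  a quasi-inverse, hence so has the square of its image, which is impossible. Quasi-inverses are
  defined by an equation without units and so are carried over by any homomorphism. The C*-identity
  reduces the general case to \<open>x^* x\<close>.\<close>

theorem star_hom_contractive:
  assumes "cstar_algebra A" "cstar_algebra B" and f: "f \<in> star_hom A B" and x: "x \<in> carrier A"
  shows "cnorm B (f x) \<le> cnorm A x"
proof -
  interpret A: cstar_algebra A by fact
  interpret B: cstar_algebra B by fact
  have sa: "cnorm B (f a) \<le> cnorm A a" if a: "a \<in> carrier A" "a\<^sup>\<star>\<^bsub>A\<^esub> = a" for a
  proof (rule ccontr)
    assume "\<not> ?thesis"
    then have less: "cnorm A a < cnorm B (f a)" by simp
    have fa: "f a \<in> carrier B" using f a by (simp add: star_homD)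
    have pos: "0 < cnorm B (f a)"
      using less A.cnorm_nonneg[OF a(1)] by linarith
    define c where "c = complex_of_real (1 / cnorm B (f a))"
    define a' where "a' = c \<odot>\<^bsub>A\<^esub> a"
    have a': "a' \<in> carrier A" "a'\<^sup>\<star>\<^bsub>A\<^esub> = a'"
      using a by (auto simp: a'_def c_def)
    have cm: "cmod c = 1 / cnorm B (f a)"
      using pos unfolding c_def by (simp only: norm_of_real) simp
    have "cnorm A a' < 1"
      using a less pos by (simp add: a'_def cm A.cnorm_smult divide_simps)
    then obtain b where b: "b \<in> carrier A" "b = a' \<otimes>\<^bsub>A\<^esub> a' \<oplus>\<^bsub>A\<^esub> b \<otimes>\<^bsub>A\<^esub> (a' \<otimes>\<^bsub>A\<^esub> a')"
      using A.quasi_inverse_of_square a' by blast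
    have "f b = f (a' \<otimes>\<^bsub>A\<^esub> a' \<oplus>\<^bsub>A\<^esub> b \<otimes>\<^bsub>A\<^esub> (a' \<otimes>\<^bsub>A\<^esub> a'))"
      using b(2) by (rule arg_cong)
    also have "\<dots> = f a' \<otimes>\<^bsub>B\<^esub> f a' \<oplus>\<^bsub>B\<^esub> f b \<otimes>\<^bsub>B\<^esub> (f a' \<otimes>\<^bsub>B\<^esub> f a')"
      using f a' b(1) by (simp add: star_homD)
    finally have "f b = f a' \<otimes>\<^bsub>B\<^esub> f a' \<oplus>\<^bsub>B\<^esub> f b \<otimes>\<^bsub>B\<^esub> (f a' \<otimes>\<^bsub>B\<^esub> f a')" .
    moreover have "f a' \<in> carrier B" "(f a')\<^sup>\<star>\<^bsub>B\<^esub> = f a'" "cnorm B (f a') = 1"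
      using a' f a fa pos star_homD(5)[OF f a'(1)]
      by (auto simp: star_homD) (simp add: a'_def star_homD B.cnorm_smult cm)
    ultimately show False
      using B.no_quasi_inverse_of_square[of "f a'" "f b"] f b by (simp add: star_homD)
  qed
  have "(cnorm B (f x))\<^sup>2 = cnorm B (f (x\<^sup>\<star>\<^bsub>A\<^esub> \<otimes>\<^bsub>A\<^esub> x))"
    using f x by (simp add: star_homD B.cstar_identity)
  also have "\<dots> \<le> cnorm A (x\<^sup>\<star>\<^bsub>A\<^esub> \<otimes>\<^bsub>A\<^esub> x)"
    using x by (intro sa) (auto simp: A.star_mult)
  also have "\<dots> = (cnorm A x)\<^sup>2"
    using x by (rule A.cstar_identity)
  finally show ?thesis
    by (rule power2_le_imp_le) (use x in simp)
qed

text \<open>If \<open>b < a\<close>, the ratio of the powers outgrows every constant. This is the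
  spectral radius argument in elementary form.\<close>

lemma real_le_of_powers_le:
  fixes a b :: real
  assumes "0 \<le> a" "0 \<le> b" "\<And>j. a ^ 2 ^ j \<le> K * b ^ 2 ^ j"
  shows "a \<le> b"
proof (rule ccontr)
  assume "\<not> a \<le> b"
  then have less: "b < a" by simp
  show False
  proof (cases "b = 0")
    case True
    then show False using assms(3)[of 0] less by simp
  next
    case False
    then have b: "0 < b" using assms by simp
    then have gt: "1 < a / b" using less by simp
    obtain j where "K < (a / b) ^ j" using real_arch_pow[OF gt] by blast
    also have "\<dots> \<le> (a / b) ^ 2 ^ j"
      using gt by (intro power_increasing) (auto simp: less_imp_le)
    finally have "K * b ^ 2 ^ j < a ^ 2 ^ j"
      using b by (simp add: power_divide divide_simps)
    with assms(3)[of j] show False by simp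
  qed
qed

text \<open>A bounded comparison of $*$-homomorphisms is contractive, by passing to powers of \<open>x\<^sup>\<star> x\<close>.\<close>

lemma star_hom_compare:
  assumes "cstar_algebra A" "cstar_algebra B" and f: "f \<in> star_hom R A" and g: "g \<in> star_hom R B"
    and mult: "\<And>x y. x \<in> carrier R \<Longrightarrow> y \<in> carrier R \<Longrightarrow> x \<otimes>\<^bsub>R\<^esub> y \<in> carrier R"
    and star: "\<And>x. x \<in> carrier R \<Longrightarrow> x\<^sup>\<star>\<^bsub>R\<^esub> \<in> carrier R"
    and bound: "\<And>x. x \<in> carrier R \<Longrightarrow> cnorm A (f x) \<le> K * cnorm B (g x)"
    and x: "x \<in> carrier R"
  shows "cnorm A (f x) \<le> cnorm B (g x)"
proof -
  interpret A: cstar_algebra A by fact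
  interpret B: cstar_algebra B by fact
  define y where "y = x\<^sup>\<star>\<^bsub>R\<^esub> \<otimes>\<^bsub>R\<^esub> x"
  have y: "y \<in> carrier R" using x mult star by (simp add: y_def)
  have fy: "f y = (f x)\<^sup>\<star>\<^bsub>A\<^esub> \<otimes>\<^bsub>A\<^esub> f x" and gy: "g y = (g x)\<^sup>\<star>\<^bsub>B\<^esub> \<otimes>\<^bsub>B\<^esub> g x"
    using f g x star by (simp_all add: y_def star_homD)
  have fx: "f x \<in> carrier A" "g x \<in> carrier B" using f g x by (auto simp: star_homD)
  have "cnorm A (f y) \<le> cnorm B (g y)"
  proof (rule real_le_of_powers_le)
    fix j :: nat
    have "cnorm A (f y) ^ 2 ^ j = cnorm A (spow A (f y) (2 ^ j - 1))"
      using fx unfolding fy by (subst A.cnorm_spow_two_power) (auto simp: A.star_mult)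
    also have "\<dots> = cnorm A (f (spow R y (2 ^ j - 1)))"
      using spow_hom[OF f y mult] by simp
    also have "\<dots> \<le> K * cnorm B (g (spow R y (2 ^ j - 1)))"
      using spow_hom[OF f y mult] by (intro bound) blast
    also have "g (spow R y (2 ^ j - 1)) = spow B (g y) (2 ^ j - 1)"
      using spow_hom[OF g y mult] by simp
    also have "cnorm B \<dots> = cnorm B (g y) ^ 2 ^ j"
      using fx unfolding gy by (subst B.cnorm_spow_two_power) (auto simp: B.star_mult)
    finally show "cnorm A (f y) ^ 2 ^ j \<le> K * cnorm B (g y) ^ 2 ^ j" .
  qed (use fx fy gy in auto)
  then have "(cnorm A (f x))\<^sup>2 \<le> (cnorm B (g x))\<^sup>2"
    using fx by (simp add: fy gy A.cstar_identity B.cstar_identity)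
  then show ?thesis by (rule power2_le_imp_le) (use fx in simp)
qed

section \<open>Extension by continuity\<close>

context cstar_algebra
begin

lemma tendsto_cnorm:
  assumes "\<And>k. f k \<in> carrier A" "x \<in> carrier A" "(\<lambda>k. cnorm A (f k \<ominus> x)) \<longlonglongrightarrow> 0"
  shows "(\<lambda>k. cnorm A (f k)) \<longlonglongrightarrow> cnorm A x"
proof -
  have "\<bar>cnorm A (f k) - cnorm A x\<bar> \<le> cnorm A (f k \<ominus> x)" for k
    using cnorm_le_diff[of "f k" x] cnorm_le_diff[of x "f k"] cnorm_minus_commute[of x "f k"] assms
    by simp
  then have "(\<lambda>k. cnorm A (f k) - cnorm A x) \<longlonglongrightarrow> 0"
    by (intro Lim_null_comparison[OF _ assms(3)]) simp
  then show ?thesis by (simp add: LIM_zero_iff)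
qed

lemma tendsto_add_cnorm:
  assumes "\<And>k. f k \<in> carrier A" "\<And>k. g k \<in> carrier A" "x \<in> carrier A" "y \<in> carrier A"
    and "(\<lambda>k. cnorm A (f k \<ominus> x)) \<longlonglongrightarrow> 0" "(\<lambda>k. cnorm A (g k \<ominus> y)) \<longlonglongrightarrow> 0"
  shows "(\<lambda>k. cnorm A ((f k \<oplus> g k) \<ominus> (x \<oplus> y))) \<longlonglongrightarrow> 0"
proof (rule tendsto_sandwich[of "\<lambda>_. 0" _ _ "\<lambda>k. cnorm A (f k \<ominus> x) + cnorm A (g k \<ominus> y)"])
  show "(\<lambda>k. cnorm A (f k \<ominus> x) + cnorm A (g k \<ominus> y)) \<longlonglongrightarrow> 0"
    using tendsto_add[OF assms(5,6)] by simp
qed (use assms cnorm_add in \<open>auto simp: add_diff_add\<close>)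

lemma tendsto_mult_cnorm:
  assumes "\<And>k. f k \<in> carrier A" "\<And>k. g k \<in> carrier A" "x \<in> carrier A" "y \<in> carrier A"
    and "(\<lambda>k. cnorm A (f k \<ominus> x)) \<longlonglongrightarrow> 0" "(\<lambda>k. cnorm A (g k \<ominus> y)) \<longlonglongrightarrow> 0"
  shows "(\<lambda>k. cnorm A ((f k \<otimes> g k) \<ominus> (x \<otimes> y))) \<longlonglongrightarrow> 0"
proof (rule tendsto_sandwich[of "\<lambda>_. 0" _ _ "\<lambda>k. cnorm A (f k \<ominus> x) * (cnorm A y + cnorm A (g k \<ominus> y))
      + cnorm A x * cnorm A (g k \<ominus> y)"])
  have "(\<lambda>k. cnorm A (f k \<ominus> x) * (cnorm A y + cnorm A (g k \<ominus> y))
      + cnorm A x * cnorm A (g k \<ominus> y)) \<longlonglongrightarrow> 0 * (cnorm A y + 0) + cnorm A x * 0"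
    by (intro tendsto_intros assms)
  then show "(\<lambda>k. cnorm A (f k \<ominus> x) * (cnorm A y + cnorm A (g k \<ominus> y))
      + cnorm A x * cnorm A (g k \<ominus> y)) \<longlonglongrightarrow> 0" by simp
  have "cnorm A ((f k \<otimes> g k) \<ominus> (x \<otimes> y))
      \<le> cnorm A (f k \<ominus> x) * (cnorm A y + cnorm A (g k \<ominus> y)) + cnorm A x * cnorm A (g k \<ominus> y)" for k
  proof -
    have "(f k \<otimes> g k) \<ominus> (x \<otimes> y) = (f k \<ominus> x) \<otimes> g k \<oplus> x \<otimes> (g k \<ominus> y)"
      using assms by (simp add: mult_minus_left mult_minus_right diff_trans)
    moreover have "cnorm A ((f k \<ominus> x) \<otimes> g k) \<le> cnorm A (f k \<ominus> x) * (cnorm A y + cnorm A (g k \<ominus> y))"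
      using assms by (intro cnorm_mult_le cnorm_le_diff) auto
    moreover have "cnorm A (x \<otimes> (g k \<ominus> y)) \<le> cnorm A x * cnorm A (g k \<ominus> y)"
      using assms by (intro cnorm_mult) auto
    ultimately show ?thesis
      using cnorm_add[of "(f k \<ominus> x) \<otimes> g k" "x \<otimes> (g k \<ominus> y)"] assms by simp
  qed
  then show "\<forall>\<^sub>F k in sequentially. cnorm A ((f k \<otimes> g k) \<ominus> (x \<otimes> y))
      \<le> cnorm A (f k \<ominus> x) * (cnorm A y + cnorm A (g k \<ominus> y)) + cnorm A x * cnorm A (g k \<ominus> y)"
    by simp
qed (use assms in auto)

lemma tendsto_star_cnorm:
  assumes "\<And>k. f k \<in> carrier A" "x \<in> carrier A" "(\<lambda>k. cnorm A (f k \<ominus> x)) \<longlonglongrightarrow> 0"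
  shows "(\<lambda>k. cnorm A ((f k)\<^sup>\<star> \<ominus> x\<^sup>\<star>)) \<longlonglongrightarrow> 0"
  using assms by (simp flip: star_minus)

lemma tendsto_scale_cnorm:
  assumes "\<And>k. f k \<in> carrier A" "x \<in> carrier A" "(\<lambda>k. cnorm A (f k \<ominus> x)) \<longlonglongrightarrow> 0"
  shows "(\<lambda>k. cnorm A (c \<odot> f k \<ominus> c \<odot> x)) \<longlonglongrightarrow> 0"
  using tendsto_mult_left[OF assms(3), of "cmod c"] assms
  by (simp add: cnorm_smult flip: scale_minus_right)

lemma dense_sequence:
  assumes "norm_topology A closure_of D = carrier A" "x \<in> carrier A"
  obtains d where "\<And>k. d k \<in> D" "\<And>k. d k \<in> carrier A" "(\<lambda>k. cnorm A (d k \<ominus> x)) \<longlonglongrightarrow> 0"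
proof -
  have "\<exists>y. y \<in> D \<and> y \<in> carrier A \<and> cnorm A (x \<ominus> y) < 1 / real (Suc k)" for k
    by (rule closure_normD[OF assms, of "1 / real (Suc k)"]) auto
  then obtain d where d: "\<And>k. d k \<in> D" "\<And>k. d k \<in> carrier A"
    "\<And>k. cnorm A (x \<ominus> d k) < 1 / real (Suc k)"
    by metis
  have "(\<lambda>k. cnorm A (d k \<ominus> x)) \<longlonglongrightarrow> 0"
  proof (rule tendsto_sandwich[of "\<lambda>_. 0" _ _ "\<lambda>k. 1 / real (Suc k)"])
    show "(\<lambda>k. 1 / real (Suc k)) \<longlonglongrightarrow> 0" by (rule LIMSEQ_Suc[OF lim_1_over_n])
    show "\<forall>\<^sub>F k in sequentially. cnorm A (d k \<ominus> x) \<le> 1 / real (Suc k)"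
      using d assms(2) by (auto simp: cnorm_minus_commute[of _ x] less_imp_le)
  qed (use d assms in auto)
  with d that show ?thesis by blast
qed

end

theorem star_hom_extension:
  assumes "cstar_algebra A" "cstar_algebra B"
    and dense: "norm_topology A closure_of D = carrier A" and D: "D \<subseteq> carrier A"
    and cl: "\<And>x y. x \<in> D \<Longrightarrow> y \<in> D \<Longrightarrow> x \<oplus>\<^bsub>A\<^esub> y \<in> D" "\<And>c x. x \<in> D \<Longrightarrow> c \<odot>\<^bsub>A\<^esub> x \<in> D"
      "\<And>x y. x \<in> D \<Longrightarrow> y \<in> D \<Longrightarrow> x \<otimes>\<^bsub>A\<^esub> y \<in> D" "\<And>x. x \<in> D \<Longrightarrow> x\<^sup>\<star>\<^bsub>A\<^esub> \<in> D"
    and f: "f \<in> star_hom (A\<lparr>carrier := D\<rparr>) B"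
    and bound: "\<And>x. x \<in> D \<Longrightarrow> cnorm B (f x) \<le> cnorm A x"
  obtains g where "g \<in> star_hom A B" "\<And>x. x \<in> D \<Longrightarrow> g x = f x"
proof -
  interpret A: cstar_algebra A by fact
  interpret B: cstar_algebra B by fact
  have fcl: "f x \<in> carrier B" if "x \<in> D" for x using f that by (auto simp: star_hom_def linear_maps_def)
  have fadd: "f (x \<oplus>\<^bsub>A\<^esub> y) = f x \<oplus>\<^bsub>B\<^esub> f y" and fmult: "f (x \<otimes>\<^bsub>A\<^esub> y) = f x \<otimes>\<^bsub>B\<^esub> f y"
    if "x \<in> D" "y \<in> D" for x y
    using f that by (auto simp: star_hom_def linear_maps_def)
  have fscale: "f (c \<odot>\<^bsub>A\<^esub> x) = c \<odot>\<^bsub>B\<^esub> f x" and fstar: "f (x\<^sup>\<star>\<^bsub>A\<^esub>) = (f x)\<^sup>\<star>\<^bsub>B\<^esub>"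
    if "x \<in> D" for c x
    using f that by (auto simp: star_hom_def linear_maps_def)
  have minus: "x \<ominus>\<^bsub>A\<^esub> y \<in> D" "f (x \<ominus>\<^bsub>A\<^esub> y) = f x \<ominus>\<^bsub>B\<^esub> f y" if "x \<in> D" "y \<in> D" for x y
    using that D cl fcl by (auto simp: subset_iff A.minus_scale B.minus_scale fadd fscale)
  have diff: "cnorm B (f x \<ominus>\<^bsub>B\<^esub> f y) \<le> cnorm A (x \<ominus>\<^bsub>A\<^esub> y)" if "x \<in> D" "y \<in> D" for x y
    using bound[OF minus(1)[OF that]] minus(2)[OF that] by simp
  have DA: "x \<in> carrier A" if "x \<in> D" for x using that D by blast
  \<comment> \<open>The limit is demanded along every sequence from \<open>D\<close> that tends to
    \<open>x\<close>, so that each algebraic rule below may be checked on a convenient sequence, for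
    instance the sum of two given ones.\<close>
  define lim where "lim x y \<longleftrightarrow> y \<in> carrier B \<and> (\<forall>d. (\<forall>k. d k \<in> D) \<longrightarrow>
    (\<lambda>k. cnorm A (d k \<ominus>\<^bsub>A\<^esub> x)) \<longlonglongrightarrow> 0 \<longrightarrow> (\<lambda>k. cnorm B (f (d k) \<ominus>\<^bsub>B\<^esub> y)) \<longlonglongrightarrow> 0)" for x y
  have ex: "\<exists>y. lim x y" if x: "x \<in> carrier A" for x
  proof -
    obtain d where d: "\<And>k. d k \<in> D" "(\<lambda>k. cnorm A (d k \<ominus>\<^bsub>A\<^esub> x)) \<longlonglongrightarrow> 0"
      using A.dense_sequence[OF dense x] by metis
    obtain y where y: "y \<in> carrier B" "(\<lambda>k. cnorm B (f (d k) \<ominus>\<^bsub>B\<^esub> y)) \<longlonglongrightarrow> 0"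
    proof (rule B.cauchy_convergent[of "\<lambda>k. f (d k)"])
      fix e :: real assume "0 < e"
      then have "\<forall>\<^sub>F k in sequentially. cnorm A (d k \<ominus>\<^bsub>A\<^esub> x) < e / 2"
        using d(2) by (intro order_tendstoD(2)[of _ 0]) auto
      then obtain K where K: "\<And>k. K \<le> k \<Longrightarrow> cnorm A (d k \<ominus>\<^bsub>A\<^esub> x) < e / 2"
        by (auto simp: eventually_sequentially)
      have "cnorm B (f (d k) \<ominus>\<^bsub>B\<^esub> f (d l)) < e" if "K \<le> k" "K \<le> l" for k l
        using K[OF that(1)] K[OF that(2)] diff[OF d(1)[of k] d(1)[of l]]
          A.cnorm_triangle_diff[OF DA[OF d(1)[of k]] x DA[OF d(1)[of l]]]
          A.cnorm_minus_commute[OF x DA[OF d(1)[of l]]] by linarith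
      then show "\<exists>K. \<forall>k\<ge>K. \<forall>l\<ge>K. cnorm B (f (d k) \<ominus>\<^bsub>B\<^esub> f (d l)) < e" by blast
    qed (use fcl d in auto)
    \<comment> \<open>Independence of the sequence: a competitor \<open>e\<close> is compared with
      \<open>d\<close> through their common limit.\<close>
    have "(\<lambda>k. cnorm B (f (e k) \<ominus>\<^bsub>B\<^esub> y)) \<longlonglongrightarrow> 0"
      if e: "\<And>k. e k \<in> D" "(\<lambda>k. cnorm A (e k \<ominus>\<^bsub>A\<^esub> x)) \<longlonglongrightarrow> 0" for e
    proof (rule tendsto_sandwich[of "\<lambda>_. 0" _ _ "\<lambda>k. cnorm A (e k \<ominus>\<^bsub>A\<^esub> x) + cnorm A (d k \<ominus>\<^bsub>A\<^esub> x)
          + cnorm B (f (d k) \<ominus>\<^bsub>B\<^esub> y)"])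
      show "(\<lambda>k. cnorm A (e k \<ominus>\<^bsub>A\<^esub> x) + cnorm A (d k \<ominus>\<^bsub>A\<^esub> x) + cnorm B (f (d k) \<ominus>\<^bsub>B\<^esub> y)) \<longlonglongrightarrow> 0"
        using tendsto_add[OF tendsto_add[OF e(2) d(2)] y(2)] by simp
      have "cnorm B (f (e k) \<ominus>\<^bsub>B\<^esub> y)
          \<le> cnorm A (e k \<ominus>\<^bsub>A\<^esub> x) + cnorm A (d k \<ominus>\<^bsub>A\<^esub> x) + cnorm B (f (d k) \<ominus>\<^bsub>B\<^esub> y)" for k
        using B.cnorm_triangle_diff[OF fcl[OF e(1)[of k]] fcl[OF d(1)[of k]] y(1)]
          diff[OF e(1)[of k] d(1)[of k]] A.cnorm_triangle_diff[OF DA[OF e(1)[of k]] x DA[OF d(1)[of k]]]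
          A.cnorm_minus_commute[OF x DA[OF d(1)[of k]]] by linarith
      then show "\<forall>\<^sub>F k in sequentially. cnorm B (f (e k) \<ominus>\<^bsub>B\<^esub> y)
          \<le> cnorm A (e k \<ominus>\<^bsub>A\<^esub> x) + cnorm A (d k \<ominus>\<^bsub>A\<^esub> x) + cnorm B (f (d k) \<ominus>\<^bsub>B\<^esub> y)" by simp
    qed (use fcl e y in auto)
    with y(1) show ?thesis unfolding lim_def by blast
  qed
  define g where "g x = (SOME y. lim x y)" for x
  have lim: "lim x (g x)" if "x \<in> carrier A" for x
    unfolding g_def using ex[OF that] by (rule someI_ex)
  have gcl: "g x \<in> carrier B" if "x \<in> carrier A" for x
    using lim[OF that] by (simp add: lim_def)
  have glim: "(\<lambda>k. cnorm B (f (d k) \<ominus>\<^bsub>B\<^esub> g x)) \<longlonglongrightarrow> 0"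
    if "x \<in> carrier A" "\<And>k. d k \<in> D" "(\<lambda>k. cnorm A (d k \<ominus>\<^bsub>A\<^esub> x)) \<longlonglongrightarrow> 0" for x d
    using lim[OF that(1)] that(2,3) by (auto simp: lim_def)
  have seq: "\<exists>d. (\<forall>k. d k \<in> D) \<and> (\<lambda>k. cnorm A (d k \<ominus>\<^bsub>A\<^esub> x)) \<longlonglongrightarrow> 0" if "x \<in> carrier A" for x
    using A.dense_sequence[OF dense that] by metis
  show ?thesis
  proof (rule that)
    show "g x = f x" if x: "x \<in> D" for x
    proof (rule B.limit_unique)
      show "(\<lambda>k. cnorm B (f x \<ominus>\<^bsub>B\<^esub> g x)) \<longlonglongrightarrow> 0"
        using glim[of x "\<lambda>_. x"] x DA by simp
    qed (use x DA gcl fcl in auto)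
    show "g \<in> star_hom A B"
    proof (rule star_homI)
      fix x assume x: "x \<in> carrier A"
      obtain d where d: "\<And>k. d k \<in> D" "(\<lambda>k. cnorm A (d k \<ominus>\<^bsub>A\<^esub> x)) \<longlonglongrightarrow> 0"
        using seq[OF x] by blast
      show "g x \<in> carrier B" using x by (rule gcl)
      show "g (c \<odot>\<^bsub>A\<^esub> x) = c \<odot>\<^bsub>B\<^esub> g x" for c
      proof (rule B.limit_unique)
        show "(\<lambda>k. cnorm B (f (c \<odot>\<^bsub>A\<^esub> d k) \<ominus>\<^bsub>B\<^esub> g (c \<odot>\<^bsub>A\<^esub> x))) \<longlonglongrightarrow> 0"
          using d x DA cl by (intro glim A.tendsto_scale_cnorm) auto
        show "(\<lambda>k. cnorm B (f (c \<odot>\<^bsub>A\<^esub> d k) \<ominus>\<^bsub>B\<^esub> c \<odot>\<^bsub>B\<^esub> g x)) \<longlonglongrightarrow> 0"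
          unfolding fscale[OF d(1)] using d x gcl fcl by (intro B.tendsto_scale_cnorm glim) auto
      qed (use d x gcl fcl cl in auto)
      show "g (x\<^sup>\<star>\<^bsub>A\<^esub>) = (g x)\<^sup>\<star>\<^bsub>B\<^esub>"
      proof (rule B.limit_unique)
        show "(\<lambda>k. cnorm B (f ((d k)\<^sup>\<star>\<^bsub>A\<^esub>) \<ominus>\<^bsub>B\<^esub> g (x\<^sup>\<star>\<^bsub>A\<^esub>))) \<longlonglongrightarrow> 0"
          using d x DA cl by (intro glim A.tendsto_star_cnorm) auto
        show "(\<lambda>k. cnorm B (f ((d k)\<^sup>\<star>\<^bsub>A\<^esub>) \<ominus>\<^bsub>B\<^esub> (g x)\<^sup>\<star>\<^bsub>B\<^esub>)) \<longlonglongrightarrow> 0"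
          unfolding fstar[OF d(1)] using d x gcl fcl by (intro B.tendsto_star_cnorm glim) auto
      qed (use d x gcl fcl cl in auto)
      fix y assume y: "y \<in> carrier A"
      obtain e where e: "\<And>k. e k \<in> D" "(\<lambda>k. cnorm A (e k \<ominus>\<^bsub>A\<^esub> y)) \<longlonglongrightarrow> 0"
        using seq[OF y] by blast
      show "g (x \<oplus>\<^bsub>A\<^esub> y) = g x \<oplus>\<^bsub>B\<^esub> g y"
      proof (rule B.limit_unique)
        show "(\<lambda>k. cnorm B (f (d k \<oplus>\<^bsub>A\<^esub> e k) \<ominus>\<^bsub>B\<^esub> g (x \<oplus>\<^bsub>A\<^esub> y))) \<longlonglongrightarrow> 0"
          using d e x y DA cl by (intro glim A.tendsto_add_cnorm) auto
        show "(\<lambda>k. cnorm B (f (d k \<oplus>\<^bsub>A\<^esub> e k) \<ominus>\<^bsub>B\<^esub> (g x \<oplus>\<^bsub>B\<^esub> g y))) \<longlonglongrightarrow> 0"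
          unfolding fadd[OF d(1) e(1)] using d e x y gcl fcl by (intro B.tendsto_add_cnorm glim) auto
      qed (use d e x y gcl fcl cl in auto)
      show "g (x \<otimes>\<^bsub>A\<^esub> y) = g x \<otimes>\<^bsub>B\<^esub> g y"
      proof (rule B.limit_unique)
        show "(\<lambda>k. cnorm B (f (d k \<otimes>\<^bsub>A\<^esub> e k) \<ominus>\<^bsub>B\<^esub> g (x \<otimes>\<^bsub>A\<^esub> y))) \<longlonglongrightarrow> 0"
          using d e x y DA cl by (intro glim A.tendsto_mult_cnorm) auto
        show "(\<lambda>k. cnorm B (f (d k \<otimes>\<^bsub>A\<^esub> e k) \<ominus>\<^bsub>B\<^esub> (g x \<otimes>\<^bsub>B\<^esub> g y))) \<longlonglongrightarrow> 0"
          unfolding fmult[OF d(1) e(1)] using d e x y gcl fcl by (intro B.tendsto_mult_cnorm glim) auto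
      qed (use d e x y gcl fcl cl in auto)
    qed
  qed
qed

text \<open>The factor two absorbs the two error terms that arise when \<open>x\<close> and
  \<open>y\<close> are compared through an approximating element.\<close>

lemma cstar_eqI_of_approx:
  assumes "cstar_algebra B" and xy: "x \<in> carrier B" "y \<in> carrier B"
    and le: "\<And>e. 0 < e \<Longrightarrow> cnorm B (x \<ominus>\<^bsub>B\<^esub> y) \<le> 2 * e"
  shows "x = y"
proof -
  interpret B: cstar_algebra B by fact
  have "cnorm B (x \<ominus>\<^bsub>B\<^esub> y) \<le> 0 + e" if "0 < e" for e
    using le[of "e / 2"] that by simp
  then have "cnorm B (x \<ominus>\<^bsub>B\<^esub> y) \<le> 0"
    by (rule field_le_epsilon)
  then have "cnorm B (x \<ominus>\<^bsub>B\<^esub> y) = 0"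
    by (rule order_antisym) (use xy in simp)
  then show ?thesis using xy by (simp add: B.cnorm_eq_0 B.minus_eq_zero_iff)
qed

lemma (in cstar_algebra) closed_star_subalgebraI:
  assumes sub: "V \<subseteq> carrier A" and zero: "\<zero> \<in> V"
    and add: "\<And>x y. x \<in> V \<Longrightarrow> y \<in> V \<Longrightarrow> x \<oplus> y \<in> V"
    and scale: "\<And>c x. x \<in> V \<Longrightarrow> c \<odot> x \<in> V"
    and mult: "\<And>x y. x \<in> V \<Longrightarrow> y \<in> V \<Longrightarrow> x \<otimes> y \<in> V"
    and star: "\<And>x. x \<in> V \<Longrightarrow> x\<^sup>\<star> \<in> V"
    and closed: "\<And>x. \<lbrakk>x \<in> carrier A; \<And>e. 0 < e \<Longrightarrow> \<exists>y\<in>V. cnorm A (x \<ominus> y) < e\<rbrakk> \<Longrightarrow> x \<in> V"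
  shows "closed_star_subalgebra V A"
  unfolding closed_star_subalgebra_def
proof (intro conjI ballI)
  show "Module.submodule V \<CC> A"
    by (rule submoduleI) (use assms in \<open>auto simp: uminus_scale subset_iff\<close>)
  show "closedin (norm_topology A) V"
    by (rule closedin_normI) (use sub closed in auto)
qed (use mult star in auto)

text \<open>Contractivity makes the fixed points norm closed. An endomorphism that fixes a
  generating set is therefore the identity, which is how two homomorphisms are recognised as inverse
  to each other.\<close>

lemma star_hom_fixed_points:
  assumes B: "cstar_algebra B" and g: "g \<in> star_hom B B"
  shows "closed_star_subalgebra {x \<in> carrier B. g x = x} B"
proof -
  interpret B: cstar_algebra B by fact
  note g' = star_homD[OF g]
  show ?thesis
  proof (rule B.closed_star_subalgebraI)
    show "\<zero>\<^bsub>B\<^esub> \<in> {x \<in> carrier B. g x = x}"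
      using linear_maps_zero[OF B.complex_module_axioms B.complex_module_axioms star_hom_linear[OF g]] by simp
    fix x assume x: "x \<in> carrier B" and ap: "\<And>e. 0 < e \<Longrightarrow> \<exists>y\<in>{x \<in> carrier B. g x = x}. cnorm B (x \<ominus>\<^bsub>B\<^esub> y) < e"
    have "g x = x"
    proof (rule cstar_eqI_of_approx[OF B])
      fix e :: real assume "0 < e"
      then obtain y where y: "y \<in> carrier B" "g y = y" "cnorm B (x \<ominus>\<^bsub>B\<^esub> y) < e" using ap by blast
      have "cnorm B (g x \<ominus>\<^bsub>B\<^esub> x) \<le> cnorm B (g x \<ominus>\<^bsub>B\<^esub> g y) + cnorm B (y \<ominus>\<^bsub>B\<^esub> x)"
        using B.cnorm_triangle_diff[of "g x" "g y" x] x y g' by simp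
      also have "g x \<ominus>\<^bsub>B\<^esub> g y = g (x \<ominus>\<^bsub>B\<^esub> y)"
        by (rule linear_maps_minus[OF B.complex_module_axioms B.complex_module_axioms star_hom_linear[OF g] x y(1), symmetric])
      also have "cnorm B (g (x \<ominus>\<^bsub>B\<^esub> y)) \<le> cnorm B (x \<ominus>\<^bsub>B\<^esub> y)"
        using x y by (intro star_hom_contractive[OF B B g]) simp
      finally show "cnorm B (g x \<ominus>\<^bsub>B\<^esub> x) \<le> 2 * e"
        using y x by (simp add: B.cnorm_minus_commute[of y x])
    qed (use x g' in auto)
    then show "x \<in> {x \<in> carrier B. g x = x}" using x by simp
  qed (use g' in auto)
qed

section \<open>Square roots and positivity\<close>

context unital_cstar_algebra
begin

declare one_closed [simp, intro] one_mult [simp] mult_one [simp]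

lemma star_one [simp]: "\<one>\<^sup>\<star> = \<one>"
  by (metis mult_one one_closed one_mult star_closed star_mult star_star)

lemma cnorm_one_le: "cnorm A \<one> \<le> 1"
  by (rule projection_cnorm_le) auto

text \<open>The square root is \<open>1 - y\<close> for the fixed point \<open>y\<close> of \<open>y \<mapsto> (t + y\<^sup>2) / 2\<close>.\<close>

lemma square_root_exists:
  assumes t: "t \<in> carrier A" "t\<^sup>\<star> = t" "cnorm A t \<le> 1 / 2"
  obtains c where "c \<in> carrier A" "c\<^sup>\<star> \<otimes> c = \<one> \<ominus> t"
proof -
  define y where "y = rec_nat \<zero> (\<lambda>_ y. (1 / 2) \<odot> (t \<oplus> y \<otimes> y))"
  have y0: "y 0 = \<zero>" and ySuc: "y (Suc k) = (1 / 2) \<odot> (t \<oplus> y k \<otimes> y k)" for k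
    by (simp_all add: y_def)
  have y: "y k \<in> carrier A \<and> (y k)\<^sup>\<star> = y k \<and> cnorm A (y k) \<le> 1 / 2" for k
  proof (induction k)
    case (Suc k)
    have "cnorm A (y k \<otimes> y k) \<le> 1 / 2 * (1 / 2)"
      using Suc by (intro cnorm_mult_le) auto
    then have "cnorm A (t \<oplus> y k \<otimes> y k) \<le> 1"
      using t Suc cnorm_add[of t "y k \<otimes> y k"] by simp
    then show ?case
      using t Suc by (simp add: ySuc star_add star_mult cnorm_smult)
  qed (simp add: y0)
  then have ycl: "y k \<in> carrier A" and yst: "(y k)\<^sup>\<star> = y k" and yn: "cnorm A (y k) \<le> 1 / 2" for k
    by auto
  \<comment> \<open>Writing \<open>u^2 - v^2 = u (u - v) + (u - v) v\<close> avoids commuting the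
    iterates. In the invariant ball of radius one half the iteration then contracts by the factor
    one half.\<close>
  have step: "cnorm A (y (Suc (Suc k)) \<ominus> y (Suc k)) \<le> 1 / 2 * cnorm A (y (Suc k) \<ominus> y k)" for k
  proof -
    let ?u = "y (Suc k)" and ?v = "y k"
    have "(t \<oplus> ?u \<otimes> ?u) \<ominus> (t \<oplus> ?v \<otimes> ?v) = ?u \<otimes> ?u \<ominus> ?v \<otimes> ?v"
      using t ycl by (simp add: add_diff_add)
    also have "\<dots> = ?u \<otimes> (?u \<ominus> ?v) \<oplus> (?u \<ominus> ?v) \<otimes> ?v"
      using ycl by (simp add: mult_minus_left mult_minus_right diff_trans)
    finally have eq: "(t \<oplus> ?u \<otimes> ?u) \<ominus> (t \<oplus> ?v \<otimes> ?v) = ?u \<otimes> (?u \<ominus> ?v) \<oplus> (?u \<ominus> ?v) \<otimes> ?v" .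
    have "cnorm A (?u \<otimes> (?u \<ominus> ?v) \<oplus> (?u \<ominus> ?v) \<otimes> ?v)
        \<le> cnorm A (?u \<otimes> (?u \<ominus> ?v)) + cnorm A ((?u \<ominus> ?v) \<otimes> ?v)"
      using ycl by (intro cnorm_add) auto
    also have "\<dots> \<le> 1 / 2 * cnorm A (?u \<ominus> ?v) + cnorm A (?u \<ominus> ?v) * (1 / 2)"
      using ycl yn by (intro add_mono cnorm_mult_le) auto
    finally have "cnorm A ((t \<oplus> ?u \<otimes> ?u) \<ominus> (t \<oplus> ?v \<otimes> ?v)) \<le> cnorm A (?u \<ominus> ?v)"
      unfolding eq by simp
    moreover have "y (Suc (Suc k)) \<ominus> y (Suc k) = (1 / 2) \<odot> ((t \<oplus> ?u \<otimes> ?u) \<ominus> (t \<oplus> ?v \<otimes> ?v))"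
      using t ycl by (simp add: scale_minus_right flip: ySuc)
    ultimately show ?thesis
      using t ycl by (simp add: cnorm_smult)
  qed
  have "cnorm A (y (Suc k) \<ominus> y k) \<le> cnorm A (y (Suc 0) \<ominus> y 0) * (1 / 2) ^ k" for k
  proof (induction k)
    case (Suc k)
    then show ?case using step[of k] by simp
  qed simp
  then obtain x where x: "x \<in> carrier A" "(\<lambda>k. cnorm A (y k \<ominus> x)) \<longlonglongrightarrow> 0"
    using geometric_convergent[of y "cnorm A (y (Suc 0) \<ominus> y 0)" "1 / 2"] ycl by auto
  have xs: "x\<^sup>\<star> = x"
  proof (rule limit_unique)
    show "(\<lambda>k. cnorm A (y k \<ominus> x\<^sup>\<star>)) \<longlonglongrightarrow> 0"
      using tendsto_star_cnorm[of y x] ycl yst x by simp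
  qed (use x ycl in auto)
  have fixed: "x = (1 / 2) \<odot> (t \<oplus> x \<otimes> x)"
  proof (rule limit_unique)
    show "(\<lambda>k. cnorm A (y (Suc k) \<ominus> x)) \<longlonglongrightarrow> 0"
      using x(2) by (rule LIMSEQ_Suc)
    show "(\<lambda>k. cnorm A (y (Suc k) \<ominus> (1 / 2) \<odot> (t \<oplus> x \<otimes> x))) \<longlonglongrightarrow> 0"
      unfolding ySuc using t ycl x
      by (intro tendsto_scale_cnorm tendsto_add_cnorm tendsto_mult_cnorm) auto
  qed (use t x ycl in auto)
  have "2 \<odot> x = t \<oplus> x \<otimes> x"
    using t x by (subst fixed) simp
  then have two: "x \<oplus> x = t \<oplus> x \<otimes> x"
    using x scale_left_add[of x 1 1] by simp
  have "(\<one> \<ominus> x) \<otimes> (\<one> \<ominus> x) = (\<one> \<ominus> x) \<ominus> (x \<ominus> x \<otimes> x)"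
    using x by (simp add: mult_minus_left mult_minus_right)
  also have "\<dots> = (\<one> \<oplus> x \<otimes> x) \<ominus> (x \<oplus> x)"
    using x by (simp add: minus_scale scale_right_add M.a_ac)
  also have "\<dots> = \<one> \<ominus> t"
    unfolding two using x t by (simp add: add_diff_add)
  finally show ?thesis
    using x xs by (intro that[of "\<one> \<ominus> x"]) (auto simp: star_minus)
qed

text \<open>In spectral terms the two bounds confine the spectrum of \<open>h\<close> to opposite
  half-lines. After rescaling to \<open>z = h / l\<close>, averaging the squares of
  \<open>1 + z\<close> and \<open>1 - z\<close> shows that \<open>1 + z^2\<close> has norm at most
  one, whereas the mean inequality forces \<open>1 + y^2\<close> to have norm at least two for the
  normalised \<open>y = z / r\<close>.\<close>

lemma selfadjoint_eq_zeroI: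
  assumes h: "h \<in> carrier A" "h\<^sup>\<star> = h" and l: "0 < l"
    and le: "cnorm A (of_real l \<odot> \<one> \<oplus> h) \<le> l" "cnorm A (of_real l \<odot> \<one> \<ominus> h) \<le> l"
  shows "h = \<zero>"
proof (rule ccontr)
  assume "h \<noteq> \<zero>"
  then have r: "0 < cnorm A h" using cnorm_nonneg[OF h(1)] cnorm_eq_0[OF h(1)] by (metis order_less_le)
  define r where "r = cnorm A h / l"
  define z where "z = complex_of_real (1 / l) \<odot> h"
  define y where "y = complex_of_real (1 / r) \<odot> z"
  have r0: "0 < r" using r l by (simp add: r_def)
  have z: "z \<in> carrier A" "z\<^sup>\<star> = z" and y: "y \<in> carrier A" "y\<^sup>\<star> = y"
    using h by (auto simp: z_def y_def)
  have nz: "cnorm A z = r" using h l by (simp add: z_def r_def cnorm_smult norm_divide)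
  have ny: "cnorm A y = 1" using z nz r0 by (simp add: y_def cnorm_smult norm_divide)
  have zy: "z = complex_of_real r \<odot> y" using z r0 by (simp add: y_def)
  have plus: "\<one> \<oplus> z = complex_of_real (1 / l) \<odot> (of_real l \<odot> \<one> \<oplus> h)"
    and minus: "\<one> \<ominus> z = complex_of_real (1 / l) \<odot> (of_real l \<odot> \<one> \<ominus> h)"
    using h l by (simp_all add: z_def scale_right_add scale_minus_right)
  have le1: "cnorm A (\<one> \<oplus> z) \<le> 1" "cnorm A (\<one> \<ominus> z) \<le> 1"
    unfolding plus minus using h l le by (simp_all add: cnorm_smult norm_divide divide_simps)

  \<comment> \<open>Makes \<open>1 - r^2\<close> nonnegative, so that it can act as a norm bound
    below.\<close>
  have "r \<le> 1"
  proof -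
    have "(\<one> \<oplus> z) \<ominus> (\<one> \<ominus> z) = (\<one> \<ominus> \<one>) \<oplus> (z \<oplus> z)"
      using z by (simp add: minus_scale scale_right_add M.a_ac del: minus_self)
    also have "\<dots> = z \<oplus> z" using z by simp
    also have "\<dots> = 2 \<odot> z" using z scale_left_add[of z 1 1] by simp
    finally show ?thesis
      using cnorm_minus_le[of "\<one> \<oplus> z" "\<one> \<ominus> z"] le1 z nz by (simp add: cnorm_smult)
  qed
  have "2 \<odot> (\<one> \<oplus> z \<otimes> z) = (\<one> \<oplus> z) \<otimes> (\<one> \<oplus> z) \<oplus> (\<one> \<ominus> z) \<otimes> (\<one> \<ominus> z)"
  proof -
    have "(\<one> \<oplus> z) \<otimes> (\<one> \<oplus> z) \<oplus> (\<one> \<ominus> z) \<otimes> (\<one> \<ominus> z)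
        = (\<one> \<oplus> z \<otimes> z) \<oplus> ((\<one> \<oplus> z \<otimes> z) \<oplus> ((z \<ominus> z) \<oplus> (z \<ominus> z)))"
      using z by (simp add: mult_add_left mult_add_right minus_scale scale_right_add M.a_ac
          del: minus_self)
    then show ?thesis
      using z scale_left_add[of "\<one> \<oplus> z \<otimes> z" 1 1] by simp
  qed
  then have "2 * cnorm A (\<one> \<oplus> z \<otimes> z)
      \<le> cnorm A ((\<one> \<oplus> z) \<otimes> (\<one> \<oplus> z)) + cnorm A ((\<one> \<ominus> z) \<otimes> (\<one> \<ominus> z))"
    using z cnorm_smult[of "\<one> \<oplus> z \<otimes> z" 2] by (metis (no_types, lifting) M.add.m_closed M.minus_closed
        cnorm_add mult_closed norm_numeral one_closed)
  also have "\<dots> \<le> 1 * 1 + 1 * 1"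
    using z le1 by (intro add_mono cnorm_mult_le) auto
  finally have "cnorm A (\<one> \<oplus> z \<otimes> z) \<le> 1" by simp
  moreover have "2 * cnorm A y \<le> cnorm A (\<one> \<oplus> y \<otimes> y)"
    using y by (intro cnorm_add_ge_geometric_mean) (auto simp: star_mult mult_assoc)
  \<comment> \<open>As \<open>z^2 = r^2 y^2\<close>, replacing \<open>z\<close> by \<open>y\<close>
    costs at most \<open>1 - r^2\<close>, which leads to the impossible
    \<open>2 \<le> 2 - r^2\<close>.\<close>
  moreover have "cnorm A (\<one> \<oplus> y \<otimes> y)
      \<le> cnorm A (\<one> \<oplus> z \<otimes> z) + cnorm A (complex_of_real (1 - r\<^sup>2) \<odot> (y \<otimes> y))"
  proof -
    have "complex_of_real (r * r) \<odot> (y \<otimes> y) \<oplus> complex_of_real (1 - r\<^sup>2) \<odot> (y \<otimes> y) = y \<otimes> y"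
      using y scale_left_add[of "y \<otimes> y" "of_real (r * r)" "of_real (1 - r\<^sup>2)"]
      by (simp add: power2_eq_square)
    then have "\<one> \<oplus> y \<otimes> y = (\<one> \<oplus> z \<otimes> z) \<oplus> complex_of_real (1 - r\<^sup>2) \<odot> (y \<otimes> y)"
      using y by (simp add: zy M.a_assoc)
    then show ?thesis
      using y z by (simp add: cnorm_add)
  qed
  moreover have "cnorm A (complex_of_real (1 - r\<^sup>2) \<odot> (y \<otimes> y)) \<le> 1 - r\<^sup>2"
  proof -
    have "0 \<le> 1 - r\<^sup>2" using \<open>r \<le> 1\<close> r0 by (simp add: power_le_one)
    then have "cmod (complex_of_real (1 - r\<^sup>2)) = 1 - r\<^sup>2" by (simp only: norm_of_real abs_of_nonneg)
    then show ?thesis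
      using y cnorm_mult_le[of y y 1 1] ny \<open>0 \<le> 1 - r\<^sup>2\<close> by (simp add: cnorm_smult mult_left_le)
  qed
  ultimately have "2 \<le> 1 + (1 - r\<^sup>2)"
    using ny by linarith
  then show False using r0 by simp
qed

text \<open>With \<open>c\<^sub>b = s\<^sub>b\<^sup>\<star> s\<^sub>a\<close>, the elements \<open>c\<^sub>b\<^sup>\<star> c\<^sub>b\<close> for
  \<open>b \<noteq> a\<close> add up to zero and all satisfy \<open>\<parallel>1 - c\<^sub>b\<^sup>\<star> c\<^sub>b\<parallel> \<le> 1\<close>.\<close>

lemma cuntz_family_orthogonal:
  assumes fam: "cuntz_family d A s" and a: "a < d" and b: "b < d" and ab: "a \<noteq> b"
  shows "(s b)\<^sup>\<star> \<otimes> s a = \<zero>"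
proof -
  have s: "s i \<in> carrier A" "(s i)\<^sup>\<star> \<otimes> s i = \<one>" if "i < d" for i
    using fam that by (auto simp: cuntz_family_def)
  have sum: "(\<Oplus>i\<in>{..<d}. s i \<otimes> (s i)\<^sup>\<star>) = \<one>"
    using fam by (simp add: cuntz_family_def)
  define h where "h i = ((s i)\<^sup>\<star> \<otimes> s a)\<^sup>\<star> \<otimes> ((s i)\<^sup>\<star> \<otimes> s a)" for i
  have hcl: "h i \<in> carrier A" "(h i)\<^sup>\<star> = h i" if "i < d" for i
    using s a that by (auto simp: h_def star_mult)
  have h_eq: "h i = (s a)\<^sup>\<star> \<otimes> (s i \<otimes> (s i)\<^sup>\<star>) \<otimes> s a" if "i < d" for i
    using s a that by (simp add: h_def star_mult mult_assoc)
  have "(\<Oplus>i\<in>{..<d}. h i) = (\<Oplus>i\<in>{..<d}. ((s a)\<^sup>\<star> \<otimes> (s i \<otimes> (s i)\<^sup>\<star>)) \<otimes> s a)"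
    using s a by (intro sum_cong) (auto simp: h_eq)
  also have "\<dots> = ((s a)\<^sup>\<star> \<otimes> (\<Oplus>i\<in>{..<d}. s i \<otimes> (s i)\<^sup>\<star>)) \<otimes> s a"
    using s a by (subst mult_sum_right) (auto intro!: mult_sum_left[symmetric])
  finally have hsum: "(\<Oplus>i\<in>{..<d}. h i) = \<one>"
    using s a by (simp add: sum)
  have norm_s: "cnorm A (s i) \<le> 1" if "i < d" for i
    using cstar_identity[of "s i"] s that cnorm_one_le by (simp add: abs_square_le_1)
  \<comment> \<open>Here \<open>1 - h i\<close> is the compression by the contraction
    \<open>s a\<close> of the projection complementary to the range projection of
    \<open>s i\<close>.\<close>
  have h1: "cnorm A (\<one> \<ominus> h i) \<le> 1" if i: "i < d" for i
  proof -
    let ?p = "s i \<otimes> (s i)\<^sup>\<star>"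
    have pp: "?p \<otimes> ?p = ?p"
    proof -
      have "?p \<otimes> ?p = s i \<otimes> ((s i)\<^sup>\<star> \<otimes> s i) \<otimes> (s i)\<^sup>\<star>"
        using s(1)[OF i] by (simp add: mult_assoc)
      then show ?thesis using s[OF i] by simp
    qed
    have "cnorm A (\<one> \<ominus> ?p) \<le> 1"
      using s[OF i] pp
      by (intro projection_cnorm_le)
        (auto simp: star_minus star_mult mult_minus_left mult_minus_right)
    then have "cnorm A (((s a)\<^sup>\<star> \<otimes> (\<one> \<ominus> ?p)) \<otimes> s a) \<le> (1 * 1) * 1"
      using s a i norm_s[OF a] by (intro cnorm_mult_le) auto
    moreover have "((s a)\<^sup>\<star> \<otimes> (\<one> \<ominus> ?p)) \<otimes> s a = \<one> \<ominus> h i"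
      using s a i by (simp add: mult_minus_left mult_minus_right h_eq)
    ultimately show ?thesis by simp
  qed
  define J where "J = {..<d} - {a, b}"
  have J: "finite J" "a \<notin> J" "b \<notin> J" "{..<d} = insert a (insert b J)" "\<And>i. i \<in> J \<Longrightarrow> i < d"
    using a b by (auto simp: J_def)
  have ha: "h a = \<one>" using s a by (simp add: h_def)
  have "\<one> = \<one> \<oplus> (h b \<oplus> (\<Oplus>i\<in>J. h i))"
    using hsum ab a b J hcl ha by (simp add: sum_insert)
  then have "h b \<oplus> (\<Oplus>i\<in>J. h i) = \<zero>"
    using hcl b J by (metis M.add.m_closed M.add.l_cancel_one' one_closed sum_closed)
  then have neg: "h b = \<ominus> (\<Oplus>i\<in>J. h i)"
    using hcl b J by (metis M.minus_equality sum_closed)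
  define m where "m = real (card J)"
  \<comment> \<open>Since \<open>h b\<close> is minus the sum of the \<open>h i\<close> over
    \<open>J\<close>, adding \<open>m = card J\<close> units to it pairs every \<open>h i\<close>
    with one unit, and each difference has norm at most one.\<close>
  have "of_nat (card K) \<odot> \<one> \<ominus> (\<Oplus>i\<in>K. h i) = (\<Oplus>i\<in>K. \<one> \<ominus> h i)" if "finite K" "K \<subseteq> J" for K
    using that
  proof (induction K)
    case (insert i K)
    have "of_nat (card (insert i K)) \<odot> \<one> = \<one> \<oplus> of_nat (card K) \<odot> \<one>"
      using insert scale_left_add[of \<one> 1 "of_nat (card K)"] by simp
    then show ?case
      using insert J(5) hcl by (simp add: sum_insert subset_iff add_diff_add)
  qed simp
  from this[OF J(1)] have mh: "of_real m \<odot> \<one> \<oplus> h b = (\<Oplus>i\<in>J. \<one> \<ominus> h i)"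
    by (simp add: m_def neg a_minus_def)
  have "cnorm A (\<Oplus>i\<in>J. \<one> \<ominus> h i) \<le> (\<Sum>i\<in>J. cnorm A (\<one> \<ominus> h i))"
    using J hcl by (intro cnorm_sum_le) auto
  also have "\<dots> \<le> m"
    unfolding m_def using h1 J(5) by (metis (mono_tags, lifting) mult.right_neutral sum_bounded_above)
  finally have le: "cnorm A (of_real m \<odot> \<one> \<oplus> h b) \<le> m" unfolding mh .
  have hb: "h b \<in> carrier A" using hcl b by simp
  have "h b = \<zero>"
  \<comment> \<open>The bound is \<open>m + 1\<close> instead of \<open>m\<close> because
    \<open>J\<close> may be empty and because the estimate for the opposite sign spends one unit on
    \<open>1 - h b\<close>.\<close>
  proof (rule selfadjoint_eq_zeroI[of _ "m + 1"])
    have "of_real (m + 1) \<odot> \<one> \<oplus> h b = \<one> \<oplus> (of_real m \<odot> \<one> \<oplus> h b)"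
      using hb scale_left_add[of \<one> "of_real m" 1] by (simp add: M.a_ac)
    then show "cnorm A (of_real (m + 1) \<odot> \<one> \<oplus> h b) \<le> m + 1"
      using hb le cnorm_one_le cnorm_add[of \<one> "of_real m \<odot> \<one> \<oplus> h b"] by simp
    have "of_real (m + 1) \<odot> \<one> \<ominus> h b = of_real m \<odot> \<one> \<oplus> (\<one> \<ominus> h b)"
      using hb scale_left_add[of \<one> "of_real m" 1] by (simp add: minus_scale M.a_assoc)
    then show "cnorm A (of_real (m + 1) \<odot> \<one> \<ominus> h b) \<le> m + 1"
      using hb h1[OF b] cnorm_one_le cnorm_add[of "of_real m \<odot> \<one>" "\<one> \<ominus> h b"]
        mult_left_le[OF cnorm_one_le, of m]
      by (simp add: cnorm_smult m_def)
  qed (use hcl b m_def in auto)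
  then have "(cnorm A ((s b)\<^sup>\<star> \<otimes> s a))\<^sup>2 = 0"
    using cstar_identity[of "(s b)\<^sup>\<star> \<otimes> s a"] s a b by (simp add: h_def)
  then show ?thesis using s a b by (simp add: cnorm_eq_0)
qed

end

section \<open>Matrix units and Kronecker products\<close>

lemma matrix_algebra_simps [simp]:
  "carrier (matrix_algebra d) = carrier_mat d d"
  "a \<otimes>\<^bsub>matrix_algebra d\<^esub> b = a * b"
  "a \<oplus>\<^bsub>matrix_algebra d\<^esub> b = a + b"
  "c \<odot>\<^bsub>matrix_algebra d\<^esub> a = c \<cdot>\<^sub>m a"
  "a\<^sup>\<star>\<^bsub>matrix_algebra d\<^esub> = mat_adjoint a"
  "\<one>\<^bsub>matrix_algebra d\<^esub> = 1\<^sub>m d"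
  "cnorm (matrix_algebra d) = op_norm"
  by (simp_all add: matrix_algebra_def)

lemma dim_mat_adjoint [simp]: "dim_row (mat_adjoint a) = dim_col a" "dim_col (mat_adjoint a) = dim_row a"
  by (simp_all add: mat_adjoint_def)

lemma mat_adjoint_carrier [simp]: "a \<in> carrier_mat m n \<Longrightarrow> mat_adjoint a \<in> carrier_mat n m"
  by (auto intro!: carrier_matI)

lemma mat_adjoint_index [simp]:
  "i < dim_col a \<Longrightarrow> j < dim_row a \<Longrightarrow> mat_adjoint a $$ (i, j) = cnj (a $$ (j, i))"
  for a :: "complex mat"
  by (simp add: mat_adjoint_def mat_of_rows_index)

lemma mat_mult_index:
  "a \<in> carrier_mat m d \<Longrightarrow> b \<in> carrier_mat d n \<Longrightarrow> i < m \<Longrightarrow> j < n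
    \<Longrightarrow> (a * b) $$ (i, j) = (\<Sum>k<d. a $$ (i, k) * b $$ (k, j))"
  for a :: "complex mat"
  by (auto simp: scalar_prod_def lessThan_atLeast0 intro!: sum.cong)

definition mat_unit :: "nat \<Rightarrow> nat \<Rightarrow> nat \<Rightarrow> complex mat" where
  "mat_unit d r c = mat d d (\<lambda>(i, j). if i = r \<and> j = c then 1 else 0)"

lemma mat_unit_carrier [simp, intro]: "mat_unit d r c \<in> carrier_mat d d"
  by (simp add: mat_unit_def)

lemma mat_unit_dim [simp]: "dim_row (mat_unit d r c) = d" "dim_col (mat_unit d r c) = d"
  by (simp_all add: mat_unit_def)

lemma mat_unit_index [simp]:
  "i < d \<Longrightarrow> j < d \<Longrightarrow> mat_unit d r c $$ (i, j) = (if i = r \<and> j = c then 1 else 0)"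
  by (simp add: mat_unit_def)

lemma mat_unit_adjoint [simp]: "mat_adjoint (mat_unit d r c) = mat_unit d c r"
  by (rule eq_matI) auto

lemma mat_unit_mult_left:
  assumes "x \<in> carrier_mat d d" "r < d" "c < d" "i < d" "j < d"
  shows "(mat_unit d r c * x) $$ (i, j) = (if i = r then x $$ (c, j) else 0)"
proof -
  have "(mat_unit d r c * x) $$ (i, j) = (\<Sum>k<d. (if i = r \<and> k = c then 1 else 0) * x $$ (k, j))"
    using assms by (subst mat_mult_index[of _ d d _ d]) auto
  then show ?thesis using assms by (cases "i = r") (simp_all add: mult_delta_left)
qed

lemma mat_unit_mult_right:
  assumes "x \<in> carrier_mat d d" "r < d" "c < d" "i < d" "j < d"
  shows "(x * mat_unit d r c) $$ (i, j) = (if j = c then x $$ (i, r) else 0)"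
proof -
  have "(x * mat_unit d r c) $$ (i, j) = (\<Sum>k<d. x $$ (i, k) * (if k = r \<and> j = c then 1 else 0))"
    using assms by (subst mat_mult_index[of _ d d _ d]) auto
  then show ?thesis using assms by (cases "j = c") (simp_all add: mult_delta_right)
qed

lemma mat_unit_mult:
  assumes "r < d" "c < d" "u < d" "v < d"
  shows "mat_unit d r c * mat_unit d u v = (if c = u then mat_unit d r v else 0\<^sub>m d d)"
  by (rule eq_matI) (use assms in \<open>auto simp: mat_unit_mult_left[of "mat_unit d u v"] simp del: index_mult_mat(1)\<close>)

lemma mat_unit_compress:
  assumes "x \<in> carrier_mat d d" "r < d" "c < d"
  shows "mat_unit d r r * x * mat_unit d c c = x $$ (r, c) \<cdot>\<^sub>m mat_unit d r c"
  by (rule eq_matI)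
    (use assms in \<open>auto simp: mat_unit_mult_right[of "mat_unit d r r * x"] mat_unit_mult_left[of x]
      mult_carrier_mat[of _ d d] simp del: index_mult_mat(1)\<close>)

lemma linear_map_mat_units:
  assumes W: "complex_module W" and f: "f \<in> linear_maps (matrix_algebra d) W"
    and x: "x \<in> carrier_mat d d"
  shows "f x = finsum W (\<lambda>r. finsum W (\<lambda>c. x $$ (r, c) \<odot>\<^bsub>W\<^esub> f (mat_unit d r c)) {..<d}) {..<d}"
proof -
  interpret W: complex_module W by fact
  have fcl: "f y \<in> carrier W" if "y \<in> carrier_mat d d" for y
    using f that by (auto simp: linear_maps_def)
  have fadd: "f (y + z) = f y \<oplus>\<^bsub>W\<^esub> f z" if "y \<in> carrier_mat d d" "z \<in> carrier_mat d d" for y z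
    using f that by (auto simp: linear_maps_def)
  have fscale: "f (c \<cdot>\<^sub>m y) = c \<odot>\<^bsub>W\<^esub> f y" if "y \<in> carrier_mat d d" for c y
    using f that by (auto simp: linear_maps_def)
  \<comment> \<open>Truncations of \<open>x\<close> to a set of index pairs: induction on the set
    replaces sums of matrices.\<close>
  define R where "R S = mat d d (\<lambda>p. if p \<in> S then x $$ p else 0)" for S
  have R: "R S \<in> carrier_mat d d" for S by (simp add: R_def)
  have "f (R S) = finsum W (\<lambda>p. x $$ p \<odot>\<^bsub>W\<^esub> f (mat_unit d (fst p) (snd p))) S"
    if "finite S" "S \<subseteq> {..<d} \<times> {..<d}" for S
    using that
  proof (induction S)
    case empty
    have "R {} = 0 \<cdot>\<^sub>m R {}" by (rule eq_matI) (auto simp: R_def)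
    then have "f (R {}) = 0 \<odot>\<^bsub>W\<^esub> f (R {})"
      using fscale[OF R] by metis
    then show ?case using fcl R by simp
  next
    case (insert p S)
    have "R (insert p S) = x $$ p \<cdot>\<^sub>m mat_unit d (fst p) (snd p) + R S"
      using insert by (intro eq_matI) (auto simp: R_def)
    then show ?case
      using insert R fcl by (simp add: fadd fscale W.sum_insert)
  qed
  from this[of "{..<d} \<times> {..<d}"]
  have "f (R ({..<d} \<times> {..<d}))
      = finsum W (\<lambda>p. x $$ p \<odot>\<^bsub>W\<^esub> f (mat_unit d (fst p) (snd p))) ({..<d} \<times> {..<d})" by simp
  also have "R ({..<d} \<times> {..<d}) = x"
    using x by (intro eq_matI) (auto simp: R_def)
  also have "finsum W (\<lambda>p. x $$ p \<odot>\<^bsub>W\<^esub> f (mat_unit d (fst p) (snd p))) ({..<d} \<times> {..<d})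
      = finsum W (\<lambda>r. finsum W (\<lambda>c. x $$ (r, c) \<odot>\<^bsub>W\<^esub> f (mat_unit d r c)) {..<d}) {..<d}"
    using fcl by (subst W.sum_product) auto
  finally show ?thesis .
qed

lemma linear_map_mat_unitsI:
  assumes "complex_module W" "f \<in> linear_maps (matrix_algebra d) W" "g \<in> linear_maps (matrix_algebra d) W"
    and "\<And>r c. r < d \<Longrightarrow> c < d \<Longrightarrow> f (mat_unit d r c) = g (mat_unit d r c)"
    and "x \<in> carrier_mat d d"
  shows "f x = g x"
proof -
  interpret W: complex_module W by fact
  have "g y \<in> carrier W" if "y \<in> carrier_mat d d" for y
    using assms(3) that by (auto simp: linear_maps_def)
  then show ?thesis
    unfolding linear_map_mat_units[OF assms(1,2,5)] linear_map_mat_units[OF assms(1,3,5)]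
    by (intro W.sum_cong) (auto simp: assms(4))
qed

text \<open>A system of matrix units amounts to a homomorphism from a matrix algebra; this is how
  isometries will produce homomorphisms on the finite levels.\<close>

lemma star_hom_of_mat_units:
  assumes "cstar_algebra C"
    and F: "\<And>r c. r < d \<Longrightarrow> c < d \<Longrightarrow> F r c \<in> carrier C"
    and mult: "\<And>r c u v. r < d \<Longrightarrow> c < d \<Longrightarrow> u < d \<Longrightarrow> v < d
      \<Longrightarrow> F r c \<otimes>\<^bsub>C\<^esub> F u v = (if c = u then F r v else \<zero>\<^bsub>C\<^esub>)"
    and star: "\<And>r c. r < d \<Longrightarrow> c < d \<Longrightarrow> (F r c)\<^sup>\<star>\<^bsub>C\<^esub> = F c r"
  defines "f \<equiv> \<lambda>x. finsum C (\<lambda>r. finsum C (\<lambda>c. x $$ (r, c) \<odot>\<^bsub>C\<^esub> F r c) {..<d}) {..<d}"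
  shows "f \<in> star_hom (matrix_algebra d) C"
    and "\<And>r c. r < d \<Longrightarrow> c < d \<Longrightarrow> f (mat_unit d r c) = F r c"
proof -
  interpret C: cstar_algebra C by fact
  note F' = F[OF lessThan_iff[THEN iffD1] lessThan_iff[THEN iffD1]]
  show fF: "f (mat_unit d r c) = F r c" if "r < d" "c < d" for r c
  proof -
    have "f (mat_unit d r c) = finsum C (\<lambda>c'. mat_unit d r c $$ (r, c') \<odot>\<^bsub>C\<^esub> F r c') {..<d}"
      unfolding f_def using that F by (intro C.sum_single C.sum_neutral) auto
    also have "\<dots> = F r c"
      using that F by (subst C.sum_single[of _ c]) auto
    finally show ?thesis .
  qed
  have fx: "f x = finsum C (\<lambda>r. finsum C (\<lambda>c. x $$ (r, c) \<odot>\<^bsub>C\<^esub> F r c) {..<d}) {..<d}" for x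
    by (simp add: f_def)
  have fcl: "f x \<in> carrier C" for x
    unfolding f_def using F by auto
  have row: "F r c \<otimes>\<^bsub>C\<^esub> f y = finsum C (\<lambda>v. y $$ (c, v) \<odot>\<^bsub>C\<^esub> F r v) {..<d}"
    if "r < d" "c < d" for r c y
  proof -
    have "F r c \<otimes>\<^bsub>C\<^esub> f y
        = finsum C (\<lambda>u. finsum C (\<lambda>v. y $$ (u, v) \<odot>\<^bsub>C\<^esub> (F r c \<otimes>\<^bsub>C\<^esub> F u v)) {..<d}) {..<d}"
      unfolding f_def using F that
      by (subst C.mult_sum_right, blast, blast, intro C.sum_cong refl, subst C.mult_sum_right)
        (auto intro!: C.sum_cong)
    also have "\<dots> = finsum C (\<lambda>v. y $$ (c, v) \<odot>\<^bsub>C\<^esub> (F r c \<otimes>\<^bsub>C\<^esub> F c v)) {..<d}"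
      using that F by (intro C.sum_single C.sum_neutral) (auto simp: mult)
    also have "\<dots> = finsum C (\<lambda>v. y $$ (c, v) \<odot>\<^bsub>C\<^esub> F r v) {..<d}"
      using that F by (intro C.sum_cong) (auto simp: mult)
    finally show ?thesis .
  qed
  show "f \<in> star_hom (matrix_algebra d) C"
  proof (rule star_homI)
    fix x assume "x \<in> carrier (matrix_algebra d)"
    then have x: "x \<in> carrier_mat d d" by simp
    show "f x \<in> carrier C" by (rule fcl)
    show "f (a \<odot>\<^bsub>matrix_algebra d\<^esub> x) = a \<odot>\<^bsub>C\<^esub> f x" for a
      unfolding f_def using F x
      by (subst C.sum_scale, blast, intro C.sum_cong refl, subst C.sum_scale) (auto intro!: C.sum_cong)
    show "f (x\<^sup>\<star>\<^bsub>matrix_algebra d\<^esub>) = (f x)\<^sup>\<star>\<^bsub>C\<^esub>"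
    proof -
      have "(f x)\<^sup>\<star>\<^bsub>C\<^esub> = finsum C (\<lambda>r. finsum C (\<lambda>c. cnj (x $$ (r, c)) \<odot>\<^bsub>C\<^esub> F c r) {..<d}) {..<d}"
        unfolding f_def using F
        by (subst C.star_sum, blast, intro C.sum_cong refl, subst C.star_sum)
          (auto intro!: C.sum_cong simp: star)
      also have "\<dots> = finsum C (\<lambda>c. finsum C (\<lambda>r. cnj (x $$ (r, c)) \<odot>\<^bsub>C\<^esub> F c r) {..<d}) {..<d}"
        using F by (intro C.sum_swap) auto
      also have "\<dots> = f (x\<^sup>\<star>\<^bsub>matrix_algebra d\<^esub>)"
        unfolding f_def using F x by (intro C.sum_cong refl) auto
      finally show ?thesis ..
    qed
    fix y assume "y \<in> carrier (matrix_algebra d)"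
    then have y: "y \<in> carrier_mat d d" by simp
    show "f (x \<oplus>\<^bsub>matrix_algebra d\<^esub> y) = f x \<oplus>\<^bsub>C\<^esub> f y"
    proof -
      have "f (x \<oplus>\<^bsub>matrix_algebra d\<^esub> y) = finsum C (\<lambda>r. finsum C (\<lambda>c. x $$ (r, c) \<odot>\<^bsub>C\<^esub> F r c) {..<d}
          \<oplus>\<^bsub>C\<^esub> finsum C (\<lambda>c. y $$ (r, c) \<odot>\<^bsub>C\<^esub> F r c) {..<d}) {..<d}"
        unfolding f_def
      proof (intro C.sum_cong refl)
        fix r assume "r \<in> {..<d}"
        then have "finsum C (\<lambda>c. (x \<oplus>\<^bsub>matrix_algebra d\<^esub> y) $$ (r, c) \<odot>\<^bsub>C\<^esub> F r c) {..<d}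
            = finsum C (\<lambda>c. x $$ (r, c) \<odot>\<^bsub>C\<^esub> F r c \<oplus>\<^bsub>C\<^esub> y $$ (r, c) \<odot>\<^bsub>C\<^esub> F r c) {..<d}"
          using F x y by (intro C.sum_cong) (auto simp: C.scale_left_add)
        also have "\<dots> = finsum C (\<lambda>c. x $$ (r, c) \<odot>\<^bsub>C\<^esub> F r c) {..<d}
            \<oplus>\<^bsub>C\<^esub> finsum C (\<lambda>c. y $$ (r, c) \<odot>\<^bsub>C\<^esub> F r c) {..<d}"
          using F \<open>r \<in> {..<d}\<close> by (intro C.sum_add) auto
        finally show "finsum C (\<lambda>c. (x \<oplus>\<^bsub>matrix_algebra d\<^esub> y) $$ (r, c) \<odot>\<^bsub>C\<^esub> F r c) {..<d} = \<dots>" .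
      qed (use F in auto)
      also have "\<dots> = f x \<oplus>\<^bsub>C\<^esub> f y"
        unfolding f_def using F by (intro C.sum_add) auto
      finally show ?thesis .
    qed
    show "f (x \<otimes>\<^bsub>matrix_algebra d\<^esub> y) = f x \<otimes>\<^bsub>C\<^esub> f y"
    proof -
      have "f x \<otimes>\<^bsub>C\<^esub> f y
          = finsum C (\<lambda>r. finsum C (\<lambda>c. x $$ (r, c) \<odot>\<^bsub>C\<^esub> (F r c \<otimes>\<^bsub>C\<^esub> f y)) {..<d}) {..<d}"
        unfolding fx[of x] using F fcl
        by (subst C.mult_sum_left, blast, blast, intro C.sum_cong refl, subst C.mult_sum_left)
          (auto intro!: C.sum_cong)
      also have "\<dots> = finsum C (\<lambda>r. finsum C (\<lambda>c. finsum C (\<lambda>v.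
          (x $$ (r, c) * y $$ (c, v)) \<odot>\<^bsub>C\<^esub> F r v) {..<d}) {..<d}) {..<d}"
        using F by (intro C.sum_cong refl, simp add: row, subst C.sum_scale) (auto intro!: C.sum_cong)
      also have "\<dots> = finsum C (\<lambda>r. finsum C (\<lambda>v. finsum C (\<lambda>c.
          (x $$ (r, c) * y $$ (c, v)) \<odot>\<^bsub>C\<^esub> F r v) {..<d}) {..<d}) {..<d}"
        using F by (intro C.sum_cong refl C.sum_swap) auto
      also have "\<dots> = finsum C (\<lambda>r. finsum C (\<lambda>v. (x * y) $$ (r, v) \<odot>\<^bsub>C\<^esub> F r v) {..<d}) {..<d}"
        using F x y
        by (intro C.sum_cong refl) (auto simp: mat_mult_index[of _ d d _ d] C.scale_sum_left
            simp del: index_mult_mat(1))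
      finally show ?thesis by (simp add: f_def)
    qed
  qed
qed

section \<open>Kronecker products\<close>

lemma sum_div_mod:
  fixes f :: "nat \<Rightarrow> nat \<Rightarrow> complex"
  shows "(\<Sum>k<m * e. f (k div e) (k mod e)) = (\<Sum>i<m. \<Sum>j<e. f i j)"
proof (cases "e = 0")
  case False
  have "(\<Sum>k<m * e. f (k div e) (k mod e)) = (\<Sum>i<m. \<Sum>k=i * e..<i * e + e. f (k div e) (k mod e))"
    by (rule sum.nat_group[symmetric])
  also have "\<dots> = (\<Sum>i<m. \<Sum>j<e. f i j)"
  proof (rule sum.cong[OF refl])
    fix i
    have "(\<Sum>k=0 + i * e..<e + i * e. f (k div e) (k mod e)) = (\<Sum>k=0..<e. f ((k + i * e) div e) ((k + i * e) mod e))"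
      by (rule sum.shift_bounds_nat_ivl)
    also have "\<dots> = (\<Sum>j<e. f i j)"
      using False by (intro sum.cong) auto
    finally show "(\<Sum>k=i * e..<i * e + e. f (k div e) (k mod e)) = (\<Sum>j<e. f i j)"
      by (simp add: add.commute)
  qed
  finally show ?thesis .
qed simp

lemma div_less_of_less_mult: "(i::nat) < m * e \<Longrightarrow> i div e < m" "(i::nat) < m * e \<Longrightarrow> i mod e < e"
  by (simp add: less_mult_imp_div_less) (cases "e = 0", auto)

lemma kronecker_carrier [simp, intro]:
  "a \<in> carrier_mat m m \<Longrightarrow> b \<in> carrier_mat e e \<Longrightarrow> kronecker a b \<in> carrier_mat (m * e) (m * e)"
  by (auto simp: kronecker_def)

lemma kronecker_dim [simp]:
  "dim_row (kronecker a b) = dim_row a * dim_row b" "dim_col (kronecker a b) = dim_col a * dim_col b"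
  by (simp_all add: kronecker_def)

lemma kronecker_index:
  "i < dim_row a * dim_row b \<Longrightarrow> j < dim_col a * dim_col b \<Longrightarrow> kronecker a b $$ (i, j)
    = a $$ (i div dim_row b, j div dim_col b) * b $$ (i mod dim_row b, j mod dim_col b)"
  by (simp add: kronecker_def)

lemma kronecker_mult:
  assumes "a \<in> carrier_mat m m" "a' \<in> carrier_mat m m" "b \<in> carrier_mat e e" "b' \<in> carrier_mat e e"
  shows "kronecker a b * kronecker a' b' = kronecker (a * a') (b * b')"
proof (rule eq_matI)
  fix i j assume "i < dim_row (kronecker (a * a') (b * b'))" "j < dim_col (kronecker (a * a') (b * b'))"
  then have ij: "i < m * e" "j < m * e" using assms by auto
  note lt = div_less_of_less_mult[OF ij(1)] div_less_of_less_mult[OF ij(2)]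
  have "(kronecker a b * kronecker a' b') $$ (i, j)
      = (\<Sum>k<m * e. kronecker a b $$ (i, k) * kronecker a' b' $$ (k, j))"
    using assms ij by (intro mat_mult_index) auto
  also have "\<dots> = (\<Sum>k<m * e. (\<lambda>u v. (a $$ (i div e, u) * b $$ (i mod e, v)) * (a' $$ (u, j div e) * b' $$ (v, j mod e)))
      (k div e) (k mod e))"
    using assms ij by (intro sum.cong) (auto simp: kronecker_index)
  also have "\<dots> = (\<Sum>u<m. \<Sum>v<e. (a $$ (i div e, u) * a' $$ (u, j div e)) * (b $$ (i mod e, v) * b' $$ (v, j mod e)))"
    by (subst sum_div_mod) (simp add: mult_ac)
  also have "\<dots> = (\<Sum>u<m. a $$ (i div e, u) * a' $$ (u, j div e)) * (\<Sum>v<e. b $$ (i mod e, v) * b' $$ (v, j mod e))"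
    by (simp add: sum_product)
  also have "\<dots> = (a * a') $$ (i div e, j div e) * (b * b') $$ (i mod e, j mod e)"
    using assms lt by (simp add: mat_mult_index[of _ m m _ m] mat_mult_index[of _ e e _ e] del: index_mult_mat(1))
  also have "\<dots> = kronecker (a * a') (b * b') $$ (i, j)"
    using assms ij by (subst kronecker_index) auto
  finally show "(kronecker a b * kronecker a' b') $$ (i, j) = kronecker (a * a') (b * b') $$ (i, j)" .
qed (use assms in auto)

lemma kronecker_adjoint: "mat_adjoint (kronecker a b) = kronecker (mat_adjoint a) (mat_adjoint b)"
proof (rule eq_matI)
  fix i j assume "i < dim_row (kronecker (mat_adjoint a) (mat_adjoint b))"
    "j < dim_col (kronecker (mat_adjoint a) (mat_adjoint b))"
  then have ij: "i < dim_col a * dim_col b" "j < dim_row a * dim_row b" by auto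
  then show "mat_adjoint (kronecker a b) $$ (i, j) = kronecker (mat_adjoint a) (mat_adjoint b) $$ (i, j)"
    using div_less_of_less_mult[OF ij(1)] div_less_of_less_mult[OF ij(2)]
    by (simp add: kronecker_index)
qed auto

lemma kronecker_add_left:
  "a \<in> carrier_mat m m \<Longrightarrow> a' \<in> carrier_mat m m \<Longrightarrow> b \<in> carrier_mat e e
    \<Longrightarrow> kronecker (a + a') b = kronecker a b + kronecker a' b"
  by (rule eq_matI) (auto simp: kronecker_index algebra_simps div_less_of_less_mult)

lemma kronecker_add_right:
  "a \<in> carrier_mat m m \<Longrightarrow> b \<in> carrier_mat e e \<Longrightarrow> b' \<in> carrier_mat e e
    \<Longrightarrow> kronecker a (b + b') = kronecker a b + kronecker a b'"
  by (rule eq_matI) (auto simp: kronecker_index algebra_simps div_less_of_less_mult)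

lemma kronecker_scale_left:
  "a \<in> carrier_mat m m \<Longrightarrow> b \<in> carrier_mat e e \<Longrightarrow> kronecker (c \<cdot>\<^sub>m a) b = c \<cdot>\<^sub>m kronecker a b"
  by (rule eq_matI) (auto simp: kronecker_index div_less_of_less_mult)

lemma kronecker_scale_right:
  "a \<in> carrier_mat m m \<Longrightarrow> b \<in> carrier_mat e e \<Longrightarrow> kronecker a (c \<cdot>\<^sub>m b) = c \<cdot>\<^sub>m kronecker a b"
  by (rule eq_matI) (auto simp: kronecker_index div_less_of_less_mult)

lemma kronecker_one: "kronecker (1\<^sub>m m) (1\<^sub>m e) = 1\<^sub>m (m * e)"
proof (rule eq_matI)
  fix i j assume "i < dim_row (1\<^sub>m (m * e) :: complex mat)" "j < dim_col (1\<^sub>m (m * e) :: complex mat)"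
  then have ij: "i < m * e" "j < m * e" by auto
  have "i = j \<longleftrightarrow> i div e = j div e \<and> i mod e = j mod e"
    by (metis div_mult_mod_eq)
  then show "kronecker (1\<^sub>m m) (1\<^sub>m e) $$ (i, j) = 1\<^sub>m (m * e) $$ (i, j)"
    using ij div_less_of_less_mult[OF ij(1)] div_less_of_less_mult[OF ij(2)]
    by (auto simp: kronecker_index)
qed auto

lemma kronecker_one_one: "kronecker a (1\<^sub>m 1) = a"
  by (rule eq_matI) (auto simp: kronecker_index)

lemma kronecker_mat_unit:
  assumes "i < m" "l < m" "u < e" "v < e"
  shows "kronecker (mat_unit m i l) (mat_unit e u v) = mat_unit (m * e) (i * e + u) (l * e + v)"
proof (rule eq_matI)
  fix r c assume "r < dim_row (mat_unit (m * e) (i * e + u) (l * e + v))"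
    "c < dim_col (mat_unit (m * e) (i * e + u) (l * e + v))"
  then have rc: "r < m * e" "c < m * e" by auto
  have "r = i * e + u \<longleftrightarrow> r div e = i \<and> r mod e = u" "c = l * e + v \<longleftrightarrow> c div e = l \<and> c mod e = v"
    using assms by auto
  then show "kronecker (mat_unit m i l) (mat_unit e u v) $$ (r, c)
      = mat_unit (m * e) (i * e + u) (l * e + v) $$ (r, c)"
    using rc div_less_of_less_mult[OF rc(1)] div_less_of_less_mult[OF rc(2)]
    by (auto simp: kronecker_index)
qed auto

lemma kronecker_assoc:
  assumes "a \<in> carrier_mat m m" "b \<in> carrier_mat e e" "c \<in> carrier_mat h h"
  shows "kronecker (kronecker a b) c = kronecker a (kronecker b c)"
proof (rule eq_matI)
  fix i j assume "i < dim_row (kronecker a (kronecker b c))" "j < dim_col (kronecker a (kronecker b c))"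
  then have ij: "i < m * e * h" "j < m * e * h" using assms by (auto simp: mult.assoc)
  then have ij': "i < m * (e * h)" "j < m * (e * h)" by (auto simp: mult.assoc)
  \<comment> \<open>Both sides read the same three digits of an index in mixed radix; these are the
    two ways of extracting them.\<close>
  have dm: "k div h div e = k div (e * h)" "k div h mod e = k mod (e * h) div h"
    "k mod h = k mod (e * h) mod h" for k
  proof -
    show "k div h div e = k div (e * h)" by (metis div_mult2_eq mult.commute)
    show "k div h mod e = k mod (e * h) div h"
      by (cases "h = 0") (simp_all add: mult.commute[of e h] mod_mult2_eq)
    show "k mod h = k mod (e * h) mod h" by (simp add: mod_mod_cancel)
  qed
  show "kronecker (kronecker a b) c $$ (i, j) = kronecker a (kronecker b c) $$ (i, j)"
    using assms ij ij' div_less_of_less_mult[OF ij(1)] div_less_of_less_mult[OF ij(2)]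
      div_less_of_less_mult[OF ij'(1)] div_less_of_less_mult[OF ij'(2)]
    by (simp add: kronecker_index dm(1,2)) (metis dm(3))
qed (use assms in \<open>auto simp: mult.assoc\<close>)

text \<open>Through the norm condition of the direct limit, this value keeps the unit of a UHF
  algebra from vanishing.\<close>

lemma op_norm_one:
  assumes "0 < d"
  shows "op_norm (1\<^sub>m d) = 1"
proof -
  let ?S = "{sqrt (Re ((1\<^sub>m d *\<^sub>v v) \<bullet>c (1\<^sub>m d *\<^sub>v v))) | v.
     v \<in> carrier_vec d \<and> Re (v \<bullet>c v) \<le> 1} :: real set"
  have "Sup ?S = 1"
  proof (rule cSup_eq_maximum)
    have "(1::real) = sqrt (Re ((1\<^sub>m d *\<^sub>v unit_vec d 0) \<bullet>c (1\<^sub>m d *\<^sub>v unit_vec d 0)))"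
      "Re (unit_vec d 0 \<bullet>c unit_vec d 0) \<le> 1" "unit_vec d 0 \<in> (carrier_vec d :: complex vec set)"
      using assms by (auto simp: scalar_prod_left_unit[of _ d])
    then show "1 \<in> ?S" by blast
    show "y \<le> 1" if "y \<in> ?S" for y
    proof -
      from that obtain v where v: "v \<in> carrier_vec d" "Re (v \<bullet>c v) \<le> 1"
        "y = sqrt (Re ((1\<^sub>m d *\<^sub>v v) \<bullet>c (1\<^sub>m d *\<^sub>v v)))" by blast
      then show ?thesis by simp
    qed
  qed
  then show ?thesis by (simp add: op_norm_def)
qed

section \<open>Hilbert modules with a finite orthonormal basis\<close>

sublocale right_hilbert_module \<subseteq> MM: complex_module M ..

context right_hilbert_module
begin

declare ract_closed [simp, intro] inprod_closed [simp, intro]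

lemma inprod_add_left:
  assumes "x \<in> carrier M" "y \<in> carrier M" "z \<in> carrier M"
  shows "\<langle>x \<oplus> y, z\<rangle> = \<langle>x, z\<rangle> \<oplus>\<^bsub>A\<^esub> \<langle>y, z\<rangle>"
proof -
  have "\<langle>x \<oplus> y, z\<rangle> = \<langle>z, x \<oplus> y\<rangle>\<^sup>\<star>\<^bsub>A\<^esub>"
    using assms by (simp add: inprod_star)
  then show ?thesis
    using assms by (simp add: inprod_add A.star_add inprod_star)
qed

lemma inprod_smult_left:
  assumes "x \<in> carrier M" "y \<in> carrier M"
  shows "\<langle>c \<odot> x, y\<rangle> = cnj c \<odot>\<^bsub>A\<^esub> \<langle>x, y\<rangle>"
proof -
  have "\<langle>c \<odot> x, y\<rangle> = \<langle>y, c \<odot> x\<rangle>\<^sup>\<star>\<^bsub>A\<^esub>"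
    using assms by (simp add: inprod_star)
  then show ?thesis
    using assms by (simp add: inprod_smult inprod_star)
qed

lemma inprod_ract_left:
  assumes "x \<in> carrier M" "y \<in> carrier M" "a \<in> carrier A"
  shows "\<langle>x \<triangleleft> a, y\<rangle> = a\<^sup>\<star>\<^bsub>A\<^esub> \<otimes>\<^bsub>A\<^esub> \<langle>x, y\<rangle>"
proof -
  have "\<langle>x \<triangleleft> a, y\<rangle> = \<langle>y, x \<triangleleft> a\<rangle>\<^sup>\<star>\<^bsub>A\<^esub>"
    using assms by (simp add: inprod_star)
  then show ?thesis
    using assms by (simp add: inprod_ract A.star_mult inprod_star)
qed

lemma inprod_linear: "x \<in> carrier M \<Longrightarrow> (\<lambda>y. \<langle>x, y\<rangle>) \<in> linear_maps M A"
  by (rule linear_mapsI) (auto simp: inprod_add inprod_smult)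

lemma inprod_sum_right:
  assumes "x \<in> carrier M" "\<And>i. i \<in> I \<Longrightarrow> f i \<in> carrier M"
  shows "\<langle>x, finsum M f I\<rangle> = finsum A (\<lambda>i. \<langle>x, f i\<rangle>) I"
  using linear_maps_sum[OF MM.complex_module_axioms A.complex_module_axioms inprod_linear[OF assms(1)], of I f] assms
  by simp

lemma inprod_minus_right:
  "\<lbrakk>x \<in> carrier M; y \<in> carrier M; z \<in> carrier M\<rbrakk> \<Longrightarrow> \<langle>x, y \<ominus> z\<rangle> = \<langle>x, y\<rangle> \<ominus>\<^bsub>A\<^esub> \<langle>x, z\<rangle>"
  using linear_maps_minus[OF MM.complex_module_axioms A.complex_module_axioms inprod_linear] by simp

lemma inprod_minus_left:
  "\<lbrakk>x \<in> carrier M; y \<in> carrier M; z \<in> carrier M\<rbrakk> \<Longrightarrow> \<langle>y \<ominus> z, x\<rangle> = \<langle>y, x\<rangle> \<ominus>\<^bsub>A\<^esub> \<langle>z, x\<rangle>"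
  by (simp add: MM.minus_scale inprod_add_left inprod_smult_left A.minus_scale)

lemma inprod_zero [simp]: "x \<in> carrier M \<Longrightarrow> \<langle>x, \<zero>\<rangle> = \<zero>\<^bsub>A\<^esub>"
  using linear_maps_zero[OF MM.complex_module_axioms A.complex_module_axioms inprod_linear] by simp

lemma inprod_zero_left [simp]: "x \<in> carrier M \<Longrightarrow> \<langle>\<zero>, x\<rangle> = \<zero>\<^bsub>A\<^esub>"
  by (metis A.star_zero M.zero_closed inprod_star inprod_zero)

lemma inprod_eqI:
  assumes "x \<in> carrier M" "y \<in> carrier M" "\<And>z. z \<in> carrier M \<Longrightarrow> \<langle>z, x\<rangle> = \<langle>z, y\<rangle>"
  shows "x = y"
proof -
  have "\<langle>x \<ominus> y, x \<ominus> y\<rangle> = \<zero>\<^bsub>A\<^esub>"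
    using assms by (simp add: inprod_minus_right)
  then show ?thesis
    using assms inprod_definite[of "x \<ominus> y"] by (simp add: MM.minus_eq_zero_iff)
qed

lemma ract_zero [simp]: "x \<in> carrier M \<Longrightarrow> x \<triangleleft> \<zero>\<^bsub>A\<^esub> = \<zero>"
  using ract_smult_right[of x "\<zero>\<^bsub>A\<^esub>" 0] by simp

text \<open>Definiteness forces this: \<open>x \<triangleleft> \<one>\<close> and \<open>x\<close>
  have the same inner products with all vectors.\<close>

lemma ract_one:
  assumes "unital_cstar_algebra A" "x \<in> carrier M"
  shows "x \<triangleleft> \<one>\<^bsub>A\<^esub> = x"
proof -
  interpret U: unital_cstar_algebra A by fact
  show ?thesis
    by (rule inprod_eqI) (use assms in \<open>auto simp: inprod_ract\<close>)
qed

lemma hnorm_nonneg [simp]: "x \<in> carrier M \<Longrightarrow> 0 \<le> hnorm A M x"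
  by (simp add: hnorm_def)

lemma hnorm_square: "x \<in> carrier M \<Longrightarrow> (hnorm A M x)\<^sup>2 = cnorm A \<langle>x, x\<rangle>"
  by (simp add: hnorm_def)

lemma hnorm_zero_iff: "x \<in> carrier M \<Longrightarrow> hnorm A M x = 0 \<longleftrightarrow> x = \<zero>"
  by (auto simp: hnorm_def A.cnorm_eq_0 intro: inprod_definite)

lemma hnorm_zero [simp]: "hnorm A M \<zero> = 0"
  by (simp add: hnorm_zero_iff)

lemma hnorm_smult: "x \<in> carrier M \<Longrightarrow> hnorm A M (c \<odot> x) = cmod c * hnorm A M x"
  by (simp add: hnorm_def inprod_smult inprod_smult_left A.cnorm_smult norm_mult real_sqrt_mult)

end

text \<open>The monotonicity assumption holds in every $C^*$-algebra; only UHF algebras are needed here.\<close>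

locale monotone_hilbert_module = right_hilbert_module +
  assumes cnorm_positive_mono: "\<lbrakk>b \<in> carrier A; z \<in> carrier A\<rbrakk>
    \<Longrightarrow> cnorm A (b\<^sup>\<star>\<^bsub>A\<^esub> \<otimes>\<^bsub>A\<^esub> b) \<le> cnorm A (b\<^sup>\<star>\<^bsub>A\<^esub> \<otimes>\<^bsub>A\<^esub> b \<oplus>\<^bsub>A\<^esub> z\<^sup>\<star>\<^bsub>A\<^esub> \<otimes>\<^bsub>A\<^esub> z)"
begin

lemma positive_elementE:
  assumes "x \<in> carrier M"
  obtains b where "b \<in> carrier A" "\<langle>x, x\<rangle> = b\<^sup>\<star>\<^bsub>A\<^esub> \<otimes>\<^bsub>A\<^esub> b"
  using inprod_positive[OF assms] by (auto simp: positive_elements_def)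

text \<open>The parallelogram-type identity
  \<open>\<langle>x + y, x + y\<rangle> + \<langle>t x - y / t, t x - y / t\<rangle> = (1 + t\<^sup>2) \<langle>x, x\<rangle> + (1 + 1 / t\<^sup>2) \<langle>y, y\<rangle>\<close> with
  \<open>t\<^sup>2 = \<parallel>y\<parallel> / \<parallel>x\<parallel>\<close> replaces the Cauchy-Schwarz inequality.\<close>

lemma hnorm_triangle:
  assumes x: "x \<in> carrier M" and y: "y \<in> carrier M"
  shows "hnorm A M (x \<oplus> y) \<le> hnorm A M x + hnorm A M y"
proof (cases "x = \<zero> \<or> y = \<zero>")
  case True
  then show ?thesis using x y by auto
next
  case False
  define a where "a = hnorm A M x"
  define b where "b = hnorm A M y"
  have pos: "0 < a" "0 < b"
    unfolding a_def b_def
    using False x y hnorm_zero_iff[OF x] hnorm_zero_iff[OF y] hnorm_nonneg[OF x] hnorm_nonneg[OF y]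
    by linarith+
  \<comment> \<open>This weight minimises \<open>(1 + t^2) a^2 + (1 + 1 / t^2) b^2\<close>, and the
    minimum is exactly \<open>(a + b)^2\<close>.\<close>
  define t where "t = sqrt (b / a)"
  have t: "0 < t" "t * t = b / a" using pos by (simp_all add: t_def)
  define c where "c = complex_of_real t"
  define d where "d = complex_of_real (- 1 / t)"
  have cd: "cnj c * c = of_real (b / a)" "cnj d * d = of_real (a / b)" "cnj c * d = - 1" "cnj d * c = - 1"
    "c * cnj c = of_real (b / a)" "d * cnj d = of_real (a / b)" "d * cnj c = - 1" "c * cnj d = - 1"
    using t pos by (auto simp: c_def d_def field_simps simp flip: of_real_mult)
  define u where "u = x \<oplus> y"
  define v where "v = c \<odot> x \<oplus> d \<odot> y"
  have uv: "u \<in> carrier M" "v \<in> carrier M" using x y by (auto simp: u_def v_def)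
  let ?p = "\<langle>x, x\<rangle>" and ?q = "\<langle>x, y\<rangle>" and ?r = "\<langle>y, x\<rangle>" and ?s = "\<langle>y, y\<rangle>"
  have cl: "?p \<in> carrier A" "?q \<in> carrier A" "?r \<in> carrier A" "?s \<in> carrier A" using x y by auto
  have "\<langle>u, u\<rangle> \<oplus>\<^bsub>A\<^esub> \<langle>v, v\<rangle> = (?p \<oplus>\<^bsub>A\<^esub> of_real (b / a) \<odot>\<^bsub>A\<^esub> ?p) \<oplus>\<^bsub>A\<^esub> (?s \<oplus>\<^bsub>A\<^esub> of_real (a / b) \<odot>\<^bsub>A\<^esub> ?s)
      \<oplus>\<^bsub>A\<^esub> ((?q \<oplus>\<^bsub>A\<^esub> (- 1) \<odot>\<^bsub>A\<^esub> ?q) \<oplus>\<^bsub>A\<^esub> (?r \<oplus>\<^bsub>A\<^esub> (- 1) \<odot>\<^bsub>A\<^esub> ?r))"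
    using x y cl
    by (simp add: u_def v_def inprod_add inprod_add_left inprod_smult inprod_smult_left
        A.scale_right_add A.M.a_ac cd del: of_real_divide)
  also have "?q \<oplus>\<^bsub>A\<^esub> (- 1) \<odot>\<^bsub>A\<^esub> ?q = \<zero>\<^bsub>A\<^esub>"
    using cl by (simp flip: A.minus_scale)
  also have "?r \<oplus>\<^bsub>A\<^esub> (- 1) \<odot>\<^bsub>A\<^esub> ?r = \<zero>\<^bsub>A\<^esub>"
    using cl by (simp flip: A.minus_scale)
  also have "?p \<oplus>\<^bsub>A\<^esub> of_real (b / a) \<odot>\<^bsub>A\<^esub> ?p = of_real (1 + b / a) \<odot>\<^bsub>A\<^esub> ?p"
    using cl A.scale_left_add[of ?p 1 "of_real (b / a)"] by simp
  also have "?s \<oplus>\<^bsub>A\<^esub> of_real (a / b) \<odot>\<^bsub>A\<^esub> ?s = of_real (1 + a / b) \<odot>\<^bsub>A\<^esub> ?s"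
    using cl A.scale_left_add[of ?s 1 "of_real (a / b)"] by simp
  finally have eq: "\<langle>u, u\<rangle> \<oplus>\<^bsub>A\<^esub> \<langle>v, v\<rangle>
      = of_real (1 + b / a) \<odot>\<^bsub>A\<^esub> ?p \<oplus>\<^bsub>A\<^esub> of_real (1 + a / b) \<odot>\<^bsub>A\<^esub> ?s"
    using cl by simp
  obtain g h where gh: "g \<in> carrier A" "\<langle>u, u\<rangle> = g\<^sup>\<star>\<^bsub>A\<^esub> \<otimes>\<^bsub>A\<^esub> g"
    "h \<in> carrier A" "\<langle>v, v\<rangle> = h\<^sup>\<star>\<^bsub>A\<^esub> \<otimes>\<^bsub>A\<^esub> h"
    using positive_elementE uv by metis
  have cm: "cmod (of_real (1 + b / a)) = 1 + b / a" "cmod (of_real (1 + a / b)) = 1 + a / b"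
    using pos by (simp_all only: norm_of_real) (simp_all add: field_simps)
  have "cnorm A \<langle>u, u\<rangle> \<le> cnorm A (of_real (1 + b / a) \<odot>\<^bsub>A\<^esub> ?p \<oplus>\<^bsub>A\<^esub> of_real (1 + a / b) \<odot>\<^bsub>A\<^esub> ?s)"
    using cnorm_positive_mono[OF gh(1,3)] gh(2,4) eq by simp
  also have "\<dots> \<le> (1 + b / a) * cnorm A ?p + (1 + a / b) * cnorm A ?s"
    using cl A.cnorm_add[of "of_real (1 + b / a) \<odot>\<^bsub>A\<^esub> ?p" "of_real (1 + a / b) \<odot>\<^bsub>A\<^esub> ?s"] cm
    by (simp add: A.cnorm_smult del: of_real_add of_real_divide)
  also have "\<dots> = (1 + b / a) * a\<^sup>2 + (1 + a / b) * b\<^sup>2"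
    unfolding a_def b_def using x y by (simp add: hnorm_square)
  also have "\<dots> = (a + b)\<^sup>2"
    using pos by (simp add: field_simps power2_eq_square)
  finally have "(hnorm A M u)\<^sup>2 \<le> (a + b)\<^sup>2"
    using uv by (simp add: hnorm_square)
  then show ?thesis
    unfolding u_def a_def b_def by (rule power2_le_imp_le) (use x y in simp)
qed

lemma hnorm_minus_commute: "\<lbrakk>x \<in> carrier M; y \<in> carrier M\<rbrakk> \<Longrightarrow> hnorm A M (x \<ominus> y) = hnorm A M (y \<ominus> x)"
  using hnorm_smult[of "x \<ominus> y" "-1"] by (simp add: MM.minus_swap[of x y])

sublocale hmetric: Metric_space "carrier M" "hdist A M"
proof
  show "0 \<le> hdist A M x y" for x y by (simp add: hdist_def)
  show "hdist A M x y = hdist A M y x" for x y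
    by (simp add: hdist_def hnorm_minus_commute)
  show "hdist A M x y = 0 \<longleftrightarrow> x = y" if "x \<in> carrier M" "y \<in> carrier M" for x y
    using that by (simp add: hdist_def hnorm_zero_iff MM.minus_eq_zero_iff)
  show "hdist A M x z \<le> hdist A M x y + hdist A M y z"
    if "x \<in> carrier M" "y \<in> carrier M" "z \<in> carrier M" for x y z
    using that hnorm_triangle[of "x \<ominus> y" "y \<ominus> z"] by (simp add: hdist_def MM.diff_trans)
qed

lemma hnorm_sum_le:
  assumes "finite I" "\<And>i. i \<in> I \<Longrightarrow> f i \<in> carrier M"
  shows "hnorm A M (finsum M f I) \<le> (\<Sum>i\<in>I. hnorm A M (f i))"
  using assms
proof (induction I)
  case (insert i I)
  then show ?case
    using hnorm_triangle[of "f i" "finsum M f I"] by (simp add: MM.sum_insert)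
qed simp

lemma hnorm_ract_le:
  assumes "x \<in> carrier M" "a \<in> carrier A"
  shows "hnorm A M (x \<triangleleft> a) \<le> hnorm A M x * cnorm A a"
proof (rule power2_le_imp_le)
  have "cnorm A (a\<^sup>\<star>\<^bsub>A\<^esub> \<otimes>\<^bsub>A\<^esub> \<langle>x, x\<rangle> \<otimes>\<^bsub>A\<^esub> a) \<le> (cnorm A a * cnorm A \<langle>x, x\<rangle>) * cnorm A a"
    using assms A.cnorm_mult[of "a\<^sup>\<star>\<^bsub>A\<^esub>" "\<langle>x, x\<rangle>"] by (intro A.cnorm_mult_le) auto
  then show "(hnorm A M (x \<triangleleft> a))\<^sup>2 \<le> (hnorm A M x * cnorm A a)\<^sup>2"
    using assms by (simp add: hnorm_square power_mult_distrib inprod_ract inprod_ract_left A.mult_assoc)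
      (simp add: power2_eq_square mult_ac)
qed (use assms in simp)

end

section \<open>Orthonormal systems and the projection onto their span\<close>

locale orthonormal_system = monotone_hilbert_module A M + A: unital_cstar_algebra A
  for A :: "'a cstar" and M :: "('a, 'm) hilbert_bimodule" (structure) +
  fixes I :: "'i set" and m :: "'i \<Rightarrow> 'm"
  assumes finite_index: "finite I"
    and basis_closed [simp, intro]: "i \<in> I \<Longrightarrow> m i \<in> carrier M"
    and orthonormal: "\<lbrakk>i \<in> I; j \<in> I\<rbrakk> \<Longrightarrow> \<langle>m i, m j\<rangle> = (if i = j then \<one>\<^bsub>A\<^esub> else \<zero>\<^bsub>A\<^esub>)"
begin

text \<open>Removing the component along \<open>m i\<close> leaves a vector \<open>z\<close> with
  \<open>\<langle>x, x\<rangle> = b^* b + \<langle>z, z\<rangle>\<close>, and the norm does not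
  decrease when a positive element is added. This bounds the coefficient maps, where the
  Cauchy-Schwarz inequality would be the usual tool.\<close>

lemma bessel:
  assumes i: "i \<in> I" and x: "x \<in> carrier M"
  shows "cnorm A \<langle>m i, x\<rangle> \<le> hnorm A M x"
proof (rule power2_le_imp_le)
  define b where "b = \<langle>m i, x\<rangle>"
  define z where "z = x \<ominus> m i \<triangleleft> b"
  have cl: "b \<in> carrier A" "z \<in> carrier M" using i x by (auto simp: b_def z_def)
  obtain h where h: "h \<in> carrier A" "\<langle>z, z\<rangle> = h\<^sup>\<star>\<^bsub>A\<^esub> \<otimes>\<^bsub>A\<^esub> h"
    using positive_elementE cl by metis
  have bs: "b\<^sup>\<star>\<^bsub>A\<^esub> = \<langle>x, m i\<rangle>" using i x by (simp add: b_def inprod_star)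
  have "\<langle>z, z\<rangle> = \<langle>x, x\<rangle> \<ominus>\<^bsub>A\<^esub> b\<^sup>\<star>\<^bsub>A\<^esub> \<otimes>\<^bsub>A\<^esub> b"
    using i x cl
    by (simp add: z_def inprod_minus_left inprod_minus_right inprod_ract inprod_ract_left orthonormal
        bs[symmetric] b_def[symmetric])
  then have "\<langle>x, x\<rangle> = b\<^sup>\<star>\<^bsub>A\<^esub> \<otimes>\<^bsub>A\<^esub> b \<oplus>\<^bsub>A\<^esub> h\<^sup>\<star>\<^bsub>A\<^esub> \<otimes>\<^bsub>A\<^esub> h"
    using x cl h by (metis A.M.a_comm A.minus_add_cancel A.mult_closed A.star_closed inprod_closed)
  then have "cnorm A (b\<^sup>\<star>\<^bsub>A\<^esub> \<otimes>\<^bsub>A\<^esub> b) \<le> cnorm A \<langle>x, x\<rangle>"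
    using cnorm_positive_mono[OF cl(1) h(1)] by simp
  then show "(cnorm A \<langle>m i, x\<rangle>)\<^sup>2 \<le> (hnorm A M x)\<^sup>2"
    using cl x by (simp add: A.cstar_identity hnorm_square b_def)
qed (use x in simp)

lemma hnorm_basis_le: "i \<in> I \<Longrightarrow> hnorm A M (m i) \<le> 1"
  using A.cnorm_one_le by (simp add: hnorm_def orthonormal)

definition project :: "'m \<Rightarrow> 'm" where
  "project x = finsum M (\<lambda>i. m i \<triangleleft> \<langle>m i, x\<rangle>) I"

lemma project_closed [simp, intro]: "x \<in> carrier M \<Longrightarrow> project x \<in> carrier M"
  by (auto simp: project_def)

lemma project_linear: "project \<in> linear_maps M M"
proof (rule linear_mapsI)
  fix x y assume "x \<in> carrier M" "y \<in> carrier M"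
  then show "project (x \<oplus> y) = project x \<oplus> project y"
    unfolding project_def
    using MM.sum_cong[of I I "\<lambda>i. m i \<triangleleft> \<langle>m i, x \<oplus> y\<rangle>" "\<lambda>i. m i \<triangleleft> \<langle>m i, x\<rangle> \<oplus> m i \<triangleleft> \<langle>m i, y\<rangle>"]
      MM.sum_add[of I "\<lambda>i. m i \<triangleleft> \<langle>m i, x\<rangle>" "\<lambda>i. m i \<triangleleft> \<langle>m i, y\<rangle>"]
    by (simp add: inprod_add ract_add_right)
next
  fix x c assume "x \<in> carrier M"
  then show "project (c \<odot> x) = c \<odot> project x"
    unfolding project_def by (subst MM.sum_scale) (auto simp: inprod_smult ract_smult_right intro!: MM.sum_cong)
qed auto

text \<open>Adding up the coefficient bounds gives the crude constant \<open>card I\<close>; what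
  matters is that the projection is continuous.\<close>

lemma hnorm_project_le:
  assumes x: "x \<in> carrier M"
  shows "hnorm A M (project x) \<le> card I * hnorm A M x"
proof -
  have "hnorm A M (project x) \<le> (\<Sum>i\<in>I. hnorm A M (m i \<triangleleft> \<langle>m i, x\<rangle>))"
    unfolding project_def using x finite_index by (intro hnorm_sum_le) auto
  also have "\<dots> \<le> (\<Sum>i\<in>I. hnorm A M x)"
  proof (rule sum_mono)
    fix i assume i: "i \<in> I"
    have "hnorm A M (m i \<triangleleft> \<langle>m i, x\<rangle>) \<le> hnorm A M (m i) * cnorm A \<langle>m i, x\<rangle>"
      using i x by (intro hnorm_ract_le) auto
    also have "\<dots> \<le> 1 * hnorm A M x"
      using i x by (intro mult_mono hnorm_basis_le bessel) auto
    finally show "hnorm A M (m i \<triangleleft> \<langle>m i, x\<rangle>) \<le> hnorm A M x" by simp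
  qed
  finally show ?thesis by simp
qed

text \<open>The defect \<open>x - project x\<close> is bounded by \<open>K = 1 + card I\<close>
  times the norm of \<open>x\<close> and is unchanged when a fixed \<open>y\<close> is subtracted
  from \<open>x\<close>. Hence the fixed points of the projection are closed.\<close>

lemma project_eq_of_approx:
  assumes x: "x \<in> carrier M"
    and approx: "\<And>e. 0 < e \<Longrightarrow> \<exists>y\<in>carrier M. project y = y \<and> hnorm A M (x \<ominus> y) < e"
  shows "project x = x"
proof (rule ccontr)
  assume "project x \<noteq> x"
  then have "0 < hnorm A M (x \<ominus> project x)"
    using x hnorm_zero_iff[of "x \<ominus> project x"] hnorm_nonneg[of "x \<ominus> project x"]
    by (simp add: MM.minus_eq_zero_iff order_less_le)
  moreover define K where "K = 1 + real (card I)"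
  ultimately have "0 < hnorm A M (x \<ominus> project x) / K" by (simp add: add_pos_nonneg)
  then obtain y where y: "y \<in> carrier M" "project y = y" "hnorm A M (x \<ominus> y) < hnorm A M (x \<ominus> project x) / K"
    using approx by blast
  have "(x \<ominus> y) \<ominus> project (x \<ominus> y) = x \<ominus> project x"
    using x y linear_maps_minus[OF MM.complex_module_axioms MM.complex_module_axioms project_linear x y(1)]
    by (simp add: MM.diff_diff_cancel)
  then have "hnorm A M (x \<ominus> project x) \<le> hnorm A M (x \<ominus> y) + hnorm A M (project (x \<ominus> y))"
    using x y hnorm_triangle[of "x \<ominus> y" "(- 1) \<odot> project (x \<ominus> y)"]
    by (simp add: hnorm_smult flip: MM.minus_scale)
  also have "\<dots> \<le> K * hnorm A M (x \<ominus> y)"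
    using x y hnorm_project_le[of "x \<ominus> y"] by (simp add: K_def algebra_simps)
  also have "\<dots> < hnorm A M (x \<ominus> project x)"
    using y(3) by (simp add: K_def field_simps add_pos_nonneg)
  finally show False by simp
qed

end

section \<open>Compact operators and covariance\<close>

lemma adjointable_simps [simp]:
  "S \<otimes>\<^bsub>adjointable_operators A M\<^esub> T = compose (carrier M) S T"
  "S \<oplus>\<^bsub>adjointable_operators A M\<^esub> T = (\<lambda>x \<in> carrier M. S x \<oplus>\<^bsub>M\<^esub> T x)"
  "c \<odot>\<^bsub>adjointable_operators A M\<^esub> T = (\<lambda>x \<in> carrier M. c \<odot>\<^bsub>M\<^esub> T x)"
  "\<zero>\<^bsub>adjointable_operators A M\<^esub> = (\<lambda>x \<in> carrier M. \<zero>\<^bsub>M\<^esub>)"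
  by (simp_all add: adjointable_operators_def)

context right_hilbert_module
begin

abbreviation "LM \<equiv> adjointable_operators A M"

lemma adjointable_iff:
  "T \<in> carrier LM \<longleftrightarrow> T \<in> carrier M \<rightarrow>\<^sub>E carrier M \<and> (\<exists>S \<in> carrier M \<rightarrow>\<^sub>E carrier M. is_adjoint M T S)"
  by (simp add: adjointable_operators_def)

lemma is_adjoint_sym:
  assumes "T \<in> carrier M \<rightarrow> carrier M" "S \<in> carrier M \<rightarrow> carrier M" "is_adjoint M T S"
  shows "is_adjoint M S T"
  unfolding is_adjoint_def
proof (intro ballI)
  fix x y assume xy: "x \<in> carrier M" "y \<in> carrier M"
  have "\<langle>S x, y\<rangle> = \<langle>y, S x\<rangle>\<^sup>\<star>\<^bsub>A\<^esub>"
    using assms(2) xy by (simp add: inprod_star Pi_iff)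
  also have "\<langle>y, S x\<rangle> = \<langle>T y, x\<rangle>"
    using assms(3) xy by (simp add: is_adjoint_def)
  also have "\<langle>T y, x\<rangle>\<^sup>\<star>\<^bsub>A\<^esub> = \<langle>x, T y\<rangle>"
    using assms(1) xy by (simp add: inprod_star Pi_iff)
  finally show "\<langle>S x, y\<rangle> = \<langle>x, T y\<rangle>" .
qed

lemma is_adjoint_unique:
  assumes "S \<in> carrier M \<rightarrow>\<^sub>E carrier M" "S' \<in> carrier M \<rightarrow>\<^sub>E carrier M"
    and "is_adjoint M T S" "is_adjoint M T S'" "T \<in> carrier M \<rightarrow> carrier M"
  shows "S = S'"
proof (rule PiE_ext[OF assms(1,2)])
  fix x assume x: "x \<in> carrier M"
  have S: "is_adjoint M S T" "is_adjoint M S' T"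
    using assms by (auto intro: is_adjoint_sym)
  show "S x = S' x"
  proof (rule inprod_eqI)
    fix z assume z: "z \<in> carrier M"
    show "\<langle>z, S x\<rangle> = \<langle>z, S' x\<rangle>"
      using assms(3,4) x z by (metis is_adjoint_def)
  qed (use assms x in auto)
qed

lemma adjointable_closed [simp, intro]: "T \<in> carrier LM \<Longrightarrow> x \<in> carrier M \<Longrightarrow> T x \<in> carrier M"
  by (auto simp: adjointable_iff)

lemma adjointable_star:
  assumes T: "T \<in> carrier LM"
  shows "T\<^sup>\<star>\<^bsub>LM\<^esub> \<in> carrier LM" "is_adjoint M T (T\<^sup>\<star>\<^bsub>LM\<^esub>)"
proof -
  obtain S where S: "S \<in> carrier M \<rightarrow>\<^sub>E carrier M" "is_adjoint M T S" and T': "T \<in> carrier M \<rightarrow>\<^sub>E carrier M"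
    using T by (auto simp: adjointable_iff)
  have "T\<^sup>\<star>\<^bsub>LM\<^esub> = (THE S. S \<in> carrier M \<rightarrow>\<^sub>E carrier M \<and> is_adjoint M T S)"
    by (simp add: adjointable_operators_def)
  also have "\<dots> = S"
    using S T' by (intro the_equality) (auto intro: is_adjoint_unique)
  finally have eq: "T\<^sup>\<star>\<^bsub>LM\<^esub> = S" .
  show "is_adjoint M T (T\<^sup>\<star>\<^bsub>LM\<^esub>)" unfolding eq by (rule S)
  show "T\<^sup>\<star>\<^bsub>LM\<^esub> \<in> carrier LM"
    unfolding eq adjointable_iff using S T' is_adjoint_sym[of T S] by blast
qed

lemma adjointable_inprod:
  assumes "T \<in> carrier LM" "x \<in> carrier M" "y \<in> carrier M"
  shows "\<langle>T x, y\<rangle> = \<langle>x, (T\<^sup>\<star>\<^bsub>LM\<^esub>) y\<rangle>" "\<langle>x, T y\<rangle> = \<langle>(T\<^sup>\<star>\<^bsub>LM\<^esub>) x, y\<rangle>"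
proof -
  show "\<langle>T x, y\<rangle> = \<langle>x, (T\<^sup>\<star>\<^bsub>LM\<^esub>) y\<rangle>"
    using adjointable_star(2)[OF assms(1)] assms by (simp add: is_adjoint_def)
  have "is_adjoint M (T\<^sup>\<star>\<^bsub>LM\<^esub>) T"
    by (rule is_adjoint_sym[OF _ _ adjointable_star(2)[OF assms(1)]])
      (use adjointable_star(1)[OF assms(1)] assms(1) in auto)
  then show "\<langle>x, T y\<rangle> = \<langle>(T\<^sup>\<star>\<^bsub>LM\<^esub>) x, y\<rangle>"
    using assms by (simp add: is_adjoint_def)
qed

text \<open>Operators are bare functions; linearity is a consequence of having an adjoint, tested
  against all inner products.\<close>

lemma adjointable_linear:
  assumes T: "T \<in> carrier LM"
  shows "T \<in> linear_maps M M"
proof (rule linear_mapsI)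
  have S: "(T\<^sup>\<star>\<^bsub>LM\<^esub>) z \<in> carrier M" if "z \<in> carrier M" for z
    using adjointable_star(1)[OF T] that by simp
  show "T (x \<oplus> y) = T x \<oplus> T y" if "x \<in> carrier M" "y \<in> carrier M" for x y
    by (rule inprod_eqI) (use T that S in \<open>auto simp: adjointable_inprod(2) inprod_add\<close>)
  show "T (c \<odot> x) = c \<odot> T x" if "x \<in> carrier M" for c x
    by (rule inprod_eqI) (use T that S in \<open>auto simp: adjointable_inprod(2) inprod_smult\<close>)
qed (use T in auto)

lemma adjointable_ract:
  assumes T: "T \<in> carrier LM" and x: "x \<in> carrier M" and a: "a \<in> carrier A"
  shows "T (x \<triangleleft> a) = T x \<triangleleft> a"
proof (rule inprod_eqI)
  have S: "(T\<^sup>\<star>\<^bsub>LM\<^esub>) z \<in> carrier M" if "z \<in> carrier M" for z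
    using adjointable_star(1)[OF T] that by simp
  show "\<langle>z, T (x \<triangleleft> a)\<rangle> = \<langle>z, T x \<triangleleft> a\<rangle>" if "z \<in> carrier M" for z
    using T x a that S by (simp add: adjointable_inprod(2) inprod_ract)
qed (use T x a in auto)

lemma adjointableI:
  assumes "\<And>x. x \<in> carrier M \<Longrightarrow> f x \<in> carrier M" "\<And>x. x \<in> carrier M \<Longrightarrow> g x \<in> carrier M"
    and "\<And>x y. x \<in> carrier M \<Longrightarrow> y \<in> carrier M \<Longrightarrow> \<langle>f x, y\<rangle> = \<langle>x, g y\<rangle>"
  shows "(\<lambda>x \<in> carrier M. f x) \<in> carrier LM"
  unfolding adjointable_iff
  by (intro conjI bexI[of _ "\<lambda>x \<in> carrier M. g x"]) (use assms in \<open>auto simp: is_adjoint_def\<close>)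

lemma adjointable_ext:
  assumes "S \<in> carrier LM" "T \<in> carrier LM" "\<And>x. x \<in> carrier M \<Longrightarrow> S x = T x"
  shows "S = T"
  using assms by (intro PiE_ext[of S "carrier M" "\<lambda>_. carrier M" T]) (auto simp: adjointable_iff)

lemma rank_one_closed [simp, intro]:
  assumes "x \<in> carrier M" "y \<in> carrier M"
  shows "\<Theta>\<^bsub>M\<^esub> x y \<in> carrier LM"
  unfolding rank_one_def
  by (rule adjointableI[of _ "\<lambda>z. y \<triangleleft> \<langle>x, z\<rangle>"])
    (use assms in \<open>auto simp: inprod_ract inprod_ract_left inprod_star\<close>)

lemma rank_one_apply: "z \<in> carrier M \<Longrightarrow> \<Theta>\<^bsub>M\<^esub> x y z = x \<triangleleft> \<langle>y, z\<rangle>"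
  by (simp add: rank_one_def)

lemma adjointable_module: "complex_module LM"
proof -
  have add: "(\<lambda>x \<in> carrier M. S x \<oplus> T x) \<in> carrier LM" if "S \<in> carrier LM" "T \<in> carrier LM" for S T
    by (rule adjointableI[of _ "\<lambda>x. (S\<^sup>\<star>\<^bsub>LM\<^esub>) x \<oplus> (T\<^sup>\<star>\<^bsub>LM\<^esub>) x"])
      (use that adjointable_star(1) in \<open>auto simp: inprod_add inprod_add_left adjointable_inprod(1)\<close>)
  have zero: "(\<lambda>x \<in> carrier M. \<zero>) \<in> carrier LM"
    by (rule adjointableI[of _ "\<lambda>x. \<zero>"]) auto
  have scale: "(\<lambda>x \<in> carrier M. c \<odot> T x) \<in> carrier LM" if "T \<in> carrier LM" for c T
    by (rule adjointableI[of _ "\<lambda>x. cnj c \<odot> (T\<^sup>\<star>\<^bsub>LM\<^esub>) x"])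
      (use that adjointable_star(1) in \<open>auto simp: inprod_smult inprod_smult_left adjointable_inprod(1)\<close>)
  have "abelian_group LM"
  proof (rule abelian_groupI)
    fix S T assume ST: "S \<in> carrier LM" "T \<in> carrier LM"
    show "S \<oplus>\<^bsub>LM\<^esub> T = T \<oplus>\<^bsub>LM\<^esub> S"
      using ST by (auto simp: M.a_comm intro!: restrict_ext)
    fix U assume "U \<in> carrier LM"
    then show "(S \<oplus>\<^bsub>LM\<^esub> T) \<oplus>\<^bsub>LM\<^esub> U = S \<oplus>\<^bsub>LM\<^esub> (T \<oplus>\<^bsub>LM\<^esub> U)"
      using ST by (auto simp: M.a_assoc intro!: restrict_ext)
  next
    fix T assume T: "T \<in> carrier LM"
    show "\<zero>\<^bsub>LM\<^esub> \<oplus>\<^bsub>LM\<^esub> T = T"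
      by (rule adjointable_ext) (use T zero add[OF zero T] in auto)
    show "\<exists>S\<in>carrier LM. S \<oplus>\<^bsub>LM\<^esub> T = \<zero>\<^bsub>LM\<^esub>"
    proof
      show "(\<lambda>x \<in> carrier M. (- 1) \<odot> T x) \<in> carrier LM" by (rule scale[OF T])
      show "(\<lambda>x \<in> carrier M. (- 1) \<odot> T x) \<oplus>\<^bsub>LM\<^esub> T = \<zero>\<^bsub>LM\<^esub>"
        using T by (auto simp: M.l_neg intro!: restrict_ext simp flip: MM.uminus_scale)
    qed
  qed (use add zero in auto)
  then have "module \<CC> LM"
    by (rule moduleI[OF cring_from_type_algebra])
      (use scale in \<open>auto simp: MM.scale_left_add MM.scale_right_add intro!: restrict_ext
        intro: adjointable_ext[OF scale]\<close>)
  then show ?thesis by (simp add: complex_module_def)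
qed

lemma adjointable_finsum_apply:
  assumes "finite J" "\<And>i. i \<in> J \<Longrightarrow> F i \<in> carrier LM" "x \<in> carrier M"
  shows "finsum LM F J x = finsum M (\<lambda>i. F i x) J"
proof -
  interpret W: complex_module LM by (rule adjointable_module)
  show ?thesis
    using assms
  proof (induction J)
    case empty
    then show ?case by simp
  next
    case (insert i J)
    then show ?case by (simp add: W.sum_insert MM.sum_insert)
  qed
qed

end

section \<open>Operators and representations expanded in a finite basis\<close>

lemma representationD:
  assumes "representation A M B \<psi> \<pi>"
  shows "\<psi> \<in> linear_maps M B" "\<pi> \<in> star_hom A B"
    "\<And>x a. \<lbrakk>x \<in> carrier M; a \<in> carrier A\<rbrakk> \<Longrightarrow> \<psi> (x \<triangleleft>\<^bsub>M\<^esub> a) = \<psi> x \<otimes>\<^bsub>B\<^esub> \<pi> a"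
    "\<And>x y. \<lbrakk>x \<in> carrier M; y \<in> carrier M\<rbrakk> \<Longrightarrow> (\<psi> x)\<^sup>\<star>\<^bsub>B\<^esub> \<otimes>\<^bsub>B\<^esub> \<psi> y = \<pi> \<langle>x, y\<rangle>\<^bsub>M\<^esub>"
    "\<And>x a. \<lbrakk>x \<in> carrier M; a \<in> carrier A\<rbrakk> \<Longrightarrow> \<psi> (a \<triangleright>\<^bsub>M\<^esub> x) = \<pi> a \<otimes>\<^bsub>B\<^esub> \<psi> x"
  using assms by (auto simp: representation_def)

locale hilbert_basis = orthonormal_system +
  assumes expand: "x \<in> carrier M \<Longrightarrow> project x = x"
begin

lemma adjointable_expand:
  assumes T: "T \<in> carrier LM" and x: "x \<in> carrier M"
  shows "T x = finsum M (\<lambda>i. T (m i) \<triangleleft> \<langle>m i, x\<rangle>) I"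
proof -
  have "T x = T (project x)" using x by (simp add: expand)
  also have "\<dots> = finsum M (\<lambda>i. T (m i \<triangleleft> \<langle>m i, x\<rangle>)) I"
    unfolding project_def using x
    by (intro linear_maps_sum[OF MM.complex_module_axioms MM.complex_module_axioms adjointable_linear[OF T]]) auto
  also have "\<dots> = finsum M (\<lambda>i. T (m i) \<triangleleft> \<langle>m i, x\<rangle>) I"
    using x T by (intro MM.sum_cong) (auto simp: adjointable_ract)
  finally show ?thesis .
qed

text \<open>Expanding the argument in the basis exhibits every adjointable operator as one of finite
  rank, so statements about compact operators become statements about finite sums.\<close>

lemma adjointable_eq_sum_rank_one:
  assumes T: "T \<in> carrier LM"
  shows "T = finsum LM (\<lambda>i. \<Theta>\<^bsub>M\<^esub> (T (m i)) (m i)) I"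
proof -
  interpret W: complex_module LM by (rule adjointable_module)
  show ?thesis
  proof (rule adjointable_ext)
    show "finsum LM (\<lambda>i. \<Theta>\<^bsub>M\<^esub> (T (m i)) (m i)) I \<in> carrier LM"
      using T by (intro W.sum_closed) auto
    fix x assume x: "x \<in> carrier M"
    show "T x = finsum LM (\<lambda>i. \<Theta>\<^bsub>M\<^esub> (T (m i)) (m i)) I x"
      using T x finite_index
      by (subst adjointable_finsum_apply) (auto simp: adjointable_expand[OF T x] rank_one_apply)
  qed (rule T)
qed

text \<open>The operator norm is a supremum of real numbers and says nothing before boundedness is
  known; the basis supplies the bound, the sum of the norms of the \<open>T (m i)\<close>.\<close>

lemma adjointable_bounded:
  assumes T: "T \<in> carrier LM" and x: "x \<in> carrier M" "hnorm A M x \<le> 1"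
  shows "hnorm A M (T x) \<le> cnorm LM T"
proof -
  have "hnorm A M (T y) \<le> (\<Sum>i\<in>I. hnorm A M (T (m i)))" if y: "y \<in> carrier M" "hnorm A M y \<le> 1" for y
  proof -
    have "hnorm A M (T y) \<le> (\<Sum>i\<in>I. hnorm A M (T (m i) \<triangleleft> \<langle>m i, y\<rangle>))"
      unfolding adjointable_expand[OF T y(1)] using T y finite_index by (intro hnorm_sum_le) auto
    also have "\<dots> \<le> (\<Sum>i\<in>I. hnorm A M (T (m i)))"
    proof (rule sum_mono)
      fix i assume i: "i \<in> I"
      have "hnorm A M (T (m i) \<triangleleft> \<langle>m i, y\<rangle>) \<le> hnorm A M (T (m i)) * cnorm A \<langle>m i, y\<rangle>"
        using i y T by (intro hnorm_ract_le) auto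
      also have "\<dots> \<le> hnorm A M (T (m i)) * 1"
        using i y T bessel[OF i y(1)] by (intro mult_left_mono) auto
      finally show "hnorm A M (T (m i) \<triangleleft> \<langle>m i, y\<rangle>) \<le> hnorm A M (T (m i))" by simp
    qed
    finally show ?thesis .
  qed
  then have "bdd_above {hnorm A M (T x) | x. x \<in> carrier M \<and> hnorm A M x \<le> 1}"
    by (intro bdd_aboveI) blast
  then show ?thesis
    using x by (auto simp: adjointable_operators_def intro!: cSup_upper)
qed

lemma adjointable_cnorm_le:
  assumes "\<And>x. x \<in> carrier M \<Longrightarrow> hnorm A M x \<le> 1 \<Longrightarrow> hnorm A M (T x) \<le> c"
  shows "cnorm LM T \<le> c"
proof -
  have "{hnorm A M (T x) | x. x \<in> carrier M \<and> hnorm A M x \<le> 1} \<noteq> {}"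
    using hnorm_zero M.zero_closed zero_le_one by (metis (mono_tags, lifting) empty_iff mem_Collect_eq)
  then show ?thesis
    using assms by (auto simp: adjointable_operators_def intro!: cSup_least)
qed

sublocale W: complex_module LM by (rule adjointable_module)

lemma adjointable_cnorm_nonneg: "T \<in> carrier LM \<Longrightarrow> 0 \<le> cnorm LM T"
  using order_trans[OF hnorm_nonneg adjointable_bounded[of T \<zero>]] by simp

lemma adjointable_cnorm_minus_commute:
  assumes "S \<in> carrier LM" "T \<in> carrier LM"
  shows "cnorm LM (S \<ominus>\<^bsub>LM\<^esub> T) \<le> cnorm LM (T \<ominus>\<^bsub>LM\<^esub> S)"
proof (rule adjointable_cnorm_le)
  fix x assume x: "x \<in> carrier M" "hnorm A M x \<le> 1"
  have "hnorm A M ((S \<ominus>\<^bsub>LM\<^esub> T) x) = hnorm A M ((T \<ominus>\<^bsub>LM\<^esub> S) x)"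
    using assms x hnorm_minus_commute[of "S x" "T x"] by (simp add: W.minus_scale MM.minus_scale)
  also have "\<dots> \<le> cnorm LM (T \<ominus>\<^bsub>LM\<^esub> S)"
    using assms x by (intro adjointable_bounded) auto
  finally show "hnorm A M ((S \<ominus>\<^bsub>LM\<^esub> T) x) \<le> cnorm LM (T \<ominus>\<^bsub>LM\<^esub> S)" .
qed

text \<open>Since \<open>closed_span\<close> is an intersection over closed subspaces,
  \<open>carrier LM\<close> contains the compact operators only once it is known to be closed, and
  for this the operator distance has to be a metric.\<close>

sublocale Wmetric: Metric_space "carrier LM" "cdist LM"
proof
  show "0 \<le> cdist LM S T" for S T
    by (auto simp: cdist_def intro: adjointable_cnorm_nonneg)
  show "cdist LM S T = cdist LM T S" for S T
    by (auto simp: cdist_def intro!: order_antisym adjointable_cnorm_minus_commute)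
  show "cdist LM S T = 0 \<longleftrightarrow> S = T" if ST: "S \<in> carrier LM" "T \<in> carrier LM" for S T
  proof
    assume "cdist LM S T = 0"
    then have zero: "cnorm LM (S \<ominus>\<^bsub>LM\<^esub> T) = 0" using ST by (simp add: cdist_def)
    have small: "S x = T x" if x: "x \<in> carrier M" "hnorm A M x \<le> 1" for x
    proof -
      have "hnorm A M ((S \<ominus>\<^bsub>LM\<^esub> T) x) \<le> 0"
        using adjointable_bounded[of "S \<ominus>\<^bsub>LM\<^esub> T" x] zero x ST by simp
      moreover have "(S \<ominus>\<^bsub>LM\<^esub> T) x = S x \<ominus> T x"
        using ST x by (simp add: W.minus_scale MM.minus_scale)
      ultimately have "hnorm A M (S x \<ominus> T x) = 0"
        using ST x hnorm_nonneg[of "S x \<ominus> T x"] by (metis M.minus_closed adjointable_closed order_antisym)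
      then show ?thesis
        using ST x by (simp add: hnorm_zero_iff MM.minus_eq_zero_iff)
    qed
    show "S = T"
    proof (rule adjointable_ext[OF ST])
      fix x assume x: "x \<in> carrier M"
      \<comment> \<open>Adding one avoids division by zero; the scaled vector lies in the unit ball,
        where \<open>S\<close> and \<open>T\<close> already agree.\<close>
      define r where "r = 1 + hnorm A M x"
      have r: "0 < r" using x by (simp add: r_def add_pos_nonneg)
      have "cmod (of_real (1 / r)) = 1 / r" using r by (simp only: norm_of_real) simp
      then have "hnorm A M (of_real (1 / r) \<odot> x) \<le> 1"
        using x r by (simp add: hnorm_smult del: of_real_divide) (simp add: r_def)
      then have "S (of_real (1 / r) \<odot> x) = T (of_real (1 / r) \<odot> x)"
        using x by (intro small) auto
      then have "of_real r \<odot> (of_real (1 / r) \<odot> S x) = of_real r \<odot> (of_real (1 / r) \<odot> T x)"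
        using x linear_mapsD(3)[OF adjointable_linear] ST by metis
      then show "S x = T x" using x ST r by simp
    qed
  next
    assume "S = T"
    have "cnorm LM (\<zero>\<^bsub>LM\<^esub>) \<le> 0" by (rule adjointable_cnorm_le) simp
    then have "cnorm LM (\<zero>\<^bsub>LM\<^esub>) = 0"
      using adjointable_cnorm_nonneg[OF W.M.zero_closed] by linarith
    then show "cdist LM S T = 0"
      using ST \<open>S = T\<close> by (simp add: cdist_def del: adjointable_simps)
  qed
  show "cdist LM S U \<le> cdist LM S T + cdist LM T U"
    if STU: "S \<in> carrier LM" "T \<in> carrier LM" "U \<in> carrier LM" for S T U
  proof -
    have "cnorm LM (S \<ominus>\<^bsub>LM\<^esub> U) \<le> cnorm LM (S \<ominus>\<^bsub>LM\<^esub> T) + cnorm LM (T \<ominus>\<^bsub>LM\<^esub> U)"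
    proof (rule adjointable_cnorm_le)
      fix x assume x: "x \<in> carrier M" "hnorm A M x \<le> 1"
      have "(S \<ominus>\<^bsub>LM\<^esub> U) x = (S \<ominus>\<^bsub>LM\<^esub> T) x \<oplus> (T \<ominus>\<^bsub>LM\<^esub> U) x"
        using STU x MM.diff_trans[of "S x" "T x" "U x"] by (simp add: W.minus_scale MM.minus_scale)
      then have "hnorm A M ((S \<ominus>\<^bsub>LM\<^esub> U) x) \<le> hnorm A M ((S \<ominus>\<^bsub>LM\<^esub> T) x) + hnorm A M ((T \<ominus>\<^bsub>LM\<^esub> U) x)"
        using STU x by (metis W.M.minus_closed adjointable_closed hnorm_triangle)
      also have "\<dots> \<le> cnorm LM (S \<ominus>\<^bsub>LM\<^esub> T) + cnorm LM (T \<ominus>\<^bsub>LM\<^esub> U)"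
        using STU x by (intro add_mono adjointable_bounded) auto
      finally show "hnorm A M ((S \<ominus>\<^bsub>LM\<^esub> U) x) \<le> \<dots>" .
    qed
    then show ?thesis using STU by (simp add: cdist_def)
  qed
qed

text \<open>A submodule containing the rank one operators contains their finite sums, hence all of
  \<open>LM\<close>; taking the closure adds nothing.\<close>

lemma compact_eq_adjointable: "carrier (compact_operators A M) = carrier LM"
proof
  let ?S = "{\<Theta>\<^bsub>M\<^esub> x y | x y. x \<in> carrier M \<and> y \<in> carrier M}"
  have car: "carrier (compact_operators A M) = closed_span LM ?S"
    by (simp add: compact_operators_def)
  have "Module.submodule (carrier LM) \<CC> LM"
    by (rule W.carrier_is_submodule)
  moreover have "closedin (norm_topology LM) (carrier LM)"
    unfolding norm_topology_def by (rule Wmetric.closedin_mspace)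
  ultimately show "carrier (compact_operators A M) \<subseteq> carrier LM"
    unfolding car closed_span_def by blast
  show "carrier LM \<subseteq> carrier (compact_operators A M)"
    unfolding car closed_span_def
  proof (intro subsetI InterI)
    fix T V assume T: "T \<in> carrier LM"
      and "V \<in> {V. Module.submodule V \<CC> LM \<and> closedin (norm_topology LM) V \<and> ?S \<subseteq> V}"
    then have V: "Module.submodule V \<CC> LM" and SV: "?S \<subseteq> V" by auto
    note sub = W.submoduleE[OF V]
    have "finsum LM (\<lambda>i. \<Theta>\<^bsub>M\<^esub> (T (m i)) (m i)) J \<in> V" if "finite J" "J \<subseteq> I" for J
      using that
    proof (induction J)
      case empty
      have "\<zero>\<^bsub>LM\<^esub> \<in> V"
        using subgroup.one_closed[OF Module.submodule.axioms(1)[OF V]] by simp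
      then show ?case by (simp del: adjointable_simps)
    next
      case (insert i J)
      have "T (m i) \<in> carrier M" "m i \<in> carrier M" using T insert by auto
      then have "\<Theta>\<^bsub>M\<^esub> (T (m i)) (m i) \<in> V" using SV by blast
      moreover have "finsum LM (\<lambda>i. \<Theta>\<^bsub>M\<^esub> (T (m i)) (m i)) (insert i J)
          = \<Theta>\<^bsub>M\<^esub> (T (m i)) (m i) \<oplus>\<^bsub>LM\<^esub> finsum LM (\<lambda>i. \<Theta>\<^bsub>M\<^esub> (T (m i)) (m i)) J"
        using insert T by (intro W.sum_insert) auto
      ultimately show ?case
        using insert sub(5) by (simp del: adjointable_simps)
    qed
    from this[OF finite_index order_refl] show "T \<in> V"
      using adjointable_eq_sum_rank_one[OF T] by simp
  qed
qed

text \<open>The homomorphism \<open>(\<psi>, \<pi>)^(1)\<close> in coordinates: its formula for rank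
  one operators, applied to \<open>T\<close> written as the sum of the operators
  \<open>\<Theta> (T (m i)) (m i)\<close>.\<close>

definition basis_rep where
  "basis_rep B \<psi> T = finsum B (\<lambda>i. \<psi> (T (m i)) \<otimes>\<^bsub>B\<^esub> (\<psi> (m i))\<^sup>\<star>\<^bsub>B\<^esub>) I"

text \<open>Everything follows from two facts: multiplying \<open>\<psi> y\<close> by the value at
  \<open>T\<close> gives \<open>\<psi> (T y)\<close>, and the value \<open>e\<close> at the identity
  operator is a two-sided unit for all values of the map.\<close>

lemma basis_rep_properties:
  assumes "cstar_algebra B" and rep: "representation A M B \<psi> \<pi>"
  shows "basis_rep B \<psi> \<in> star_hom LM B"
    and "\<And>x y. \<lbrakk>x \<in> carrier M; y \<in> carrier M\<rbrakk>
      \<Longrightarrow> basis_rep B \<psi> (\<Theta>\<^bsub>M\<^esub> x y) = \<psi> x \<otimes>\<^bsub>B\<^esub> (\<psi> y)\<^sup>\<star>\<^bsub>B\<^esub>"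
proof -
  interpret B: cstar_algebra B by fact
  note rep = representationD[OF rep]
  let ?r = "basis_rep B \<psi>"
  have pcl [simp, intro]: "\<psi> x \<in> carrier B" if "x \<in> carrier M" for x
    using rep(1) that by (simp add: linear_mapsD)
  have picl [simp, intro]: "\<pi> a \<in> carrier B" if "a \<in> carrier A" for a
    using rep(2) that by (simp add: star_homD)
  have rcl [simp, intro]: "?r T \<in> carrier B" if "T \<in> carrier LM" for T
    unfolding basis_rep_def using that by auto
  have act: "?r T \<otimes>\<^bsub>B\<^esub> \<psi> y = \<psi> (T y)" if T: "T \<in> carrier LM" and y: "y \<in> carrier M" for T y
  proof -
    have "?r T \<otimes>\<^bsub>B\<^esub> \<psi> y = finsum B (\<lambda>i. (\<psi> (T (m i)) \<otimes>\<^bsub>B\<^esub> (\<psi> (m i))\<^sup>\<star>\<^bsub>B\<^esub>) \<otimes>\<^bsub>B\<^esub> \<psi> y) I"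
      unfolding basis_rep_def using T y by (intro B.mult_sum_left) auto
    also have "\<dots> = finsum B (\<lambda>i. \<psi> (T (m i) \<triangleleft> \<langle>m i, y\<rangle>)) I"
      using T y by (intro B.sum_cong) (auto simp: B.mult_assoc rep(3,4))
    also have "\<dots> = \<psi> (finsum M (\<lambda>i. T (m i) \<triangleleft> \<langle>m i, y\<rangle>) I)"
      using T y
      by (intro linear_maps_sum[OF MM.complex_module_axioms B.complex_module_axioms rep(1), symmetric]) auto
    finally show ?thesis by (simp add: adjointable_expand[OF T y])
  qed
  have mult: "?r T \<otimes>\<^bsub>B\<^esub> ?r S = finsum B (\<lambda>i. \<psi> (T (S (m i))) \<otimes>\<^bsub>B\<^esub> (\<psi> (m i))\<^sup>\<star>\<^bsub>B\<^esub>) I"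
    if "T \<in> carrier LM" "S \<in> carrier LM" for S T
    unfolding basis_rep_def[of B \<psi> S] using that
    by (subst B.mult_sum_right) (auto intro!: B.sum_cong simp: B.mult_assoc[symmetric] act)
  define e where "e = finsum B (\<lambda>i. \<psi> (m i) \<otimes>\<^bsub>B\<^esub> (\<psi> (m i))\<^sup>\<star>\<^bsub>B\<^esub>) I"
  have ecl: "e \<in> carrier B" unfolding e_def by auto
  have es: "e\<^sup>\<star>\<^bsub>B\<^esub> = e"
    unfolding e_def by (subst B.star_sum) (auto intro!: B.sum_cong simp: B.star_mult)
  have id: "(\<lambda>x \<in> carrier M. x) \<in> carrier LM" by (rule adjointableI[of _ "\<lambda>x. x"]) auto
  have e_eq: "?r (\<lambda>x \<in> carrier M. x) = e"
    unfolding basis_rep_def e_def by (intro B.sum_cong) auto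
  have eact: "e \<otimes>\<^bsub>B\<^esub> \<psi> y = \<psi> y" if "y \<in> carrier M" for y
    using act[OF id that] that by (simp add: e_eq)
  have re: "?r T \<otimes>\<^bsub>B\<^esub> e = ?r T" "e \<otimes>\<^bsub>B\<^esub> ?r T = ?r T" if "T \<in> carrier LM" for T
  proof -
    show "?r T \<otimes>\<^bsub>B\<^esub> e = ?r T"
      using mult[OF that id] that unfolding e_eq
      by (simp add: basis_rep_def) (intro B.sum_cong, use that in auto)
    show "e \<otimes>\<^bsub>B\<^esub> ?r T = ?r T"
      using mult[OF id that] that unfolding e_eq
      by (simp add: basis_rep_def) (intro B.sum_cong, use that in auto)
  qed
  have star: "(?r T)\<^sup>\<star>\<^bsub>B\<^esub> = ?r (T\<^sup>\<star>\<^bsub>LM\<^esub>)" if T: "T \<in> carrier LM" for T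
  proof -
    have Ts: "T\<^sup>\<star>\<^bsub>LM\<^esub> \<in> carrier LM" by (rule adjointable_star(1)[OF T])
    have eT: "e \<otimes>\<^bsub>B\<^esub> (?r T)\<^sup>\<star>\<^bsub>B\<^esub> = (?r T)\<^sup>\<star>\<^bsub>B\<^esub>" "(?r T)\<^sup>\<star>\<^bsub>B\<^esub> \<otimes>\<^bsub>B\<^esub> e = (?r T)\<^sup>\<star>\<^bsub>B\<^esub>"
      using B.star_mult[of "?r T" e] B.star_mult[of e "?r T"] re[OF T] T ecl es by simp_all
    have inner: "(\<psi> x)\<^sup>\<star>\<^bsub>B\<^esub> \<otimes>\<^bsub>B\<^esub> ((?r T)\<^sup>\<star>\<^bsub>B\<^esub> \<otimes>\<^bsub>B\<^esub> \<psi> y) = (\<psi> x)\<^sup>\<star>\<^bsub>B\<^esub> \<otimes>\<^bsub>B\<^esub> \<psi> ((T\<^sup>\<star>\<^bsub>LM\<^esub>) y)"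
      if xy: "x \<in> carrier M" "y \<in> carrier M" for x y
    proof -
      have "(\<psi> x)\<^sup>\<star>\<^bsub>B\<^esub> \<otimes>\<^bsub>B\<^esub> ((?r T)\<^sup>\<star>\<^bsub>B\<^esub> \<otimes>\<^bsub>B\<^esub> \<psi> y) = (?r T \<otimes>\<^bsub>B\<^esub> \<psi> x)\<^sup>\<star>\<^bsub>B\<^esub> \<otimes>\<^bsub>B\<^esub> \<psi> y"
        using T xy by (simp add: B.star_mult B.mult_assoc)
      also have "\<dots> = \<pi> \<langle>T x, y\<rangle>" using T xy by (simp add: act rep(4))
      also have "\<dots> = (\<psi> x)\<^sup>\<star>\<^bsub>B\<^esub> \<otimes>\<^bsub>B\<^esub> \<psi> ((T\<^sup>\<star>\<^bsub>LM\<^esub>) y)"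
        using T Ts xy by (simp add: adjointable_inprod(1) rep(4))
      finally show ?thesis .
    qed
    \<comment> \<open>The adjoint of \<open>?r T\<close> is controlled only through products with
      elements \<open>\<psi> x\<close>. Multiplying by \<open>e\<close> expresses an element through
      exactly such products.\<close>
    have proj: "e \<otimes>\<^bsub>B\<^esub> z = finsum B (\<lambda>i. \<psi> (m i) \<otimes>\<^bsub>B\<^esub> ((\<psi> (m i))\<^sup>\<star>\<^bsub>B\<^esub> \<otimes>\<^bsub>B\<^esub> z)) I" if "z \<in> carrier B" for z
      unfolding e_def using that by (subst B.mult_sum_left) (auto intro!: B.sum_cong simp: B.mult_assoc)
    have act': "(?r T)\<^sup>\<star>\<^bsub>B\<^esub> \<otimes>\<^bsub>B\<^esub> \<psi> y = \<psi> ((T\<^sup>\<star>\<^bsub>LM\<^esub>) y)" if y: "y \<in> carrier M" for y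
    proof -
      have "(?r T)\<^sup>\<star>\<^bsub>B\<^esub> \<otimes>\<^bsub>B\<^esub> \<psi> y = e \<otimes>\<^bsub>B\<^esub> ((?r T)\<^sup>\<star>\<^bsub>B\<^esub> \<otimes>\<^bsub>B\<^esub> \<psi> y)"
        using eT T y ecl by (simp add: B.mult_assoc[symmetric])
      also have "\<dots> = e \<otimes>\<^bsub>B\<^esub> \<psi> ((T\<^sup>\<star>\<^bsub>LM\<^esub>) y)"
        using T Ts y by (subst (1 2) proj) (auto intro!: B.sum_cong simp: inner)
      also have "\<dots> = \<psi> ((T\<^sup>\<star>\<^bsub>LM\<^esub>) y)" using Ts y by (intro eact) auto
      finally show ?thesis .
    qed
    have "(?r T)\<^sup>\<star>\<^bsub>B\<^esub> = (?r T)\<^sup>\<star>\<^bsub>B\<^esub> \<otimes>\<^bsub>B\<^esub> e" using eT by simp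
    also have "\<dots> = ?r (T\<^sup>\<star>\<^bsub>LM\<^esub>)"
      unfolding e_def basis_rep_def[of B \<psi> "T\<^sup>\<star>\<^bsub>LM\<^esub>"] using T Ts
      by (subst B.mult_sum_right) (auto intro!: B.sum_cong simp: B.mult_assoc[symmetric] act')
    finally show ?thesis .
  qed
  show "?r \<in> star_hom LM B"
  proof (rule star_homI)
    fix T assume T: "T \<in> carrier LM"
    show "?r T \<in> carrier B" using T by simp
    show "?r (c \<odot>\<^bsub>LM\<^esub> T) = c \<odot>\<^bsub>B\<^esub> ?r T" for c
      unfolding basis_rep_def using T
      by (subst B.sum_scale) (auto intro!: B.sum_cong simp: linear_mapsD(3)[OF rep(1)])
    show "?r (T\<^sup>\<star>\<^bsub>LM\<^esub>) = (?r T)\<^sup>\<star>\<^bsub>B\<^esub>" using star[OF T] by simp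
    fix S assume S: "S \<in> carrier LM"
    have "?r (T \<oplus>\<^bsub>LM\<^esub> S) = finsum B (\<lambda>i. \<psi> (T (m i)) \<otimes>\<^bsub>B\<^esub> (\<psi> (m i))\<^sup>\<star>\<^bsub>B\<^esub>
        \<oplus>\<^bsub>B\<^esub> \<psi> (S (m i)) \<otimes>\<^bsub>B\<^esub> (\<psi> (m i))\<^sup>\<star>\<^bsub>B\<^esub>) I"
      unfolding basis_rep_def using T S
      by (intro B.sum_cong) (auto simp: linear_mapsD(2)[OF rep(1)] B.mult_add_left)
    also have "\<dots> = ?r T \<oplus>\<^bsub>B\<^esub> ?r S"
      unfolding basis_rep_def using T S by (intro B.sum_add) auto
    finally show "?r (T \<oplus>\<^bsub>LM\<^esub> S) = ?r T \<oplus>\<^bsub>B\<^esub> ?r S" .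
    show "?r (T \<otimes>\<^bsub>LM\<^esub> S) = ?r T \<otimes>\<^bsub>B\<^esub> ?r S"
      unfolding mult[OF T S] unfolding basis_rep_def using T S
      by (intro B.sum_cong) (auto simp: compose_eq)
  qed
  show "?r (\<Theta>\<^bsub>M\<^esub> x y) = \<psi> x \<otimes>\<^bsub>B\<^esub> (\<psi> y)\<^sup>\<star>\<^bsub>B\<^esub>" if xy: "x \<in> carrier M" "y \<in> carrier M" for x y
  proof -
    have "?r (\<Theta>\<^bsub>M\<^esub> x y) = finsum B (\<lambda>i. \<psi> x \<otimes>\<^bsub>B\<^esub> ((\<psi> y)\<^sup>\<star>\<^bsub>B\<^esub> \<otimes>\<^bsub>B\<^esub> (\<psi> (m i) \<otimes>\<^bsub>B\<^esub> (\<psi> (m i))\<^sup>\<star>\<^bsub>B\<^esub>))) I"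
      unfolding basis_rep_def using xy
      by (intro B.sum_cong)
        (auto simp: rank_one_apply rep(3) rep(4)[symmetric] B.mult_assoc)
    also have "\<dots> = \<psi> x \<otimes>\<^bsub>B\<^esub> ((\<psi> y)\<^sup>\<star>\<^bsub>B\<^esub> \<otimes>\<^bsub>B\<^esub> e)"
      unfolding e_def using xy by (simp add: B.mult_sum_right)
    also have "(\<psi> y)\<^sup>\<star>\<^bsub>B\<^esub> \<otimes>\<^bsub>B\<^esub> e = (e \<otimes>\<^bsub>B\<^esub> \<psi> y)\<^sup>\<star>\<^bsub>B\<^esub>"
      using xy ecl es by (simp add: B.star_mult)
    finally show ?thesis using xy by (simp add: eact)
  qed
qed

text \<open>A definite description requires existence and uniqueness. Uniqueness follows from
  additivity, every operator being a finite sum of rank one operators.\<close>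

lemma compact_rep_eq:
  assumes B: "cstar_algebra B" and rep: "representation A M B \<psi> \<pi>" and T: "T \<in> carrier LM"
  shows "compact_rep A M B \<psi> T = basis_rep B \<psi> T"
proof -
  interpret B: cstar_algebra B by fact
  let ?K = "compact_operators A M"
  have hom: "star_hom ?K B = star_hom LM B"
    using compact_eq_adjointable
    by (simp add: star_hom_def linear_maps_def compact_operators_def)
  note r = basis_rep_properties[OF B rep]
  let ?r = "restrict (basis_rep B \<psi>) (carrier LM)"
  have add: "S \<oplus>\<^bsub>LM\<^esub> S' \<in> carrier LM" "S \<otimes>\<^bsub>LM\<^esub> S' \<in> carrier LM"
    if "S \<in> carrier LM" "S' \<in> carrier LM" for S S'
  proof -
    show "S \<oplus>\<^bsub>LM\<^esub> S' \<in> carrier LM" using that by (rule W.M.add.m_closed)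
    have "(\<lambda>x \<in> carrier M. S (S' x)) \<in> carrier LM"
      by (rule adjointableI[of _ "\<lambda>x. (S'\<^sup>\<star>\<^bsub>LM\<^esub>) ((S\<^sup>\<star>\<^bsub>LM\<^esub>) x)"])
        (use that adjointable_star(1) in \<open>auto simp: adjointable_inprod(1)\<close>)
    then show "S \<otimes>\<^bsub>LM\<^esub> S' \<in> carrier LM"
      by (simp add: compose_def)
  qed
  have "compact_rep A M B \<psi> = ?r"
    unfolding compact_rep_def hom compact_eq_adjointable
  proof (rule the_equality)
    have "?r \<in> star_hom LM B"
      using r(1) add W.scale_closed adjointable_star(1)
      by (intro star_homI) (simp_all add: star_homD del: adjointable_simps)
    then show "?r \<in> star_hom LM B \<and> ?r \<in> extensional (carrier LM) \<and>
        (\<forall>x\<in>carrier M. \<forall>y\<in>carrier M. ?r (\<Theta>\<^bsub>M\<^esub> x y) = \<psi> x \<otimes>\<^bsub>B\<^esub> (\<psi> y)\<^sup>\<star>\<^bsub>B\<^esub>)"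
      using r(2) by auto
  next
    fix \<rho> assume \<rho>: "\<rho> \<in> star_hom LM B \<and> \<rho> \<in> extensional (carrier LM) \<and>
        (\<forall>x\<in>carrier M. \<forall>y\<in>carrier M. \<rho> (\<Theta>\<^bsub>M\<^esub> x y) = \<psi> x \<otimes>\<^bsub>B\<^esub> (\<psi> y)\<^sup>\<star>\<^bsub>B\<^esub>)"
    have "\<rho> S = basis_rep B \<psi> S" if S: "S \<in> carrier LM" for S
    proof -
      have "\<rho> S = \<rho> (finsum LM (\<lambda>i. \<Theta>\<^bsub>M\<^esub> (S (m i)) (m i)) I)"
        using adjointable_eq_sum_rank_one[OF S] by simp
      also have "\<dots> = finsum B (\<lambda>i. \<rho> (\<Theta>\<^bsub>M\<^esub> (S (m i)) (m i))) I"
        using S \<rho>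
        by (intro linear_maps_sum[OF W.complex_module_axioms B.complex_module_axioms]) (auto simp: star_hom_linear)
      also have "\<dots> = basis_rep B \<psi> S"
        unfolding basis_rep_def using S \<rho> linear_mapsD(1)[OF representationD(1)[OF rep]]
        by (intro B.sum_cong) auto
      finally show ?thesis .
    qed
    then show "\<rho> = ?r"
      using \<rho> by (intro extensionalityI[of \<rho> "carrier LM"]) auto
  qed
  then show ?thesis using T by simp
qed

end

locale hilbert_bimodule_basis = hilbert_basis +
  assumes bimodule: "right_hilbert_bimodule A M"
    and lact_one: "i \<in> I \<Longrightarrow> \<one>\<^bsub>A\<^esub> \<triangleright>\<^bsub>M\<^esub> m i = m i"
begin

lemma left_operator_hom: "\<phi>\<^bsub>M\<^esub> \<in> star_hom A LM"
  using bimodule by (simp add: right_hilbert_bimodule_def)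

lemma left_operator_apply: "x \<in> carrier M \<Longrightarrow> \<phi>\<^bsub>M\<^esub> a x = a \<triangleright>\<^bsub>M\<^esub> x"
  by (simp add: left_operator_def)

lemma lact_closed [simp, intro]: "\<lbrakk>a \<in> carrier A; x \<in> carrier M\<rbrakk> \<Longrightarrow> a \<triangleright>\<^bsub>M\<^esub> x \<in> carrier M"
  using adjointable_closed[OF star_homD(1)[OF left_operator_hom]] by (simp add: left_operator_apply)

lemma compact_ideal_eq: "compact_ideal A M = carrier A"
  using star_homD(1)[OF left_operator_hom] by (auto simp: compact_ideal_def compact_eq_adjointable)

text \<open>In coordinates the value of \<open>(\<psi>, \<pi>)^(1)\<close> at
  \<open>\<phi> a\<close> is \<open>\<pi> a\<close> times the sum \<open>e\<close> on the right. So
  covariance at the unit gives covariance everywhere after multiplication by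
  \<open>\<pi> a\<close>.\<close>

lemma covariant_iff:
  assumes B: "cstar_algebra B"
  shows "covariant_on (carrier A) A M B \<psi> \<pi> \<longleftrightarrow> representation A M B \<psi> \<pi> \<and>
    \<pi> \<one>\<^bsub>A\<^esub> = finsum B (\<lambda>i. \<psi> (m i) \<otimes>\<^bsub>B\<^esub> (\<psi> (m i))\<^sup>\<star>\<^bsub>B\<^esub>) I"
proof (cases "representation A M B \<psi> \<pi>")
  case True
  interpret B: cstar_algebra B by fact
  note rep = representationD[OF True]
  have cl: "\<psi> x \<in> carrier B" if "x \<in> carrier M" for x
    using rep(1) that by (simp add: linear_mapsD)
  define e where "e = finsum B (\<lambda>i. \<psi> (m i) \<otimes>\<^bsub>B\<^esub> (\<psi> (m i))\<^sup>\<star>\<^bsub>B\<^esub>) I"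
  have eq: "compact_rep A M B \<psi> (\<phi>\<^bsub>M\<^esub> a) = \<pi> a \<otimes>\<^bsub>B\<^esub> e" if a: "a \<in> carrier A" for a
  proof -
    have "compact_rep A M B \<psi> (\<phi>\<^bsub>M\<^esub> a) = basis_rep B \<psi> (\<phi>\<^bsub>M\<^esub> a)"
      by (rule compact_rep_eq[OF B True star_homD(1)[OF left_operator_hom a]])
    also have "\<dots> = \<pi> a \<otimes>\<^bsub>B\<^esub> e"
      unfolding e_def basis_rep_def using a cl star_homD(1)[OF rep(2)]
      by (subst B.mult_sum_right) (auto intro!: B.sum_cong simp: left_operator_apply rep(5) B.mult_assoc)
    finally show ?thesis .
  qed
  \<comment> \<open>The unit of \<open>A\<close> acts as the identity on the basis vectors, so
    \<open>\<pi> 1\<close> is a left unit for \<open>e\<close>.\<close>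
  have one: "\<pi> \<one>\<^bsub>A\<^esub> \<otimes>\<^bsub>B\<^esub> e = e"
    unfolding e_def using cl star_homD(1)[OF rep(2)]
    by (subst B.mult_sum_right) (auto intro!: B.sum_cong simp: B.mult_assoc[symmetric] rep(5)[symmetric] lact_one)
  have "(\<forall>a\<in>carrier A. \<pi> a = compact_rep A M B \<psi> (\<phi>\<^bsub>M\<^esub> a)) \<longleftrightarrow> \<pi> \<one>\<^bsub>A\<^esub> = e"
  proof
    assume "\<forall>a\<in>carrier A. \<pi> a = compact_rep A M B \<psi> (\<phi>\<^bsub>M\<^esub> a)"
    then show "\<pi> \<one>\<^bsub>A\<^esub> = e" using eq one by simp
  next
    assume "\<pi> \<one>\<^bsub>A\<^esub> = e"
    then show "\<forall>a\<in>carrier A. \<pi> a = compact_rep A M B \<psi> (\<phi>\<^bsub>M\<^esub> a)"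
      using eq star_homD(4)[OF rep(2) _ A.one_closed] by (auto simp flip: \<open>\<pi> \<one>\<^bsub>A\<^esub> = e\<close>)
  qed
  then show ?thesis using True by (simp add: covariant_on_def e_def)
qed (simp add: covariant_on_def)

end

section \<open>UHF algebras\<close>

locale uhf =
  fixes n :: nat and A :: "'a cstar" and \<iota> :: "nat \<Rightarrow> complex mat \<Rightarrow> 'a"
  assumes two_le: "2 \<le> n" and uhf: "uhf_algebra n A \<iota>"
begin

sublocale A: unital_cstar_algebra A
  using uhf by (simp add: uhf_algebra_def)

lemma limit: "direct_limit (tensor_power n) (\<lambda>k a. kronecker a (1\<^sub>m n)) A \<iota>"
  using uhf by (simp add: uhf_algebra_def)

lemma level_hom: "\<iota> k \<in> star_hom (matrix_algebra (n ^ k)) A"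
  using limit by (simp add: direct_limit_def tensor_power_def)

lemma level_linear: "\<iota> k \<in> linear_maps (matrix_algebra (n ^ k)) A"
  by (rule star_hom_linear[OF level_hom])

lemmas level_hom' = star_homD[OF level_hom, simplified]

lemma level_closed [simp, intro]: "x \<in> carrier_mat (n ^ k) (n ^ k) \<Longrightarrow> \<iota> k x \<in> carrier A"
  by (rule level_hom')

lemma level_bonding: "x \<in> carrier_mat (n ^ k) (n ^ k) \<Longrightarrow> \<iota> (Suc k) (kronecker x (1\<^sub>m n)) = \<iota> k x"
  using limit by (simp add: direct_limit_def tensor_power_def)

lemma kronecker_level [simp, intro]:
  "x \<in> carrier_mat (n ^ k) (n ^ k) \<Longrightarrow> y \<in> carrier_mat n n \<Longrightarrow> kronecker x y \<in> carrier_mat (n ^ Suc k) (n ^ Suc k)"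
  "y \<in> carrier_mat n n \<Longrightarrow> x \<in> carrier_mat (n ^ k) (n ^ k) \<Longrightarrow> kronecker y x \<in> carrier_mat (n ^ Suc k) (n ^ Suc k)"
  using kronecker_carrier[of x "n ^ k" y n] kronecker_carrier[of y n x "n ^ k"] by (simp_all add: mult.commute)

lemma level_shift:
  assumes "x \<in> carrier_mat (n ^ k) (n ^ k)"
  shows "kronecker x (1\<^sub>m (n ^ l)) \<in> carrier_mat (n ^ (k + l)) (n ^ (k + l))
    \<and> \<iota> (k + l) (kronecker x (1\<^sub>m (n ^ l))) = \<iota> k x"
proof (induction l)
  case 0
  then show ?case using assms kronecker_one_one[of x] by simp
next
  case (Suc l)
  have "kronecker (kronecker x (1\<^sub>m (n ^ l))) (1\<^sub>m n) = kronecker x (1\<^sub>m (n ^ Suc l))"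
    using assms by (subst kronecker_assoc[of _ "n ^ k" _ "n ^ l" _ n]) (auto simp: kronecker_one mult.commute)
  then show ?case
    using Suc level_bonding[of "kronecker x (1\<^sub>m (n ^ l))" "k + l"]
      kronecker_level(1)[of "kronecker x (1\<^sub>m (n ^ l))" "k + l" "1\<^sub>m n"]
    by simp
qed

definition levels :: "'a set" where
  "levels = (\<Union>k. \<iota> k ` carrier_mat (n ^ k) (n ^ k))"

lemma levels_dense: "norm_topology A closure_of levels = carrier A"
  using limit by (simp add: direct_limit_def tensor_power_def levels_def)

lemma levels_subset: "levels \<subseteq> carrier A"
  by (auto simp: levels_def)

lemma levelsE:
  assumes "d \<in> levels"
  obtains k x where "x \<in> carrier_mat (n ^ k) (n ^ k)" "d = \<iota> k x"
  using assms by (auto simp: levels_def)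

text \<open>The common level is made positive so that a first tensor factor can always be split
  off.\<close>

lemma levels_common:
  assumes "d \<in> levels" "e \<in> levels"
  obtains k x y where "x \<in> carrier_mat (n ^ Suc k) (n ^ Suc k)" "d = \<iota> (Suc k) x"
    "y \<in> carrier_mat (n ^ Suc k) (n ^ Suc k)" "e = \<iota> (Suc k) y"
proof -
  obtain k x where x: "x \<in> carrier_mat (n ^ k) (n ^ k)" "d = \<iota> k x" using assms levelsE by blast
  obtain l y where y: "y \<in> carrier_mat (n ^ l) (n ^ l)" "e = \<iota> l y" using assms levelsE by blast
  have "k + Suc l = Suc (k + l)" "l + Suc k = Suc (k + l)" by simp_all
  then show ?thesis
    using level_shift[OF x(1), of "Suc l"] level_shift[OF y(1), of "Suc k"] x(2) y(2)
      that[of "kronecker x (1\<^sub>m (n ^ Suc l))" "k + l" "kronecker y (1\<^sub>m (n ^ Suc k))"] by (simp only: simp_thms)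
qed

lemma approx:
  assumes "a \<in> carrier A" "0 < e"
  obtains k x where "x \<in> carrier_mat (n ^ Suc k) (n ^ Suc k)" "cnorm A (a \<ominus>\<^bsub>A\<^esub> \<iota> (Suc k) x) < e"
proof -
  obtain d where d: "d \<in> levels" "cnorm A (a \<ominus>\<^bsub>A\<^esub> d) < e"
    using A.closure_normD[OF levels_dense assms] by metis
  show ?thesis
    using levels_common[OF d(1) d(1)] d(2) that by metis
qed

text \<open>The maps \<open>\<iota> k\<close> are not unital by definition. Their common value
  \<open>u\<close> at the units is a projection that fixes every level; approximating the unit of
  \<open>A\<close> by \<open>d\<close> from some level gives
  \<open>1 - u = (1 - d) - u (1 - d)\<close>, which is arbitrarily small.\<close>

lemma level_one: "\<iota> k (1\<^sub>m (n ^ k)) = \<one>\<^bsub>A\<^esub>"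
proof -
  have shift: "\<iota> l (1\<^sub>m (n ^ l)) = \<iota> 0 (1\<^sub>m (n ^ 0))" for l
    using level_shift[of "1\<^sub>m (n ^ 0)" 0 l] kronecker_one[of "n ^ 0" "n ^ l"] by simp
  define u where "u = \<iota> 0 (1\<^sub>m (n ^ 0))"
  have ucl: "u \<in> carrier A" by (auto simp: u_def intro!: level_closed)
  have u1: "cnorm A u \<le> 1"
  proof (rule A.projection_cnorm_le[OF ucl])
    have "mat_adjoint (1\<^sub>m (n ^ 0)) * 1\<^sub>m (n ^ 0) = (1\<^sub>m (n ^ 0) :: complex mat)"
      by (rule eq_matI) auto
    then show "u\<^sup>\<star>\<^bsub>A\<^esub> \<otimes>\<^bsub>A\<^esub> u = u"
      using level_hom'(5)[of "1\<^sub>m (n ^ 0)" 0] level_hom'(4)[of "mat_adjoint (1\<^sub>m (n ^ 0))" 0 "1\<^sub>m (n ^ 0)"]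
      by (simp add: u_def)
  qed
  have "cnorm A (\<one>\<^bsub>A\<^esub> \<ominus>\<^bsub>A\<^esub> u) \<le> 2 * e" if e: "0 < e" for e
  proof -
    obtain l x where x: "x \<in> carrier_mat (n ^ Suc l) (n ^ Suc l)" "cnorm A (\<one>\<^bsub>A\<^esub> \<ominus>\<^bsub>A\<^esub> \<iota> (Suc l) x) < e"
      using approx[OF A.one_closed e] by metis
    define d where "d = \<iota> (Suc l) x"
    have dcl: "d \<in> carrier A" unfolding d_def by (rule level_closed[OF x(1)])
    have "u \<otimes>\<^bsub>A\<^esub> d = d"
      using level_hom'(4)[of "1\<^sub>m (n ^ Suc l)" "Suc l" x] x(1) left_mult_one_mat[OF x(1)] shift[of "Suc l"]
      by (simp add: u_def d_def del: power_Suc)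
    then have "\<one>\<^bsub>A\<^esub> \<ominus>\<^bsub>A\<^esub> u = (\<one>\<^bsub>A\<^esub> \<ominus>\<^bsub>A\<^esub> d) \<ominus>\<^bsub>A\<^esub> u \<otimes>\<^bsub>A\<^esub> (\<one>\<^bsub>A\<^esub> \<ominus>\<^bsub>A\<^esub> d)"
      using ucl dcl by (simp add: A.mult_minus_right A.diff_diff_cancel)
    moreover have "cnorm A (u \<otimes>\<^bsub>A\<^esub> (\<one>\<^bsub>A\<^esub> \<ominus>\<^bsub>A\<^esub> d)) \<le> 1 * e"
      using ucl dcl u1 x(2) by (intro A.cnorm_mult_le) (auto simp: d_def)
    ultimately show ?thesis
      using A.cnorm_minus_le[of "\<one>\<^bsub>A\<^esub> \<ominus>\<^bsub>A\<^esub> d" "u \<otimes>\<^bsub>A\<^esub> (\<one>\<^bsub>A\<^esub> \<ominus>\<^bsub>A\<^esub> d)"] ucl dcl x(2)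
      by (simp add: d_def)
  qed
  then have "cnorm A (\<one>\<^bsub>A\<^esub> \<ominus>\<^bsub>A\<^esub> u) \<le> 0 + e" if "0 < e" for e
    using that by (metis add_0 field_sum_of_halves half_gt_zero mult_2)
  then have "cnorm A (\<one>\<^bsub>A\<^esub> \<ominus>\<^bsub>A\<^esub> u) \<le> 0"
    by (rule field_le_epsilon)
  then have "cnorm A (\<one>\<^bsub>A\<^esub> \<ominus>\<^bsub>A\<^esub> u) = 0"
    by (rule order_antisym) (use ucl in simp)
  then show ?thesis
    using ucl shift[of k] by (simp add: A.cnorm_eq_0 A.minus_eq_zero_iff u_def)
qed

text \<open>Bonding maps send units to units, which have norm one at every level, so the norm
  condition of the direct limit gives the unit norm one.\<close>

lemma one_nonzero: "\<one>\<^bsub>A\<^esub> \<noteq> \<zero>\<^bsub>A\<^esub>"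
proof
  assume "\<one>\<^bsub>A\<^esub> = \<zero>\<^bsub>A\<^esub>"
  then have zero: "cnorm A (\<iota> 0 (1\<^sub>m (n ^ 0))) = 0" by (simp only: level_one A.cnorm_zero)
  have "iterated_bonding (\<lambda>k a. kronecker a (1\<^sub>m n)) 0 l (1\<^sub>m (n ^ 0)) = 1\<^sub>m (n ^ l)" for l
    by (induction l) (simp_all add: kronecker_one mult.commute)
  moreover have "(\<lambda>l. cnorm (tensor_power n (0 + l))
      (iterated_bonding (\<lambda>k a. kronecker a (1\<^sub>m n)) 0 l (1\<^sub>m (n ^ 0)))) \<longlonglongrightarrow> cnorm A (\<iota> 0 (1\<^sub>m (n ^ 0)))"
    using limit unfolding direct_limit_def tensor_power_def
    by (elim conjE allE[of _ 0] ballE[of _ _ "1\<^sub>m (n ^ 0)"]) (simp_all add: tensor_power_def)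
  ultimately have "(\<lambda>l::nat. 1::real) \<longlonglongrightarrow> 0"
    using zero two_le by (simp add: tensor_power_def op_norm_one)
  then show False
    using LIMSEQ_unique[OF tendsto_const] by fastforce
qed

text \<open>Simplicity of full matrix algebras: products with one matrix unit reach all the others,
  so if one of them vanished in \<open>A\<close>, the unit would vanish too.\<close>

lemma level_unit_nonzero:
  assumes "r < n ^ k" "c < n ^ k"
  shows "\<iota> k (mat_unit (n ^ k) r c) \<noteq> \<zero>\<^bsub>A\<^esub>"
proof
  assume zero: "\<iota> k (mat_unit (n ^ k) r c) = \<zero>\<^bsub>A\<^esub>"
  have "\<iota> k (mat_unit (n ^ k) u v) = \<zero>\<^bsub>A\<^esub>" if uv: "u < n ^ k" "v < n ^ k" for u v
  proof -
    have "mat_unit (n ^ k) u v = mat_unit (n ^ k) u r * (mat_unit (n ^ k) r c * mat_unit (n ^ k) c v)"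
      using assms uv by (simp add: mat_unit_mult)
    then have "\<iota> k (mat_unit (n ^ k) u v)
        = \<iota> k (mat_unit (n ^ k) u r) \<otimes>\<^bsub>A\<^esub> (\<iota> k (mat_unit (n ^ k) r c) \<otimes>\<^bsub>A\<^esub> \<iota> k (mat_unit (n ^ k) c v))"
      using level_hom'(4)[of _ k] by (simp add: mult_carrier_mat[of _ "n ^ k" "n ^ k"])
    then show ?thesis by (simp add: zero)
  qed
  then have "\<iota> k (1\<^sub>m (n ^ k)) = \<zero>\<^bsub>A\<^esub>"
    by (subst linear_map_mat_units[OF A.complex_module_axioms level_linear])
      (auto intro!: A.sum_neutral)
  then show False using one_nonzero by (simp add: level_one)
qed

text \<open>Compressing by two diagonal matrix units isolates one entry times a matrix unit, and the
  image of the latter has norm one because it is a nonzero partial isometry.\<close>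

lemma entry_le:
  assumes x: "x \<in> carrier_mat (n ^ k) (n ^ k)" and rc: "r < n ^ k" "c < n ^ k"
  shows "cmod (x $$ (r, c)) \<le> cnorm A (\<iota> k x)"
proof -
  let ?e = "\<lambda>u v. \<iota> k (mat_unit (n ^ k) u v)"
  have ee: "?e u v \<otimes>\<^bsub>A\<^esub> ?e v w = ?e u w" if "u < n ^ k" "v < n ^ k" "w < n ^ k" for u v w
    using that level_hom'(4)[of "mat_unit (n ^ k) u v" k "mat_unit (n ^ k) v w"] by (simp add: mat_unit_mult)
  have es: "(?e u v)\<^sup>\<star>\<^bsub>A\<^esub> = ?e v u" for u v
    using level_hom'(5)[of "mat_unit (n ^ k) u v" k] by simp
  have diag: "cnorm A (?e u u) \<le> 1" if "u < n ^ k" for u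
    using that by (intro A.projection_cnorm_le) (auto simp: es ee)
  have "(cnorm A (?e c c))\<^sup>2 = cnorm A (?e c c)"
    using rc A.cstar_identity[of "?e c c"] by (simp add: es ee)
  then have "cnorm A (?e c c) = 1"
    using level_unit_nonzero[of c k c] rc by (auto simp: power2_eq_square A.cnorm_eq_0)
  then have "(cnorm A (?e r c))\<^sup>2 = 1"
    using rc A.cstar_identity[of "?e r c"] by (simp add: es ee)
  then have one: "cnorm A (?e r c) = 1"
    using A.cnorm_nonneg[OF level_closed[OF mat_unit_carrier], of k r c] by (simp add: power2_eq_1_iff)
  have "x $$ (r, c) \<odot>\<^bsub>A\<^esub> ?e r c = \<iota> k (mat_unit (n ^ k) r r * x * mat_unit (n ^ k) c c)"
    using x rc by (simp add: mat_unit_compress level_hom'(3))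
  also have "\<dots> = ?e r r \<otimes>\<^bsub>A\<^esub> \<iota> k x \<otimes>\<^bsub>A\<^esub> ?e c c"
    using x level_hom'(4)[of _ k] by (simp add: mult_carrier_mat[of _ "n ^ k" "n ^ k"])
  finally have "cmod (x $$ (r, c)) = cnorm A (?e r r \<otimes>\<^bsub>A\<^esub> \<iota> k x \<otimes>\<^bsub>A\<^esub> ?e c c)"
    using A.cnorm_smult[of "?e r c" "x $$ (r, c)"] one by simp
  also have "\<dots> \<le> (1 * cnorm A (\<iota> k x)) * 1"
    using x rc diag by (intro A.cnorm_mult_le) auto
  finally show ?thesis by simp
qed

text \<open>The bound on entries compares the norms up to the constant \<open>K\<close>, and passing
  to powers removes \<open>K\<close>. This takes the place of the uniqueness of the C*-norm on
  matrices, with the norm inherited from \<open>A\<close>.\<close>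

lemma level_contractive:
  assumes B: "cstar_algebra B" and f: "f \<in> star_hom (matrix_algebra (n ^ k)) B"
    and x: "x \<in> carrier_mat (n ^ k) (n ^ k)"
  shows "cnorm B (f x) \<le> cnorm A (\<iota> k x)"
proof -
  interpret B: cstar_algebra B by fact
  define K where "K = (\<Sum>r<n ^ k. \<Sum>c<n ^ k. cnorm B (f (mat_unit (n ^ k) r c)))"
  have fcl: "f (mat_unit (n ^ k) r c) \<in> carrier B" for r c
    using star_homD(1)[OF f] by simp
  have "cnorm B (f y) \<le> K * cnorm A (\<iota> k y)" if y: "y \<in> carrier_mat (n ^ k) (n ^ k)" for y
  proof -
    have "cnorm B (f y) \<le> (\<Sum>r<n ^ k. cnorm B (finsum B (\<lambda>c. y $$ (r, c) \<odot>\<^bsub>B\<^esub> f (mat_unit (n ^ k) r c)) {..<n ^ k}))"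
      unfolding linear_map_mat_units[OF B.complex_module_axioms star_hom_linear[OF f] y]
      using fcl by (intro B.cnorm_sum_le) auto
    also have "\<dots> \<le> (\<Sum>r<n ^ k. \<Sum>c<n ^ k. cnorm B (y $$ (r, c) \<odot>\<^bsub>B\<^esub> f (mat_unit (n ^ k) r c)))"
      using fcl by (intro sum_mono B.cnorm_sum_le) auto
    also have "\<dots> \<le> (\<Sum>r<n ^ k. \<Sum>c<n ^ k. cnorm B (f (mat_unit (n ^ k) r c)) * cnorm A (\<iota> k y))"
      using fcl y entry_le[OF y]
      by (intro sum_mono) (auto simp: B.cnorm_smult mult.commute intro!: mult_right_mono)
    finally show ?thesis by (simp add: K_def sum_distrib_right)
  qed
  then show ?thesis
    using star_hom_compare[OF B A.cstar_algebra_axioms f level_hom, of K x] x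
    by (simp add: mult_carrier_mat[of _ "n ^ k" "n ^ k"])
qed

text \<open>The unused tensor factor \<open>M\<^sub>n\<close> of the next level provides the matrix units
  that turn a pair \<open>(b, z)\<close> into a column.\<close>

lemma level_positive_mono:
  assumes b: "b \<in> carrier_mat (n ^ k) (n ^ k)" and z: "z \<in> carrier_mat (n ^ k) (n ^ k)"
  shows "(cnorm A (\<iota> k b))\<^sup>2 \<le> cnorm A (\<iota> k (mat_adjoint b * b + mat_adjoint z * z))"
proof -
  let ?d = "n ^ k"
  let ?E = "mat_unit n"
  have n: "0 < n" "1 < n" using two_le by auto
  \<comment> \<open>The corner embedding \<open>x \<mapsto> x \<otimes> e_00\<close>, a second copy
    of level \<open>k\<close>. It preserves norms, so norms may be computed in the corner.\<close>
  define g where "g x = \<iota> (Suc k) (kronecker x (?E 0 0))" for x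
  have kc: "kronecker x (?E i j) \<in> carrier_mat (n ^ Suc k) (n ^ Suc k)" if "x \<in> carrier_mat ?d ?d" for x i j
    using that by (intro kronecker_level) auto
  have km: "kronecker x (?E i j) * kronecker y (?E u v) = (if j = u then kronecker (x * y) (?E i v)
      else 0\<^sub>m (n ^ Suc k) (n ^ Suc k))"
    if "x \<in> carrier_mat ?d ?d" "y \<in> carrier_mat ?d ?d" "i < n" "j < n" "u < n" "v < n" for x y i j u v
  proof -
    have "kronecker (x * y) (0\<^sub>m n n) = 0\<^sub>m (n ^ Suc k) (n ^ Suc k)"
      using that by (intro eq_matI) (auto simp: kronecker_index div_less_of_less_mult mult.commute)
    then show ?thesis
      using that by (simp add: kronecker_mult[of _ ?d _ _ n] mat_unit_mult)
  qed
  have g: "g \<in> star_hom (matrix_algebra ?d) A"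
  proof (rule star_homI)
    fix x assume "x \<in> carrier (matrix_algebra ?d)"
    then have x: "x \<in> carrier_mat ?d ?d" by simp
    show "g x \<in> carrier A" unfolding g_def by (rule level_closed[OF kc[OF x]])
    show "g (c \<odot>\<^bsub>matrix_algebra ?d\<^esub> x) = c \<odot>\<^bsub>A\<^esub> g x" for c
      using x level_hom'(3)[OF kc[OF x]] by (simp add: g_def kronecker_scale_left[of x ?d _ n])
    show "g (x\<^sup>\<star>\<^bsub>matrix_algebra ?d\<^esub>) = (g x)\<^sup>\<star>\<^bsub>A\<^esub>"
      using level_hom'(5)[OF kc[OF x]] by (simp add: g_def kronecker_adjoint)
    fix y assume "y \<in> carrier (matrix_algebra ?d)"
    then have y: "y \<in> carrier_mat ?d ?d" by simp
    show "g (x \<oplus>\<^bsub>matrix_algebra ?d\<^esub> y) = g x \<oplus>\<^bsub>A\<^esub> g y"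
      using x y level_hom'(2)[OF kc[OF x] kc[OF y]] by (simp add: g_def kronecker_add_left[of x ?d y _ n])
    show "g (x \<otimes>\<^bsub>matrix_algebra ?d\<^esub> y) = g x \<otimes>\<^bsub>A\<^esub> g y"
      using x y n level_hom'(4)[OF kc[OF x, of 0 0] kc[OF y, of 0 0]] by (simp add: g_def km)
  qed
  define V where "V i j = \<iota> (Suc k) (kronecker (1\<^sub>m ?d) (?E i j))" for i j
  have Vcl: "V i j \<in> carrier A" for i j unfolding V_def by (rule level_closed[OF kc]) simp
  have V1: "cnorm A (V i j) \<le> 1" if "i < n" "j < n" for i j
  proof -
    have 1: "mat_adjoint (1\<^sub>m ?d) = (1\<^sub>m ?d :: complex mat)" by (rule eq_matI) auto
    have Vs: "(V u v)\<^sup>\<star>\<^bsub>A\<^esub> = V v u" for u v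
      using level_hom'(5)[OF kc, of "1\<^sub>m ?d" u v] by (simp add: V_def kronecker_adjoint 1)
    have VV: "V u v \<otimes>\<^bsub>A\<^esub> V v w = V u w" if "u < n" "v < n" "w < n" for u v w
      using that level_hom'(4)[OF kc kc, of "1\<^sub>m ?d" "1\<^sub>m ?d" u v v w] by (simp add: V_def km)
    have "cnorm A (V j j) \<le> 1"
      using that Vcl by (intro A.projection_cnorm_le) (auto simp: Vs VV)
    then have "(cnorm A (V i j))\<^sup>2 \<le> 1"
      using A.cstar_identity[OF Vcl, of i j] that by (simp add: Vs VV)
    then show ?thesis
      using abs_square_le_1[of "cnorm A (V i j)"] by simp
  qed
  \<comment> \<open>The \<open>n\<close> diagonal translates of the corner copy add up to
    \<open>x \<otimes> 1\<close>, which gives the estimate with a factor \<open>n\<close>;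
    comparison of powers removes it.\<close>
  have lower: "cnorm A (\<iota> k x) \<le> cnorm A (g x)" if x: "x \<in> carrier_mat ?d ?d" for x
  proof -
    have "cnorm A (\<iota> k y) \<le> real n * cnorm A (g y)" if y: "y \<in> carrier_mat ?d ?d" for y
    proof -
      have lin: "(\<lambda>w. \<iota> (Suc k) (kronecker y w)) \<in> linear_maps (matrix_algebra n) A"
        using y by (intro linear_mapsI)
          (auto simp: kronecker_add_right[of y ?d _ n] kronecker_scale_right[of y ?d _ n]
            level_hom'(2,3)[OF kronecker_level(1)] intro!: level_hom'(2,3)[OF kronecker_level(1)] level_closed)
      have yE: "\<iota> (Suc k) (kronecker y (?E i i)) = V i 0 \<otimes>\<^bsub>A\<^esub> g y \<otimes>\<^bsub>A\<^esub> V 0 i" if "i < n" for i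
      proof -
        have "kronecker y (?E i i) = kronecker (1\<^sub>m ?d) (?E i 0) * kronecker y (?E 0 0) * kronecker (1\<^sub>m ?d) (?E 0 i)"
          using that y n by (simp add: km mult_carrier_mat[of _ ?d ?d])
        then show ?thesis
          using y kc[OF y] kc[of "1\<^sub>m ?d"] unfolding g_def V_def
          by (metis level_hom'(4) mult_carrier_mat one_carrier_mat)
      qed
      have "\<iota> k y = \<iota> (Suc k) (kronecker y (1\<^sub>m n))"
        using level_bonding[OF y] by simp
      also have "\<dots> = finsum A (\<lambda>i. finsum A (\<lambda>j. 1\<^sub>m n $$ (i, j) \<odot>\<^bsub>A\<^esub> \<iota> (Suc k) (kronecker y (?E i j))) {..<n}) {..<n}"
        by (rule linear_map_mat_units[OF A.complex_module_axioms lin]) simp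
      also have "\<dots> = finsum A (\<lambda>i. V i 0 \<otimes>\<^bsub>A\<^esub> g y \<otimes>\<^bsub>A\<^esub> V 0 i) {..<n}"
      proof (intro A.sum_cong refl)
        fix i assume i: "i \<in> {..<n}"
        have "finsum A (\<lambda>j. 1\<^sub>m n $$ (i, j) \<odot>\<^bsub>A\<^esub> \<iota> (Suc k) (kronecker y (?E i j))) {..<n}
            = 1\<^sub>m n $$ (i, i) \<odot>\<^bsub>A\<^esub> \<iota> (Suc k) (kronecker y (?E i i))"
          using i level_closed[OF kc[OF y]] by (intro A.sum_single) auto
        then show "finsum A (\<lambda>j. 1\<^sub>m n $$ (i, j) \<odot>\<^bsub>A\<^esub> \<iota> (Suc k) (kronecker y (?E i j))) {..<n}
            = V i 0 \<otimes>\<^bsub>A\<^esub> g y \<otimes>\<^bsub>A\<^esub> V 0 i"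
          using i level_closed[OF kc[OF y]] yE Vcl y star_homD(1)[OF g] by (simp del: power_Suc)
      qed (use Vcl y star_homD(1)[OF g] in auto)
      finally have "cnorm A (\<iota> k y) \<le> (\<Sum>i<n. cnorm A (V i 0 \<otimes>\<^bsub>A\<^esub> g y \<otimes>\<^bsub>A\<^esub> V 0 i))"
        using A.cnorm_sum_le[of "{..<n}" "\<lambda>i. V i 0 \<otimes>\<^bsub>A\<^esub> g y \<otimes>\<^bsub>A\<^esub> V 0 i"] Vcl y star_homD(1)[OF g] by simp
      also have "\<dots> \<le> (\<Sum>i<n. (1 * cnorm A (g y)) * 1)"
        using V1 Vcl y star_homD(1)[OF g] n by (intro sum_mono A.cnorm_mult_le) auto
      finally show ?thesis by simp
    qed
    then show ?thesis
      using star_hom_compare[OF A.cstar_algebra_axioms A.cstar_algebra_axioms level_hom g, of "real n" x] x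
      by (simp add: mult_carrier_mat[of _ ?d ?d])
  qed
  define h where "h = mat_adjoint b * b + mat_adjoint z * z"
  have bs: "mat_adjoint b \<in> carrier_mat ?d ?d" "mat_adjoint z \<in> carrier_mat ?d ?d" using b z by auto
  have h: "h \<in> carrier_mat ?d ?d"
    unfolding h_def using b z bs by (metis add_carrier_mat mult_carrier_mat)
  \<comment> \<open>The column with entries \<open>b\<close> and \<open>z\<close>:
    \<open>colm^* colm\<close> is \<open>b^* b + z^* z\<close> in the corner, and the first entry is
    recovered by multiplying with \<open>1 \<otimes> e_00\<close>. A second row exists since
    \<open>n\<close> is at least two.\<close>
  define colm where "colm = kronecker b (?E 0 0) + kronecker z (?E 1 0)"
  note kb = kc[OF b] and kz = kc[OF z]
  have colm: "colm \<in> carrier_mat (n ^ Suc k) (n ^ Suc k)" using kb kz by (simp add: colm_def)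
  have cols: "mat_adjoint colm = kronecker (mat_adjoint b) (?E 0 0) + kronecker (mat_adjoint z) (?E 0 1)"
  proof -
    have "mat_adjoint (u + v) = mat_adjoint u + mat_adjoint v"
      if "u \<in> carrier_mat (n ^ Suc k) (n ^ Suc k)" "v \<in> carrier_mat (n ^ Suc k) (n ^ Suc k)" for u v :: "complex mat"
      using that by (intro eq_matI) auto
    then show ?thesis using kb kz by (simp add: colm_def kronecker_adjoint del: power_Suc)
  qed
  have colcol: "mat_adjoint colm * colm = kronecker h (?E 0 0)"
  proof -
    have bb: "mat_adjoint b * b \<in> carrier_mat ?d ?d" "mat_adjoint z * z \<in> carrier_mat ?d ?d"
      using b z bs by (metis mult_carrier_mat)+
    have "mat_adjoint colm * colm = kronecker (mat_adjoint b) (?E 0 0) * colm + kronecker (mat_adjoint z) (?E 0 1) * colm"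
      unfolding cols by (rule add_mult_distrib_mat[OF kc[OF bs(1)] kc[OF bs(2)] colm])
    also have "kronecker (mat_adjoint b) (?E 0 0) * colm = kronecker (mat_adjoint b * b) (?E 0 0)"
      unfolding colm_def mult_add_distrib_mat[OF kc[OF bs(1)] kb kz]
      using b z bs n kc[OF bb(1)] by (simp add: km del: power_Suc)
    also have "kronecker (mat_adjoint z) (?E 0 1) * colm = kronecker (mat_adjoint z * z) (?E 0 0)"
      unfolding colm_def mult_add_distrib_mat[OF kc[OF bs(2)] kb kz]
      using b z bs n kc[OF bb(2)] by (simp add: km del: power_Suc)
    finally show ?thesis
      using b z bs by (simp add: h_def kronecker_add_left[of _ ?d _ _ n] mult_carrier_mat[of _ ?d ?d])
  qed
  have "(cnorm A (\<iota> (Suc k) colm))\<^sup>2 = cnorm A (\<iota> (Suc k) (mat_adjoint colm * colm))"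
    using colm level_hom'(4)[of "mat_adjoint colm" "Suc k" colm] level_hom'(5)[of colm "Suc k"]
    by (simp add: A.cstar_identity del: power_Suc)
  also have "\<dots> = cnorm A (g h)" by (simp add: colcol g_def)
  also have "\<dots> \<le> cnorm A (\<iota> k h)" by (rule level_contractive[OF A.cstar_algebra_axioms g h])
  finally have upper: "(cnorm A (\<iota> (Suc k) colm))\<^sup>2 \<le> cnorm A (\<iota> k h)" .
  have "kronecker (1\<^sub>m ?d) (?E 0 0) * colm = kronecker b (?E 0 0)"
    unfolding colm_def mult_add_distrib_mat[OF kc[OF one_carrier_mat] kb kz]
    using b z kb n by (simp add: km del: power_Suc)
  then have "g b = V 0 0 \<otimes>\<^bsub>A\<^esub> \<iota> (Suc k) colm"
    using level_hom'(4)[OF kc[OF one_carrier_mat] colm, of 0 0] by (simp add: g_def V_def)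
  then have "cnorm A (g b) \<le> 1 * cnorm A (\<iota> (Suc k) colm)"
    using A.cnorm_mult_le[OF Vcl level_closed[OF colm] V1 order_refl] n by simp
  then have "cnorm A (\<iota> k b) \<le> cnorm A (\<iota> (Suc k) colm)"
    using lower[OF b] by simp
  then have "(cnorm A (\<iota> k b))\<^sup>2 \<le> (cnorm A (\<iota> (Suc k) colm))\<^sup>2"
    using b by (intro power_mono) auto
  then show ?thesis using upper by (simp add: h_def)
qed

text \<open>Both sides are continuous in the pair, so the inequality passes to limits of pairs taken
  from common levels.\<close>

lemma positive_mono:
  assumes b: "b \<in> carrier A" and z: "z \<in> carrier A"
  shows "cnorm A (b\<^sup>\<star>\<^bsub>A\<^esub> \<otimes>\<^bsub>A\<^esub> b) \<le> cnorm A (b\<^sup>\<star>\<^bsub>A\<^esub> \<otimes>\<^bsub>A\<^esub> b \<oplus>\<^bsub>A\<^esub> z\<^sup>\<star>\<^bsub>A\<^esub> \<otimes>\<^bsub>A\<^esub> z)"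
proof -
  obtain d where d: "\<And>k. d k \<in> levels" "\<And>k. d k \<in> carrier A" "(\<lambda>k. cnorm A (d k \<ominus>\<^bsub>A\<^esub> b)) \<longlonglongrightarrow> 0"
    using A.dense_sequence[OF levels_dense b] by metis
  obtain e where e: "\<And>k. e k \<in> levels" "\<And>k. e k \<in> carrier A" "(\<lambda>k. cnorm A (e k \<ominus>\<^bsub>A\<^esub> z)) \<longlonglongrightarrow> 0"
    using A.dense_sequence[OF levels_dense z] by metis
  have le: "cnorm A ((d k)\<^sup>\<star>\<^bsub>A\<^esub> \<otimes>\<^bsub>A\<^esub> d k)
      \<le> cnorm A ((d k)\<^sup>\<star>\<^bsub>A\<^esub> \<otimes>\<^bsub>A\<^esub> d k \<oplus>\<^bsub>A\<^esub> (e k)\<^sup>\<star>\<^bsub>A\<^esub> \<otimes>\<^bsub>A\<^esub> e k)" for k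
  proof -
    obtain l x y where xy: "x \<in> carrier_mat (n ^ Suc l) (n ^ Suc l)" "d k = \<iota> (Suc l) x"
      "y \<in> carrier_mat (n ^ Suc l) (n ^ Suc l)" "e k = \<iota> (Suc l) y"
      using levels_common[OF d(1) e(1)] by metis
    have "(d k)\<^sup>\<star>\<^bsub>A\<^esub> \<otimes>\<^bsub>A\<^esub> d k \<oplus>\<^bsub>A\<^esub> (e k)\<^sup>\<star>\<^bsub>A\<^esub> \<otimes>\<^bsub>A\<^esub> e k
        = \<iota> (Suc l) (mat_adjoint x * x + mat_adjoint y * y)"
    proof -
      have adj: "mat_adjoint x \<in> carrier_mat (n ^ Suc l) (n ^ Suc l)" "mat_adjoint y \<in> carrier_mat (n ^ Suc l) (n ^ Suc l)"
        by (rule mat_adjoint_carrier[OF xy(1)], rule mat_adjoint_carrier[OF xy(3)])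
      show ?thesis
        unfolding xy(2,4) level_hom'(2)[OF mult_carrier_mat[OF adj(1) xy(1)] mult_carrier_mat[OF adj(2) xy(3)]]
          level_hom'(4)[OF adj(1) xy(1)] level_hom'(4)[OF adj(2) xy(3)] level_hom'(5)[OF xy(1)] level_hom'(5)[OF xy(3)]
        by (rule refl)
    qed
    then show ?thesis
      using level_positive_mono[OF xy(1,3)] d(2)[of k] by (simp add: A.cstar_identity xy(2))
  qed
  show ?thesis
    using le b z d e
    by (intro LIMSEQ_le[of "\<lambda>k. cnorm A ((d k)\<^sup>\<star>\<^bsub>A\<^esub> \<otimes>\<^bsub>A\<^esub> d k)" _
          "\<lambda>k. cnorm A ((d k)\<^sup>\<star>\<^bsub>A\<^esub> \<otimes>\<^bsub>A\<^esub> d k \<oplus>\<^bsub>A\<^esub> (e k)\<^sup>\<star>\<^bsub>A\<^esub> \<otimes>\<^bsub>A\<^esub> e k)"]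
        A.tendsto_cnorm A.tendsto_add_cnorm A.tendsto_mult_cnorm A.tendsto_star_cnorm) auto
qed

text \<open>Each \<open>\<theta> k\<close> is dominated by the norm of \<open>A\<close>, so it
  vanishes wherever \<open>\<iota> k\<close> does and descends to the union of the levels; the same
  domination permits the extension by continuity.\<close>

lemma star_hom_from_levels:
  assumes C: "cstar_algebra C" and \<theta>: "\<And>k. \<theta> k \<in> star_hom (matrix_algebra (n ^ k)) C"
    and compat: "\<And>k x. x \<in> carrier_mat (n ^ k) (n ^ k) \<Longrightarrow> \<theta> (Suc k) (kronecker x (1\<^sub>m n)) = \<theta> k x"
  obtains \<pi> where "\<pi> \<in> star_hom A C" "\<And>k x. x \<in> carrier_mat (n ^ k) (n ^ k) \<Longrightarrow> \<pi> (\<iota> k x) = \<theta> k x"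
proof -
  interpret C: cstar_algebra C by fact
  note th = star_homD[OF \<theta>, simplified]
  have shift: "\<theta> (k + l) (kronecker x (1\<^sub>m (n ^ l))) = \<theta> k x" if x: "x \<in> carrier_mat (n ^ k) (n ^ k)" for k l x
  proof (induction l)
    case 0
    then show ?case using kronecker_one_one[of x] by simp
  next
    case (Suc l)
    have "kronecker (kronecker x (1\<^sub>m (n ^ l))) (1\<^sub>m n) = kronecker x (1\<^sub>m (n ^ Suc l))"
      using x by (subst kronecker_assoc[of _ "n ^ k" _ "n ^ l" _ n]) (auto simp: kronecker_one mult.commute)
    then show ?case
      using Suc compat[of "kronecker x (1\<^sub>m (n ^ l))" "k + l"] level_shift[OF x, of l] by simp
  qed
  have same: "\<theta> k x = \<theta> k y"
    if xy: "x \<in> carrier_mat (n ^ k) (n ^ k)" "y \<in> carrier_mat (n ^ k) (n ^ k)" "\<iota> k x = \<iota> k y" for k x y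
  proof -
    let ?w = "x + (- 1) \<cdot>\<^sub>m y"
    have w: "?w \<in> carrier_mat (n ^ k) (n ^ k)" using xy by simp
    have "\<iota> k ?w = \<zero>\<^bsub>A\<^esub>"
      using xy by (simp add: level_hom'(2,3) flip: A.minus_scale)
    then have "cnorm C (\<theta> k ?w) \<le> 0"
      using level_contractive[OF C \<theta> w] by simp
    then have "\<theta> k ?w = \<zero>\<^bsub>C\<^esub>"
      using C.cnorm_eq_0[OF th(1)[OF w]] C.cnorm_nonneg[OF th(1)[OF w]] by simp
    moreover have "\<theta> k ?w = \<theta> k x \<ominus>\<^bsub>C\<^esub> \<theta> k y"
      using xy th(1) by (simp add: th(2,3) C.minus_scale)
    ultimately show ?thesis using xy th(1) by (simp add: C.minus_eq_zero_iff)
  qed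
  have well: "\<theta> k x = \<theta> l y"
    if x: "x \<in> carrier_mat (n ^ k) (n ^ k)" and y: "y \<in> carrier_mat (n ^ l) (n ^ l)" and eq: "\<iota> k x = \<iota> l y" for k l x y
  proof -
    have "l + k = k + l" by simp
    then have "\<theta> (k + l) (kronecker x (1\<^sub>m (n ^ l))) = \<theta> (k + l) (kronecker y (1\<^sub>m (n ^ k)))"
      using level_shift[OF x, of l] level_shift[OF y, of k] eq
      by (intro same) (simp_all only: simp_thms)
    then show ?thesis
      using shift[OF x, of l] shift[OF y, of k] \<open>l + k = k + l\<close> by (simp only: simp_thms)
  qed
  define f where "f d = (SOME c. \<exists>k x. x \<in> carrier_mat (n ^ k) (n ^ k) \<and> \<iota> k x = d \<and> \<theta> k x = c)" for d
  have f: "f (\<iota> k x) = \<theta> k x" if x: "x \<in> carrier_mat (n ^ k) (n ^ k)" for k x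
    unfolding f_def by (rule some_equality) (use x well in blast)+
  have lev: "\<iota> k x \<in> levels" if "x \<in> carrier_mat (n ^ k) (n ^ k)" for k x
    using that by (auto simp: levels_def)
  have cl: "d \<oplus>\<^bsub>A\<^esub> e \<in> levels \<and> f (d \<oplus>\<^bsub>A\<^esub> e) = f d \<oplus>\<^bsub>C\<^esub> f e"
    "d \<otimes>\<^bsub>A\<^esub> e \<in> levels \<and> f (d \<otimes>\<^bsub>A\<^esub> e) = f d \<otimes>\<^bsub>C\<^esub> f e"
    if "d \<in> levels" "e \<in> levels" for d e
  proof -
    obtain k x y where xy: "x \<in> carrier_mat (n ^ Suc k) (n ^ Suc k)" "d = \<iota> (Suc k) x"
      "y \<in> carrier_mat (n ^ Suc k) (n ^ Suc k)" "e = \<iota> (Suc k) y"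
      using levels_common[OF \<open>d \<in> levels\<close> \<open>e \<in> levels\<close>] by metis
    have sum: "x + y \<in> carrier_mat (n ^ Suc k) (n ^ Suc k)" "x * y \<in> carrier_mat (n ^ Suc k) (n ^ Suc k)"
      using xy by auto
    show "d \<oplus>\<^bsub>A\<^esub> e \<in> levels \<and> f (d \<oplus>\<^bsub>A\<^esub> e) = f d \<oplus>\<^bsub>C\<^esub> f e"
      using lev[OF sum(1)] f[OF sum(1)] f[OF xy(1)] f[OF xy(3)]
      by (simp only: xy(2,4) level_hom'(2)[OF xy(1,3)] th(2)[OF xy(1,3)] simp_thms)
    show "d \<otimes>\<^bsub>A\<^esub> e \<in> levels \<and> f (d \<otimes>\<^bsub>A\<^esub> e) = f d \<otimes>\<^bsub>C\<^esub> f e"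
      using lev[OF sum(2)] f[OF sum(2)] f[OF xy(1)] f[OF xy(3)]
      by (simp only: xy(2,4) level_hom'(4)[OF xy(1,3)] th(4)[OF xy(1,3)] simp_thms)
  qed
  have cl': "c \<odot>\<^bsub>A\<^esub> d \<in> levels \<and> f (c \<odot>\<^bsub>A\<^esub> d) = c \<odot>\<^bsub>C\<^esub> f d"
    "d\<^sup>\<star>\<^bsub>A\<^esub> \<in> levels \<and> f (d\<^sup>\<star>\<^bsub>A\<^esub>) = (f d)\<^sup>\<star>\<^bsub>C\<^esub>" "f d \<in> carrier C" "cnorm C (f d) \<le> cnorm A d"
    if "d \<in> levels" for d c
  proof -
    obtain k x where x: "x \<in> carrier_mat (n ^ k) (n ^ k)" "d = \<iota> k x"
      using levelsE[OF \<open>d \<in> levels\<close>] by metis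
    have sc: "c \<cdot>\<^sub>m x \<in> carrier_mat (n ^ k) (n ^ k)" "mat_adjoint x \<in> carrier_mat (n ^ k) (n ^ k)"
      using x by auto
    show "c \<odot>\<^bsub>A\<^esub> d \<in> levels \<and> f (c \<odot>\<^bsub>A\<^esub> d) = c \<odot>\<^bsub>C\<^esub> f d"
      using lev[OF sc(1)] f[OF sc(1)] f[OF x(1)] by (simp add: x level_hom'(3) th(3))
    show "d\<^sup>\<star>\<^bsub>A\<^esub> \<in> levels \<and> f (d\<^sup>\<star>\<^bsub>A\<^esub>) = (f d)\<^sup>\<star>\<^bsub>C\<^esub>"
      using lev[OF sc(2)] f[OF sc(2)] f[OF x(1)] by (simp add: x level_hom'(5) th(5))
    show "f d \<in> carrier C" using f[OF x(1)] th(1)[OF x(1)] x by simp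
    show "cnorm C (f d) \<le> cnorm A d"
      using level_contractive[OF C \<theta> x(1)] f[OF x(1)] x by simp
  qed
  have fhom: "f \<in> star_hom (A\<lparr>carrier := levels\<rparr>) C"
    by (rule star_homI) (use cl cl' in auto)
  obtain \<pi> where "\<pi> \<in> star_hom A C" "\<And>d. d \<in> levels \<Longrightarrow> \<pi> d = f d"
    by (rule star_hom_extension[OF A.cstar_algebra_axioms C levels_dense levels_subset _ _ _ _ fhom])
      (use cl cl' in auto)
  then show ?thesis using that lev f by metis
qed

text \<open>The positive levels are dense and spanned by their matrix units. Arbitrary constants are
  allowed because the maps compared later, such as
  \<open>a \<mapsto> \<psi> (a \<triangleright> m)\<close>, are linear and bounded but not
  homomorphisms.\<close>

lemma bounded_linear_eqI:
  assumes B: "cstar_algebra B" and f: "f \<in> linear_maps A B" and g: "g \<in> linear_maps A B"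
    and bound: "\<And>a. a \<in> carrier A \<Longrightarrow> cnorm B (f a) \<le> K * cnorm A a"
      "\<And>a. a \<in> carrier A \<Longrightarrow> cnorm B (g a) \<le> K' * cnorm A a"
    and eq: "\<And>k r c. r < n ^ Suc k \<Longrightarrow> c < n ^ Suc k
      \<Longrightarrow> f (\<iota> (Suc k) (mat_unit (n ^ Suc k) r c)) = g (\<iota> (Suc k) (mat_unit (n ^ Suc k) r c))"
    and a: "a \<in> carrier A"
  shows "f a = g a"
proof -
  interpret B: cstar_algebra B by fact
  note lin = linear_mapsD[OF f] linear_mapsD[OF g]
  have level: "f (\<iota> (Suc k) x) = g (\<iota> (Suc k) x)" if x: "x \<in> carrier_mat (n ^ Suc k) (n ^ Suc k)" for k x
  proof (rule linear_map_mat_unitsI[OF B.complex_module_axioms _ _ _ x, where f = "\<lambda>x. f (\<iota> (Suc k) x)"])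
    show "(\<lambda>x. f (\<iota> (Suc k) x)) \<in> linear_maps (matrix_algebra (n ^ Suc k)) B"
      "(\<lambda>x. g (\<iota> (Suc k) x)) \<in> linear_maps (matrix_algebra (n ^ Suc k)) B"
      by (intro linear_mapsI; simp add: lin level_hom'(2,3) level_closed del: power_Suc)+
  qed (rule eq)
  have cl: "f a \<in> carrier B" "g a \<in> carrier B" using lin a by auto
  have "cnorm B (f a \<ominus>\<^bsub>B\<^esub> g a) \<le> 0"
  proof (rule field_le_epsilon)
    fix e :: real assume e: "0 < e"
    define R where "R = 1 + \<bar>K\<bar> + \<bar>K'\<bar>"
    have R: "0 < R" by (simp add: R_def)
    then obtain k x where x: "x \<in> carrier_mat (n ^ Suc k) (n ^ Suc k)" "cnorm A (a \<ominus>\<^bsub>A\<^esub> \<iota> (Suc k) x) < e / R"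
      using approx[OF a, of "e / R"] e by (metis divide_pos_pos)
    define d where "d = \<iota> (Suc k) x"
    have d: "d \<in> carrier A" "f d = g d" using x(1) level by (auto simp: d_def simp del: power_Suc)
    have fd: "f d \<in> carrier B" using d lin by auto
    have w: "a \<ominus>\<^bsub>A\<^esub> d \<in> carrier A" using a d by simp
    have "f (a \<ominus>\<^bsub>A\<^esub> d) = f a \<ominus>\<^bsub>B\<^esub> f d" "g (a \<ominus>\<^bsub>A\<^esub> d) = g a \<ominus>\<^bsub>B\<^esub> f d"
      using linear_maps_minus[OF A.complex_module_axioms B.complex_module_axioms f a d(1)]
        linear_maps_minus[OF A.complex_module_axioms B.complex_module_axioms g a d(1)] d(2) by simp_all
    then have "f a \<ominus>\<^bsub>B\<^esub> g a = f (a \<ominus>\<^bsub>A\<^esub> d) \<ominus>\<^bsub>B\<^esub> g (a \<ominus>\<^bsub>A\<^esub> d)"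
      using B.diff_diff_cancel[OF cl(1) fd cl(2)] by simp
    also have "cnorm B \<dots> \<le> cnorm B (f (a \<ominus>\<^bsub>A\<^esub> d)) + cnorm B (g (a \<ominus>\<^bsub>A\<^esub> d))"
      using w lin by (intro B.cnorm_minus_le) auto
    also have "\<dots> \<le> K * cnorm A (a \<ominus>\<^bsub>A\<^esub> d) + K' * cnorm A (a \<ominus>\<^bsub>A\<^esub> d)"
      using w by (intro add_mono bound)
    also have "\<dots> \<le> R * cnorm A (a \<ominus>\<^bsub>A\<^esub> d)"
    proof -
      have "K + K' \<le> R" by (simp add: R_def)
      then show ?thesis using w mult_right_mono[of "K + K'" R "cnorm A (a \<ominus>\<^bsub>A\<^esub> d)"] by (simp add: algebra_simps)
    qed
    also have "\<dots> \<le> e"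
      using x(2) R by (simp add: d_def field_simps)
    finally show "cnorm B (f a \<ominus>\<^bsub>B\<^esub> g a) \<le> 0 + e" by simp
  qed
  then have "cnorm B (f a \<ominus>\<^bsub>B\<^esub> g a) = 0"
    using cl B.cnorm_nonneg[of "f a \<ominus>\<^bsub>B\<^esub> g a"] by (metis B.M.minus_closed order_antisym B.cnorm_nonneg)
  then show ?thesis using cl by (simp add: B.cnorm_eq_0 B.minus_eq_zero_iff)
qed

end

section \<open>The Exel system\<close>

text \<open>The formulas for \<open>\<alpha>\<close> and \<open>L\<close> are given on elementary
  tensors. A matrix unit is one, its factors being indexed by the base \<open>n\<close> digits of
  row and column; linearity then reaches all matrices.\<close>

lemma mat_unit_elementary_tensor:
  assumes "r < n ^ k" "c < n ^ k"
  shows "\<exists>as. length as = k \<and> set as \<subseteq> carrier_mat n n \<and> elementary_tensor as = mat_unit (n ^ k) r c"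
  using assms
proof (induction k arbitrary: r c)
  case 0
  have "elementary_tensor [] = mat_unit (n ^ 0) r c"
    unfolding elementary_tensor_def using 0 by (intro eq_matI) auto
  then show ?case by (intro exI[of _ "[]"]) simp
next
  case (Suc k)
  have rc: "r < n * n ^ k" "c < n * n ^ k" using Suc.prems by simp_all
  note lt = div_less_of_less_mult[OF rc(1)] div_less_of_less_mult[OF rc(2)]
  obtain as where as: "length as = k" "set as \<subseteq> carrier_mat n n"
    "elementary_tensor as = mat_unit (n ^ k) (r mod n ^ k) (c mod n ^ k)"
    using Suc.IH lt by blast
  have "elementary_tensor (mat_unit n (r div n ^ k) (c div n ^ k) # as) = mat_unit (n ^ Suc k) r c"
    using as lt by (simp add: elementary_tensor_def kronecker_mat_unit div_mult_mod_eq[of r] div_mult_mod_eq[of c])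
  then show ?case
    using as by (intro exI[of _ "mat_unit n (r div n ^ k) (c div n ^ k) # as"]) simp
qed

lemma corner_projection_carrier [simp, intro]: "corner_projection n N \<in> carrier_mat n n"
  by (simp add: corner_projection_def)

lemma corner_projection_index [simp]:
  "i < n \<Longrightarrow> j < n \<Longrightarrow> corner_projection n N $$ (i, j) = (if i = j \<and> i < N then 1 else 0)"
  by (simp add: corner_projection_def)

lemma corner_mult_unit:
  assumes "i < n" "j < n"
  shows "corner_projection n N * mat_unit n i j = (if i < N then mat_unit n i j else 0\<^sub>m n n)"
    "mat_unit n i j * corner_projection n N = (if j < N then mat_unit n i j else 0\<^sub>m n n)"
proof -
  show "corner_projection n N * mat_unit n i j = (if i < N then mat_unit n i j else 0\<^sub>m n n)"
    by (rule eq_matI)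
      (use assms in \<open>auto simp: mat_unit_mult_right[of "corner_projection n N"] carrier_matD[OF corner_projection_carrier]
        simp del: index_mult_mat(1)\<close>)
  show "mat_unit n i j * corner_projection n N = (if j < N then mat_unit n i j else 0\<^sub>m n n)"
    by (rule eq_matI)
      (use assms in \<open>auto simp: mat_unit_mult_left[of "corner_projection n N"] carrier_matD[OF corner_projection_carrier]
        simp del: index_mult_mat(1)\<close>)
qed

lemma corner_trace_unit:
  assumes "i < n" "j < n" "N \<le> n"
  shows "corner_trace N (corner_projection n N * mat_unit n i j * corner_projection n N)
    = (if i = j \<and> i < N then 1 / of_nat N else 0)"
proof -
  have "corner_trace N (mat_unit n i j) = (if i = j \<and> i < N then 1 / of_nat N else 0)"
  proof -
    have "(\<Sum>k<N. mat_unit n i j $$ (k, k)) = (\<Sum>k<N. if k = i then (if i = j then 1 else 0) else 0)"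
      using assms by (intro sum.cong) auto
    then show ?thesis by (simp add: corner_trace_def)
  qed
  moreover have "corner_trace N (0\<^sub>m n n) = 0"
    using assms by (simp add: corner_trace_def)
  ultimately show ?thesis
    using assms by (auto simp: corner_mult_unit left_mult_zero_mat[OF corner_projection_carrier])
qed

locale exel_uhf = uhf +
  fixes N :: nat and \<alpha> L :: "'a \<Rightarrow> 'a" and M :: "('a, 'm) hilbert_bimodule" (structure) and q :: "'a \<Rightarrow> 'm"
  assumes N: "1 \<le> N" "N \<le> n"
    and exel: "exel_system A \<alpha> L"
    and \<alpha>_tensor: "set as \<subseteq> carrier_mat n n \<Longrightarrow> \<alpha> (\<iota> (length as) (elementary_tensor as))
      = \<iota> (Suc (length as)) (elementary_tensor (corner_projection n N # as))"
    and L_tensor: "\<lbrakk>a \<in> carrier_mat n n; set as \<subseteq> carrier_mat n n\<rbrakk> \<Longrightarrow>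
      L (\<iota> (Suc (length as)) (elementary_tensor (a # as)))
      = corner_trace N (corner_projection n N * a * corner_projection n N)
        \<odot>\<^bsub>A\<^esub> \<iota> (length as) (elementary_tensor as)"
    and bimodule: "exel_bimodule A \<alpha> L M q"
begin

abbreviation "p \<equiv> corner_projection n N"

lemma \<alpha>_hom: "\<alpha> \<in> star_hom A A" and L_linear: "L \<in> linear_maps A A"
  and L_positive: "a \<in> positive_elements A \<Longrightarrow> L a \<in> positive_elements A"
  and L_one: "L \<one>\<^bsub>A\<^esub> = \<one>\<^bsub>A\<^esub>"
  using exel by (auto simp: exel_system_def)

lemmas \<alpha>_hom' = star_homD[OF \<alpha>_hom]
lemmas L_linear' = linear_mapsD[OF L_linear]

lemma kron_linear:
  assumes "a \<in> carrier_mat n n"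
  shows "(\<lambda>b. \<iota> (Suc k) (kronecker a b)) \<in> linear_maps (matrix_algebra (n ^ k)) A"
proof (rule linear_mapsI)
  fix x assume "x \<in> carrier (matrix_algebra (n ^ k))"
  then have x: "x \<in> carrier_mat (n ^ k) (n ^ k)" by simp
  note ax = kronecker_level(2)[OF assms x]
  show "\<iota> (Suc k) (kronecker a x) \<in> carrier A" by (rule level_closed[OF ax])
  show "\<iota> (Suc k) (kronecker a (c \<odot>\<^bsub>matrix_algebra (n ^ k)\<^esub> x)) = c \<odot>\<^bsub>A\<^esub> \<iota> (Suc k) (kronecker a x)" for c
    using level_hom'(3)[OF ax] by (simp add: kronecker_scale_right[OF assms x])
  fix y assume "y \<in> carrier (matrix_algebra (n ^ k))"
  then have y: "y \<in> carrier_mat (n ^ k) (n ^ k)" by simp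
  show "\<iota> (Suc k) (kronecker a (x \<oplus>\<^bsub>matrix_algebra (n ^ k)\<^esub> y)) = \<iota> (Suc k) (kronecker a x) \<oplus>\<^bsub>A\<^esub> \<iota> (Suc k) (kronecker a y)"
    using level_hom'(2)[OF ax kronecker_level(2)[OF assms y]] by (simp add: kronecker_add_right[OF assms x y])
qed

lemma \<alpha>_level:
  assumes b: "b \<in> carrier_mat (n ^ k) (n ^ k)"
  shows "\<alpha> (\<iota> k b) = \<iota> (Suc k) (kronecker p b)"
proof (rule linear_map_mat_unitsI[OF A.complex_module_axioms _ kron_linear[OF corner_projection_carrier] _ b])
  show "(\<lambda>b. \<alpha> (\<iota> k b)) \<in> linear_maps (matrix_algebra (n ^ k)) A"
    by (rule linear_mapsI) (simp_all add: level_hom'(2,3) \<alpha>_hom')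
  fix r c assume "r < n ^ k" "c < n ^ k"
  then obtain as where "length as = k" "set as \<subseteq> carrier_mat n n" "elementary_tensor as = mat_unit (n ^ k) r c"
    using mat_unit_elementary_tensor by metis
  then show "\<alpha> (\<iota> k (mat_unit (n ^ k) r c)) = \<iota> (Suc k) (kronecker p (mat_unit (n ^ k) r c))"
    using \<alpha>_tensor[of as] by (simp add: elementary_tensor_def)
qed

lemma L_level:
  assumes a: "a \<in> carrier_mat n n" and b: "b \<in> carrier_mat (n ^ k) (n ^ k)"
  shows "L (\<iota> (Suc k) (kronecker a b)) = corner_trace N (p * a * p) \<odot>\<^bsub>A\<^esub> \<iota> k b"
proof (rule linear_map_mat_unitsI[OF A.complex_module_axioms _ _ _ b, where f = "\<lambda>b. L (\<iota> (Suc k) (kronecker a b))"])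
  show "(\<lambda>b. L (\<iota> (Suc k) (kronecker a b))) \<in> linear_maps (matrix_algebra (n ^ k)) A"
    using linear_mapsD[OF kron_linear[OF a], of _ k] by (intro linear_mapsI) (simp_all add: L_linear')
  show "(\<lambda>b. corner_trace N (p * a * p) \<odot>\<^bsub>A\<^esub> \<iota> k b) \<in> linear_maps (matrix_algebra (n ^ k)) A"
    by (rule linear_mapsI) (simp_all add: level_hom'(2,3) A.scale_right_add mult.commute)
  fix r c assume "r < n ^ k" "c < n ^ k"
  then obtain as where "length as = k" "set as \<subseteq> carrier_mat n n" "elementary_tensor as = mat_unit (n ^ k) r c"
    using mat_unit_elementary_tensor by metis
  then show "L (\<iota> (Suc k) (kronecker a (mat_unit (n ^ k) r c)))
      = corner_trace N (p * a * p) \<odot>\<^bsub>A\<^esub> \<iota> k (mat_unit (n ^ k) r c)"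
    using L_tensor[OF a, of as] by (simp add: elementary_tensor_def)
qed

section \<open>Matrix units in the first tensor factor\<close>

definition e :: "nat \<Rightarrow> nat \<Rightarrow> 'a" where
  "e i j = \<iota> 1 (mat_unit n i j)"

text \<open>The same element seen at an arbitrary positive level, for multiplication with elements
  of that level.\<close>

lemma e_eq: "e i j = \<iota> (Suc k) (kronecker (mat_unit n i j) (1\<^sub>m (n ^ k)))"
  using level_shift[of "mat_unit n i j" 1 k] by (simp add: e_def)

lemma e_closed [simp, intro]: "e i j \<in> carrier A"
  using level_closed[of "mat_unit n i j" 1] by (simp add: e_def)

lemma e_star [simp]: "(e i j)\<^sup>\<star>\<^bsub>A\<^esub> = e j i"
  using level_hom'(5)[of "mat_unit n i j" 1] by (simp add: e_def)

lemma e_mult: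
  assumes "i < n" "j < n" "k < n" "l < n"
  shows "e i j \<otimes>\<^bsub>A\<^esub> e k l = (if j = k then e i l else \<zero>\<^bsub>A\<^esub>)"
proof -
  have "\<iota> 1 (0\<^sub>m n n) = \<zero>\<^bsub>A\<^esub>"
    using level_hom'(3)[of "0\<^sub>m n n" 1 0] level_closed[of "0\<^sub>m n n" 1] by simp
  then show ?thesis
    using assms level_hom'(4)[of "mat_unit n i j" 1 "mat_unit n k l"]
    by (cases "j = k") (simp_all add: e_def mat_unit_mult)
qed

lemma level_kronecker_zero:
  assumes x: "x \<in> carrier_mat (n ^ h) (n ^ h)"
  shows "\<iota> (Suc h) (kronecker (0\<^sub>m n n) x) = \<zero>\<^bsub>A\<^esub>"
proof -
  have "kronecker (0\<^sub>m n n) x = 0 \<cdot>\<^sub>m kronecker (0\<^sub>m n n) x"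
    using x by (intro eq_matI) (auto simp: kronecker_index div_less_of_less_mult)
  then show ?thesis
    using level_hom'(3)[OF kronecker_level(2)[OF zero_carrier_mat x], of 0]
      level_closed[OF kronecker_level(2)[OF zero_carrier_mat x]] by simp
qed

lemma e_mult_level:
  assumes "i < n" "j < n" "k < n" "l < n" and b: "b \<in> carrier_mat (n ^ h) (n ^ h)"
  shows "e i j \<otimes>\<^bsub>A\<^esub> \<iota> (Suc h) (kronecker (mat_unit n k l) b)
      = (if j = k then \<iota> (Suc h) (kronecker (mat_unit n i l) b) else \<zero>\<^bsub>A\<^esub>)"
    "\<iota> (Suc h) (kronecker (mat_unit n k l) b) \<otimes>\<^bsub>A\<^esub> e i j
      = (if l = i then \<iota> (Suc h) (kronecker (mat_unit n k j) b) else \<zero>\<^bsub>A\<^esub>)"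
proof -
  note z = level_kronecker_zero[OF b]
  have kc: "kronecker (mat_unit n u v) c \<in> carrier_mat (n ^ Suc h) (n ^ Suc h)" if "c \<in> carrier_mat (n ^ h) (n ^ h)" for u v c
    using that by (intro kronecker_level) auto
  have km: "\<iota> (Suc h) (kronecker (mat_unit n u v) c) \<otimes>\<^bsub>A\<^esub> \<iota> (Suc h) (kronecker (mat_unit n u' v') c')
      = \<iota> (Suc h) (kronecker (mat_unit n u v * mat_unit n u' v') (c * c'))"
    if "c \<in> carrier_mat (n ^ h) (n ^ h)" "c' \<in> carrier_mat (n ^ h) (n ^ h)" for u v u' v' c c'
    using level_hom'(4)[OF kc[OF that(1), of u v] kc[OF that(2), of u' v']] that
    by (simp add: kronecker_mult[of _ n _ _ "n ^ h"])
  show "e i j \<otimes>\<^bsub>A\<^esub> \<iota> (Suc h) (kronecker (mat_unit n k l) b)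
      = (if j = k then \<iota> (Suc h) (kronecker (mat_unit n i l) b) else \<zero>\<^bsub>A\<^esub>)"
    unfolding e_eq[of i j h] km[OF one_carrier_mat b] using assms z by (simp add: mat_unit_mult)
  show "\<iota> (Suc h) (kronecker (mat_unit n k l) b) \<otimes>\<^bsub>A\<^esub> e i j
      = (if l = i then \<iota> (Suc h) (kronecker (mat_unit n k j) b) else \<zero>\<^bsub>A\<^esub>)"
    unfolding e_eq[of i j h] km[OF b one_carrier_mat] using assms z by (simp add: mat_unit_mult)
qed

text \<open>The endomorphism puts \<open>p\<close> into the first factor, and \<open>e_ij p\<close>
  is \<open>e_ij\<close> or zero according to \<open>j < N\<close>. This is what makes columns from
  \<open>N\<close> on disappear in the module and leaves \<open>n N\<close> basis vectors.\<close>

lemma mult_\<alpha>_level: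
  assumes "i < n" "j < n" and b: "b \<in> carrier_mat (n ^ h) (n ^ h)" and c: "c \<in> carrier_mat (n ^ h) (n ^ h)"
  shows "\<iota> (Suc h) (kronecker (mat_unit n i j) b) \<otimes>\<^bsub>A\<^esub> \<alpha> (\<iota> h c)
      = (if j < N then \<iota> (Suc h) (kronecker (mat_unit n i j) (b * c)) else \<zero>\<^bsub>A\<^esub>)"
proof -

  have "\<iota> (Suc h) (kronecker (mat_unit n i j) b) \<otimes>\<^bsub>A\<^esub> \<alpha> (\<iota> h c)
      = \<iota> (Suc h) (kronecker (mat_unit n i j) b * kronecker p c)"
    unfolding \<alpha>_level[OF c]
    by (rule level_hom'(4)[symmetric]) (use b c in \<open>auto intro!: kronecker_level\<close>)
  also have "kronecker (mat_unit n i j) b * kronecker p c = kronecker (mat_unit n i j * p) (b * c)"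
    using b c by (intro kronecker_mult) auto
  finally show ?thesis
    using assms level_kronecker_zero[of "b * c" h] by (simp add: corner_mult_unit)
qed

lemma e_mult_\<alpha>:
  assumes "i < n" "j < N" and c: "c \<in> carrier_mat (n ^ h) (n ^ h)"
  shows "e i j \<otimes>\<^bsub>A\<^esub> \<alpha> (\<iota> h c) = \<iota> (Suc h) (kronecker (mat_unit n i j) c)"
  unfolding e_eq[of i j h] using assms N mult_\<alpha>_level[of i j "1\<^sub>m (n ^ h)" h c] by simp

lemma L_unit_level:
  assumes "i < n" "j < n" and b: "b \<in> carrier_mat (n ^ h) (n ^ h)"
  shows "L (\<iota> (Suc h) (kronecker (mat_unit n i j) b)) = (if i = j \<and> i < N then (1 / of_nat N) \<odot>\<^bsub>A\<^esub> \<iota> h b else \<zero>\<^bsub>A\<^esub>)"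
  using assms N by (simp add: L_level corner_trace_unit)

text \<open>The transfer operator is contractive on positive elements up to a constant, since
  \<open>1 - s\<close> is positive for \<open>s = c\<^sup>\<star> c / (2 \<parallel>c\<parallel>\<^sup>2)\<close>.\<close>

lemma L_bounded:
  assumes c: "c \<in> carrier A"
  shows "cnorm A (L (c\<^sup>\<star>\<^bsub>A\<^esub> \<otimes>\<^bsub>A\<^esub> c)) \<le> 2 * (cnorm A c)\<^sup>2"
proof (cases "c = \<zero>\<^bsub>A\<^esub>")
  case True
  then show ?thesis
    using linear_maps_zero[OF A.complex_module_axioms A.complex_module_axioms L_linear] by simp
next
  case False
  then have pos: "0 < cnorm A c"
    using c A.cnorm_eq_0[OF c] A.cnorm_nonneg[OF c] by linarith
  \<comment> \<open>Chosen so that \<open>s\<close> has norm exactly one half, the largest norm that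
    the lemma on square roots admits.\<close>
  define R where "R = 2 * (cnorm A c)\<^sup>2"
  have R: "0 < R" using pos by (simp add: R_def)
  define d where "d = complex_of_real (sqrt (1 / R)) \<odot>\<^bsub>A\<^esub> c"
  define s where "s = d\<^sup>\<star>\<^bsub>A\<^esub> \<otimes>\<^bsub>A\<^esub> d"
  have d: "d \<in> carrier A" using c by (simp add: d_def)
  have s: "s = complex_of_real (1 / R) \<odot>\<^bsub>A\<^esub> (c\<^sup>\<star>\<^bsub>A\<^esub> \<otimes>\<^bsub>A\<^esub> c)"
  proof -
    have "complex_of_real (sqrt (1 / R)) * complex_of_real (sqrt (1 / R)) = complex_of_real (1 / R)"
      using R by (simp flip: of_real_mult)
    then show ?thesis using c by (simp add: s_def d_def del: of_real_divide)
  qed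
  have scl: "s \<in> carrier A" "s\<^sup>\<star>\<^bsub>A\<^esub> = s" using d by (auto simp: s_def A.star_mult)
  have cm: "cmod (complex_of_real (1 / R)) = 1 / R" using R by (simp only: norm_of_real) simp
  have "cnorm A s = 1 / R * (cnorm A c)\<^sup>2"
    unfolding s using c cm by (simp add: A.cnorm_smult A.cstar_identity del: of_real_divide)
  then have "cnorm A s \<le> 1 / 2" using pos by (simp add: R_def)
  then obtain b where b: "b \<in> carrier A" "b\<^sup>\<star>\<^bsub>A\<^esub> \<otimes>\<^bsub>A\<^esub> b = \<one>\<^bsub>A\<^esub> \<ominus>\<^bsub>A\<^esub> s"
    using A.square_root_exists[OF scl] by metis
  have "L (b\<^sup>\<star>\<^bsub>A\<^esub> \<otimes>\<^bsub>A\<^esub> b) \<in> positive_elements A" "L s \<in> positive_elements A"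
    unfolding s_def using b(1) d by (intro L_positive; unfold positive_elements_def; blast)+
  then obtain z w where zw: "z \<in> carrier A" "L (b\<^sup>\<star>\<^bsub>A\<^esub> \<otimes>\<^bsub>A\<^esub> b) = z\<^sup>\<star>\<^bsub>A\<^esub> \<otimes>\<^bsub>A\<^esub> z"
    "w \<in> carrier A" "L s = w\<^sup>\<star>\<^bsub>A\<^esub> \<otimes>\<^bsub>A\<^esub> w"
    by (auto simp: positive_elements_def)
  have "\<one>\<^bsub>A\<^esub> \<ominus>\<^bsub>A\<^esub> L s = L (b\<^sup>\<star>\<^bsub>A\<^esub> \<otimes>\<^bsub>A\<^esub> b)"
    unfolding b(2)
    using linear_maps_minus[OF A.complex_module_axioms A.complex_module_axioms L_linear A.one_closed scl(1)]
    by (simp add: L_one)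
  \<comment> \<open>The unit is the sum of \<open>L s\<close> and \<open>L (1 - s)\<close>, both
    positive, so monotonicity of the norm bounds the first summand.\<close>
  then have "\<one>\<^bsub>A\<^esub> = w\<^sup>\<star>\<^bsub>A\<^esub> \<otimes>\<^bsub>A\<^esub> w \<oplus>\<^bsub>A\<^esub> z\<^sup>\<star>\<^bsub>A\<^esub> \<otimes>\<^bsub>A\<^esub> z"
    using zw by (metis A.M.a_comm A.minus_add_cancel A.mult_closed A.one_closed A.star_closed)
  then have "cnorm A (L s) \<le> cnorm A \<one>\<^bsub>A\<^esub>"
    using positive_mono[OF zw(3,1)] zw(4) by simp
  also have "\<dots> \<le> 1" by (rule A.cnorm_one_le)
  finally have "1 / R * cnorm A (L (c\<^sup>\<star>\<^bsub>A\<^esub> \<otimes>\<^bsub>A\<^esub> c)) \<le> 1"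
    unfolding s using c cm L_linear'(3)[of "c\<^sup>\<star>\<^bsub>A\<^esub> \<otimes>\<^bsub>A\<^esub> c"] L_linear'(1)
    by (simp add: A.cnorm_smult del: of_real_divide)
  then show ?thesis using R by (simp add: R_def field_simps)
qed

section \<open>The orthonormal basis of the module\<close>

lemma q_linear: "q \<in> linear_maps A M"
  and q_ract: "\<lbrakk>a \<in> carrier A; b \<in> carrier A\<rbrakk> \<Longrightarrow> q a \<triangleleft> b = q (a \<otimes>\<^bsub>A\<^esub> \<alpha> b)"
  and q_lact: "\<lbrakk>a \<in> carrier A; b \<in> carrier A\<rbrakk> \<Longrightarrow> a \<triangleright> q b = q (a \<otimes>\<^bsub>A\<^esub> b)"
  and q_inprod: "\<lbrakk>a \<in> carrier A; b \<in> carrier A\<rbrakk> \<Longrightarrow> \<langle>q a, q b\<rangle> = L (a\<^sup>\<star>\<^bsub>A\<^esub> \<otimes>\<^bsub>A\<^esub> b)"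
  and q_dense: "Metric_space.mtopology (carrier M) (hdist A M) closure_of (q ` carrier A) = carrier M"
  and M_bimodule: "right_hilbert_bimodule A M"
  using bimodule by (auto simp: exel_bimodule_def)

lemmas q_linear' = linear_mapsD[OF q_linear]

sublocale H: monotone_hilbert_module A M
proof -
  interpret right_hilbert_module A M
    using M_bimodule by (simp add: right_hilbert_bimodule_def)
  show "monotone_hilbert_module A M"
    by unfold_locales (rule positive_mono)
qed

text \<open>The factor \<open>sqrt 2\<close> is rounded up; the point is that \<open>q\<close> is
  continuous, so that density of the levels passes to the module.\<close>

lemma hnorm_q_le: "c \<in> carrier A \<Longrightarrow> hnorm A M (q c) \<le> 2 * cnorm A c"
proof -
  assume c: "c \<in> carrier A"
  have "(hnorm A M (q c))\<^sup>2 \<le> 2 * (cnorm A c)\<^sup>2"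
    using c L_bounded[OF c] by (simp add: H.hnorm_square q_inprod q_linear')
  also have "\<dots> \<le> (2 * cnorm A c)\<^sup>2" by (simp add: power2_eq_square)
  finally show ?thesis by (rule power2_le_imp_le) (use c in simp)
qed

text \<open>The square root compensates the normalised trace: for \<open>j < N\<close> the inner
  square of \<open>q (e i j)\<close> is \<open>L (e j j) = 1 / N\<close>.\<close>

definition basis :: "nat \<times> nat \<Rightarrow> 'm" where
  "basis = (\<lambda>(i, j). q (complex_of_real (sqrt (real N)) \<odot>\<^bsub>A\<^esub> e i j))"

abbreviation "I \<equiv> {..<n} \<times> {..<N}"

lemma sqrt_N: "complex_of_real (sqrt (real N)) * complex_of_real (sqrt (real N)) = of_nat N"
  by (metis of_real_mult of_real_of_nat_eq real_sqrt_mult_self abs_of_nat)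

lemma L_e: "i < n \<Longrightarrow> j < n \<Longrightarrow> L (e i j) = (if i = j \<and> i < N then (1 / of_nat N) \<odot>\<^bsub>A\<^esub> \<one>\<^bsub>A\<^esub> else \<zero>\<^bsub>A\<^esub>)"
  using L_unit_level[of i j "1\<^sub>m (n ^ 0)" 0] level_one[of 0] by (simp add: e_eq[of i j 0])

sublocale H: orthonormal_system A M I basis
proof
  fix x y assume "x \<in> I" "y \<in> I"
  moreover obtain i j where x: "x = (i, j)" by fastforce
  moreover obtain k l where y: "y = (k, l)" by fastforce
  ultimately have lt: "i < n" "j < N" "k < n" "l < N" by auto
  then have lt': "j < n" "l < n" using N by auto
  have "\<langle>basis x, basis y\<rangle> = of_nat N \<odot>\<^bsub>A\<^esub> L (e j i \<otimes>\<^bsub>A\<^esub> e k l)"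
    by (simp add: basis_def x y q_inprod L_linear' sqrt_N)
  also have "\<dots> = (if x = y then \<one>\<^bsub>A\<^esub> else \<zero>\<^bsub>A\<^esub>)"
    using lt lt' N linear_maps_zero[OF A.complex_module_axioms A.complex_module_axioms L_linear]
    by (auto simp: e_mult L_e x y)
  finally show "\<langle>basis x, basis y\<rangle> = (if x = y then \<one>\<^bsub>A\<^esub> else \<zero>\<^bsub>A\<^esub>)" .
qed (auto simp: basis_def q_linear')

lemma basis_ract:
  assumes "i < n" "j < N" and b: "b \<in> carrier_mat (n ^ h) (n ^ h)"
  shows "basis (i, j) \<triangleleft> \<iota> h b = complex_of_real (sqrt (real N)) \<odot> q (\<iota> (Suc h) (kronecker (mat_unit n i j) b))"
proof -
  have "\<iota> (Suc h) (kronecker (mat_unit n i j) b) \<in> carrier A"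
    using b by (intro level_closed kronecker_level) auto
  then show ?thesis
    using assms level_closed[OF b] \<alpha>_hom'(1)
    by (simp add: basis_def q_linear'(1,3) H.ract_smult_left q_ract e_mult_\<alpha>)
qed

lemma basis_lact:
  assumes "i < n" "l < n" "i' < n" "j < N" and b: "b \<in> carrier_mat (n ^ h) (n ^ h)"
  shows "\<iota> (Suc h) (kronecker (mat_unit n i l) b) \<triangleright> basis (i', j)
    = (if l = i' then basis (i, j) \<triangleleft> \<iota> h b else \<zero>)"
proof -
  have kc: "\<iota> (Suc h) (kronecker (mat_unit n u v) b) \<in> carrier A" for u v
    using b by (intro level_closed kronecker_level) auto
  have q0: "q \<zero>\<^bsub>A\<^esub> = \<zero>"
    by (rule linear_maps_zero[OF A.complex_module_axioms H.MM.complex_module_axioms q_linear])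
  have "\<iota> (Suc h) (kronecker (mat_unit n i l) b) \<triangleright> basis (i', j)
      = q (complex_of_real (sqrt (real N)) \<odot>\<^bsub>A\<^esub> (\<iota> (Suc h) (kronecker (mat_unit n i l) b) \<otimes>\<^bsub>A\<^esub> e i' j))"
    using kc by (simp add: basis_def q_lact)
  also have "\<dots> = (if l = i' then basis (i, j) \<triangleleft> \<iota> h b else \<zero>)"
    using assms N kc q0 basis_ract[of i j b h] by (simp add: e_mult_level q_linear'(3))
  finally show ?thesis .
qed

text \<open>For \<open>l < N\<close> only the coefficient at \<open>(i, l)\<close> can be present,
  and it is \<open>(sqrt N / N) b\<close>. For \<open>l \<ge> N\<close> all coefficients vanish, and
  so does the vector.\<close>

lemma project_q_level:
  assumes "i < n" "l < n" and b: "b \<in> carrier_mat (n ^ h) (n ^ h)"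
  shows "H.project (q (\<iota> (Suc h) (kronecker (mat_unit n i l) b))) = q (\<iota> (Suc h) (kronecker (mat_unit n i l) b))"
proof -
  define y where "y = \<iota> (Suc h) (kronecker (mat_unit n i l) b)"
  let ?s = "complex_of_real (sqrt (real N))"
  have kc: "\<iota> (Suc h) (kronecker (mat_unit n u v) b) \<in> carrier A" for u v
    using b by (intro level_closed kronecker_level) auto
  have y: "y \<in> carrier A" using kc by (simp add: y_def)
  have q0: "q \<zero>\<^bsub>A\<^esub> = \<zero>" "L \<zero>\<^bsub>A\<^esub> = \<zero>\<^bsub>A\<^esub>"
    using linear_maps_zero[OF A.complex_module_axioms H.MM.complex_module_axioms q_linear]
      linear_maps_zero[OF A.complex_module_axioms A.complex_module_axioms L_linear] by auto
  have coeff: "\<langle>basis (u, v), q y\<rangle> = (if u = i \<and> v = l then (?s / of_nat N) \<odot>\<^bsub>A\<^esub> \<iota> h b else \<zero>\<^bsub>A\<^esub>)"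
    if "u < n" "v < N" for u v
    using that assms N y kc[of v l] q0 unfolding y_def
    by (simp add: basis_def q_inprod L_linear' e_mult_level L_unit_level)
  have trm: "basis (u, v) \<triangleleft> \<langle>basis (u, v), q y\<rangle> = (if u = i \<and> v = l then q y else \<zero>)"
    if "u < n" "v < N" for u v
  proof (cases "u = i \<and> v = l")
    case True
    have one: "?s / of_nat N * ?s = 1" using sqrt_N N by simp
    have il: "i < n" "l < N" using True that by auto
    have "basis (i, l) \<triangleleft> \<langle>basis (i, l), q y\<rangle> = (?s / of_nat N) \<odot> (basis (i, l) \<triangleleft> \<iota> h b)"
      using il b H.basis_closed[of "(i, l)"] coeff[OF il] by (simp add: H.ract_smult_right)
    also have "\<dots> = (?s / of_nat N * ?s) \<odot> q y"
      using il b y q_linear'(1) by (simp add: basis_ract flip: y_def)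
    also have "\<dots> = q y" unfolding one using y q_linear'(1) by simp
    finally show ?thesis using True by simp
  next
    case False
    have "\<langle>basis (u, v), q y\<rangle> = \<zero>\<^bsub>A\<^esub>" using coeff[OF that] unfolding if_not_P[OF False] .
    then show ?thesis unfolding if_not_P[OF False] using that H.basis_closed[of "(u, v)"] by simp
  qed
  have "H.project (q y) = q y"
  proof (cases "l < N")
    case True
    have "H.project (q y) = basis (i, l) \<triangleleft> \<langle>basis (i, l), q y\<rangle>"
      unfolding H.project_def
      by (rule H.MM.sum_single) (use True assms trm y q_linear' in \<open>auto split: if_splits\<close>)
    then show ?thesis using trm[of i l] True assms by simp
  next
    case False
    have "H.project (q y) = \<zero>"
      unfolding H.project_def by (rule H.MM.sum_neutral) (use False trm in auto)
    \<comment> \<open>Acting with the unit of \<open>A\<close> from the right changes nothing in the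
      module, yet it multiplies \<open>y\<close> by \<open>\<alpha> 1\<close>, which kills the
      columns from \<open>N\<close> on.\<close>
    moreover have "q y = \<zero>"
    proof -
      have "y \<otimes>\<^bsub>A\<^esub> \<alpha> \<one>\<^bsub>A\<^esub> = \<zero>\<^bsub>A\<^esub>"
        using mult_\<alpha>_level[OF assms one_carrier_mat] False by (simp add: level_one y_def)
      then have "q y \<triangleleft> \<one>\<^bsub>A\<^esub> = \<zero>" using y q0 by (simp add: q_ract)
      then show ?thesis using H.ract_one[OF A.unital_cstar_algebra_axioms] y q_linear' by simp
    qed
    ultimately show ?thesis by simp
  qed
  then show ?thesis by (simp add: y_def)
qed

lemma unit_kronecker:
  assumes "r < n ^ Suc k" "c < n ^ Suc k"
  shows "mat_unit (n ^ Suc k) r c = kronecker (mat_unit n (r div n ^ k) (c div n ^ k)) (mat_unit (n ^ k) (r mod n ^ k) (c mod n ^ k))"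
    "r div n ^ k < n" "c div n ^ k < n" "r mod n ^ k < n ^ k" "c mod n ^ k < n ^ k"
proof -
  have rc: "r < n * n ^ k" "c < n * n ^ k" using assms by simp_all
  note lt = div_less_of_less_mult[OF rc(1)] div_less_of_less_mult[OF rc(2)]
  show "r div n ^ k < n" "c div n ^ k < n" "r mod n ^ k < n ^ k" "c mod n ^ k < n ^ k" using lt by auto
  show "mat_unit (n ^ Suc k) r c = kronecker (mat_unit n (r div n ^ k) (c div n ^ k)) (mat_unit (n ^ k) (r mod n ^ k) (c mod n ^ k))"
    using lt by (simp add: kronecker_mat_unit div_mult_mod_eq[of r] div_mult_mod_eq[of c])
qed

lemma project_q:
  assumes c: "c \<in> carrier A"
  shows "H.project (q c) = q c"
proof (rule H.project_eq_of_approx)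
  show "q c \<in> carrier M" using c q_linear' by simp
  fix t :: real assume "0 < t"
  then obtain k x where x: "x \<in> carrier_mat (n ^ Suc k) (n ^ Suc k)" "cnorm A (c \<ominus>\<^bsub>A\<^esub> \<iota> (Suc k) x) < t / 2"
    using approx[OF c, of "t / 2"] by (metis half_gt_zero)
  have d: "\<iota> (Suc k) x \<in> carrier A" by (rule level_closed[OF x(1)])
  have "H.project (q (\<iota> (Suc k) x)) = q (\<iota> (Suc k) x)"
  proof (rule linear_map_mat_unitsI[OF H.MM.complex_module_axioms _ _ _ x(1),
        where f = "\<lambda>x. H.project (q (\<iota> (Suc k) x))" and g = "\<lambda>x. q (\<iota> (Suc k) x)"])
    show lin: "(\<lambda>x. q (\<iota> (Suc k) x)) \<in> linear_maps (matrix_algebra (n ^ Suc k)) M"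
      by (intro linear_mapsI; simp add: q_linear' level_hom'(2,3) level_closed del: power_Suc)
    show "(\<lambda>x. H.project (q (\<iota> (Suc k) x))) \<in> linear_maps (matrix_algebra (n ^ Suc k)) M"
      using linear_mapsD[OF lin] linear_mapsD[OF H.project_linear] by (intro linear_mapsI) (simp_all del: power_Suc)
    show "H.project (q (\<iota> (Suc k) (mat_unit (n ^ Suc k) r c))) = q (\<iota> (Suc k) (mat_unit (n ^ Suc k) r c))"
      if "r < n ^ Suc k" "c < n ^ Suc k" for r c
      unfolding unit_kronecker(1)[OF that] by (rule project_q_level) (use unit_kronecker[OF that] in auto)
  qed
  moreover have "hnorm A M (q c \<ominus> q (\<iota> (Suc k) x)) < t"
    using hnorm_q_le[of "c \<ominus>\<^bsub>A\<^esub> \<iota> (Suc k) x"] c d x(2)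
      linear_maps_minus[OF A.complex_module_axioms H.MM.complex_module_axioms q_linear c d] by simp
  ultimately show "\<exists>y\<in>carrier M. H.project y = y \<and> hnorm A M (q c \<ominus> y) < t"
    using d q_linear'(1) by blast
qed

text \<open>The fixed points of the projection are closed and contain the dense image of
  \<open>q\<close>, so the orthonormal system spans the whole module.\<close>

sublocale H: hilbert_bimodule_basis A M I basis
proof unfold_locales
  show "right_hilbert_bimodule A M" by (rule M_bimodule)
  show "\<one>\<^bsub>A\<^esub> \<triangleright> basis x = basis x" if "x \<in> I" for x
    by (auto simp: basis_def q_lact split: prod.split)
  show "H.project x = x" if x: "x \<in> carrier M" for x
  proof (rule H.project_eq_of_approx[OF x])
    fix t :: real assume t: "0 < t"
    have "x \<in> H.hmetric.mtopology closure_of (q ` carrier A)" using x q_dense by simp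
    then obtain y where "y \<in> q ` carrier A" "y \<in> H.hmetric.mball x t"
      using t by (auto simp: H.hmetric.metric_closure_of)
    then show "\<exists>y\<in>carrier M. H.project y = y \<and> hnorm A M (x \<ominus> y) < t"
      using project_q by (auto simp: hdist_def split: if_splits)
  qed
qed

text \<open>Because \<open>N\<close> is at least one, \<open>e i 0\<close> is unchanged by
  \<open>\<alpha> 1\<close>, and \<open>a e_ii = (a e_i0) \<alpha>(1) e_0i\<close>. Summing over
  \<open>i\<close> puts every \<open>a\<close> into the algebraic span already.\<close>

lemma exel_ideal_eq: "exel_ideal A \<alpha> M = carrier A"
proof -
  let ?S = "{a \<otimes>\<^bsub>A\<^esub> \<alpha> b \<otimes>\<^bsub>A\<^esub> c | a b c. a \<in> carrier A \<and> b \<in> carrier A \<and> c \<in> carrier A}"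
  have n0: "0 < n" "0 < N" using two_le N by auto
  have e1: "e i 0 \<otimes>\<^bsub>A\<^esub> \<alpha> \<one>\<^bsub>A\<^esub> = e i 0" if "i < n" for i
    using e_mult_\<alpha>[OF that n0(2) one_carrier_mat, of 0] by (simp only: level_one e_eq[of i 0 0, symmetric])
  have "finsum A (\<lambda>i. e i i) {..<n} = \<one>\<^bsub>A\<^esub>"
  proof -
    have "\<iota> 1 (1\<^sub>m (n ^ 1)) = finsum A (\<lambda>r. finsum A (\<lambda>c. 1\<^sub>m (n ^ 1) $$ (r, c) \<odot>\<^bsub>A\<^esub> \<iota> 1 (mat_unit (n ^ 1) r c)) {..<n ^ 1}) {..<n ^ 1}"
      by (rule linear_map_mat_units[OF A.complex_module_axioms level_linear]) simp
    also have "\<dots> = finsum A (\<lambda>i. e i i) {..<n}"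
    proof (intro A.sum_cong)
      fix i assume i: "i \<in> {..<n}"
      have "finsum A (\<lambda>c. 1\<^sub>m (n ^ 1) $$ (i, c) \<odot>\<^bsub>A\<^esub> \<iota> 1 (mat_unit (n ^ 1) i c)) {..<n ^ 1}
          = 1\<^sub>m (n ^ 1) $$ (i, i) \<odot>\<^bsub>A\<^esub> \<iota> 1 (mat_unit (n ^ 1) i i)"
        using i e_closed by (intro A.sum_single) (auto simp: e_def)
      then show "finsum A (\<lambda>c. 1\<^sub>m (n ^ 1) $$ (i, c) \<odot>\<^bsub>A\<^esub> \<iota> 1 (mat_unit (n ^ 1) i c)) {..<n ^ 1} = e i i"
        using i e_closed[of i i] by (simp add: e_def)
    qed auto
    finally show ?thesis using level_one[of 1] by simp
  qed
  have "carrier A \<subseteq> closed_span A ?S"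
    unfolding closed_span_def
  proof (intro subsetI InterI)
    fix a V assume a: "a \<in> carrier A"
      and "V \<in> {V. Module.submodule V \<CC> A \<and> closedin (norm_topology A) V \<and> ?S \<subseteq> V}"
    then have V: "Module.submodule V \<CC> A" and SV: "?S \<subseteq> V" by auto
    note sub = A.submoduleE[OF V]
    have gen: "a \<otimes>\<^bsub>A\<^esub> e i i \<in> V" if "i < n" for i
    proof -
      have "a \<otimes>\<^bsub>A\<^esub> e i i = (a \<otimes>\<^bsub>A\<^esub> e i 0) \<otimes>\<^bsub>A\<^esub> \<alpha> \<one>\<^bsub>A\<^esub> \<otimes>\<^bsub>A\<^esub> e 0 i"
      proof -
        have "(a \<otimes>\<^bsub>A\<^esub> e i 0) \<otimes>\<^bsub>A\<^esub> \<alpha> \<one>\<^bsub>A\<^esub> = a \<otimes>\<^bsub>A\<^esub> e i 0"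
          using a \<alpha>_hom'(1)[OF A.one_closed] e1[OF that] by (simp add: A.mult_assoc)
        moreover have "(a \<otimes>\<^bsub>A\<^esub> e i 0) \<otimes>\<^bsub>A\<^esub> e 0 i = a \<otimes>\<^bsub>A\<^esub> e i i"
          using a that n0 by (simp add: A.mult_assoc e_mult)
        ultimately show ?thesis by simp
      qed
      then show ?thesis using SV a e_closed A.one_closed by blast
    qed
    have "finsum A (\<lambda>i. a \<otimes>\<^bsub>A\<^esub> e i i) J \<in> V" if "finite J" "J \<subseteq> {..<n}" for J
      using that
    proof (induction J)
      case empty
      then show ?case using subgroup.one_closed[OF Module.submodule.axioms(1)[OF V]] by simp
    next
      case (insert i J)
      then show ?case using a sub(5) gen by (simp add: A.sum_insert)
    qed
    then have "finsum A (\<lambda>i. a \<otimes>\<^bsub>A\<^esub> e i i) {..<n} \<in> V" by simp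
    also have "finsum A (\<lambda>i. a \<otimes>\<^bsub>A\<^esub> e i i) {..<n} = a \<otimes>\<^bsub>A\<^esub> finsum A (\<lambda>i. e i i) {..<n}"
      using a by (simp add: A.mult_sum_right)
    finally show "a \<in> V" using a \<open>finsum A (\<lambda>i. e i i) {..<n} = \<one>\<^bsub>A\<^esub>\<close> by simp
  qed
  then show ?thesis
    unfolding exel_ideal_def H.compact_ideal_eq by blast
qed

end

section \<open>The representation in the Cuntz algebra\<close>

context exel_uhf
begin

lemma lact_one_all: "x \<in> carrier M \<Longrightarrow> \<one>\<^bsub>A\<^esub> \<triangleright> x = x"
proof -
  assume x: "x \<in> carrier M"
  have "\<one>\<^bsub>A\<^esub> \<triangleright> x = finsum M (\<lambda>i. (\<one>\<^bsub>A\<^esub> \<triangleright> basis i) \<triangleleft> \<langle>basis i, x\<rangle>) I"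
    using H.adjointable_expand[OF star_homD(1)[OF H.left_operator_hom A.one_closed] x] x
    by (simp add: H.left_operator_apply cong: H.MM.sum_cong)
  also have "\<dots> = H.project x"
    unfolding H.project_def using x by (intro H.MM.sum_cong refl) (auto simp: H.lact_one)
  finally show "\<one>\<^bsub>A\<^esub> \<triangleright> x = x" using x by (simp add: H.expand)
qed

text \<open>Write \<open>\<pi> a = \<pi> a \<pi> 1\<close> and replace \<open>\<pi> 1\<close> by the
  sum over the basis. For \<open>a = e_il \<otimes> b\<close> only the vectors \<open>m_lj\<close>
  survive, and they become \<open>m_ij b\<close>. So the isometries determine \<open>\<pi>\<close>
  level by level, and the recursion defining \<open>F\<close> is read off from this formula.\<close>

lemma covariant_unit_Suc:
  assumes B: "cstar_algebra B" and cov: "covariant_on (carrier A) A M B \<psi> \<pi>"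
    and rc: "r < n ^ Suc k" "c < n ^ Suc k"
  shows "\<pi> (\<iota> (Suc k) (mat_unit (n ^ Suc k) r c)) = finsum B (\<lambda>j. \<psi> (basis (r div n ^ k, j))
      \<otimes>\<^bsub>B\<^esub> \<pi> (\<iota> k (mat_unit (n ^ k) (r mod n ^ k) (c mod n ^ k))) \<otimes>\<^bsub>B\<^esub> (\<psi> (basis (c div n ^ k, j)))\<^sup>\<star>\<^bsub>B\<^esub>) {..<N}"
proof -
  interpret B: cstar_algebra B by fact
  have rep: "representation A M B \<psi> \<pi>" and one: "\<pi> \<one>\<^bsub>A\<^esub> = finsum B (\<lambda>i. \<psi> (basis i) \<otimes>\<^bsub>B\<^esub> (\<psi> (basis i))\<^sup>\<star>\<^bsub>B\<^esub>) I"
    using cov H.covariant_iff[OF B] by auto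
  note rep' = representationD[OF rep]
  have cl: "\<psi> x \<in> carrier B" if "x \<in> carrier M" for x using rep'(1) that by (simp add: linear_mapsD)
  have picl: "\<pi> a \<in> carrier B" if "a \<in> carrier A" for a using rep'(2) that by (simp add: star_homD)
  define i where "i = r div n ^ k"
  define l where "l = c div n ^ k"
  define b where "b = mat_unit (n ^ k) (r mod n ^ k) (c mod n ^ k)"
  note uk = unit_kronecker[OF rc, folded i_def l_def b_def]
  have b: "b \<in> carrier_mat (n ^ k) (n ^ k)" by (simp add: b_def)
  define a where "a = \<iota> (Suc k) (kronecker (mat_unit n i l) b)"
  have a: "a \<in> carrier A" unfolding a_def using b by (intro level_closed kronecker_level) auto
  have bcl: "basis (u, j) \<in> carrier M" if "u < n" "j < N" for u j using that by (intro H.basis_closed) simp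
  have "\<pi> a = \<pi> a \<otimes>\<^bsub>B\<^esub> \<pi> \<one>\<^bsub>A\<^esub>"
    using a star_homD(4)[OF rep'(2) a A.one_closed] by simp
  also have "\<dots> = finsum B (\<lambda>x. \<psi> (a \<triangleright> basis x) \<otimes>\<^bsub>B\<^esub> (\<psi> (basis x))\<^sup>\<star>\<^bsub>B\<^esub>) I"
    unfolding one using a cl picl
    by (subst B.mult_sum_right) (auto intro!: B.sum_cong simp: rep'(5) B.mult_assoc)
  also have "\<dots> = finsum B (\<lambda>u. finsum B (\<lambda>j. \<psi> (a \<triangleright> basis (u, j)) \<otimes>\<^bsub>B\<^esub> (\<psi> (basis (u, j)))\<^sup>\<star>\<^bsub>B\<^esub>) {..<N}) {..<n}"
    using a cl bcl by (intro B.sum_product) auto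
  also have "\<dots> = finsum B (\<lambda>j. \<psi> (a \<triangleright> basis (l, j)) \<otimes>\<^bsub>B\<^esub> (\<psi> (basis (l, j)))\<^sup>\<star>\<^bsub>B\<^esub>) {..<N}"
  proof (rule B.sum_single)
    fix u assume u: "u \<in> {..<n}" "u \<noteq> l"
    then show "finsum B (\<lambda>j. \<psi> (a \<triangleright> basis (u, j)) \<otimes>\<^bsub>B\<^esub> (\<psi> (basis (u, j)))\<^sup>\<star>\<^bsub>B\<^esub>) {..<N} = \<zero>\<^bsub>B\<^esub>"
      using uk b cl bcl linear_maps_zero[OF H.MM.complex_module_axioms B.complex_module_axioms rep'(1)]
      by (intro B.sum_neutral) (simp add: a_def basis_lact)
  qed (use uk a cl bcl in auto)
  also have "\<dots> = finsum B (\<lambda>j. \<psi> (basis (i, j)) \<otimes>\<^bsub>B\<^esub> \<pi> (\<iota> k b) \<otimes>\<^bsub>B\<^esub> (\<psi> (basis (l, j)))\<^sup>\<star>\<^bsub>B\<^esub>) {..<N}"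
    using uk b cl bcl picl level_closed[OF b]
    by (intro B.sum_cong refl) (auto simp: a_def basis_lact rep'(3))
  finally show ?thesis
    by (simp only: a_def uk(1) i_def l_def b_def)
qed

end

locale cuntz_rep = exel_uhf + C: unital_cstar_algebra C for C :: "'c cstar" +
  fixes s :: "nat \<Rightarrow> 'c"
  assumes family: "cuntz_family (n * N) C s"
begin

section \<open>The Cuntz isometries indexed by pairs, and matrix units built from them\<close>

definition S :: "nat \<times> nat \<Rightarrow> 'c" where
  "S x = s (fst x * N + snd x)"

lemma index_less: "i < n \<Longrightarrow> j < N \<Longrightarrow> i * N + j < n * N"
proof -
  assume "i < n" "j < N"
  then have "i * N + j < Suc i * N" by simp
  also have "\<dots> \<le> n * N" using \<open>i < n\<close> by (intro mult_right_mono) auto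
  finally show ?thesis .
qed

lemma index_image: "(\<lambda>x. fst x * N + snd x) ` I = {..<n * N}"
proof
  show "(\<lambda>x. fst x * N + snd x) ` I \<subseteq> {..<n * N}" using index_less by auto
  show "{..<n * N} \<subseteq> (\<lambda>x. fst x * N + snd x) ` I"
  proof
    fix a assume "a \<in> {..<n * N}"
    then have "(a div N, a mod N) \<in> I" "a = fst (a div N, a mod N) * N + snd (a div N, a mod N)"
      using div_less_of_less_mult[of a n N] by auto
    then show "a \<in> (\<lambda>x. fst x * N + snd x) ` I" by blast
  qed
qed

lemma index_inj: "inj_on (\<lambda>x. fst x * N + snd x) I"
proof (rule inj_onI)
  fix x y :: "nat \<times> nat" assume xy: "x \<in> I" "y \<in> I" "fst x * N + snd x = fst y * N + snd y"
  have "(fst z * N + snd z) div N = fst z" "(fst z * N + snd z) mod N = snd z" if "z \<in> I" for z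
    using that by auto
  then show "x = y" using xy by (metis prod_eqI)
qed

lemma S_closed [simp, intro]: "x \<in> I \<Longrightarrow> S x \<in> carrier C"
  using family index_less by (auto simp: S_def cuntz_family_def)

lemma S_orthogonal:
  assumes "x \<in> I" "y \<in> I"
  shows "(S x)\<^sup>\<star>\<^bsub>C\<^esub> \<otimes>\<^bsub>C\<^esub> S y = (if x = y then \<one>\<^bsub>C\<^esub> else \<zero>\<^bsub>C\<^esub>)"
proof -
  have lt: "fst x * N + snd x < n * N" "fst y * N + snd y < n * N"
    using assms index_less by auto
  show ?thesis
  proof (cases "x = y")
    case True
    then show ?thesis using family lt by (simp add: S_def cuntz_family_def)
  next
    case False
    then have "fst x * N + snd x \<noteq> fst y * N + snd y" using index_inj assms by (auto dest: inj_onD)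
    then show ?thesis
      using C.cuntz_family_orthogonal[OF family lt(2,1)] False by (simp add: S_def)
  qed
qed

lemma S_sum: "finsum C (\<lambda>x. S x \<otimes>\<^bsub>C\<^esub> (S x)\<^sup>\<star>\<^bsub>C\<^esub>) I = \<one>\<^bsub>C\<^esub>"
proof -
  have "\<one>\<^bsub>C\<^esub> = finsum C (\<lambda>a. s a \<otimes>\<^bsub>C\<^esub> (s a)\<^sup>\<star>\<^bsub>C\<^esub>) ((\<lambda>x. fst x * N + snd x) ` I)"
    using family by (simp add: cuntz_family_def index_image)
  also have "\<dots> = finsum C (\<lambda>x. S x \<otimes>\<^bsub>C\<^esub> (S x)\<^sup>\<star>\<^bsub>C\<^esub>) I"
    unfolding S_def using index_inj S_closed unfolding S_def by (intro C.sum_reindex) auto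
  finally show ?thesis ..
qed

text \<open>The images of the matrix units of \<open>M\<^sub>n\<^sup>\<otimes>\<^sup>k\<close>.\<close>

primrec F :: "nat \<Rightarrow> nat \<Rightarrow> nat \<Rightarrow> 'c" where
  "F 0 r c = \<one>\<^bsub>C\<^esub>"
| "F (Suc k) r c = finsum C (\<lambda>j. S (r div n ^ k, j) \<otimes>\<^bsub>C\<^esub> F k (r mod n ^ k) (c mod n ^ k)
      \<otimes>\<^bsub>C\<^esub> (S (c div n ^ k, j))\<^sup>\<star>\<^bsub>C\<^esub>) {..<N}"

lemma F_closed [simp, intro]: "r < n ^ k \<Longrightarrow> c < n ^ k \<Longrightarrow> F k r c \<in> carrier C"
proof (induction k arbitrary: r c)
  case (Suc k)
  then show ?case using unit_kronecker(2-)[OF Suc.prems] by (auto simp del: power_Suc)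
qed simp

lemma F_star: "r < n ^ k \<Longrightarrow> c < n ^ k \<Longrightarrow> (F k r c)\<^sup>\<star>\<^bsub>C\<^esub> = F k c r"
proof (induction k arbitrary: r c)
  case (Suc k)
  note lt = unit_kronecker(2-)[OF Suc.prems]
  show ?case
    using lt Suc.IH F_closed[OF lt(3,4)]
    by (simp del: power_Suc, subst C.star_sum)
      (auto intro!: C.sum_cong simp: C.star_mult C.mult_assoc simp del: power_Suc)
qed simp

text \<open>Orthogonality of the isometries makes the double sum diagonal in \<open>j\<close> and
  compares the leading digits of \<open>c\<close> and \<open>u\<close>; the induction hypothesis
  treats the remaining digits.\<close>

lemma F_mult:
  "\<lbrakk>r < n ^ k; c < n ^ k; u < n ^ k; v < n ^ k\<rbrakk>
    \<Longrightarrow> F k r c \<otimes>\<^bsub>C\<^esub> F k u v = (if c = u then F k r v else \<zero>\<^bsub>C\<^esub>)"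
proof (induction k arbitrary: r c u v)
  case (Suc k)
  note lt = unit_kronecker(2-)[OF Suc.prems(1,2)] unit_kronecker(2-)[OF Suc.prems(3,4)]
  let ?a = "F k (r mod n ^ k) (c mod n ^ k)" and ?b = "F k (u mod n ^ k) (v mod n ^ k)"
  let ?S = "\<lambda>x j. S (x div n ^ k, j)"
  have cl: "?a \<in> carrier C" "?b \<in> carrier C" using lt by auto
  have Scl: "?S x j \<in> carrier C" if "x div n ^ k < n" "j < N" for x j using that by auto
  have eq: "c = u \<longleftrightarrow> c div n ^ k = u div n ^ k \<and> c mod n ^ k = u mod n ^ k"
    by (metis div_mult_mod_eq)
  have prod: "(?S r j \<otimes>\<^bsub>C\<^esub> ?a \<otimes>\<^bsub>C\<^esub> (?S c j)\<^sup>\<star>\<^bsub>C\<^esub>) \<otimes>\<^bsub>C\<^esub> (?S u j' \<otimes>\<^bsub>C\<^esub> ?b \<otimes>\<^bsub>C\<^esub> (?S v j')\<^sup>\<star>\<^bsub>C\<^esub>)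
      = (if j' = j then (if c = u then ?S r j \<otimes>\<^bsub>C\<^esub> F k (r mod n ^ k) (v mod n ^ k) \<otimes>\<^bsub>C\<^esub> (?S v j)\<^sup>\<star>\<^bsub>C\<^esub> else \<zero>\<^bsub>C\<^esub>) else \<zero>\<^bsub>C\<^esub>)"
    if "j < N" "j' < N" for j j'
  proof -
    have "(?S r j \<otimes>\<^bsub>C\<^esub> ?a \<otimes>\<^bsub>C\<^esub> (?S c j)\<^sup>\<star>\<^bsub>C\<^esub>) \<otimes>\<^bsub>C\<^esub> (?S u j' \<otimes>\<^bsub>C\<^esub> ?b \<otimes>\<^bsub>C\<^esub> (?S v j')\<^sup>\<star>\<^bsub>C\<^esub>)
        = ?S r j \<otimes>\<^bsub>C\<^esub> (?a \<otimes>\<^bsub>C\<^esub> (((?S c j)\<^sup>\<star>\<^bsub>C\<^esub> \<otimes>\<^bsub>C\<^esub> ?S u j') \<otimes>\<^bsub>C\<^esub> (?b \<otimes>\<^bsub>C\<^esub> (?S v j')\<^sup>\<star>\<^bsub>C\<^esub>)))"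
      using that lt cl Scl by (simp add: C.mult_assoc)
    also have "(?S c j)\<^sup>\<star>\<^bsub>C\<^esub> \<otimes>\<^bsub>C\<^esub> ?S u j' = (if c div n ^ k = u div n ^ k \<and> j = j' then \<one>\<^bsub>C\<^esub> else \<zero>\<^bsub>C\<^esub>)"
      using that lt by (subst S_orthogonal) auto
    finally show ?thesis
      using that lt cl Scl Suc.IH[OF lt(3,4,7,8)] eq
      by (cases "c div n ^ k = u div n ^ k \<and> j = j'") (auto simp: C.mult_assoc simp flip: C.mult_assoc[of ?a ?b])
  qed
  have "F (Suc k) r c \<otimes>\<^bsub>C\<^esub> F (Suc k) u v = finsum C (\<lambda>j. finsum C (\<lambda>j'.
      (?S r j \<otimes>\<^bsub>C\<^esub> ?a \<otimes>\<^bsub>C\<^esub> (?S c j)\<^sup>\<star>\<^bsub>C\<^esub>) \<otimes>\<^bsub>C\<^esub> (?S u j' \<otimes>\<^bsub>C\<^esub> ?b \<otimes>\<^bsub>C\<^esub> (?S v j')\<^sup>\<star>\<^bsub>C\<^esub>)) {..<N}) {..<N}"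
    unfolding F.simps using lt cl Scl
    by (subst C.mult_sum_left, blast, blast, intro C.sum_cong refl, subst C.mult_sum_right) auto
  also have "\<dots> = finsum C (\<lambda>j. if c = u then ?S r j \<otimes>\<^bsub>C\<^esub> F k (r mod n ^ k) (v mod n ^ k) \<otimes>\<^bsub>C\<^esub> (?S v j)\<^sup>\<star>\<^bsub>C\<^esub> else \<zero>\<^bsub>C\<^esub>) {..<N}"
  proof (intro C.sum_cong refl)
    fix j assume j: "j \<in> {..<N}"
    have "finsum C (\<lambda>j'. (?S r j \<otimes>\<^bsub>C\<^esub> ?a \<otimes>\<^bsub>C\<^esub> (?S c j)\<^sup>\<star>\<^bsub>C\<^esub>) \<otimes>\<^bsub>C\<^esub> (?S u j' \<otimes>\<^bsub>C\<^esub> ?b \<otimes>\<^bsub>C\<^esub> (?S v j')\<^sup>\<star>\<^bsub>C\<^esub>)) {..<N}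
        = (?S r j \<otimes>\<^bsub>C\<^esub> ?a \<otimes>\<^bsub>C\<^esub> (?S c j)\<^sup>\<star>\<^bsub>C\<^esub>) \<otimes>\<^bsub>C\<^esub> (?S u j \<otimes>\<^bsub>C\<^esub> ?b \<otimes>\<^bsub>C\<^esub> (?S v j)\<^sup>\<star>\<^bsub>C\<^esub>)"
      using j lt cl Scl by (intro C.sum_single) (simp_all add: prod)
    then show "finsum C (\<lambda>j'. (?S r j \<otimes>\<^bsub>C\<^esub> ?a \<otimes>\<^bsub>C\<^esub> (?S c j)\<^sup>\<star>\<^bsub>C\<^esub>) \<otimes>\<^bsub>C\<^esub> (?S u j' \<otimes>\<^bsub>C\<^esub> ?b \<otimes>\<^bsub>C\<^esub> (?S v j')\<^sup>\<star>\<^bsub>C\<^esub>)) {..<N}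
        = (if c = u then ?S r j \<otimes>\<^bsub>C\<^esub> F k (r mod n ^ k) (v mod n ^ k) \<otimes>\<^bsub>C\<^esub> (?S v j)\<^sup>\<star>\<^bsub>C\<^esub> else \<zero>\<^bsub>C\<^esub>)"
      using j by (simp add: prod)
  qed (use lt Scl in auto)
  also have "\<dots> = (if c = u then F (Suc k) r v else \<zero>\<^bsub>C\<^esub>)"
    by (auto intro!: C.sum_neutral)
  finally show ?case .
qed simp

text \<open>The recursion peels off the first tensor factor while the bonding map appends a last
  one. Induction therefore moves the claim to level zero, where it is the relation that the range
  projections add up to one.\<close>

lemma F_bonding:
  "r < n ^ k \<Longrightarrow> c < n ^ k \<Longrightarrow> finsum C (\<lambda>m. F (Suc k) (r * n + m) (c * n + m)) {..<n} = F k r c"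
proof (induction k arbitrary: r c)
  case 0
  then have "finsum C (\<lambda>m. F (Suc 0) (r * n + m) (c * n + m)) {..<n}
      = finsum C (\<lambda>m. finsum C (\<lambda>j. S (m, j) \<otimes>\<^bsub>C\<^esub> (S (m, j))\<^sup>\<star>\<^bsub>C\<^esub>) {..<N}) {..<n}"
    by (intro C.sum_cong refl) (auto intro!: C.sum_cong)
  also have "\<dots> = finsum C (\<lambda>x. S x \<otimes>\<^bsub>C\<^esub> (S x)\<^sup>\<star>\<^bsub>C\<^esub>) I"
    by (rule C.sum_product[symmetric]) auto
  finally show ?case by (simp add: S_sum)
next
  case (Suc k)
  note lt = unit_kronecker(2-)[OF Suc.prems]
  have dm: "(x * n + m) div n ^ Suc k = x div n ^ k" "(x * n + m) mod n ^ Suc k = (x mod n ^ k) * n + m"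
    if "m < n" for x m
    using that by (simp_all add: div_mult2_eq mod_mult2_eq mult.commute)
  let ?S = "\<lambda>x j. S (x div n ^ k, j)"
  let ?G = "\<lambda>m. F (Suc k) (r mod n ^ k * n + m) (c mod n ^ k * n + m)"
  have Scl: "?S x j \<in> carrier C" if "x div n ^ k < n" "j < N" for x j using that by auto
  have Gcl: "?G m \<in> carrier C" if "m < n" for m
  proof (rule F_closed)
    have "x * n + m < n ^ Suc k" if "x < n ^ k" for x
    proof -
      have "x * n + m < Suc x * n" using \<open>m < n\<close> by simp
      also have "\<dots> \<le> n ^ k * n" using that by (intro mult_right_mono) auto
      finally show ?thesis by (simp add: mult.commute)
    qed
    then show "r mod n ^ k * n + m < n ^ Suc k" "c mod n ^ k * n + m < n ^ Suc k" using lt by auto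
  qed
  have step: "F (Suc (Suc k)) (r * n + m) (c * n + m)
      = finsum C (\<lambda>j. ?S r j \<otimes>\<^bsub>C\<^esub> ?G m \<otimes>\<^bsub>C\<^esub> (?S c j)\<^sup>\<star>\<^bsub>C\<^esub>) {..<N}" if "m < n" for m
    by (simp only: F.simps(2)[of "Suc k"] dm[OF that])
  have "finsum C (\<lambda>m. F (Suc (Suc k)) (r * n + m) (c * n + m)) {..<n}
      = finsum C (\<lambda>m. finsum C (\<lambda>j. ?S r j \<otimes>\<^bsub>C\<^esub> ?G m \<otimes>\<^bsub>C\<^esub> (?S c j)\<^sup>\<star>\<^bsub>C\<^esub>) {..<N}) {..<n}"
    using lt Scl Gcl by (intro C.sum_cong refl) (auto simp: step simp del: F.simps)
  also have "\<dots> = finsum C (\<lambda>j. finsum C (\<lambda>m. ?S r j \<otimes>\<^bsub>C\<^esub> ?G m \<otimes>\<^bsub>C\<^esub> (?S c j)\<^sup>\<star>\<^bsub>C\<^esub>) {..<n}) {..<N}"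
    using lt Scl Gcl by (intro C.sum_swap) auto
  also have "\<dots> = finsum C (\<lambda>j. ?S r j \<otimes>\<^bsub>C\<^esub> finsum C ?G {..<n} \<otimes>\<^bsub>C\<^esub> (?S c j)\<^sup>\<star>\<^bsub>C\<^esub>) {..<N}"
    using lt Scl Gcl
    by (intro C.sum_cong refl, subst C.mult_sum_right)
      (auto simp del: F.simps intro!: C.mult_sum_left[symmetric])
  also have "finsum C ?G {..<n} = F k (r mod n ^ k) (c mod n ^ k)"
    using Suc.IH lt by blast
  finally show ?case by simp
qed

lemma coefficient_hom_exists:
  obtains \<pi> where "\<pi> \<in> star_hom A C" "\<And>k r c. r < n ^ k \<Longrightarrow> c < n ^ k \<Longrightarrow> \<pi> (\<iota> k (mat_unit (n ^ k) r c)) = F k r c"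
proof -
  define \<theta> where "\<theta> k x = finsum C (\<lambda>r. finsum C (\<lambda>c. x $$ (r, c) \<odot>\<^bsub>C\<^esub> F k r c) {..<n ^ k}) {..<n ^ k}" for k and x :: "complex mat"
  have \<theta>: "\<theta> k \<in> star_hom (matrix_algebra (n ^ k)) C"
    "\<And>r c. r < n ^ k \<Longrightarrow> c < n ^ k \<Longrightarrow> \<theta> k (mat_unit (n ^ k) r c) = F k r c" for k
    using star_hom_of_mat_units[OF C.cstar_algebra_axioms, of "n ^ k" "F k"] F_mult F_star
    unfolding \<theta>_def by blast+
  \<comment> \<open>It suffices to treat matrix units; there \<open>x \<otimes> 1\<close> is a sum
    of \<open>n\<close> matrix units of the next level, and the claim becomes
    \<open>F_bonding\<close>.\<close>
  have compat: "\<theta> (Suc k) (kronecker x (1\<^sub>m n)) = \<theta> k x" if x: "x \<in> carrier_mat (n ^ k) (n ^ k)" for k x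
  proof (rule linear_map_mat_unitsI[OF C.complex_module_axioms _ star_hom_linear[OF \<theta>(1)] _ x])
    note th = star_homD[OF \<theta>(1), simplified]
    show "(\<lambda>x. \<theta> (Suc k) (kronecker x (1\<^sub>m n))) \<in> linear_maps (matrix_algebra (n ^ k)) C"
    proof (rule linear_mapsI)
      fix y assume "y \<in> carrier (matrix_algebra (n ^ k))"
      then have y: "y \<in> carrier_mat (n ^ k) (n ^ k)" by simp
      note yk = kronecker_level(1)[OF y one_carrier_mat]
      show "\<theta> (Suc k) (kronecker y (1\<^sub>m n)) \<in> carrier C" by (rule th(1)[OF yk])
      show "\<theta> (Suc k) (kronecker (a \<odot>\<^bsub>matrix_algebra (n ^ k)\<^esub> y) (1\<^sub>m n)) = a \<odot>\<^bsub>C\<^esub> \<theta> (Suc k) (kronecker y (1\<^sub>m n))" for a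
        using th(3)[OF yk] y by (simp add: kronecker_scale_left[of y "n ^ k" _ n])
      fix z assume "z \<in> carrier (matrix_algebra (n ^ k))"
      then have z: "z \<in> carrier_mat (n ^ k) (n ^ k)" by simp
      show "\<theta> (Suc k) (kronecker (y \<oplus>\<^bsub>matrix_algebra (n ^ k)\<^esub> z) (1\<^sub>m n))
          = \<theta> (Suc k) (kronecker y (1\<^sub>m n)) \<oplus>\<^bsub>C\<^esub> \<theta> (Suc k) (kronecker z (1\<^sub>m n))"
        using th(2)[OF yk kronecker_level(1)[OF z one_carrier_mat]] y z
        by (simp add: kronecker_add_left[of y "n ^ k" _ _ n])
    qed
    fix r c assume rc: "r < n ^ k" "c < n ^ k"
    let ?E = "mat_unit (n ^ k) r c"
    have Ek: "kronecker ?E y \<in> carrier_mat (n ^ Suc k) (n ^ Suc k)" if "y \<in> carrier_mat n n" for y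
      using that by (intro kronecker_level) auto
    have lin: "(\<lambda>y. \<theta> (Suc k) (kronecker ?E y)) \<in> linear_maps (matrix_algebra n) C"
    proof (rule linear_mapsI)
      fix y assume "y \<in> carrier (matrix_algebra n)"
      then have y: "y \<in> carrier_mat n n" by simp
      show "\<theta> (Suc k) (kronecker ?E y) \<in> carrier C" by (rule th(1)[OF Ek[OF y]])
      show "\<theta> (Suc k) (kronecker ?E (a \<odot>\<^bsub>matrix_algebra n\<^esub> y)) = a \<odot>\<^bsub>C\<^esub> \<theta> (Suc k) (kronecker ?E y)" for a
        using th(3)[OF Ek[OF y]] y by (simp add: kronecker_scale_right[of _ "n ^ k" _ n])
      fix z assume "z \<in> carrier (matrix_algebra n)"
      then have z: "z \<in> carrier_mat n n" by simp
      show "\<theta> (Suc k) (kronecker ?E (y \<oplus>\<^bsub>matrix_algebra n\<^esub> z)) = \<theta> (Suc k) (kronecker ?E y) \<oplus>\<^bsub>C\<^esub> \<theta> (Suc k) (kronecker ?E z)"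
        using th(2)[OF Ek[OF y] Ek[OF z]] y z by (simp add: kronecker_add_right[of _ "n ^ k" _ n])
    qed
    have lt: "x * n + m < n ^ Suc k" if "x < n ^ k" "m < n" for x m
    proof -
      have "x * n + m < Suc x * n" using that by simp
      also have "\<dots> \<le> n ^ k * n" using that by (intro mult_right_mono) auto
      finally show ?thesis by (simp add: mult.commute)
    qed
    have unit: "\<theta> (Suc k) (kronecker ?E (mat_unit n m m)) = F (Suc k) (r * n + m) (c * n + m)" if "m < n" for m
    proof -
      have "kronecker ?E (mat_unit n m m) = mat_unit (n ^ Suc k) (r * n + m) (c * n + m)"
        using rc that kronecker_mat_unit[of r "n ^ k" c m n m] by (simp add: mult.commute)
      then show ?thesis
        using \<theta>(2)[of "r * n + m" "Suc k" "c * n + m"] lt[OF rc(1) that] lt[OF rc(2) that] by (simp only:)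
    qed
    have Fcl: "F (Suc k) (r * n + m) (c * n + m) \<in> carrier C" if "m < n" for m
      using lt[OF rc(1) that] lt[OF rc(2) that] by (rule F_closed)
    have "\<theta> (Suc k) (kronecker ?E (1\<^sub>m n))
        = finsum C (\<lambda>m. finsum C (\<lambda>m'. 1\<^sub>m n $$ (m, m') \<odot>\<^bsub>C\<^esub> \<theta> (Suc k) (kronecker ?E (mat_unit n m m'))) {..<n}) {..<n}"
      by (rule linear_map_mat_units[OF C.complex_module_axioms lin]) simp
    also have "\<dots> = finsum C (\<lambda>m. F (Suc k) (r * n + m) (c * n + m)) {..<n}"
    proof (intro C.sum_cong refl)
      fix m assume m: "m \<in> {..<n}"
      have "finsum C (\<lambda>m'. 1\<^sub>m n $$ (m, m') \<odot>\<^bsub>C\<^esub> \<theta> (Suc k) (kronecker ?E (mat_unit n m m'))) {..<n}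
          = 1\<^sub>m n $$ (m, m) \<odot>\<^bsub>C\<^esub> \<theta> (Suc k) (kronecker ?E (mat_unit n m m))"
        using m linear_mapsD(1)[OF lin, simplified] by (intro C.sum_single) auto
      then show "finsum C (\<lambda>m'. 1\<^sub>m n $$ (m, m') \<odot>\<^bsub>C\<^esub> \<theta> (Suc k) (kronecker ?E (mat_unit n m m'))) {..<n}
          = F (Suc k) (r * n + m) (c * n + m)"
        using m Fcl unit by (simp del: F.simps)
    qed (use Fcl in auto)
    also have "\<dots> = \<theta> k ?E" using F_bonding[OF rc] \<theta>(2)[OF rc] by simp
    finally show "\<theta> (Suc k) (kronecker ?E (1\<^sub>m n)) = \<theta> k ?E" .
  qed
  obtain \<pi> where "\<pi> \<in> star_hom A C" "\<And>k x. x \<in> carrier_mat (n ^ k) (n ^ k) \<Longrightarrow> \<pi> (\<iota> k x) = \<theta> k x"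
    using star_hom_from_levels[OF C.cstar_algebra_axioms \<theta>(1) compat] by metis
  then show ?thesis using that \<theta>(2) by simp
qed

end

section \<open>The covariant representation attached to a Cuntz family\<close>

context cuntz_rep
begin

text \<open>The right action and inner products are respected because \<open>\<psi>\<close> places
  coordinates on isometries that are orthonormal like the basis. The substance is the left action,
  where the recursion defining \<open>F\<close> enters.\<close>

theorem cuntz_representation:
  obtains \<psi> \<pi> where "covariant_on (carrier A) A M C \<psi> \<pi>"
    "\<And>k r c. r < n ^ k \<Longrightarrow> c < n ^ k \<Longrightarrow> \<pi> (\<iota> k (mat_unit (n ^ k) r c)) = F k r c"
    "\<And>x. x \<in> carrier M \<Longrightarrow> \<psi> x = finsum C (\<lambda>i. S i \<otimes>\<^bsub>C\<^esub> \<pi> \<langle>basis i, x\<rangle>) I"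
    "\<And>i. i \<in> I \<Longrightarrow> \<psi> (basis i) = S i"
proof -
  obtain \<pi> where \<pi>: "\<pi> \<in> star_hom A C"
    and \<pi>F: "\<And>k r c. r < n ^ k \<Longrightarrow> c < n ^ k \<Longrightarrow> \<pi> (\<iota> k (mat_unit (n ^ k) r c)) = F k r c"
    using coefficient_hom_exists by metis
  note \<pi>' = star_homD[OF \<pi>]
  define \<psi> where "\<psi> x = finsum C (\<lambda>i. S i \<otimes>\<^bsub>C\<^esub> \<pi> \<langle>basis i, x\<rangle>) I" for x
  have \<psi>cl: "\<psi> x \<in> carrier C" if "x \<in> carrier M" for x
    unfolding \<psi>_def using that \<pi>' by auto
  have \<pi>0: "\<pi> \<zero>\<^bsub>A\<^esub> = \<zero>\<^bsub>C\<^esub>"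
    by (rule linear_maps_zero[OF A.complex_module_axioms C.complex_module_axioms star_hom_linear[OF \<pi>]])
  have \<pi>1: "\<pi> \<one>\<^bsub>A\<^esub> = \<one>\<^bsub>C\<^esub>"
  proof -
    have "1\<^sub>m (n ^ 0) = mat_unit (n ^ 0) 0 0" by (rule eq_matI) auto
    then show ?thesis using \<pi>F[of 0 0 0] level_one[of 0] by simp
  qed
  have \<psi>lin: "\<psi> \<in> linear_maps M C"
  proof (rule linear_mapsI)
    fix x assume x: "x \<in> carrier M"
    show "\<psi> x \<in> carrier C" by (rule \<psi>cl[OF x])
    show "\<psi> (a \<odot> x) = a \<odot>\<^bsub>C\<^esub> \<psi> x" for a
      unfolding \<psi>_def using x \<pi>'
      by (subst C.sum_scale) (auto intro!: C.sum_cong simp: H.inprod_smult)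
    fix y assume y: "y \<in> carrier M"
    have "\<psi> (x \<oplus> y) = finsum C (\<lambda>i. S i \<otimes>\<^bsub>C\<^esub> \<pi> \<langle>basis i, x\<rangle> \<oplus>\<^bsub>C\<^esub> S i \<otimes>\<^bsub>C\<^esub> \<pi> \<langle>basis i, y\<rangle>) I"
      unfolding \<psi>_def using x y \<pi>'
      by (intro C.sum_cong refl) (auto simp: H.inprod_add C.mult_add_right)
    also have "\<dots> = \<psi> x \<oplus>\<^bsub>C\<^esub> \<psi> y"
      unfolding \<psi>_def using x y \<pi>' by (intro C.sum_add) auto
    finally show "\<psi> (x \<oplus> y) = \<psi> x \<oplus>\<^bsub>C\<^esub> \<psi> y" .
  qed
  have \<psi>ract: "\<psi> (x \<triangleleft> a) = \<psi> x \<otimes>\<^bsub>C\<^esub> \<pi> a" if "x \<in> carrier M" "a \<in> carrier A" for x a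
    unfolding \<psi>_def using that \<pi>'
    by (subst C.mult_sum_left) (auto intro!: C.sum_cong simp: H.inprod_ract C.mult_assoc)
  have \<psi>basis: "\<psi> (basis i) = S i" if i: "i \<in> I" for i
  proof -
    have "\<psi> (basis i) = S i \<otimes>\<^bsub>C\<^esub> \<pi> \<langle>basis i, basis i\<rangle>"
      unfolding \<psi>_def using i \<pi>' \<pi>0 \<pi>1 H.orthonormal by (intro C.sum_single) (auto simp: H.orthonormal)
    then show ?thesis using i \<pi>1 by (simp add: H.orthonormal del: mem_Sigma_iff)
  qed
  have \<psi>inner: "(\<psi> x)\<^sup>\<star>\<^bsub>C\<^esub> \<otimes>\<^bsub>C\<^esub> \<psi> y = \<pi> \<langle>x, y\<rangle>" if x: "x \<in> carrier M" and y: "y \<in> carrier M" for x y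
  proof -
    have picl: "\<pi> \<langle>basis i, z\<rangle> \<in> carrier C" if "i \<in> I" "z \<in> carrier M" for i z
      using that \<pi>' by auto
    have coeff: "(S i)\<^sup>\<star>\<^bsub>C\<^esub> \<otimes>\<^bsub>C\<^esub> \<psi> y = \<pi> \<langle>basis i, y\<rangle>" if i: "i \<in> I" for i
    proof -
      have "(S i)\<^sup>\<star>\<^bsub>C\<^esub> \<otimes>\<^bsub>C\<^esub> \<psi> y = finsum C (\<lambda>j. ((S i)\<^sup>\<star>\<^bsub>C\<^esub> \<otimes>\<^bsub>C\<^esub> S j) \<otimes>\<^bsub>C\<^esub> \<pi> \<langle>basis j, y\<rangle>) I"
        unfolding \<psi>_def using i y picl
        by (subst C.mult_sum_right) (auto intro!: C.sum_cong simp: C.mult_assoc)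
      also have "\<dots> = ((S i)\<^sup>\<star>\<^bsub>C\<^esub> \<otimes>\<^bsub>C\<^esub> S i) \<otimes>\<^bsub>C\<^esub> \<pi> \<langle>basis i, y\<rangle>"
        using i y picl by (intro C.sum_single) (auto simp: S_orthogonal simp del: mem_Sigma_iff)
      finally show ?thesis using i y picl by (simp add: S_orthogonal del: mem_Sigma_iff)
    qed
    have "(\<psi> x)\<^sup>\<star>\<^bsub>C\<^esub> \<otimes>\<^bsub>C\<^esub> \<psi> y = finsum C (\<lambda>i. (\<pi> \<langle>basis i, x\<rangle>)\<^sup>\<star>\<^bsub>C\<^esub> \<otimes>\<^bsub>C\<^esub> ((S i)\<^sup>\<star>\<^bsub>C\<^esub> \<otimes>\<^bsub>C\<^esub> \<psi> y)) I"
      unfolding \<psi>_def[of x] using x y picl \<psi>cl[OF y]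
      by (subst C.star_sum, blast, subst C.mult_sum_left)
        (auto intro!: C.sum_cong simp: C.star_mult C.mult_assoc)
    also have "\<dots> = finsum C (\<lambda>i. \<pi> \<langle>x, basis i \<triangleleft> \<langle>basis i, y\<rangle>\<rangle>) I"
    proof (intro C.sum_cong refl)
      fix i assume i: "i \<in> I"
      have b: "basis i \<in> carrier M" using i by (rule H.basis_closed)
      have "(\<pi> \<langle>basis i, x\<rangle>)\<^sup>\<star>\<^bsub>C\<^esub> = \<pi> \<langle>x, basis i\<rangle>"
        using \<pi>'(5)[of "\<langle>basis i, x\<rangle>"] b x by (simp add: H.inprod_star)
      then show "(\<pi> \<langle>basis i, x\<rangle>)\<^sup>\<star>\<^bsub>C\<^esub> \<otimes>\<^bsub>C\<^esub> ((S i)\<^sup>\<star>\<^bsub>C\<^esub> \<otimes>\<^bsub>C\<^esub> \<psi> y) = \<pi> \<langle>x, basis i \<triangleleft> \<langle>basis i, y\<rangle>\<rangle>"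
        using b x y \<pi>'(4) by (simp add: coeff[OF i] H.inprod_ract)
      show "\<pi> \<langle>x, basis i \<triangleleft> \<langle>basis i, y\<rangle>\<rangle> \<in> carrier C" using b x y \<pi>'(1) by simp
    qed
    also have "\<dots> = \<pi> (finsum A (\<lambda>i. \<langle>x, basis i \<triangleleft> \<langle>basis i, y\<rangle>\<rangle>) I)"
      using x y
      by (intro linear_maps_sum[OF A.complex_module_axioms C.complex_module_axioms star_hom_linear[OF \<pi>], symmetric])
        (auto simp del: mem_Sigma_iff)
    also have "finsum A (\<lambda>i. \<langle>x, basis i \<triangleleft> \<langle>basis i, y\<rangle>\<rangle>) I = \<langle>x, H.project y\<rangle>"
      unfolding H.project_def using x y by (intro H.inprod_sum_right[symmetric]) (auto simp del: mem_Sigma_iff)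
    finally show ?thesis using y by (simp add: H.expand)
  qed
  \<comment> \<open>Preservation of inner products makes \<open>\<psi>\<close> contractive, which
    the density argument for the left action requires.\<close>
  have \<psi>norm: "cnorm C (\<psi> x) \<le> hnorm A M x" if x: "x \<in> carrier M" for x
  proof (rule power2_le_imp_le)
    have "(cnorm C (\<psi> x))\<^sup>2 = cnorm C (\<pi> \<langle>x, x\<rangle>)"
      using C.cstar_identity[OF \<psi>cl[OF x]] \<psi>inner[OF x x] by simp
    also have "\<dots> \<le> (hnorm A M x)\<^sup>2"
      using x star_hom_contractive[OF A.cstar_algebra_axioms C.cstar_algebra_axioms \<pi>, of "\<langle>x, x\<rangle>"]
      by (simp add: H.hnorm_square)
    finally show "(cnorm C (\<psi> x))\<^sup>2 \<le> (hnorm A M x)\<^sup>2" .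
  qed (use x in simp)
  have \<psi>lact_basis: "\<psi> (a \<triangleright> basis (i, j)) = \<pi> a \<otimes>\<^bsub>C\<^esub> S (i, j)" if ij: "i < n" "j < N" and a: "a \<in> carrier A" for a i j
  proof -
    \<comment> \<open>With \<open>basis (i, j) = q w\<close>, the vector
      \<open>b \<triangleright> basis (i, j)\<close> is \<open>q (b w)\<close>, so it depends
      linearly and boundedly on \<open>b\<close>.\<close>
    define w where "w = complex_of_real (sqrt (real N)) \<odot>\<^bsub>A\<^esub> e i j"
    have w: "w \<in> carrier A" by (simp add: w_def)
    have act: "b \<triangleright> basis (i, j) = q (b \<otimes>\<^bsub>A\<^esub> w)" if "b \<in> carrier A" for b
      using that w by (simp add: basis_def q_lact flip: w_def)
    have Scl: "S (i, j) \<in> carrier C" using ij by (intro S_closed) simp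
    show ?thesis
    proof (rule bounded_linear_eqI[OF C.cstar_algebra_axioms _ _ _ _ _ a])
      show "(\<lambda>a. \<psi> (a \<triangleright> basis (i, j))) \<in> linear_maps A C"
      proof (rule linear_mapsI)
        fix b assume b: "b \<in> carrier A"
        show "\<psi> (b \<triangleright> basis (i, j)) \<in> carrier C" using b w by (simp add: act q_linear' \<psi>cl)
        show "\<psi> ((t \<odot>\<^bsub>A\<^esub> b) \<triangleright> basis (i, j)) = t \<odot>\<^bsub>C\<^esub> \<psi> (b \<triangleright> basis (i, j))" for t
          using b w by (simp add: act q_linear' linear_mapsD[OF \<psi>lin])
        fix d assume d: "d \<in> carrier A"
        show "\<psi> ((b \<oplus>\<^bsub>A\<^esub> d) \<triangleright> basis (i, j)) = \<psi> (b \<triangleright> basis (i, j)) \<oplus>\<^bsub>C\<^esub> \<psi> (d \<triangleright> basis (i, j))"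
          using b d w by (simp add: act q_linear' linear_mapsD[OF \<psi>lin] A.mult_add_left)
      qed
      show "(\<lambda>a. \<pi> a \<otimes>\<^bsub>C\<^esub> S (i, j)) \<in> linear_maps A C"
        by (rule linear_mapsI) (use \<pi>' Scl in \<open>auto simp: C.mult_add_left\<close>)
      fix b assume b: "b \<in> carrier A"
      have "cnorm C (\<psi> (b \<triangleright> basis (i, j))) \<le> hnorm A M (q (b \<otimes>\<^bsub>A\<^esub> w))"
        using b w by (simp add: act \<psi>norm q_linear')
      also have "\<dots> \<le> 2 * cnorm A (b \<otimes>\<^bsub>A\<^esub> w)"
        using b w by (intro hnorm_q_le) auto
      also have "\<dots> \<le> 2 * (cnorm A b * cnorm A w)"
        using A.cnorm_mult[OF b w] by simp
      finally show "cnorm C (\<psi> (b \<triangleright> basis (i, j))) \<le> (2 * cnorm A w) * cnorm A b"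
        by (simp add: mult_ac)
      have "cnorm C (\<pi> b \<otimes>\<^bsub>C\<^esub> S (i, j)) \<le> cnorm A b * cnorm C (S (i, j))"
        using b Scl \<pi>' star_hom_contractive[OF A.cstar_algebra_axioms C.cstar_algebra_axioms \<pi> b]
        by (intro C.cnorm_mult_le) auto
      then show "cnorm C (\<pi> b \<otimes>\<^bsub>C\<^esub> S (i, j)) \<le> cnorm C (S (i, j)) * cnorm A b"
        by (simp add: mult.commute)
    next
      fix k r c assume rc: "r < n ^ Suc k" "c < n ^ Suc k"
      note uk = unit_kronecker[OF rc]
      let ?b = "mat_unit (n ^ k) (r mod n ^ k) (c mod n ^ k)"
      have bcl: "?b \<in> carrier_mat (n ^ k) (n ^ k)" by simp
      have rj: "(r div n ^ k, j) \<in> I" using uk ij by simp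
      have cl: "S (r div n ^ k, j') \<in> carrier C" "S (c div n ^ k, j') \<in> carrier C" if "j' < N" for j'
        using uk that by auto
      have Fcl: "F k (r mod n ^ k) (c mod n ^ k) \<in> carrier C" using uk by auto
      have left: "\<psi> (\<iota> (Suc k) (mat_unit (n ^ Suc k) r c) \<triangleright> basis (i, j))
          = (if c div n ^ k = i then S (r div n ^ k, j) \<otimes>\<^bsub>C\<^esub> F k (r mod n ^ k) (c mod n ^ k) else \<zero>\<^bsub>C\<^esub>)"
      proof -
        have "\<iota> (Suc k) (mat_unit (n ^ Suc k) r c) \<triangleright> basis (i, j)
            = (if c div n ^ k = i then basis (r div n ^ k, j) \<triangleleft> \<iota> k ?b else \<zero>)"
          unfolding uk(1) using uk ij by (intro basis_lact) auto
        then show ?thesis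
          using \<psi>ract[OF H.basis_closed[OF rj] level_closed[OF bcl]] \<psi>basis[OF rj] \<pi>F[OF uk(4,5)]
            linear_maps_zero[OF H.MM.complex_module_axioms C.complex_module_axioms \<psi>lin] by simp
      qed
      have "\<pi> (\<iota> (Suc k) (mat_unit (n ^ Suc k) r c)) \<otimes>\<^bsub>C\<^esub> S (i, j)
          = F (Suc k) r c \<otimes>\<^bsub>C\<^esub> S (i, j)"
        using \<pi>F[OF rc] by simp
      also have "\<dots> = finsum C (\<lambda>j'. (S (r div n ^ k, j') \<otimes>\<^bsub>C\<^esub> F k (r mod n ^ k) (c mod n ^ k)
          \<otimes>\<^bsub>C\<^esub> (S (c div n ^ k, j'))\<^sup>\<star>\<^bsub>C\<^esub>) \<otimes>\<^bsub>C\<^esub> S (i, j)) {..<N}"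
        unfolding F.simps using cl Fcl Scl by (intro C.mult_sum_left) auto
      also have "\<dots> = finsum C (\<lambda>j'. if j' = j then (if c div n ^ k = i then S (r div n ^ k, j) \<otimes>\<^bsub>C\<^esub> F k (r mod n ^ k) (c mod n ^ k) else \<zero>\<^bsub>C\<^esub>) else \<zero>\<^bsub>C\<^esub>) {..<N}"
        using cl Fcl Scl uk ij by (intro C.sum_cong refl) (auto simp: C.mult_assoc S_orthogonal)
      also have "\<dots> = (if c div n ^ k = i then S (r div n ^ k, j) \<otimes>\<^bsub>C\<^esub> F k (r mod n ^ k) (c mod n ^ k) else \<zero>\<^bsub>C\<^esub>)"
        using cl Fcl ij by (subst C.sum_single[of _ j]) auto
      finally show "\<psi> (\<iota> (Suc k) (mat_unit (n ^ Suc k) r c) \<triangleright> basis (i, j))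
          = \<pi> (\<iota> (Suc k) (mat_unit (n ^ Suc k) r c)) \<otimes>\<^bsub>C\<^esub> S (i, j)"
        using left by simp
    qed
  qed
  \<comment> \<open>From basis vectors to all vectors by expansion, since the left action commutes
    with the right one.\<close>
  have \<psi>lact: "\<psi> (a \<triangleright> x) = \<pi> a \<otimes>\<^bsub>C\<^esub> \<psi> x" if x: "x \<in> carrier M" and a: "a \<in> carrier A" for x a
  proof -
    have "a \<triangleright> x = finsum M (\<lambda>i. (a \<triangleright> basis i) \<triangleleft> \<langle>basis i, x\<rangle>) I"
      using H.adjointable_expand[OF star_homD(1)[OF H.left_operator_hom a] x] x a
      by (simp add: H.left_operator_apply cong: H.MM.sum_cong)
    then have "\<psi> (a \<triangleright> x) = finsum C (\<lambda>i. \<psi> ((a \<triangleright> basis i) \<triangleleft> \<langle>basis i, x\<rangle>)) I"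
      using a x linear_maps_sum[OF H.MM.complex_module_axioms C.complex_module_axioms \<psi>lin, of I "\<lambda>i. (a \<triangleright> basis i) \<triangleleft> \<langle>basis i, x\<rangle>"]
      by (simp del: mem_Sigma_iff)
    also have "\<dots> = finsum C (\<lambda>i. \<pi> a \<otimes>\<^bsub>C\<^esub> (S i \<otimes>\<^bsub>C\<^esub> \<pi> \<langle>basis i, x\<rangle>)) I"
    proof (intro C.sum_cong refl)
      fix i assume i: "i \<in> I"
      then have "\<psi> (a \<triangleright> basis i) = \<pi> a \<otimes>\<^bsub>C\<^esub> S i"
        using \<psi>lact_basis[of "fst i" "snd i" a] a by auto
      then show "\<psi> ((a \<triangleright> basis i) \<triangleleft> \<langle>basis i, x\<rangle>) = \<pi> a \<otimes>\<^bsub>C\<^esub> (S i \<otimes>\<^bsub>C\<^esub> \<pi> \<langle>basis i, x\<rangle>)"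
        using i a x \<pi>' \<psi>ract by (simp add: C.mult_assoc del: mem_Sigma_iff)
    qed (use a x \<pi>' in auto)
    also have "\<dots> = \<pi> a \<otimes>\<^bsub>C\<^esub> \<psi> x"
      unfolding \<psi>_def using a x \<pi>' by (intro C.mult_sum_right[symmetric]) auto
    finally show ?thesis .
  qed
  have "representation A M C \<psi> \<pi>"
    unfolding representation_def using \<psi>lin \<pi> \<psi>ract \<psi>inner \<psi>lact by blast
  moreover have "\<pi> \<one>\<^bsub>A\<^esub> = finsum C (\<lambda>i. \<psi> (basis i) \<otimes>\<^bsub>C\<^esub> (\<psi> (basis i))\<^sup>\<star>\<^bsub>C\<^esub>) I"
  proof -
    have "finsum C (\<lambda>i. \<psi> (basis i) \<otimes>\<^bsub>C\<^esub> (\<psi> (basis i))\<^sup>\<star>\<^bsub>C\<^esub>) I = finsum C (\<lambda>i. S i \<otimes>\<^bsub>C\<^esub> (S i)\<^sup>\<star>\<^bsub>C\<^esub>) I"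
      by (intro C.sum_cong refl) (auto simp: \<psi>basis simp del: mem_Sigma_iff)
    then show ?thesis using \<pi>1 S_sum by simp
  qed
  ultimately have "covariant_on (carrier A) A M C \<psi> \<pi>"
    by (simp add: H.covariant_iff[OF C.cstar_algebra_axioms])
  then show ?thesis using that \<pi>F \<psi>_def \<psi>basis by blast
qed

end

section \<open>The isomorphism with the Cuntz algebra\<close>

text \<open>In an algebra not known to be unital the field \<open>one\<close> is arbitrary. The
  universal property of the Cuntz algebra concerns unital targets, so this field is overwritten with
  the unit found below; the other operations are untouched.\<close>

lemma cstar_algebra_one_update:
  assumes "cstar_algebra B"
  shows "cstar_algebra (B\<lparr>one := u\<rparr>)"
proof -
  interpret B: cstar_algebra B by fact
  let ?B = "B\<lparr>one := u\<rparr>"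
  have add: "add_monoid ?B = add_monoid B" by simp
  have ab: "abelian_group ?B"
    using B.abelian_group_axioms unfolding abelian_group_def abelian_monoid_def abelian_group_axioms_def add by simp
  have inv: "a_inv ?B = a_inv B" by (rule ext) (simp add: a_inv_def add)
  have dist: "cdist ?B = cdist B" by (intro ext) (simp add: cdist_def a_minus_def inv)
  have "module \<CC> ?B"
    by (rule moduleI[OF cring_from_type_algebra ab])
      (auto simp: B.scale_left_add B.scale_right_add)
  then show ?thesis
    by (rule cstar_algebra.intro, unfold_locales)
      (auto simp: dist B.mult_assoc B.mult_add_left B.mult_add_right B.star_add B.star_mult B.cnorm_eq_0
        B.cnorm_smult B.cnorm_add B.cnorm_mult B.cstar_identity B.complete)
qed

section \<open>The unit of an algebra generated by a covariant representation\<close>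

context exel_uhf
begin

text \<open>The elements on which \<open>u = kA 1\<close> acts as a two-sided unit form a closed
  star-subalgebra, and it contains the generators because the unit of \<open>A\<close> acts
  trivially on the module from both sides.\<close>

lemma covariant_unit:
  assumes E: "cstar_algebra E" and cov: "covariant_on (carrier A) A M E kM kA"
    and gen: "generates (kM ` carrier M \<union> kA ` carrier A) E"
  shows "unital_cstar_algebra (E\<lparr>one := kA \<one>\<^bsub>A\<^esub>\<rparr>)"
proof -
  interpret E: cstar_algebra E by fact
  have rep: "representation A M E kM kA" using cov by (simp add: covariant_on_def)
  note rep' = representationD[OF rep]
  note kA' = star_homD[OF rep'(2)]
  define u where "u = kA \<one>\<^bsub>A\<^esub>"
  have u: "u \<in> carrier E" "u\<^sup>\<star>\<^bsub>E\<^esub> = u" "u \<otimes>\<^bsub>E\<^esub> u = u"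
    using kA'(1)[OF A.one_closed] kA'(4)[OF A.one_closed A.one_closed] kA'(5)[OF A.one_closed] by (simp_all add: u_def)
  have un: "cnorm E u \<le> 1" by (rule E.projection_cnorm_le) (use u in simp_all)
  define V where "V = {x \<in> carrier E. u \<otimes>\<^bsub>E\<^esub> x = x \<and> x \<otimes>\<^bsub>E\<^esub> u = x}"
  have "closed_star_subalgebra V E"
  proof (rule E.closed_star_subalgebraI)
    show "x \<otimes>\<^bsub>E\<^esub> y \<in> V" if "x \<in> V" "y \<in> V" for x y
      using that u E.mult_assoc[of u x y] E.mult_assoc[of x y u] by (auto simp: V_def)
    show "x\<^sup>\<star>\<^bsub>E\<^esub> \<in> V" if "x \<in> V" for x
      using that u E.star_mult[of u x] E.star_mult[of x u] by (auto simp: V_def)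
    fix x assume x: "x \<in> carrier E" and ap: "\<And>e. 0 < e \<Longrightarrow> \<exists>y\<in>V. cnorm E (x \<ominus>\<^bsub>E\<^esub> y) < e"
    have "u \<otimes>\<^bsub>E\<^esub> x = x" "x \<otimes>\<^bsub>E\<^esub> u = x"
    proof -
      have le: "cnorm E (u \<otimes>\<^bsub>E\<^esub> x \<ominus>\<^bsub>E\<^esub> x) \<le> 2 * t \<and> cnorm E (x \<otimes>\<^bsub>E\<^esub> u \<ominus>\<^bsub>E\<^esub> x) \<le> 2 * t" if t: "0 < t" for t
      proof -
        obtain y where y: "y \<in> carrier E" "u \<otimes>\<^bsub>E\<^esub> y = y" "y \<otimes>\<^bsub>E\<^esub> u = y" "cnorm E (x \<ominus>\<^bsub>E\<^esub> y) < t"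
          using ap[OF t] by (auto simp: V_def)
        have "cnorm E (u \<otimes>\<^bsub>E\<^esub> (x \<ominus>\<^bsub>E\<^esub> y)) \<le> 1 * t"
          by (rule E.cnorm_mult_le) (use x y u un in auto)
        moreover have "cnorm E ((x \<ominus>\<^bsub>E\<^esub> y) \<otimes>\<^bsub>E\<^esub> u) \<le> t * 1"
          by (rule E.cnorm_mult_le) (use x y u un in auto)
        ultimately show ?thesis
          using x y u E.cnorm_triangle_diff[of "u \<otimes>\<^bsub>E\<^esub> x" y x] E.cnorm_triangle_diff[of "x \<otimes>\<^bsub>E\<^esub> u" y x]
            E.cnorm_minus_commute[of y x]
          by (simp add: E.mult_minus_left E.mult_minus_right)
      qed
      show "u \<otimes>\<^bsub>E\<^esub> x = x" by (rule cstar_eqI_of_approx[OF E]) (use x u le in auto)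
      show "x \<otimes>\<^bsub>E\<^esub> u = x" by (rule cstar_eqI_of_approx[OF E]) (use x u le in auto)
    qed
    then show "x \<in> V" using x by (simp add: V_def)
  qed (use u in \<open>auto simp: V_def E.mult_add_left E.mult_add_right\<close>)
  moreover have "kM ` carrier M \<union> kA ` carrier A \<subseteq> V"
  proof -
    have "kM x \<in> V" if x: "x \<in> carrier M" for x
      using rep'(3)[OF x A.one_closed] rep'(5)[OF x A.one_closed] linear_mapsD(1)[OF rep'(1) x]
        H.ract_one[OF A.unital_cstar_algebra_axioms x] lact_one_all[OF x] by (simp add: V_def u_def)
    moreover have "kA a \<in> V" if a: "a \<in> carrier A" for a
      using kA'(1)[OF a] kA'(4)[OF A.one_closed a] kA'(4)[OF a A.one_closed] a by (simp add: V_def u_def)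
    ultimately show ?thesis by blast
  qed
  ultimately have V: "V = carrier E" using gen by (auto simp: generates_def)
  show ?thesis
  proof (rule unital_cstar_algebra.intro[OF cstar_algebra_one_update[OF E]], unfold_locales)
    show "\<one>\<^bsub>E\<lparr>one := kA \<one>\<^bsub>A\<^esub>\<rparr>\<^esub> \<in> carrier (E\<lparr>one := kA \<one>\<^bsub>A\<^esub>\<rparr>)" using u by (simp add: u_def)
    fix x assume "x \<in> carrier (E\<lparr>one := kA \<one>\<^bsub>A\<^esub>\<rparr>)"
    then have "x \<in> V" using V by simp
    then show "\<one>\<^bsub>E\<lparr>one := kA \<one>\<^bsub>A\<^esub>\<rparr>\<^esub> \<otimes>\<^bsub>E\<lparr>one := kA \<one>\<^bsub>A\<^esub>\<rparr>\<^esub> x = x"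
      "x \<otimes>\<^bsub>E\<lparr>one := kA \<one>\<^bsub>A\<^esub>\<rparr>\<^esub> \<one>\<^bsub>E\<lparr>one := kA \<one>\<^bsub>A\<^esub>\<rparr>\<^esub> = x"
      by (simp_all add: V_def u_def)
  qed
qed

end

context cuntz_rep
begin

text \<open>Quotient and remainder by \<open>N\<close> invert the enumeration \<open>i N + j\<close>
  behind \<open>S\<close>. Orthonormality of the basis gives the isometry relations and covariance
  the sum relation, both with \<open>kA 1\<close> as the unit.\<close>

lemma covariant_cuntz_family:
  assumes E: "cstar_algebra E" and cov: "covariant_on (carrier A) A M E kM kA"
  shows "cuntz_family (n * N) (E\<lparr>one := kA \<one>\<^bsub>A\<^esub>\<rparr>) (\<lambda>a. kM (basis (a div N, a mod N)))"
proof -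
  interpret E: cstar_algebra E by fact
  have rep: "representation A M E kM kA" using cov by (simp add: covariant_on_def)
  note rep' = representationD[OF rep]
  let ?t = "\<lambda>a. kM (basis (a div N, a mod N))"
  have lt: "(a div N, a mod N) \<in> I" if "a < n * N" for a
    using that div_less_of_less_mult[of a n N] by simp
  have cl: "kM (basis x) \<in> carrier E" if "x \<in> I" for x
    using linear_mapsD(1)[OF rep'(1) H.basis_closed[OF that]] .
  have fs: "finsum (E\<lparr>one := kA \<one>\<^bsub>A\<^esub>\<rparr>) = finsum E"
    by (simp add: finsum_def)
  have "finsum E (\<lambda>a. ?t a \<otimes>\<^bsub>E\<^esub> (?t a)\<^sup>\<star>\<^bsub>E\<^esub>) {..<n * N}
      = finsum E (\<lambda>a. ?t a \<otimes>\<^bsub>E\<^esub> (?t a)\<^sup>\<star>\<^bsub>E\<^esub>) ((\<lambda>x. fst x * N + snd x) ` I)"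
    by (simp only: index_image)
  also have "\<dots> = finsum E (\<lambda>x. kM (basis x) \<otimes>\<^bsub>E\<^esub> (kM (basis x))\<^sup>\<star>\<^bsub>E\<^esub>) I"
    using cl index_inj by (subst E.sum_reindex) (auto intro!: E.sum_cong)
  also have "\<dots> = kA \<one>\<^bsub>A\<^esub>" using cov H.covariant_iff[OF E] by simp
  finally have sum: "finsum E (\<lambda>a. ?t a \<otimes>\<^bsub>E\<^esub> (?t a)\<^sup>\<star>\<^bsub>E\<^esub>) {..<n * N} = kA \<one>\<^bsub>A\<^esub>" .
  have "(?t a)\<^sup>\<star>\<^bsub>E\<^esub> \<otimes>\<^bsub>E\<^esub> ?t a = kA \<one>\<^bsub>A\<^esub>" if "a < n * N" for a
    using rep'(4)[OF H.basis_closed[OF lt[OF that]] H.basis_closed[OF lt[OF that]]] H.orthonormal[OF lt[OF that] lt[OF that]]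
    by simp
  then show ?thesis
    using sum cl lt by (simp add: cuntz_family_def fs)
qed

text \<open>The pair \<open>\<psi>\<close>, \<open>\<pi>\<close> and its properties are hypotheses
  so that one representation, chosen before \<open>E\<close>, serves every \<open>E\<close>.\<close>

lemma isomorphism:
  fixes E :: "'c cstar"
  assumes gen: "generates (s ` {..<n * N}) C"
    and univ: "\<And>(B :: 'c cstar) t. unital_cstar_algebra B \<Longrightarrow> cuntz_family (n * N) B t
      \<Longrightarrow> \<exists>h \<in> star_hom C B. \<forall>i<n * N. h (s i) = t i"
    and \<psi>\<pi>: "covariant_on (carrier A) A M C \<psi> \<pi>"
    and \<pi>F: "\<And>k r c. r < n ^ k \<Longrightarrow> c < n ^ k \<Longrightarrow> \<pi> (\<iota> k (mat_unit (n ^ k) r c)) = F k r c"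
    and \<psi>_eq: "\<And>x. x \<in> carrier M \<Longrightarrow> \<psi> x = finsum C (\<lambda>i. S i \<otimes>\<^bsub>C\<^esub> \<pi> \<langle>basis i, x\<rangle>) I"
    and \<psi>basis: "\<And>i. i \<in> I \<Longrightarrow> \<psi> (basis i) = S i"
    and E: "relative_cuntz_pimsner_algebra (carrier A) A M E kM kA"
  shows "\<exists>h. integrated_form A M E kM kA C \<psi> \<pi> h \<and> h \<in> star_iso E C"
proof -
  have Ec: "cstar_algebra E" and cov: "covariant_on (carrier A) A M E kM kA"
    and Egen: "generates (kM ` carrier M \<union> kA ` carrier A) E"
    and Euniv: "\<exists>h. integrated_form A M E kM kA C \<psi> \<pi> h"
    using E C.cstar_algebra_axioms \<psi>\<pi> by (auto simp: relative_cuntz_pimsner_algebra_def)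
  interpret E: cstar_algebra E by fact
  have rep: "representation A M E kM kA" using cov by (simp add: covariant_on_def)
  note rep' = representationD[OF rep]
  have \<pi>: "\<pi> \<in> star_hom A C"
    using \<psi>\<pi> by (auto simp: covariant_on_def representation_def)
  obtain h where h: "h \<in> star_hom E C" "\<And>x. x \<in> carrier M \<Longrightarrow> h (kM x) = \<psi> x" "\<And>a. a \<in> carrier A \<Longrightarrow> h (kA a) = \<pi> a"
    "integrated_form A M E kM kA C \<psi> \<pi> h"
    using Euniv by (auto simp: integrated_form_def)
  let ?E = "E\<lparr>one := kA \<one>\<^bsub>A\<^esub>\<rparr>"
  obtain g where g': "g \<in> star_hom C ?E" "\<And>a. a < n * N \<Longrightarrow> g (s a) = kM (basis (a div N, a mod N))"
    using univ[OF covariant_unit[OF Ec cov Egen] covariant_cuntz_family[OF Ec cov]] by blast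
  \<comment> \<open>Homomorphisms do not refer to the field \<open>one\<close>, so the same
    \<open>g\<close> maps into the original \<open>E\<close>.\<close>
  have g: "g \<in> star_hom C E" using g'(1) by (simp add: star_hom_def linear_maps_def)
  note gD = star_homD[OF g] and hD = star_homD[OF h(1)]
  have gS: "g (S i) = kM (basis i)" if "i \<in> I" for i
    using g'(2)[of "fst i * N + snd i"] that index_less[of "fst i" "snd i"] by (auto simp: S_def)
  have n0: "(0, 0) \<in> I" using two_le N by simp
  \<comment> \<open>Homomorphisms need not preserve units, but the unit of \<open>C\<close> is
    \<open>S^* S\<close> for an isometry whose image is known.\<close>
  have gone: "g \<one>\<^bsub>C\<^esub> = kA \<one>\<^bsub>A\<^esub>"
  proof -
    have "g \<one>\<^bsub>C\<^esub> = g ((S (0, 0))\<^sup>\<star>\<^bsub>C\<^esub> \<otimes>\<^bsub>C\<^esub> S (0, 0))" using n0 by (simp add: S_orthogonal del: mem_Sigma_iff)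
    also have "\<dots> = (kM (basis (0, 0)))\<^sup>\<star>\<^bsub>E\<^esub> \<otimes>\<^bsub>E\<^esub> kM (basis (0, 0))"
      using S_closed[OF n0] gS[OF n0] gD(4,5) by simp
    also have "\<dots> = kA \<one>\<^bsub>A\<^esub>"
      using rep'(4)[OF H.basis_closed[OF n0] H.basis_closed[OF n0]] H.orthonormal[OF n0 n0] by simp
    finally show ?thesis .
  qed
  \<comment> \<open>Both sides obey the same recursion: \<open>F\<close> by definition,
    \<open>kA\<close> by covariance.\<close>
  have units: "g (F k r c) = kA (\<iota> k (mat_unit (n ^ k) r c))" if "r < n ^ k" "c < n ^ k" for k r c
    using that
  proof (induction k arbitrary: r c)
    case 0
    then have "mat_unit (n ^ 0) r c = 1\<^sub>m (n ^ 0)" by (intro eq_matI) auto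
    then have "\<iota> 0 (mat_unit (n ^ 0) r c) = \<one>\<^bsub>A\<^esub>" by (simp only: level_one)
    then show ?case using gone by simp
  next
    case (Suc k)
    note lt = unit_kronecker(2-)[OF Suc.prems]
    have cl: "S (r div n ^ k, j) \<in> carrier C" "S (c div n ^ k, j) \<in> carrier C" if "j < N" for j
      using lt that by auto
    have Fcl: "F k (r mod n ^ k) (c mod n ^ k) \<in> carrier C" using lt by auto
    have "g (F (Suc k) r c) = finsum E (\<lambda>j. g (S (r div n ^ k, j) \<otimes>\<^bsub>C\<^esub> F k (r mod n ^ k) (c mod n ^ k)
        \<otimes>\<^bsub>C\<^esub> (S (c div n ^ k, j))\<^sup>\<star>\<^bsub>C\<^esub>)) {..<N}"
      unfolding F.simps using cl Fcl
      by (intro linear_maps_sum[OF C.complex_module_axioms E.complex_module_axioms star_hom_linear[OF g]]) auto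
    also have "\<dots> = finsum E (\<lambda>j. kM (basis (r div n ^ k, j)) \<otimes>\<^bsub>E\<^esub> kA (\<iota> k (mat_unit (n ^ k) (r mod n ^ k) (c mod n ^ k)))
        \<otimes>\<^bsub>E\<^esub> (kM (basis (c div n ^ k, j)))\<^sup>\<star>\<^bsub>E\<^esub>) {..<N}"
    proof (intro E.sum_cong refl)
      fix j assume "j \<in> {..<N}"
      then have j: "(r div n ^ k, j) \<in> I" "(c div n ^ k, j) \<in> I" and cls: "S (r div n ^ k, j) \<in> carrier C" "S (c div n ^ k, j) \<in> carrier C"
        using lt cl by auto
      show "g (S (r div n ^ k, j) \<otimes>\<^bsub>C\<^esub> F k (r mod n ^ k) (c mod n ^ k) \<otimes>\<^bsub>C\<^esub> (S (c div n ^ k, j))\<^sup>\<star>\<^bsub>C\<^esub>)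
          = kM (basis (r div n ^ k, j)) \<otimes>\<^bsub>E\<^esub> kA (\<iota> k (mat_unit (n ^ k) (r mod n ^ k) (c mod n ^ k)))
            \<otimes>\<^bsub>E\<^esub> (kM (basis (c div n ^ k, j)))\<^sup>\<star>\<^bsub>E\<^esub>"
        using cls Fcl lt by (simp add: gD(4,5) gS[OF j(1)] gS[OF j(2)] Suc.IH)
      show "kM (basis (r div n ^ k, j)) \<otimes>\<^bsub>E\<^esub> kA (\<iota> k (mat_unit (n ^ k) (r mod n ^ k) (c mod n ^ k)))
            \<otimes>\<^bsub>E\<^esub> (kM (basis (c div n ^ k, j)))\<^sup>\<star>\<^bsub>E\<^esub> \<in> carrier E"
        using linear_mapsD(1)[OF rep'(1) H.basis_closed[OF j(1)]] linear_mapsD(1)[OF rep'(1) H.basis_closed[OF j(2)]]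
          star_homD(1)[OF rep'(2) level_closed[of _ k]] by simp
    qed
    also have "\<dots> = kA (\<iota> (Suc k) (mat_unit (n ^ Suc k) r c))"
      by (rule covariant_unit_Suc[OF Ec cov Suc.prems, symmetric])
    finally show ?case .
  qed
  have g\<pi>: "g (\<pi> a) = kA a" if a: "a \<in> carrier A" for a
  proof (rule bounded_linear_eqI[OF Ec _ star_hom_linear[OF rep'(2)] _ _ _ a, of "\<lambda>a. g (\<pi> a)" 1 1])
    show "(\<lambda>a. g (\<pi> a)) \<in> linear_maps A E"
      by (rule linear_mapsI) (use star_homD[OF \<pi>] gD in auto)
    fix b assume b: "b \<in> carrier A"
    show "cnorm E (g (\<pi> b)) \<le> 1 * cnorm A b"
      using star_hom_contractive[OF C.cstar_algebra_axioms Ec g, of "\<pi> b"]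
        star_hom_contractive[OF A.cstar_algebra_axioms C.cstar_algebra_axioms \<pi> b] star_homD(1)[OF \<pi> b] by simp
    show "cnorm E (kA b) \<le> 1 * cnorm A b"
      using star_hom_contractive[OF A.cstar_algebra_axioms Ec rep'(2) b] by simp
  qed (simp only: \<pi>F units)
  have g\<psi>: "g (\<psi> x) = kM x" if x: "x \<in> carrier M" for x
  proof -
    have "g (\<psi> x) = finsum E (\<lambda>i. g (S i \<otimes>\<^bsub>C\<^esub> \<pi> \<langle>basis i, x\<rangle>)) I"
      unfolding \<psi>_eq[OF x] using x star_homD(1)[OF \<pi>]
      by (intro linear_maps_sum[OF C.complex_module_axioms E.complex_module_axioms star_hom_linear[OF g]]) auto
    also have "\<dots> = finsum E (\<lambda>i. kM (basis i \<triangleleft> \<langle>basis i, x\<rangle>)) I"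
    proof (intro E.sum_cong refl)
      fix i assume i: "i \<in> I"
      have b: "basis i \<in> carrier M" using i by (rule H.basis_closed)
      show "g (S i \<otimes>\<^bsub>C\<^esub> \<pi> \<langle>basis i, x\<rangle>) = kM (basis i \<triangleleft> \<langle>basis i, x\<rangle>)"
        using b x i S_closed[OF i] star_homD(1)[OF \<pi>] by (simp add: gD(4) gS[OF i] g\<pi> rep'(3))
      show "kM (basis i \<triangleleft> \<langle>basis i, x\<rangle>) \<in> carrier E"
        using b x linear_mapsD(1)[OF rep'(1)] by simp
    qed
    also have "\<dots> = kM (finsum M (\<lambda>i. basis i \<triangleleft> \<langle>basis i, x\<rangle>) I)"
      using x
      by (intro linear_maps_sum[OF H.MM.complex_module_axioms E.complex_module_axioms rep'(1), symmetric]) (auto simp del: mem_Sigma_iff)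
    also have "\<dots> = kM x"
      using H.expand[OF x] by (simp add: H.project_def)
    finally show ?thesis .
  qed
  have gh: "g (h x) = x" if "x \<in> carrier E" for x
  proof -
    let ?V = "{x \<in> carrier E. g (h x) = x}"
    have "(\<lambda>x. g (h x)) \<in> star_hom E E"
      by (rule star_homI) (use gD hD in auto)
    then have "closed_star_subalgebra ?V E" by (rule star_hom_fixed_points[OF Ec])
    moreover have "kM ` carrier M \<union> kA ` carrier A \<subseteq> ?V"
      using linear_mapsD(1)[OF rep'(1)] star_homD(1)[OF rep'(2)] by (auto simp: h(2,3) g\<pi> g\<psi>)
    ultimately have "?V = carrier E" using Egen unfolding generates_def by blast
    then show ?thesis using that by blast
  qed
  have hg: "h (g x) = x" if "x \<in> carrier C" for x
  proof -
    let ?V = "{x \<in> carrier C. h (g x) = x}"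
    have "(\<lambda>x. h (g x)) \<in> star_hom C C"
      by (rule star_homI) (use gD hD in auto)
    then have "closed_star_subalgebra ?V C" by (rule star_hom_fixed_points[OF C.cstar_algebra_axioms])
    moreover have "s ` {..<n * N} \<subseteq> ?V"
    proof clarify
      fix a assume "a < n * N"
      then have i: "(a div N, a mod N) \<in> I" and sa: "s a = S (a div N, a mod N)"
        using div_less_of_less_mult[of a n N] by (auto simp: S_def)
      show "s a \<in> carrier C \<and> h (g (s a)) = s a"
        unfolding sa using S_closed[OF i] gS[OF i] h(2)[OF H.basis_closed[OF i]] \<psi>basis[OF i] by simp
    qed
    ultimately have "?V = carrier C" using gen unfolding generates_def by blast
    then show ?thesis using that by blast
  qed
  have "bij_betw h (carrier E) (carrier C)"
    by (rule bij_betwI[of _ _ _ g]) (use gD(1) hD(1) gh hg in auto)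
  then show ?thesis using h by (auto simp: star_iso_def)
qed

end

theorem theorem6p6:
  fixes n N :: nat and p :: "complex mat"
    and A :: "'a cstar" and \<iota> :: "nat \<Rightarrow> complex mat \<Rightarrow> 'a" and \<alpha> L :: "'a \<Rightarrow> 'a"
    and M\<^sub>L :: "('a, 'm) hilbert_bimodule" and q :: "'a \<Rightarrow> 'm"
    and C :: "'u cstar" and s :: "nat \<Rightarrow> 'u"
  assumes "2 \<le> n" and "1 \<le> N" and "N \<le> n"
    and "uhf_algebra n A \<iota>"
    and "p = corner_projection n N"
    and "exel_system A \<alpha> L"
    and "\<And>as. set as \<subseteq> carrier_mat n n \<Longrightarrow>
      \<alpha> (\<iota> (length as) (elementary_tensor as)) = \<iota> (Suc (length as)) (elementary_tensor (p # as))"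
    and "\<And>a as. \<lbrakk>a \<in> carrier_mat n n; set as \<subseteq> carrier_mat n n\<rbrakk> \<Longrightarrow>
      L (\<iota> (Suc (length as)) (elementary_tensor (a # as))) =
        corner_trace N (p * a * p) \<odot>\<^bsub>A\<^esub> \<iota> (length as) (elementary_tensor as)"
    and "exel_bimodule A \<alpha> L M\<^sub>L q"
    and "cuntz_algebra (n * N) C s"
  shows "(\<forall>(E :: 'u cstar) k\<^sub>M k\<^sub>A.
      exel_crossed_product A \<alpha> M\<^sub>L E k\<^sub>M k\<^sub>A \<longleftrightarrow> cuntz_pimsner_algebra A M\<^sub>L E k\<^sub>M k\<^sub>A) \<and>
    (\<exists>\<psi> \<pi>. cuntz_pimsner_covariant A M\<^sub>L C \<psi> \<pi> \<and>
      (\<forall>(E :: 'u cstar) k\<^sub>M k\<^sub>A. exel_crossed_product A \<alpha> M\<^sub>L E k\<^sub>M k\<^sub>A \<longrightarrow>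
        (\<exists>h. integrated_form A M\<^sub>L E k\<^sub>M k\<^sub>A C \<psi> \<pi> h \<and> h \<in> star_iso E C)))"
proof -
  have C: "unital_cstar_algebra C" "cuntz_family (n * N) C s" "generates (s ` {..<n * N}) C"
    and univ: "\<And>(B :: 'u cstar) t. unital_cstar_algebra B \<Longrightarrow> cuntz_family (n * N) B t
      \<Longrightarrow> \<exists>h \<in> star_hom C B. \<forall>i<n * N. h (s i) = t i"
    using assms(10) by (auto simp: cuntz_algebra_def)
  interpret uhf n A \<iota>
    by unfold_locales (use assms in auto)
  interpret exel_uhf n A \<iota> N \<alpha> L M\<^sub>L q
    by unfold_locales (use assms in auto)
  interpret cuntz_rep n A \<iota> N \<alpha> L M\<^sub>L q C s
    by (intro cuntz_rep.intro cuntz_rep_axioms.intro exel_uhf_axioms C)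
  obtain \<psi> \<pi> where rep: "covariant_on (carrier A) A M\<^sub>L C \<psi> \<pi>"
    "\<And>k r c. r < n ^ k \<Longrightarrow> c < n ^ k \<Longrightarrow> \<pi> (\<iota> k (mat_unit (n ^ k) r c)) = F k r c"
    "\<And>x. x \<in> carrier M\<^sub>L \<Longrightarrow> \<psi> x = finsum C (\<lambda>i. S i \<otimes>\<^bsub>C\<^esub> \<pi> \<langle>basis i, x\<rangle>\<^bsub>M\<^sub>L\<^esub>) ({..<n} \<times> {..<N})"
    "\<And>i. i \<in> {..<n} \<times> {..<N} \<Longrightarrow> \<psi> (basis i) = S i"
    using cuntz_representation by blast
  have "cuntz_pimsner_covariant A M\<^sub>L C \<psi> \<pi>"
    using rep(1) by (simp add: cuntz_pimsner_covariant_def H.compact_ideal_eq)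
  moreover have "\<exists>h. integrated_form A M\<^sub>L E k\<^sub>M k\<^sub>A C \<psi> \<pi> h \<and> h \<in> star_iso E C"
    if "exel_crossed_product A \<alpha> M\<^sub>L E k\<^sub>M k\<^sub>A" for E :: "'u cstar" and k\<^sub>M k\<^sub>A
    using that C(3) univ rep
    by (intro isomorphism) (auto simp: exel_crossed_product_def exel_ideal_eq simp del: F.simps)
  \<comment> \<open>Both ideals are all of \<open>A\<close>, so the crossed product and the
    Cuntz-Pimsner algebra are given by the same predicate.\<close>
  ultimately show ?thesis
    by (auto simp: exel_crossed_product_def cuntz_pimsner_algebra_def exel_ideal_eq H.compact_ideal_eq)
qed

end
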